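(* Let $N\ge 3$ and $k>0$. Assume that $V$ satisfies $(V)$ and $f$ satisfies $(f_1)$, $(f_2)$, $(f_3)$ (conditions listed in the context). If $0$ is not an eigenvalue of $-\Delta+V$, then the equation $$-\Delta u+V(x)u+\frac{k}{2}\Delta(u^2)u=f(u)\quad\text{in }\mathbb{R}^N$$ has a nontrivial (i.e. not identically zero) solution.
   Context: Conditions on $V:\mathbb{R}^N\to\mathbb{R}$ and $f:\mathbb{R}\to\mathbb{R}$, with $F(t)=\int_0^t f(s)\,ds$ and $2^*=\frac{2N}{N-2}$: $(V)$ $V\in C(\mathbb{R}^N)$, $\inf_{\mathbb{R}^N}V>-\infty$, and $\lim_{|x|\to\infty}V(x)=+\infty$. $(f_1)$ $f(s)=o(s)$ as $s\to0$. $(f_2)$ $f\in C(\mathbb{R})$ and $\limsup_{|s|\to\infty}\frac{|f(s)|}{|s|^{p-1}}=0$ for some $p\in(2,2^* )$. $(f_3)$ There exists $\mu>\frac83$ such that $0<\mu F(s)\le s f(s)$ for all $s\ne0$. Space: fix $m_0>0$ with $\widetilde V(x):=V(x)+m_0>0$ for all $x$. $E=\{u\in H^1(\mathbb{R}^N):\int_{\mathbb{R}^N}V(x)u^2<\infty\}$ with inner product $(u,v)=\int_{\mathbb{R}^N}(\nabla u\cdot\nabla v+\widetilde V(x)uv)$ and norm $\|u\|=(u,u)^{1/2}$. Eigenvalues: $\lambda\in\mathbb{R}$ is an eigenvalue of $-\Delta+V$ if $-\Delta u+V(x)u=\lambda u$ has a nonzero (weak) solution $u\in E$. Solutions: a (weak)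 solution of $-\Delta u+V(x)u+\frac{k}{2}\Delta(u^2)u=f(u)$ is a function $u\in E$ with $\int_{\mathbb{R}^N}u^2|\nabla u|^2<\infty$ such that for all $\varphi\in C_c^\infty(\mathbb{R}^N)$ $$\int_{\mathbb{R}^N}\left[(1-ku^2)\nabla u\cdot\nabla\varphi-ku|\nabla u|^2\varphi+V(x)u\varphi\right]=\int_{\mathbb{R}^N}f(u)\varphi.$$ *)

theory Defs
  imports "HOL-Analysis.Analysis" "HOL-Library.Landau_Symbols"
begin

definition partial_deriv :: "'n::finite \<Rightarrow> (real^'n \<Rightarrow> real) \<Rightarrow> real^'n \<Rightarrow> real" where
  "partial_deriv i \<phi> x = frechet_derivative \<phi> (at x) (axis i 1)"

definition grad :: "(real^'n::finite \<Rightarrow> real) \<Rightarrow> real^'n \<Rightarrow> real^'n" where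
  "grad \<phi> x = (\<chi> i. partial_deriv i \<phi> x)"

text \<open>Class \<open>C\<^sup>m\<close> on the whole space. Continuity of the first partials need not be
  stated separately in the successor case: they are again of class \<open>C\<^sup>m\<close>.\<close>

fun C_k :: "nat \<Rightarrow> (real^'n::finite \<Rightarrow> real) \<Rightarrow> bool" where
  "C_k 0 \<phi> \<longleftrightarrow> continuous_on UNIV \<phi>"
| "C_k (Suc m) \<phi> \<longleftrightarrow>
     (\<forall>x. \<phi> differentiable (at x)) \<and> (\<forall>i. C_k m (partial_deriv i \<phi>))"

definition Cc_infinity :: "(real^'n::finite \<Rightarrow> real) set" where
  "Cc_infinity = {\<phi>. (\<forall>m. C_k m \<phi>) \<and> compact (closure {x. \<phi> x \<noteq> 0})}"

definition L1_loc :: "('a::euclidean_space \<Rightarrow> 'b::euclidean_space) set" where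
  "L1_loc = {h. \<forall>K. compact K \<longrightarrow> set_integrable lebesgue K h}"

definition L2 :: "('a::euclidean_space \<Rightarrow> 'b::euclidean_space) set" where
  "L2 = {h. h \<in> borel_measurable lebesgue \<and> integrable lebesgue (\<lambda>x. (norm (h x))\<^sup>2)}"

text \<open>Elements of the function spaces are representatives, not classes modulo null sets.
  The weak gradient is therefore a relation; it determines \<open>g\<close> up to a null set,
  so the integrals below do not depend on the choice of \<open>g\<close>.\<close>

definition has_weak_gradient ::
    "(real^'n::finite \<Rightarrow> real) \<Rightarrow> (real^'n \<Rightarrow> real^'n) \<Rightarrow> bool" where
  "has_weak_gradient u g \<longleftrightarrow> u \<in> L1_loc \<and> g \<in> L1_loc \<and>
     (\<forall>\<phi>\<in>Cc_infinity. \<forall>i.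
        (\<integral>x. u x * partial_deriv i \<phi> x \<partial>lebesgue) = - (\<integral>x. g x $ i * \<phi> x \<partial>lebesgue))"

definition H1 :: "(real^'n::finite \<Rightarrow> real) set" where
  "H1 = {u \<in> L2. \<exists>g\<in>L2. has_weak_gradient u g}"

text \<open>For \<open>V\<close> bounded below and \<open>u \<in> L2\<close>, the negative part of \<open>V u\<^sup>2\<close> is
  integrable, so finiteness of its integral is integrability.\<close>

definition space_E :: "(real^'n::finite \<Rightarrow> real) \<Rightarrow> (real^'n \<Rightarrow> real) set" where
  "space_E V = {u \<in> H1. integrable lebesgue (\<lambda>x. V x * (u x)\<^sup>2)}"

definition cond_V :: "(real^'n::finite \<Rightarrow> real) \<Rightarrow> bool" where
  "cond_V V \<longleftrightarrow> continuous_on UNIV V \<and> bdd_below (range V) \<and> filterlim V at_top at_infinity"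

definition cond_f1 :: "(real \<Rightarrow> real) \<Rightarrow> bool" where
  "cond_f1 f \<longleftrightarrow> f \<in> o[at 0](\<lambda>s. s)"

definition critical_exponent :: "nat \<Rightarrow> real" where
  "critical_exponent N = 2 * real N / (real N - 2)"

definition cond_f2 :: "nat \<Rightarrow> (real \<Rightarrow> real) \<Rightarrow> bool" where
  "cond_f2 N f \<longleftrightarrow> continuous_on UNIV f \<and>
     (\<exists>p. 2 < p \<and> p < critical_exponent N \<and>
        Limsup at_infinity (\<lambda>s. ereal (\<bar>f s\<bar> / \<bar>s\<bar> powr (p - 1))) = 0)"

text \<open>The interval integral is oriented: it changes sign for \<open>t < 0\<close>.\<close>

definition primitive :: "(real \<Rightarrow> real) \<Rightarrow> real \<Rightarrow> real" where
  "primitive f t = (LBINT s=ereal 0..ereal t. f s)"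

definition cond_f3 :: "(real \<Rightarrow> real) \<Rightarrow> bool" where
  "cond_f3 f \<longleftrightarrow> (\<exists>\<mu>>8/3. \<forall>s. s \<noteq> 0 \<longrightarrow>
     0 < \<mu> * primitive f s \<and> \<mu> * primitive f s \<le> s * f s)"

text \<open>The Bochner integral of a non-integrable function is 0 by convention. The integrability
  clauses below rule out that junk value; for continuous \<open>V\<close> (and \<open>f\<close> of subcritical
  growth) they follow from the remaining clauses.\<close>

definition schroedinger_eigenvalue :: "(real^'n::finite \<Rightarrow> real) \<Rightarrow> real \<Rightarrow> bool" where
  "schroedinger_eigenvalue V \<Lambda> \<longleftrightarrow>
     (\<exists>u\<in>space_E V. \<not> (AE x in lebesgue. u x = 0) \<and>
       (\<exists>g. has_weak_gradient u g \<and>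
         (\<forall>\<phi>\<in>Cc_infinity.
            integrable lebesgue (\<lambda>x. g x \<bullet> grad \<phi> x + V x * u x * \<phi> x) \<and>
            (\<integral>x. g x \<bullet> grad \<phi> x + V x * u x * \<phi> x \<partial>lebesgue) =
            (\<integral>x. \<Lambda> * u x * \<phi> x \<partial>lebesgue))))"

definition weak_solution ::
    "(real^'n::finite \<Rightarrow> real) \<Rightarrow> real \<Rightarrow> (real \<Rightarrow> real) \<Rightarrow> (real^'n \<Rightarrow> real) \<Rightarrow> bool" where
  "weak_solution V k f u \<longleftrightarrow> u \<in> space_E V \<and>
     (\<exists>g. has_weak_gradient u g \<and>
       integrable lebesgue (\<lambda>x. (u x)\<^sup>2 * (norm (g x))\<^sup>2) \<and>
       (\<forall>\<phi>\<in>Cc_infinity.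
          integrable lebesgue (\<lambda>x. (1 - k * (u x)\<^sup>2) * (g x \<bullet> grad \<phi> x)
            - k * u x * (norm (g x))\<^sup>2 * \<phi> x + V x * u x * \<phi> x) \<and>
          integrable lebesgue (\<lambda>x. f (u x) * \<phi> x) \<and>
          (\<integral>x. (1 - k * (u x)\<^sup>2) * (g x \<bullet> grad \<phi> x)
            - k * u x * (norm (g x))\<^sup>2 * \<phi> x + V x * u x * \<phi> x \<partial>lebesgue) =
          (\<integral>x. f (u x) * \<phi> x \<partial>lebesgue)))"

end

theory Submission
  imports Defs "HOL-Computational_Algebra.Polynomial"
begin

text \<open>After rescaling to \<open>k = 1\<close> the equation degenerates where \<open>|u| = 1\<close>, and the solution is built so as to
  exploit this. With \<open>h(t) = sqrt (1 - t^2)\<close>, \<open>H' = h\<close> and \<open>w = H(u)\<close> the equation becomes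
  \<open>- Delta w + (V u - f(u)) / h(u) = 0\<close>, and its flux \<open>h(u) grad w\<close> vanishes where \<open>u = 1\<close>. Hence a solution of the
  Dirichlet problem \<open>u = 1\<close> on a sphere, \<open>|u| <= 1\<close> on both sides of it, is a weak solution across the sphere,
  with a cusp there, and it is not trivial.

  The sphere is placed so far out that \<open>V\<close> is large near it. There the linearised operators \<open>- Delta + Q\<close> are strongly
  positive, elsewhere \<open>Q\<close> is close to \<open>V\<close>; as \<open>0\<close> is not an eigenvalue, compactness makes these operators uniformly
  invertible, and Schauder's theorem solves the problem with \<open>h\<close> replaced by \<open>sqrt (1 - rho t^2)\<close>, \<open>rho < 1\<close>.
  A De Giorgi argument shows that \<open>u\<close> is small away from the sphere and at most \<open>1\<close>. For \<open>rho\<close> tending to \<open>1\<close>,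
  testing with \<open>h(u) - h(1)\<close> bounds the gradient of \<open>u\<close>, gradients converge strongly on compact sets, the contact set
  \<open>{u = 1}\<close> is null, and test functions that vanish near contact suffice to pass to the limit.\<close>

text \<open>Since \<open>V\<close> may be negative, the operator is indefinite and comparison
  arguments work only where \<open>V\<close> is large; and the only upper bound at hand for the
  coefficient of the \<open>w\<close> equation is of order \<open>1 / (1 - rho)\<close>. So every
  uniform constant has to be free of that upper bound: \<open>admissible\<close> asks for closeness
  to \<open>V\<close> outside \<open>cball c 2\<close> only, and for a mere lower bound inside.
  Closeness presupposes that \<open>w\<close> is small there; hence the coefficient is truncated
  first, and the sup bound then shows that the truncation is inactive. The balls around
  \<open>c\<close> have fixed radii: 1 is the sphere, large values are confined to 2, the exterior
  cutoff acts between 3 and 4, the local one between 4 and 5, and \<open>V\<close> is large up to 5.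
  A general test function does not vanish on the sphere. Multiplied by \<open>h(u) kappa(u)\<close>,
  where \<open>kappa\<close> is zero near 1, it does, because \<open>u = 1\<close> there; this is
  why the sphere leaves no term in the limit equation. This test function brings in the square of
  the gradient, hence the strong convergence; and \<open>kappa\<close> can tend to 1 almost
  everywhere only if contact is null.\<close>

abbreviation BM :: "('a::topological_space => 'b::topological_space) set" where "BM == borel_measurable borel"

abbreviation (input) Cc :: "(real^'n::finite => real) set" where "Cc == Cc_infinity"

abbreviation (input) pd :: "'n::finite => (real^'n => real) => real^'n => real" where "pd == partial_deriv"

abbreviation (input) scaleR_infix (infixr "*R" 75) where "c *R x == scaleR c x"

abbreviation (input) seq_limit (infix "---->" 60) where "X ----> l == (X \<longlonglongrightarrow> l)"

section \<open>Schauder's fixed point theorem\<close>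

text \<open>Tychonoff's theorem, as \<open>nat => real\<close> carries the product topology. It
  supplies the convergent subsequences both in Brouwer's theorem and in the weak compactness of
  bounded sequences.\<close>

lemma compact_unit_cube: "compact {s::nat => real. \<forall>i. 0 <= s i & s i <= 1}"
proof -
 have "compactin (product_topology (%i::nat. euclidean::real topology) UNIV) (PiE UNIV (%i. {0..1}))"
  by (subst compactin_PiE) auto
 moreover have "PiE UNIV (%i::nat. {0..1::real}) = {s. \<forall>i. 0 <= s i & s i <= 1}"
  by (auto simp: PiE_def Pi_def)
 ultimately show ?thesis
  by (simp add: euclidean_product_topology)
qed

text \<open>The dimension is a number and not a type, because in Schauder's theorem it is the size
  of an \<open>e\<close>-net and changes with \<open>e\<close>. Kuhn's lemma gives in each grid of
  mesh \<open>1 / Suc k\<close> a cell where every coordinate has both labels; along a subsequence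
  the cells shrink to a point at which \<open>F\<close> moves no coordinate up or down.\<close>

theorem brouwer_nat_cube:
 fixes F :: "(nat => real) => nat => real"
 assumes cont: "!!i. i < n ==> continuous_on UNIV (%s. F s i)"
  and rng: "!!s i. i < n ==> 0 <= F s i & F s i <= 1"
 shows "\<exists>s. \<forall>i<n. F s i = s i"
proof -
 define pt :: "nat => (nat => nat) => nat => real"
  where "pt p x i = (if i < n then real (x i) / real p else 0)" for p x i
 \<comment> \<open>The label tells whether \<open>F\<close> moves the coordinate up (0) or down (1).
   On the faces its value is prescribed by Kuhn's lemma; it agrees there with the direction because
   \<open>F\<close> takes values in the unit cube.\<close>
 define label :: "nat => (nat => nat) => nat => nat"
  where "label p x i = (if x i = p then 1 else if x i = 0 \<or> F (pt p x) i >= pt p x i then 0 else 1)" for p x i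
 have lab0: "F (pt p x) i >= pt p x i" if "label p x i = 0" "i < n" for p x i
  using that rng[of i "pt p x"] by (auto simp: label_def pt_def split: if_splits)
 have lab1: "F (pt p x) i <= pt p x i" if "label p x i = 1" "i < n" "p > 0" for p x i
  using that rng[of i "pt p x"] by (auto simp: label_def pt_def split: if_splits)
 have "\<exists>q. (\<forall>i<n. q i < Suc k) & (\<forall>i<n. \<exists>r s. (\<forall>j<n. q j <= r j & r j <= q j + 1) &
     (\<forall>j<n. q j <= s j & s j <= q j + 1) & label (Suc k) r i = 0 & label (Suc k) s i = 1)" for k
 proof -
  obtain q where q: "\<forall>i<n. q i < Suc k"
   "\<forall>i<n. \<exists>r s. (\<forall>j<n. q j <= r j & r j <= q j + 1) &
     (\<forall>j<n. q j <= s j & s j <= q j + 1) & label (Suc k) r i \<noteq> label (Suc k) s i"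
   by (rule kuhn_lemma[of "Suc k" n "label (Suc k)"]) (auto simp: label_def)
  have "\<exists>r s. (\<forall>j<n. q j <= r j & r j <= q j + 1) &
     (\<forall>j<n. q j <= s j & s j <= q j + 1) & label (Suc k) r i = 0 & label (Suc k) s i = 1" if "i < n" for i
  proof -
   obtain r s where rs: "\<forall>j<n. q j <= r j & r j <= q j + 1" "\<forall>j<n. q j <= s j & s j <= q j + 1"
    "label (Suc k) r i \<noteq> label (Suc k) s i" using q(2) \<open>i < n\<close> by blast
   have "label (Suc k) r i \<in> {0,1}" "label (Suc k) s i \<in> {0,1}" by (auto simp: label_def)
   with rs show ?thesis by (metis insert_iff singletonD)
  qed
  with q(1) show ?thesis by blast
 qed
 then obtain q where q: "!!k i. i < n ==> q k i < Suc k"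
  "!!k i. i < n ==> \<exists>r s. (\<forall>j<n. q k j <= r j & r j <= q k j + 1) &
     (\<forall>j<n. q k j <= s j & s j <= q k j + 1) & label (Suc k) r i = 0 & label (Suc k) s i = 1"
  by metis
 let ?C = "{s::nat => real. \<forall>i. 0 <= s i & s i <= 1}"
 have ptC: "pt (Suc k) (q k) \<in> ?C" for k
 proof -
  have "real (q k i) <= 1 + real k" if "i < n" for i using q(1)[OF that, of k] by linarith
  then show ?thesis by (auto simp: pt_def divide_le_eq)
 qed
 obtain l sub where l: "strict_mono sub" "(%k. pt (Suc (sub k)) (q (sub k))) ----> l"
  using ptC compact_unit_cube[unfolded compact_def, rule_format, of "%k. pt (Suc k) (q k)"]
  by (auto simp: o_def)
 \<comment> \<open>Coordinates of the corners of a cell differ by at most one grid step, so every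
   choice of corners has the same limit \<open>l\<close>.\<close>
 have close: "(%k. pt (Suc (sub k)) (r k)) ----> l"
  if r: "!!k j. j < n ==> q (sub k) j <= r k j & r k j <= q (sub k) j + 1" for r
 proof -
  have lj: "(%k. pt (Suc (sub k)) (q (sub k)) j) ----> l j" for j
   using continuous_on_tendsto_compose[OF continuous_on_product_coordinates[of j] l(2)] by auto
  have "(%k. pt (Suc (sub k)) (r k) j) ----> l j" for j
  proof (cases "j < n")
   case True
   have up: "(%k. pt (Suc (sub k)) (q (sub k)) j + 1 / real (Suc (sub k))) ----> l j"
    using tendsto_add[OF lj[of j] LIMSEQ_subseq_LIMSEQ[OF LIMSEQ_inverse_real_of_nat l(1)]]
    by (simp add: o_def inverse_eq_divide)
   have lo: "pt (Suc (sub k)) (q (sub k)) j <= pt (Suc (sub k)) (r k) j"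
    "pt (Suc (sub k)) (r k) j <= pt (Suc (sub k)) (q (sub k)) j + 1 / real (Suc (sub k))" for k
   proof -
    have "real (q (sub k) j) <= real (r k j)" "real (r k j) <= real (q (sub k) j) + 1"
     using r[OF True, of k] by linarith+
    then show "pt (Suc (sub k)) (q (sub k)) j <= pt (Suc (sub k)) (r k) j"
     "pt (Suc (sub k)) (r k) j <= pt (Suc (sub k)) (q (sub k)) j + 1 / real (Suc (sub k))"
     using True by (auto simp: pt_def divide_right_mono simp flip: add_divide_distrib)
   qed
   show ?thesis
    by (rule tendsto_sandwich[OF _ _ lj[of j] up]) (use lo in auto)
  next
   case False
   then show ?thesis using lj[of j] by (simp add: pt_def)
  qed
  then have "limitin (product_topology (%i::nat. euclidean::real topology) UNIV) (%k. pt (Suc (sub k)) (r k)) l sequentially"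
   by (subst limitin_componentwise) auto
  then show ?thesis by (simp add: euclidean_product_topology)
 qed
 have "F l i = l i" if i: "i < n" for i
 proof -
  have "\<forall>k. \<exists>r s. (\<forall>j<n. q (sub k) j <= r j & r j <= q (sub k) j + 1) &
     (\<forall>j<n. q (sub k) j <= s j & s j <= q (sub k) j + 1) & label (Suc (sub k)) r i = 0 & label (Suc (sub k)) s i = 1"
   using q(2)[OF i] by blast
  from choice[OF this] obtain r where "\<forall>k. \<exists>s. (\<forall>j<n. q (sub k) j <= r k j & r k j <= q (sub k) j + 1) &
     (\<forall>j<n. q (sub k) j <= s j & s j <= q (sub k) j + 1) & label (Suc (sub k)) (r k) i = 0 & label (Suc (sub k)) s i = 1"
   by blast
  from choice[OF this] obtain s where "\<forall>k. (\<forall>j<n. q (sub k) j <= r k j & r k j <= q (sub k) j + 1) &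
     (\<forall>j<n. q (sub k) j <= s k j & s k j <= q (sub k) j + 1) & label (Suc (sub k)) (r k) i = 0 & label (Suc (sub k)) (s k) i = 1"
   by blast
  then have rs: "!!k j. j < n ==> q (sub k) j <= r k j & r k j <= q (sub k) j + 1"
   "!!k j. j < n ==> q (sub k) j <= s k j & s k j <= q (sub k) j + 1"
   "!!k. label (Suc (sub k)) (r k) i = 0" "!!k. label (Suc (sub k)) (s k) i = 1"
   by auto
  note cr = close[OF rs(1)] and cs = close[OF rs(2)]
  have pr: "(%k. f (pt (Suc (sub k)) (g k))) ----> f l"
   if "(%k. pt (Suc (sub k)) (g k)) ----> l" "continuous_on UNIV f" for f :: "(nat => real) => real" and g
   using continuous_on_tendsto_compose[OF that(2,1)] by auto
  have "l i <= F l i"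
   by (rule LIMSEQ_le[OF pr[OF cr continuous_on_product_coordinates] pr[OF cr cont[OF i]]]) (use lab0 rs(3) i in auto)
  moreover have "F l i <= l i"
   by (rule LIMSEQ_le[OF pr[OF cs cont[OF i]] pr[OF cs continuous_on_product_coordinates]]) (use lab1 rs(4) i in auto)
  ultimately show ?thesis by simp
 qed
 then show ?thesis by blast
qed

text \<open>Projection onto a finite \<open>e\<close>-net \<open>y\<close> of \<open>K\<close> by
  the partition of unity \<open>b i / S\<close> reduces the problem to finitely many coefficients,
  and approximate fixed points accumulate in \<open>K\<close>. The map is defined on the whole
  space, which is how the solution operator will be given.\<close>

theorem schauder:
 fixes T :: "'a::real_normed_vector => 'a"
 assumes cont: "continuous_on UNIV T" and K: "compact K" and TK: "!!x. T x \<in> K"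
 shows "\<exists>x. T x = x"
proof -
 have approx: "\<exists>x. norm (x - T x) < e" if e: "e > 0" for e
 proof -
  obtain k where k: "finite k" "K \<subseteq> (\<Union>x\<in>k. ball x e)"
   using K e unfolding compact_eq_totally_bounded by blast
  obtain n y where y: "k = y ` {i::nat. i < n}" using finite_imp_nat_seg_image_inj_on[OF k(1)] by metis
  define b where "b i z = max 0 (e - norm (z - y i))" for i and z :: 'a
  define S where "S z = (\<Sum>i<n. b i z)" for z
  have b0: "b i z >= 0" for i z by (simp add: b_def)
  have Spos: "S z > 0" if zK: "z \<in> K" for z
  proof -
   obtain i where i: "i < n" "norm (z - y i) < e"
    using k(2) zK unfolding y by (auto simp: dist_norm norm_minus_commute)
   have "b i z <= S z" unfolding S_def by (rule member_le_sum) (use i b0 in auto)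
   then show ?thesis using i(2) by (auto simp: b_def)
  qed
  define X where "X s = (\<Sum>j<n. s j *R y j)" for s
  \<comment> \<open>\<open>F\<close> sends coefficients \<open>s\<close> to those of the projection
    of \<open>T (X s)\<close>. It acts on a cube and not on the simplex, to match the form of
    Brouwer's theorem above.\<close>
  define F where "F s i = b i (T (X s)) / S (T (X s))" for s i
  have cX: "continuous_on UNIV (%s. T (X s))" unfolding X_def
   by (rule continuous_on_compose2[OF cont])
    (auto intro!: continuous_intros continuous_on_sum continuous_on_scaleR continuous_on_product_coordinates)
  have "\<exists>s. \<forall>i<n. F s i = s i"
  proof (rule brouwer_nat_cube)
   show "continuous_on UNIV (%s. F s i)" for i
    unfolding F_def b_def S_def
    by (intro continuous_intros cX) (use Spos TK in \<open>auto simp: S_def b_def less_imp_neq[THEN not_sym]\<close>)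
   show "0 <= F s i & F s i <= 1" if "i < n" for s i
   proof -
    have "b i (T (X s)) <= S (T (X s))" unfolding S_def by (rule member_le_sum) (use that b0 in auto)
    then show ?thesis using Spos[OF TK[of "X s"]] b0 by (auto simp: F_def)
   qed
  qed
  then obtain s where s: "!!i. i < n ==> F s i = s i" by blast
  let ?z = "T (X s)"
  note Sp = Spos[OF TK[of "X s"]]
  \<comment> \<open>That the coefficients sum to one is a consequence of the fixed point
    equation.\<close>
  have s1: "(\<Sum>i<n. s i) = 1"
   using Sp by (simp add: s[symmetric] F_def S_def flip: sum_divide_distrib)
  have "?z - X s = (\<Sum>i<n. s i) *R ?z - X s" by (simp add: s1)
  also have "\<dots> = (\<Sum>i<n. s i *R (?z - y i))"
   unfolding X_def by (simp add: scaleR_diff_right sum_subtractf scaleR_sum_left)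
  finally have "norm (?z - X s) <= (\<Sum>i<n. norm (s i *R (?z - y i)))" by (metis norm_sum)
  also have "\<dots> < (\<Sum>i<n. s i) * e"
  proof -
   have le: "norm (s i *R (?z - y i)) <= s i * e" if "i < n" for i
   proof (cases "norm (?z - y i) < e")
    case True
    have "s i >= 0" unfolding s[OF that, symmetric] F_def using Sp b0[of i ?z] by simp
    then show ?thesis using True by (auto intro!: mult_left_mono)
   next
    case False
    then have "s i = 0" using s[OF that] by (auto simp: F_def b_def)
    then show ?thesis by simp
   qed
   obtain i where i: "i < n" "norm (?z - y i) < e"
    using k(2) TK[of "X s"] unfolding y by (auto simp: dist_norm norm_minus_commute)
   have "s i > 0" unfolding s[OF i(1), symmetric] F_def b_def using Sp i(2) by simp
   then have "norm (s i *R (?z - y i)) < s i * e" using i(2) by simp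
   then have "(\<Sum>i<n. norm (s i *R (?z - y i))) < (\<Sum>i<n. s i * e)"
    by (intro sum_strict_mono_ex1) (use le i in auto)
   then show ?thesis by (simp add: sum_distrib_right)
  qed
  finally show ?thesis using s1 by (intro exI[of _ "X s"]) (simp add: norm_minus_commute)
 qed
 have "\<exists>x. \<forall>n. norm (x n - T (x n)) < inverse (real (Suc n))"
  by (rule choice) (use approx in auto)
 then obtain x where x: "!!n. norm (x n - T (x n)) < inverse (real (Suc n))" by blast
 obtain l sub where l: "strict_mono sub" "(%n. T (x (sub n))) ----> l"
  using K[unfolded compact_def, rule_format, of "%n. T (x n)"] TK by (auto simp: o_def)
 have "(%n. x (sub n) - T (x (sub n))) ----> 0"
 proof (rule Lim_null_comparison)
  show "(%n. inverse (real (Suc (sub n)))) ----> 0"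
   using LIMSEQ_subseq_LIMSEQ[OF LIMSEQ_inverse_real_of_nat l(1)] by (simp add: o_def)
 qed (use x in \<open>auto intro!: always_eventually less_imp_le\<close>)
 from tendsto_add[OF this l(2)] have xl: "(%n. x (sub n)) ----> l" by simp
 have "(%n. T (x (sub n))) ----> T l"
  using continuous_on_tendsto_compose[OF cont xl] by auto
 then show ?thesis using LIMSEQ_unique l(2) by blast
qed

section \<open>Hilbert spaces\<close>

lemma parallelogram_law:
 fixes x y :: "'h::real_inner"
 shows "(norm (x - y))^2 = 2 * (norm x)^2 + 2 * (norm y)^2 - 4 * (norm ((1/2) *R (x + y)))^2"
 by (simp add: power_divide power2_norm_eq_inner inner_diff_left inner_diff_right inner_add_left inner_add_right inner_commute field_simps)

lemma projection_exists:
 fixes S :: "'h::{real_inner,complete_space} set"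
 assumes S: "subspace S" "closed S"
 shows "\<exists>y\<in>S. \<forall>s\<in>S. (x - y) \<bullet> s = 0"
proof -
 define d where "d = Inf ((%s. (norm (x - s))^2) ` S)"
 have ne: "S \<noteq> {}" using S(1) subspace_0 by auto
 have bdd: "bdd_below ((%s. (norm (x - s))^2) ` S)" by (intro bdd_belowI[of _ 0]) auto
 have dle: "d <= (norm (x - s))^2" if "s \<in> S" for s
  unfolding d_def by (rule cInf_lower) (use that bdd in auto)
 have "\<exists>s\<in>S. (norm (x - s))^2 < d + inverse (real (Suc n))" for n
 proof -
  have "d < d + inverse (real (Suc n))" by simp
  then show ?thesis unfolding d_def using cInf_lessD[of "(%s. (norm (x - s))^2) ` S"] ne by auto
 qed
 then obtain s where s: "!!n. s n \<in> S" "!!n. (norm (x - s n))^2 < d + inverse (real (Suc n))" by metis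
 have dist_le: "(norm (s m - s n))^2 <= 2 * inverse (real (Suc m)) + 2 * inverse (real (Suc n))" for m n
 proof -
  have "(1/2) *R (s m + s n) \<in> S" using S(1) s(1) by (intro subspace_scale subspace_add) auto
  from dle[OF this] have "d <= (norm ((1/2) *R ((x - s m) + (x - s n))))^2"
   by (simp add: scaleR_add_right scaleR_diff_right algebra_simps flip: scaleR_add_left)
  with parallelogram_law[of "x - s n" "x - s m"] s(2)[of m] s(2)[of n] show ?thesis by (simp add: add.commute)
 qed
 have "Cauchy s"
 proof (rule CauchyI)
  fix e :: real assume "e > 0"
  then obtain N where N: "inverse (real (Suc N)) < e^2 / 4"
   using reals_Archimedean[of "e^2 / 4"] by auto
  show "\<exists>M. \<forall>m\<ge>M. \<forall>n\<ge>M. norm (s m - s n) < e"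
  proof (intro exI allI impI)
   fix m n assume "m >= N" "n >= N"
   then have "inverse (real (Suc m)) <= inverse (real (Suc N))" "inverse (real (Suc n)) <= inverse (real (Suc N))"
    by (auto intro!: le_imp_inverse_le)
   with dist_le[of m n] N have "(norm (s m - s n))^2 < e^2" by linarith
   then show "norm (s m - s n) < e" using \<open>e > 0\<close> by (simp add: power_less_imp_less_base)
  qed
 qed
 then obtain y where y: "s ----> y" using Cauchy_convergent_iff convergent_def by blast
 have yS: "y \<in> S" using S(2) s(1) y closed_sequentially by blast
 have "(%n. (norm (x - s n))^2) ----> (norm (x - y))^2" by (intro tendsto_intros y)
 moreover have "(%n. d + inverse (real (Suc n))) ----> d + 0" by (intro tendsto_intros LIMSEQ_inverse_real_of_nat)
 ultimately have ymin: "(norm (x - y))^2 <= d"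
  using s(2) by (intro LIMSEQ_le[where Y = "%n. d + inverse (real (Suc n))"]) (auto intro: less_imp_le)
 have "(x - y) \<bullet> s = 0" if sS: "s \<in> S" for s
 proof (rule ccontr)
  assume nz: "(x - y) \<bullet> s \<noteq> 0"
  define t where "t = ((x - y) \<bullet> s) / (norm s)^2"
  have s0: "(norm s)^2 > 0" using nz by auto
  have "y + t *R s \<in> S" using S(1) yS sS by (intro subspace_add subspace_scale) auto
  from order_trans[OF ymin dle[OF this]]
  have "(norm (x - y))^2 <= (norm ((x - y) - t *R s))^2" by (simp add: algebra_simps)
  also have "\<dots> = (norm (x - y))^2 - 2 * t * ((x - y) \<bullet> s) + t^2 * (norm s)^2"
   unfolding power2_norm_eq_inner power2_eq_square[of t]
   by (simp add: inner_diff_left inner_diff_right inner_commute algebra_simps)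
  also have "\<dots> = (norm (x - y))^2 - ((x - y) \<bullet> s)^2 / (norm s)^2"
   using s0 by (simp add: t_def power2_eq_square field_simps)
  finally show False using nz s0 by (simp add: divide_le_0_iff)
 qed
 with yS show ?thesis by blast
qed

lemma riesz_representation:
 fixes f :: "'h::{real_inner,complete_space} => real"
 assumes "bounded_linear f"
 shows "\<exists>y. \<forall>x. f x = y \<bullet> x"
proof (cases "\<forall>x. f x = 0")
 case True
 then show ?thesis by (intro exI[of _ 0]) auto
next
 case False
 interpret bounded_linear f by fact
 obtain x where x: "f x \<noteq> 0" using False by blast
 let ?S = "{z. f z = 0}"
 have "subspace ?S" by (simp add: subspace_def zero add scaleR)
 moreover have "closed ?S"
  using continuous_closed_vimage[of "{0}" f] assms linear_continuous_at by (auto simp: vimage_def)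
 ultimately obtain y where y: "f y = 0" "!!s. f s = 0 ==> (x - y) \<bullet> s = 0"
  using projection_exists[of ?S x] by auto
 define w where "w = x - y"
 have w: "f w = f x" using y by (simp add: w_def diff)
 have ww: "w \<bullet> w \<noteq> 0" using w x zero by auto
 have "f z = ((f w / (w \<bullet> w)) *R w) \<bullet> z" for z
 proof -
  have "f (z - (f z / f w) *R w) = 0" using w x by (simp add: diff scaleR)
  from y(2)[OF this] have "w \<bullet> z = (f z / f w) * (w \<bullet> w)" by (simp add: w_def[symmetric] inner_diff_right)
  then show ?thesis using w x ww by (simp add: field_simps)
 qed
 then show ?thesis by blast
qed

text \<open>The inner products of the sequence with its own members lie, after an affine change, in
  a compact cube, so a subsequence makes all of them converge. The vectors against which it
  converges form a closed subspace; what is orthogonal to this subspace is orthogonal to every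
  \<open>x n\<close>, so convergence extends to all vectors.\<close>

theorem weak_compactness:
 fixes x :: "nat => 'h::{real_inner,complete_space}"
 assumes M: "!!n. norm (x n) <= M"
 shows "\<exists>sub l. strict_mono sub & (\<forall>y. (%n. x (sub n) \<bullet> y) ----> l \<bullet> y)"
proof -
 have M0: "M >= 0" using M[of 0] norm_ge_zero order_trans by blast
 define K where "K = M * M + 1"
 have K: "K > 0" using M0 by (simp add: K_def add_nonneg_pos)
 have xx: "\<bar>x n \<bullet> x m\<bar> <= K" for n m
 proof -
  have "\<bar>x n \<bullet> x m\<bar> <= norm (x n) * norm (x m)" by (rule Cauchy_Schwarz_ineq2)
  also have "\<dots> <= M * M" using M M0 by (intro mult_mono) auto
  finally show ?thesis by (simp add: K_def)
 qed
 define g where "g n m = (x n \<bullet> x m / K + 1) / 2" for n m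
 have "g n \<in> {s. \<forall>i. 0 <= s i & s i <= 1}" for n
 proof -
  have "0 <= x n \<bullet> x m / K + 1" "x n \<bullet> x m / K <= 1" for m
   using xx[of n m] K by (auto simp: field_simps abs_le_iff)
  then show ?thesis by (simp add: g_def)
 qed
 then obtain l sub where l: "strict_mono sub" "(%n. g (sub n)) ----> l"
  using compact_unit_cube[unfolded compact_def, rule_format, of g] by (auto simp: o_def)
 define L where "L = {y. convergent (%n. x (sub n) \<bullet> y)}"
 have gm: "(%n. g (sub n) m) ----> l m" for m
  using continuous_on_tendsto_compose[OF continuous_on_product_coordinates[of m] l(2)] by auto
 have xL: "x m \<in> L" for m
 proof -
  have "(%n. (2 * g (sub n) m - 1) * K) ----> (2 * l m - 1) * K" by (intro tendsto_intros gm)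
  moreover have "(2 * g (sub n) m - 1) * K = x (sub n) \<bullet> x m" for n using K by (simp add: g_def field_simps)
  ultimately show ?thesis by (auto simp: L_def convergent_def)
 qed
 have sL: "subspace L"
  by (auto simp: subspace_def L_def inner_add_right intro: convergent_add convergent_mult convergent_const)
 have "closed L"
 proof (subst closed_sequential_limits, intro allI impI)
  fix y z assume "(\<forall>n. y n \<in> L) & y ----> z"
  then have yL: "!!n. y n \<in> L" and yz: "y ----> z" by auto
  have "Cauchy (%n. x (sub n) \<bullet> z)"
  proof (rule CauchyI)
   fix e :: real assume e: "e > 0"
   define e' where "e' = e / (3 * (M + 1))"
   have e': "e' > 0" using e M0 by (simp add: e'_def)
   obtain k where k: "norm (y k - z) < e'"
    using LIMSEQ_D[OF yz e'] by blast
   have small: "\<bar>x (sub n) \<bullet> z - x (sub n) \<bullet> y k\<bar> < e / 3" for n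
   proof -
    have "\<bar>x (sub n) \<bullet> z - x (sub n) \<bullet> y k\<bar> <= norm (x (sub n)) * norm (y k - z)"
     by (metis Cauchy_Schwarz_ineq2 inner_diff_right norm_minus_commute)
    also have "\<dots> <= M * norm (y k - z)" using M by (intro mult_right_mono) auto
    also have "\<dots> <= M * e'" using k M0 by (intro mult_left_mono) auto
    also have "\<dots> < (M + 1) * e'" using e' by simp
    also have "\<dots> = e / 3" using M0 by (simp add: e'_def field_simps)
    finally show ?thesis .
   qed
   have "Cauchy (%n. x (sub n) \<bullet> y k)" using yL[of k] by (simp add: L_def convergent_Cauchy)
   from CauchyD[OF this, of "e/3"] e obtain N where
    N: "!!m n. m >= N ==> n >= N ==> norm (x (sub m) \<bullet> y k - x (sub n) \<bullet> y k) < e / 3" by auto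
   show "\<exists>N. \<forall>m\<ge>N. \<forall>n\<ge>N. norm (x (sub m) \<bullet> z - x (sub n) \<bullet> z) < e"
   proof (intro exI allI impI)
    fix m n assume "m >= N" "n >= N"
    from N[OF this] small[of m] small[of n] show "norm (x (sub m) \<bullet> z - x (sub n) \<bullet> z) < e"
     unfolding real_norm_def by linarith
   qed
  qed
  then show "z \<in> L" by (simp add: L_def Cauchy_convergent)
 qed
 have conv: "convergent (%n. x (sub n) \<bullet> y)" for y
 proof -
  obtain p where p: "p \<in> L" "!!s. s \<in> L ==> (y - p) \<bullet> s = 0"
   using projection_exists[OF sL \<open>closed L\<close>, of y] by blast
  have "x (sub n) \<bullet> y = x (sub n) \<bullet> p" for n
   using p(2)[OF xL[of "sub n"]] by (simp add: inner_diff_left inner_commute)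
  then show ?thesis using p(1) by (simp add: L_def)
 qed
 define phi where "phi y = lim (%n. x (sub n) \<bullet> y)" for y
 have lim: "(%n. x (sub n) \<bullet> y) ----> phi y" for y
  using conv[of y] by (simp add: phi_def convergent_LIMSEQ_iff)
 have "bounded_linear phi"
 proof (rule bounded_linear_intro)
  show "phi (a + b) = phi a + phi b" for a b
   using tendsto_add[OF lim[of a] lim[of b]] lim[of "a + b"] by (simp add: inner_add_right LIMSEQ_unique)
  show "phi (r *R a) = r *R phi a" for r a
   using tendsto_mult_left[OF lim[of a], of r] lim[of "r *R a"] by (simp add: LIMSEQ_unique)
  show "norm (phi a) <= norm a * M" for a
  proof (rule LIMSEQ_le_const2[OF tendsto_norm[OF lim]], intro exI allI impI)
   fix n
   have "norm (x (sub n) \<bullet> a) <= norm (x (sub n)) * norm a" by (simp add: Cauchy_Schwarz_ineq2)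
   also have "\<dots> <= norm a * M" using M[of "sub n"] by (subst mult.commute) (intro mult_left_mono, auto)
   finally show "norm (x (sub n) \<bullet> a) <= norm a * M" .
  qed
 qed
 from riesz_representation[OF this] obtain l where "!!y. phi y = l \<bullet> y" by blast
 with lim l(1) show ?thesis by metis
qed

text \<open>The inf-sup inequality makes the set \<open>R\<close> of solvable right-hand sides
  closed. If \<open>v\<close> in \<open>S\<close> is orthogonal to \<open>R\<close>, then by
  symmetry \<open>a v z = 0\<close> for all \<open>z\<close> in \<open>S\<close>, and the inf-sup
  inequality gives \<open>v = 0\<close>.\<close>

theorem symmetric_inf_sup_solvable:
 fixes a :: "'h::{real_inner,complete_space} => 'h => real"
 assumes S: "subspace S" "closed S" and a: "bounded_bilinear a" and sym: "!!x y. a x y = a y x"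
  and c: "c > 0" and infsup: "!!z. z \<in> S ==> \<exists>xi\<in>S. norm xi <= 1 & a z xi >= c * norm z"
  and l: "bounded_linear l"
 shows "\<exists>z\<in>S. \<forall>xi\<in>S. a z xi = l xi"
proof -
 interpret a: bounded_bilinear a by fact
 define R where "R = {y\<in>S. \<exists>z\<in>S. \<forall>xi\<in>S. a z xi = y \<bullet> xi}"
 have bound: "c * norm z <= norm y" if "z \<in> S" "\<forall>xi\<in>S. a z xi = y \<bullet> xi" for y z
 proof -
  obtain xi where xi: "xi \<in> S" "norm xi <= 1" "a z xi >= c * norm z" using infsup[OF \<open>z \<in> S\<close>] by blast
  have "c * norm z <= y \<bullet> xi" using that xi by simp
  also have "\<dots> <= norm y * norm xi" by (rule norm_cauchy_schwarz)
  also have "\<dots> <= norm y" using xi(2) by (simp add: mult_left_le)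
  finally show ?thesis .
 qed
 have sR: "subspace R"
  unfolding subspace_def
 proof (intro conjI ballI allI)
  show "0 \<in> R" using S(1) by (auto simp: R_def subspace_0 a.zero_left intro!: bexI[of _ 0])
 next
  fix x y assume "x \<in> R" "y \<in> R"
  then obtain z z' where "x \<in> S" "y \<in> S" "z \<in> S" "\<forall>xi\<in>S. a z xi = x \<bullet> xi" "z' \<in> S" "\<forall>xi\<in>S. a z' xi = y \<bullet> xi"
   by (auto simp: R_def)
  then show "x + y \<in> R" unfolding R_def using S(1)
   by (auto simp: subspace_add a.add_left inner_add_left intro!: bexI[of _ "z + z'"])
 next
  fix r x assume "x \<in> R"
  then obtain z where "x \<in> S" "z \<in> S" "\<forall>xi\<in>S. a z xi = x \<bullet> xi" by (auto simp: R_def)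
  then show "r *R x \<in> R" unfolding R_def using S(1)
   by (auto simp: subspace_scale a.scaleR_left intro!: bexI[of _ "r *R z"])
 qed
 have "closed R"
 proof (subst closed_sequential_limits, intro allI impI)
  fix y w assume "(\<forall>n. y n \<in> R) & y ----> w"
  then have yR: "!!n. y n \<in> R" and yw: "y ----> w" by auto
  then obtain z where z: "!!n. z n \<in> S" "!!n. \<forall>xi\<in>S. a (z n) xi = y n \<bullet> xi" by (auto simp: R_def) metis
  have yS: "y n \<in> S" for n using yR by (auto simp: R_def)
  have zd: "c * norm (z m - z n) <= norm (y m - y n)" for m n
   by (rule bound) (use z S(1) in \<open>auto simp: subspace_diff a.diff_left inner_diff_left\<close>)
  have "Cauchy z"
  proof (rule CauchyI)
   fix e :: real assume "e > 0"
   then obtain N where N: "!!m n. m >= N ==> n >= N ==> norm (y m - y n) < c * e"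
    using CauchyD[OF LIMSEQ_imp_Cauchy[OF yw], of "c * e"] c by auto
   show "\<exists>N. \<forall>m\<ge>N. \<forall>n\<ge>N. norm (z m - z n) < e"
   proof (intro exI allI impI)
    fix m n assume "m >= N" "n >= N"
    then have "c * norm (z m - z n) < c * e" using zd[of m n] N[of m n] by simp
    then show "norm (z m - z n) < e" using c by simp
   qed
  qed
  then obtain v where v: "z ----> v" using Cauchy_convergent_iff convergent_def by blast
  have vS: "v \<in> S" using S(2) z(1) v closed_sequentially by blast
  have wS: "w \<in> S" using S(2) yS yw closed_sequentially by blast
  have "a v xi = w \<bullet> xi" if "xi \<in> S" for xi
  proof (rule LIMSEQ_unique)
   show "(%n. a (z n) xi) ----> a v xi" by (intro a.tendsto v tendsto_const)
   have "(%n. y n \<bullet> xi) ----> w \<bullet> xi" by (intro tendsto_intros yw)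
   then show "(%n. a (z n) xi) ----> w \<bullet> xi" using z(2) that by simp
  qed
  with vS wS show "w \<in> R" by (auto simp: R_def)
 qed
 obtain y where y: "!!x. l x = y \<bullet> x" using riesz_representation[OF l] by blast
 obtain p where p: "p \<in> S" "!!s. s \<in> S ==> (y - p) \<bullet> s = 0" using projection_exists[OF S] by blast
 obtain q where q: "q \<in> R" "!!s. s \<in> R ==> (p - q) \<bullet> s = 0" using projection_exists[OF sR \<open>closed R\<close>] by blast
 have qS: "q \<in> S" using q(1) by (auto simp: R_def)
 define v where "v = p - q"
 have vS: "v \<in> S" using p(1) qS S(1) by (simp add: v_def subspace_diff)
 have av: "a v z = 0" if zS: "z \<in> S" for z
 proof -
  have "bounded_linear (a z)" by (rule a.bounded_linear_right)
  then obtain t where t: "!!x. a z x = t \<bullet> x" using riesz_representation by blast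
  obtain t' where t': "t' \<in> S" "!!s. s \<in> S ==> (t - t') \<bullet> s = 0" using projection_exists[OF S] by blast
  have tt: "a z xi = t' \<bullet> xi" if "xi \<in> S" for xi using t t'(2)[OF that] by (simp add: inner_diff_left)
  then have "t' \<in> R" using zS t'(1) by (auto simp: R_def)
  then have "v \<bullet> t' = 0" using q(2) by (simp add: v_def)
  then show ?thesis using tt[OF vS] sym by (simp add: inner_commute)
 qed
 obtain xi where "xi \<in> S" "a v xi >= c * norm v" using infsup[OF vS] by blast
 then have "v = 0" using av c by (simp add: mult_le_0_iff)
 then have "p \<in> R" using q(1) by (simp add: v_def)
 then obtain z where "z \<in> S" "\<forall>xi\<in>S. a z xi = p \<bullet> xi" by (auto simp: R_def)
 then show ?thesis using p(2) y by (auto simp: inner_diff_left intro!: bexI[of _ z])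
qed

section \<open>The Hilbert space of square integrable functions\<close>

text \<open>Borel representatives and \<open>lborel\<close> are used throughout, so that
  translations and compositions stay measurable; \<open>completion_facts\<close> returns to Lebesgue
  measure.\<close>

definition sq_int :: "('a::euclidean_space => 'b::euclidean_space) => bool" where
 "sq_int f \<longleftrightarrow> f \<in> BM & integrable lborel (%x. (norm (f x))^2)"

lemma sq_int_measurable [measurable_dest]: "sq_int f ==> f \<in> BM"
 and sq_int_integrable: "sq_int f ==> integrable lborel (%x. (norm (f x))^2)"
 by (auto simp: sq_int_def)

lemma sq_int_0 [simp]: "sq_int (%x. 0)"
 by (simp add: sq_int_def)

lemma sq_int_bound:
 assumes g: "integrable lborel g" and [measurable]: "f \<in> BM"
  and le: "AE x in lborel. (norm (f x))^2 <= g x"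
 shows "sq_int f"
 unfolding sq_int_def by (auto intro!: Bochner_Integration.integrable_bound[OF g] eventually_mono[OF le])

lemma sq_int_bounded_by:
 assumes g: "sq_int g" and f: "f \<in> BM" and le: "AE x in lborel. norm (f x) <= C * norm (g x)"
 shows "sq_int f"
proof (rule sq_int_bound[OF _ f])
 show "integrable lborel (%x. C^2 * (norm (g x))^2)" using sq_int_integrable[OF g] by simp
 show "AE x in lborel. (norm (f x))^2 <= C^2 * (norm (g x))^2"
  using le by eventually_elim (metis norm_ge_zero power_mono power_mult_distrib)
qed

lemma sq_int_add [intro]:
 assumes "sq_int f" "sq_int g" shows "sq_int (%x. f x + g x)"
proof (rule sq_int_bound)
 show "integrable lborel (%x. 2 * (norm (f x))^2 + 2 * (norm (g x))^2)" using assms by (simp add: sq_int_def)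
 show "(%x. f x + g x) \<in> BM" using assms by measurable
 have "(norm (f x + g x))^2 <= 2 * (norm (f x))^2 + 2 * (norm (g x))^2" for x
  using parallelogram_law[of "f x" "- g x"] zero_le_power2[of "norm ((1/2) *R (f x + - g x))"] by simp
 then show "AE x in lborel. (norm (f x + g x))^2 <= 2 * (norm (f x))^2 + 2 * (norm (g x))^2" by simp
qed

lemma sq_int_scaleR [intro]: "sq_int f ==> sq_int (%x. c *R f x)"
 by (auto simp: sq_int_def power_mult_distrib)

lemma sq_int_cmult [intro]: "sq_int (f :: _ => real) ==> sq_int (%x. c * f x)"
 using sq_int_scaleR[of f c] by simp

lemma sq_int_minus [intro]: "sq_int f ==> sq_int (%x. - f x)"
 using sq_int_scaleR[of f "-1"] by simp

lemma sq_int_diff [intro]: "sq_int f ==> sq_int g ==> sq_int (%x. f x - g x)"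
 using sq_int_add[of f "%x. - g x"] sq_int_minus[of g] by simp

lemma sq_int_mult_bounded:
 assumes "sq_int g" "b \<in> BM" "!!x. \<bar>b x\<bar> <= C"
 shows "sq_int (%x. b x *R g x)"
 by (rule sq_int_bounded_by[OF assms(1), of _ C])
  (use assms sq_int_measurable in \<open>auto intro!: mult_right_mono borel_measurable_scaleR\<close>)

lemma sq_int_mult_bounded':
 assumes "sq_int (g :: _ => real)" "b \<in> BM" "!!x. \<bar>b x\<bar> <= C"
 shows "sq_int (%x. b x * g x)"
 using sq_int_mult_bounded[OF assms] by simp

lemma integrable_inner:
 assumes "sq_int f" "sq_int g" shows "integrable lborel (%x. f x \<bullet> g x)"
proof (rule Bochner_Integration.integrable_bound)
 show "integrable lborel (%x. (norm (f x))^2 + (norm (g x))^2)" using assms by (simp add: sq_int_def)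
 show "(%x. f x \<bullet> g x) \<in> borel_measurable lborel" using assms by measurable
 have "\<bar>f x \<bullet> g x\<bar> <= (norm (f x))^2 + (norm (g x))^2" for x
 proof -
  have "2 * (norm (f x) * norm (g x)) <= (norm (f x))^2 + (norm (g x))^2"
   using sum_squares_bound[of "norm (f x)" "norm (g x)"] by (simp add: algebra_simps)
  moreover have "0 <= norm (f x) * norm (g x)" by simp
  ultimately show ?thesis using Cauchy_Schwarz_ineq2[of "f x" "g x"] by linarith
 qed
 then show "AE x in lborel. norm (f x \<bullet> g x) <= norm ((norm (f x))^2 + (norm (g x))^2)" by simp
qed

lemma integrable_sq_mult:
 "sq_int (f :: _ => real) ==> sq_int g ==> integrable lborel (%x. f x * g x)"
 using integrable_inner[of f g] by simp

definition l2_rel :: "('a::euclidean_space => 'b::euclidean_space) => ('a => 'b) => bool" where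
 "l2_rel f g \<longleftrightarrow> sq_int f & sq_int g & (AE x in lborel. f x = g x)"

\<comment> \<open>The Hilbert space results speak about a type class, so L^2 has to become a type.
  The quotient is partial because only square integrable functions represent a class.\<close>
quotient_type (overloaded) ('a, 'b) l2 = "'a::euclidean_space => 'b::euclidean_space" / partial: l2_rel
 morphisms rep_l2 cls
proof (rule part_equivpI)
 show "\<exists>f. l2_rel f f" by (rule exI[of _ "%x. 0"]) (simp add: l2_rel_def)
 show "symp l2_rel" by (auto simp: symp_def l2_rel_def)
 show "transp l2_rel" by (auto simp: transp_def l2_rel_def)
qed

instantiation l2 :: (euclidean_space, euclidean_space) real_inner
begin

lift_definition zero_l2 :: "('a, 'b) l2" is "%x. 0" by (simp add: l2_rel_def)
lift_definition plus_l2 :: "('a, 'b) l2 => ('a, 'b) l2 => ('a, 'b) l2" is "%f g x. f x + g x"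
 by (auto simp: l2_rel_def)
lift_definition uminus_l2 :: "('a, 'b) l2 => ('a, 'b) l2" is "%f x. - f x"
 by (auto simp: l2_rel_def)
lift_definition minus_l2 :: "('a, 'b) l2 => ('a, 'b) l2 => ('a, 'b) l2" is "%f g x. f x - g x"
 by (auto simp: l2_rel_def)
lift_definition scaleR_l2 :: "real => ('a, 'b) l2 => ('a, 'b) l2" is "%c f x. c *\<^sub>R f x"
 by (auto simp: l2_rel_def)
lift_definition inner_l2 :: "('a, 'b) l2 => ('a, 'b) l2 => real" is "%f g. LBINT x. f x \<bullet> g x"
proof -
 fix f f' g g' :: "'a => 'b"
 assume a: "l2_rel f f'" "l2_rel g g'"
 then have [measurable]: "f \<in> BM" "f' \<in> BM"
  "g \<in> BM" "g' \<in> BM" by (auto simp: l2_rel_def)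
 show "(LBINT x. f x \<bullet> g x) = (LBINT x. f' x \<bullet> g' x)"
  by (rule integral_cong_AE) (use a in \<open>auto simp: l2_rel_def\<close>)
qed

definition norm_l2 :: "('a, 'b) l2 => real" where "norm_l2 x = sqrt (x \<bullet> x)"
definition dist_l2 :: "('a, 'b) l2 => ('a, 'b) l2 => real" where "dist_l2 x y = norm (x - y)"
definition sgn_l2 :: "('a, 'b) l2 => ('a, 'b) l2" where "sgn_l2 x = inverse (norm x) *\<^sub>R x"
definition uniformity_l2 :: "(('a, 'b) l2 \<times> ('a, 'b) l2) filter" where
 "uniformity_l2 = (INF e\<in>{0<..}. principal {(x, y). dist x y < e})"
definition open_l2 :: "('a, 'b) l2 set => bool" where
 "open_l2 U \<longleftrightarrow> (\<forall>x\<in>U. eventually (%(x', y). x' = x --> y \<in> U) uniformity)"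

instance
proof
 fix x y z :: "('a, 'b) l2" and a b r :: real and U :: "('a, 'b) l2 set"
 show "dist x y = norm (x - y)" by (rule dist_l2_def)
 show "sgn x = inverse (norm x) *\<^sub>R x" by (rule sgn_l2_def)
 show "norm x = sqrt (x \<bullet> x)" by (rule norm_l2_def)
 show "(uniformity :: (('a, 'b) l2 \<times> ('a, 'b) l2) filter) = (INF e\<in>{0<..}. principal {(x, y). dist x y < e})"
  by (rule uniformity_l2_def)
 show "open U \<longleftrightarrow> (\<forall>x\<in>U. eventually (%(x', y). x' = x --> y \<in> U) uniformity)" by (rule open_l2_def)
 show "x + y + z = x + (y + z)" by transfer (auto simp: l2_rel_def add.assoc)
 show "x + y = y + x" by transfer (auto simp: l2_rel_def add.commute)
 show "0 + x = x" by transfer (auto simp: l2_rel_def)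
 show "- x + x = 0" by transfer (auto simp: l2_rel_def)
 show "x - y = x + - y" by transfer (auto simp: l2_rel_def)
 show "r *\<^sub>R (x + y) = r *\<^sub>R x + r *\<^sub>R y" by transfer (auto simp: l2_rel_def scaleR_add_right)
 show "(a + b) *\<^sub>R x = a *\<^sub>R x + b *\<^sub>R x" by transfer (auto simp: l2_rel_def scaleR_add_left)
 show "a *\<^sub>R b *\<^sub>R x = (a * b) *\<^sub>R x" by transfer (auto simp: l2_rel_def)
 show "1 *\<^sub>R x = x" by transfer (auto simp: l2_rel_def)
 show "x \<bullet> y = y \<bullet> x" by transfer (simp add: inner_commute)
 show "(x + y) \<bullet> z = x \<bullet> z + y \<bullet> z"
  by transfer (simp add: l2_rel_def inner_add_left integrable_inner)
 show "r *\<^sub>R x \<bullet> y = r * (x \<bullet> y)"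
  by transfer (simp add: l2_rel_def)
 show "0 <= x \<bullet> x" by transfer simp
 show "x \<bullet> x = 0 \<longleftrightarrow> x = 0"
 proof (transfer)
  fix f :: "'a => 'b" assume "l2_rel f f"
  then have f: "sq_int f" by (simp add: l2_rel_def)
  have "(LBINT x. f x \<bullet> f x) = 0 \<longleftrightarrow> (AE x in lborel. f x \<bullet> f x = 0)"
   by (rule integral_nonneg_eq_0_iff_AE) (auto intro: integrable_inner f)
  then show "(LBINT x. f x \<bullet> f x) = 0 \<longleftrightarrow> l2_rel f (%x. 0)" using f by (simp add: l2_rel_def)
 qed
qed

end

lemma sq_int_rep [simp, intro]: "sq_int (rep_l2 X)"
 using Quotient3_rep_reflp[OF Quotient3_l2, of X] by (simp add: l2_rel_def)

lemma cls_rep [simp]: "cls (rep_l2 X) = X"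
 by (rule Quotient3_abs_rep[OF Quotient3_l2])

lemma rep_cls: "sq_int f ==> AE x in lborel. rep_l2 (cls f) x = f x"
 using rep_abs_rsp_left[OF Quotient3_l2, of f f] by (simp add: l2_rel_def)

lemma cls_eq_iff: "sq_int f ==> sq_int g ==> cls f = cls g \<longleftrightarrow> (AE x in lborel. f x = g x)"
 using Quotient3_rel[OF Quotient3_l2, of f g] by (simp add: l2_rel_def)

lemma cls_add: "sq_int f ==> sq_int g ==> cls f + cls g = cls (%x. f x + g x)"
 by (rule plus_l2.abs_eq) (auto simp: l2_rel_def)

lemma cls_diff: "sq_int f ==> sq_int g ==> cls f - cls g = cls (%x. f x - g x)"
 by (rule minus_l2.abs_eq) (auto simp: l2_rel_def)

lemma cls_scaleR: "sq_int f ==> c *R cls f = cls (%x. c *R f x)"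
 by (rule scaleR_l2.abs_eq) (auto simp: l2_rel_def)

lemma cls_0: "cls (%x. 0) = 0"
 by (simp add: zero_l2.abs_eq)

lemma inner_cls: "sq_int f ==> sq_int g ==> cls f \<bullet> cls g = (LBINT x. f x \<bullet> g x)"
 by (rule inner_l2.abs_eq) (auto simp: l2_rel_def)

lemma norm_cls: "sq_int f ==> (norm (cls f))^2 = (LBINT x. (norm (f x))^2)"
 by (simp add: power2_norm_eq_inner inner_cls)

lemma L2_Cauchy_Schwarz:
 assumes "sq_int f" "sq_int g"
 shows "\<bar>LBINT x. f x \<bullet> g x\<bar> <= sqrt (LBINT x. (norm (f x))^2) * sqrt (LBINT x. (norm (g x))^2)"
 using Cauchy_Schwarz_ineq2[of "cls f" "cls g"]
 unfolding inner_cls[OF assms] norm_cls[OF assms(1), symmetric] norm_cls[OF assms(2), symmetric] by simp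

lemma L2_Cauchy_Schwarz':
 assumes "sq_int (f :: _ => real)" "sq_int g"
 shows "\<bar>LBINT x. f x * g x\<bar> <= sqrt (LBINT x. (f x)^2) * sqrt (LBINT x. (g x)^2)"
 using L2_Cauchy_Schwarz[OF assms] by simp

text \<open>Riesz-Fischer: a rapidly convergent subsequence converges almost everywhere, and Fatou's
  lemma shows that the pointwise limit is also the limit in norm.\<close>

instance l2 :: (euclidean_space, euclidean_space) complete_space
proof
 fix X :: "nat => ('a, 'b) l2" assume CX: "Cauchy X"
 have "\<exists>N. \<forall>m\<ge>N. \<forall>n\<ge>N. norm (X m - X n) < (1/4)^k" for k
  using CauchyD[OF CX, of "(1/4)^k"] by simp
 then obtain N where N: "!!k m n. m >= N k ==> n >= N k ==> norm (X m - X n) < (1/4)^k" by metis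
 define M where "M k = Max (N ` {..k})" for k
 have MN: "N k <= M j" if "k <= j" for k j unfolding M_def using that by (intro Max_ge) auto
 define f where "f k = rep_l2 (X (M k))" for k
 have sf: "sq_int (f k)" for k by (simp add: f_def)
 then have [measurable]: "f k \<in> BM" for k by (simp add: sq_int_def)
 have ff: "(LBINT x. (norm (f j x - f k x))^2) <= ((1/4)^i)^2" if "j >= i" "k >= i" for i j k
 proof -
  have "(LBINT x. (norm (f j x - f k x))^2) = (norm (X (M j) - X (M k)))^2"
   using norm_cls[OF sq_int_diff[OF sf[of j] sf[of k]]] cls_diff[OF sf[of j] sf[of k]] by (simp add: f_def)
  also have "\<dots> <= ((1/4)^i)^2" using N[of i "M j" "M k"] MN that by (intro power_mono) auto
  finally show ?thesis .
 qed
 let ?d = "%k x. norm (f (Suc k) x - f k x)"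
 \<comment> \<open>Squared distances are at most \<open>16^-k\<close>. The weight \<open>4^k\<close>
   keeps the series integrable, while boundedness of the weighted terms at a point gives increments
   of order \<open>2^-k\<close>.\<close>
 have int: "(\<integral>\<^sup>+x. ennreal (4^k * (?d k x)^2) \<partial>lborel) <= ennreal ((1/4)^k)" for k
 proof -
  have i: "integrable lborel (%x. 4^k * (?d k x)^2)"
   using sq_int_integrable[OF sq_int_diff[OF sf sf]] by simp
  have "(\<integral>\<^sup>+x. ennreal (4^k * (?d k x)^2) \<partial>lborel) = ennreal (LBINT x. 4^k * (?d k x)^2)"
   by (rule nn_integral_eq_integral[OF i]) simp
  also have "\<dots> <= ennreal ((1/4)^k)"
  proof (rule ennreal_leI)
   have "(LBINT x. 4^k * (?d k x)^2) <= 4^k * ((1/4)^k)^2" using ff[of k "Suc k" k] by simp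
   also have "\<dots> = (1/4)^k" by (simp add: power2_eq_square field_simps flip: power_mult_distrib)
   finally show "(LBINT x. 4^k * (?d k x)^2) <= (1/4)^k" .
  qed
  finally show ?thesis .
 qed
 have "(\<integral>\<^sup>+x. (\<Sum>k. ennreal (4^k * (?d k x)^2)) \<partial>lborel) = (\<Sum>k. \<integral>\<^sup>+x. ennreal (4^k * (?d k x)^2) \<partial>lborel)"
  by (rule nn_integral_suminf) measurable
 also have "\<dots> <= (\<Sum>k. ennreal ((1/4)^k))" by (intro suminf_le int) auto
 also have "\<dots> < \<infinity>" by (subst suminf_ennreal2) (auto intro!: summable_geometric)
 finally have fin: "(\<integral>\<^sup>+x. (\<Sum>k. ennreal (4^k * (?d k x)^2)) \<partial>lborel) \<noteq> \<infinity>" by simp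
 have "AE x in lborel. (\<Sum>k. ennreal (4^k * (?d k x)^2)) \<noteq> \<infinity>"
  by (rule nn_integral_PInf_AE[OF _ fin]) measurable
 then have conv: "AE x in lborel. convergent (%k. f k x)"
 proof eventually_elim
  fix x assume "(\<Sum>k. ennreal (4^k * (?d k x)^2)) \<noteq> \<infinity>"
  then have "summable (%k. 4^k * (?d k x)^2)" by (intro summable_suminf_not_top) auto
  then have "Bseq (%k. 4^k * (?d k x)^2)" by (rule convergent_imp_Bseq[OF convergentI[OF summable_LIMSEQ_zero]])
  then obtain K where K: "K > 0" "!!k. norm (4^k * (?d k x)^2) <= K" by (auto simp: Bseq_def)
  have dle: "?d k x <= sqrt K * (1/2)^k" for k
  proof -
   have "(2^k * ?d k x)^2 = 4^k * (?d k x)^2"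
    by (simp add: power_mult_distrib power2_eq_square flip: power_mult_distrib[of 2 2])
   then have "(2^k * ?d k x)^2 <= K" using K(2)[of k] by simp
   then have "2^k * ?d k x <= sqrt K" by (rule real_le_rsqrt)
   then show ?thesis by (simp add: field_simps power_divide)
  qed
  have geo: "summable (%k. sqrt K * (1/2)^k)" by (rule summable_mult[OF summable_geometric]) simp
  have "summable (%k. f (Suc k) x - f k x)"
   by (rule summable_comparison_test'[where N = 0, OF geo dle])
  then have "convergent (%n. f n x - f 0 x)" by (simp only: summable_iff_convergent sum_lessThan_telescope[of "%k. f k x"])
  from convergent_add[OF this convergent_const[of "f 0 x"]] show "convergent (%k. f k x)" by (simp only: diff_add_cancel)
 qed
 define g where "g x = lim (%k. f k x)" for x
 have [measurable]: "g \<in> BM"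
  unfolding g_def by (rule borel_measurable_lim_metric) measurable
 have lim: "AE x in lborel. (%k. f k x) ----> g x"
  using conv by eventually_elim (simp add: g_def convergent_LIMSEQ_iff)
 have nn: "(\<integral>\<^sup>+x. ennreal ((norm (g x - f i x))^2) \<partial>lborel) <= ennreal (((1/4)^i)^2)" for i
 proof -
  have "(\<integral>\<^sup>+x. ennreal ((norm (g x - f i x))^2) \<partial>lborel) = (\<integral>\<^sup>+x. liminf (%j. ennreal ((norm (f j x - f i x))^2)) \<partial>lborel)"
  proof (rule nn_integral_cong_AE)
   show "AE x in lborel. ennreal ((norm (g x - f i x))^2) = liminf (%j. ennreal ((norm (f j x - f i x))^2))"
    using lim
   proof eventually_elim
    fix x assume "(%k. f k x) ----> g x"
    then have "(%j. ennreal ((norm (f j x - f i x))^2)) ----> ennreal ((norm (g x - f i x))^2)"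
     by (intro tendsto_intros)
    from lim_imp_Liminf[OF _ this] show "ennreal ((norm (g x - f i x))^2) = liminf (%j. ennreal ((norm (f j x - f i x))^2))" by simp
   qed
  qed
  also have "\<dots> <= liminf (%j. \<integral>\<^sup>+x. ennreal ((norm (f j x - f i x))^2) \<partial>lborel)"
   by (rule nn_integral_liminf) measurable
  also have "\<dots> <= liminf (%j. ennreal (((1/4)^i)^2))"
  proof (rule Liminf_mono)
   have "(\<integral>\<^sup>+x. ennreal ((norm (f j x - f i x))^2) \<partial>lborel) <= ennreal (((1/4)^i)^2)" if "j >= i" for j
    using ff[OF that order_refl] sq_int_integrable[OF sq_int_diff[OF sf[of j] sf[of i]]]
    by (subst nn_integral_eq_integral) (auto intro: ennreal_leI)
   then show "\<forall>\<^sub>F j in sequentially. (\<integral>\<^sup>+x. ennreal ((norm (f j x - f i x))^2) \<partial>lborel) <= ennreal (((1/4)^i)^2)"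
    unfolding eventually_sequentially by blast
  qed
  also have "\<dots> = ennreal (((1/4)^i)^2)" by (rule Liminf_const) simp
  finally show ?thesis .
 qed
 have sgf: "sq_int (%x. g x - f i x)" for i
  unfolding sq_int_def
  by (auto intro!: integrableI_nonneg le_less_trans[OF nn])
 have sg: "sq_int g" using sq_int_add[OF sgf[of 0] sf[of 0]] by simp
 have close: "norm (cls g - X (M i)) <= (1/4)^i" for i
 proof -
  have "(norm (cls g - X (M i)))^2 = (LBINT x. (norm (g x - f i x))^2)"
   using norm_cls[OF sgf[of i]] cls_diff[OF sg sf[of i]] by (simp add: f_def)
  also have "\<dots> <= ((1/4)^i)^2"
   using nn[of i] sq_int_integrable[OF sgf[of i]] by (subst (asm) nn_integral_eq_integral) auto
  finally show ?thesis by (rule power2_le_imp_le) simp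
 qed
 have "X ----> cls g"
 proof (rule LIMSEQ_I)
  fix r :: real assume r: "r > 0"
  obtain k where k: "(1/4::real)^k < r / 2" using real_arch_pow_inv[of "r/2" "1/4"] r by auto
  show "\<exists>no. \<forall>n\<ge>no. norm (X n - cls g) < r"
  proof (intro exI allI impI)
   fix n assume "n >= M k"
   then have "norm (X n - X (M k)) < (1/4)^k" using MN[of k k] by (intro N) auto
   moreover have "norm (X n - cls g) <= norm (X n - X (M k)) + norm (X (M k) - cls g)"
    using norm_triangle_ineq[of "X n - X (M k)" "X (M k) - cls g"] by simp
   ultimately show "norm (X n - cls g) < r" using close[of k] k by (simp add: norm_minus_commute)
  qed
 qed
 then show "convergent X" by (rule convergentI)
qed

section \<open>Smooth test functions\<close>

lemma partial_deriv_eq: "(phi has_derivative D) (at x) ==> pd i phi x = D (axis i 1)"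
 unfolding partial_deriv_def by (metis frechet_derivative_at)

lemma has_derivative_grad:
 fixes phi :: "real^'n::finite => real"
 assumes "phi differentiable (at x)"
 shows "(phi has_derivative (%h. grad phi x \<bullet> h)) (at x)"
proof -
 obtain D where D: "(phi has_derivative D) (at x)" using assms unfolding differentiable_def by blast
 interpret D: bounded_linear D using D by (rule has_derivative_bounded_linear)
 have "D h = grad phi x \<bullet> h" for h
 proof -
  have "D h = D (\<Sum>i\<in>UNIV. (h $ i) *R axis i 1)" by (simp add: basis_expansion[of h, unfolded scalar_mult_eq_scaleR])
  also have "\<dots> = (\<Sum>i\<in>UNIV. h $ i * D (axis i 1))" by (simp add: D.sum D.scaleR)
  also have "\<dots> = grad phi x \<bullet> h"
   by (simp add: inner_vec_def grad_def partial_deriv_eq[OF D] mult.commute)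
  finally show ?thesis .
 qed
 then show ?thesis using D by (metis (no_types, lifting) ext)
qed

lemma C_k_Suc_imp: "C_k (Suc m) phi ==> C_k m phi"
proof (induction m arbitrary: phi)
 case 0
 then show ?case by (auto simp: continuous_on_eq_continuous_at intro: differentiable_imp_continuous_within)
next
 case (Suc m)
 then show ?case using C_k.simps(2) by blast
qed

lemma C_k_add: "C_k m f ==> C_k m g ==> C_k m (%x. f x + g x)"
proof (induction m arbitrary: f g)
 case 0
 then show ?case by (auto intro: continuous_intros)
next
 case (Suc m)
 have "pd i (%x. f x + g x) = (%x. pd i f x + pd i g x)" for i
 proof
  fix x
  have "f differentiable (at x)" "g differentiable (at x)" using Suc.prems by auto
  from partial_deriv_eq[OF has_derivative_add[OF this[THEN has_derivative_grad]]]
  show "pd i (%x. f x + g x) x = pd i f x + pd i g x"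
   by (simp add: inner_axis grad_def)
 qed
 then show ?case using Suc by (auto intro: differentiable_add)
qed

lemma C_k_mult: "C_k m f ==> C_k m g ==> C_k m (%x. f x * g x)"
proof (induction m arbitrary: f g)
 case 0
 then show ?case by (auto intro: continuous_intros)
next
 case (Suc m)
 have "pd i (%x. f x * g x) = (%x. f x * pd i g x + pd i f x * g x)" for i
 proof
  fix x
  have "f differentiable (at x)" "g differentiable (at x)" using Suc.prems by auto
  from partial_deriv_eq[OF has_derivative_mult[OF this[THEN has_derivative_grad]]]
  show "pd i (%x. f x * g x) x = f x * pd i g x + pd i f x * g x"
   by (simp add: inner_axis grad_def)
 qed
 moreover have "C_k m f" "C_k m g" using Suc.prems by (auto dest: C_k_Suc_imp simp del: C_k.simps)
 ultimately show ?case using Suc by (auto intro!: differentiable_mult C_k_add)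
qed

lemma C_k_const: "C_k m (%x::real^'n::finite. c)"
proof (induction m arbitrary: c)
 case (Suc m)
 have "pd i (%x::real^'n. c) = (%x. 0)" for i
  by (rule ext) (simp add: partial_deriv_eq[OF has_derivative_const])
 then show ?case using Suc by simp
qed simp

lemma C_k_nth: "C_k m (%x::real^'n::finite. x $ j)"
proof (cases m)
 case (Suc k)
 have d: "((%x::real^'n. x $ j) has_derivative (%h. h $ j)) (at x)" for x
  by (rule bounded_linear_imp_has_derivative[OF bounded_linear_vec_nth])
 have "pd i (%x::real^'n. x $ j) = (%x. axis i 1 $ j)" for i
  by (rule ext) (rule partial_deriv_eq[OF d])
 then show ?thesis using Suc d by (auto simp: C_k_const differentiable_def)
qed (simp add: continuous_intros)

lemma C_k_shift: "C_k m phi ==> C_k m (%x. phi (x - a))"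
 and partial_deriv_shift: "(!!x. phi differentiable (at x)) ==> pd i (%x. phi (x - a)) x = pd i phi (x - a)"
proof -
 have d: "((%x. phi (x - a)) has_derivative (%h. grad phi (x - a) \<bullet> h)) (at x)"
  if "!!x. phi differentiable (at x)" for phi :: "real^'n::finite => real" and a x
 proof -
  have s: "((%x. x - a) has_derivative (%h. h)) (at x)" by (auto intro!: derivative_eq_intros)
  show ?thesis using has_derivative_compose[OF s has_derivative_grad[OF that]] .
 qed
 have p: "pd i (%x. phi (x - a)) x = pd i phi (x - a)"
  if "!!x. phi differentiable (at x)" for phi :: "real^'n::finite => real" and a x i
  using partial_deriv_eq[OF d[OF that]] by (simp add: grad_def inner_axis)
 show "(!!x. phi differentiable (at x)) ==> pd i (%x. phi (x - a)) x = pd i phi (x - a)"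
  by (rule p)
 show "C_k m phi ==> C_k m (%x. phi (x - a))"
 proof (induction m arbitrary: phi)
  case 0
  then show ?case by (auto intro!: continuous_intros continuous_on_compose2[of UNIV phi])
 next
  case (Suc m)
  have "pd i (%x. phi (x - a)) = (%x. pd i phi (x - a))" for i
   by (rule ext, rule p) (use Suc.prems in auto)
  then show ?case using Suc d[of phi a] by (auto simp: differentiable_def)
 qed
qed

text \<open>The derivatives of \<open>exp (- 1 / s)\<close> are of the form \<open>p (1 / s) * exp (- 1 / s)\<close> with polynomials \<open>p\<close>.\<close>

definition flat_exp :: "real poly => real => real" where
 "flat_exp p s = (if s > 0 then poly p (1 / s) * exp (- (1 / s)) else 0)"

lemma poly_exp_tendsto_0: "((%t. poly p t * exp (- t)) \<longlongrightarrow> (0::real)) at_top"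
proof -
 have "((%t. \<Sum>i\<le>degree p. coeff p i * (t ^ i / exp t)) \<longlongrightarrow> (\<Sum>i\<le>degree p. coeff p i * 0)) at_top"
  by (intro tendsto_intros tendsto_power_div_exp_0)
 then show ?thesis
  by (simp add: poly_altdef exp_minus divide_inverse sum_distrib_right mult.assoc)
qed

lemma flat_exp_derivative:
 "(flat_exp p has_real_derivative flat_exp ([:0, 0, 1:] * (p - pderiv p)) s) (at s)"
proof (cases s "0::real" rule: linorder_cases)
 case less
 have "((%s. 0) has_real_derivative 0) (at s)" by simp
 then show ?thesis
  using less by (subst DERIV_cong_ev[of s s _ "%s. 0" _ 0])
   (auto simp: flat_exp_def intro!: eventually_mono[OF eventually_nhds_in_open[of "{..<0}" s]])
next
 case greater
 have "((%s. poly p (1 / s) * exp (- (1 / s))) has_real_derivative flat_exp ([:0, 0, 1:] * (p - pderiv p)) s) (at s)"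
  using greater by (auto intro!: derivative_eq_intros DERIV_chain2[OF poly_DERIV] simp: flat_exp_def field_simps power2_eq_square)
 then show ?thesis
  using greater by (subst DERIV_cong_ev[of s s _ "%s. poly p (1 / s) * exp (- (1 / s))" _ "flat_exp ([:0, 0, 1:] * (p - pderiv p)) s"])
   (auto simp: flat_exp_def intro!: eventually_mono[OF eventually_nhds_in_open[of "{0<..}" s]])
next
 case equal
 have r: "((%h. (flat_exp p (0 + h) - flat_exp p 0) / h) \<longlongrightarrow> 0) (at_right 0)"
 proof -
  have "((%h. poly (pCons 0 p) (inverse h) * exp (- (inverse h))) \<longlongrightarrow> 0) (at_right 0)"
   by (rule filterlim_compose[OF poly_exp_tendsto_0 filterlim_inverse_at_top_right])
  then show ?thesis
   by (rule Lim_transform_eventually)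
    (auto simp: flat_exp_def divide_inverse eventually_at_right_less intro!: eventually_mono[OF eventually_at_right_less[of 0]])
 qed
 have l: "((%h. (flat_exp p (0 + h) - flat_exp p 0) / h) \<longlongrightarrow> 0) (at_left 0)"
  by (rule tendsto_eventually, rule eventually_mono[OF eventually_at_left_real[of "-1" 0]]) (auto simp: flat_exp_def)
 have "((%h. (flat_exp p (0 + h) - flat_exp p 0) / h) \<longlongrightarrow> 0) (at 0)"
  using l r by (simp add: filterlim_split_at)
 then show ?thesis using equal by (simp add: DERIV_def flat_exp_def)
qed

lemma C_k_flat_exp:
 assumes q: "!!m. C_k m q" shows "C_k m (%x. flat_exp p (q x))"
proof (induction m arbitrary: p)
 case 0
 have "continuous_on UNIV (flat_exp p)"
  using flat_exp_derivative DERIV_isCont continuous_at_imp_continuous_on by blast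
 then show ?case using q[of 0] by (auto intro: continuous_on_compose2)
next
 case (Suc m)
 let ?D = "[:0, 0, 1:] * (p - pderiv p)"
 have qd: "q differentiable (at x)" for x using q[of 1] by simp
 have d: "((%x. flat_exp p (q x)) has_derivative (%h. flat_exp ?D (q x) * (grad q x \<bullet> h))) (at x)" for x
  using has_derivative_compose[OF has_derivative_grad[OF qd] flat_exp_derivative[of p "q x", unfolded has_field_derivative_def]]
  by simp
 have "pd i (%x. flat_exp p (q x)) = (%x. flat_exp ?D (q x) * pd i q x)" for i
  by (rule ext, subst partial_deriv_eq[OF d]) (simp add: grad_def inner_axis)
 moreover have "C_k m (pd i q)" for i using q[of "Suc m"] by simp
 ultimately show ?case using d Suc by (auto simp: differentiable_def intro!: C_k_mult simp del: mult_pCons_left)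
qed

definition C_inf :: "(real^'n::finite => real) set" where "C_inf = {phi. \<forall>m. C_k m phi}"

lemma C_inf_intros [intro]:
 "(%x. c) \<in> C_inf" "(%x. x $ j) \<in> C_inf"
 "f \<in> C_inf ==> g \<in> C_inf ==> (%x. f x + g x) \<in> C_inf"
 "f \<in> C_inf ==> g \<in> C_inf ==> (%x. f x * g x) \<in> C_inf"
 "f \<in> C_inf ==> (%x. flat_exp p (f x)) \<in> C_inf"
 "f \<in> C_inf ==> (%x. f (x - a)) \<in> C_inf"
 by (auto simp: C_inf_def C_k_const C_k_nth C_k_add C_k_mult C_k_flat_exp C_k_shift)

lemma C_inf_diff: "f \<in> C_inf ==> g \<in> C_inf ==> (%x. f x - g x) \<in> C_inf"
 using C_inf_intros(3)[of f, OF _ C_inf_intros(4)[OF C_inf_intros(1)[of "-1"], of g]] by simp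

lemma C_inf_sum: "finite A ==> (!!i. i \<in> A ==> f i \<in> C_inf) ==> (%x. \<Sum>i\<in>A. f i x) \<in> C_inf"
 by (induction A rule: finite_induct) auto

lemma C_inf_prod: "finite A ==> (!!i. i \<in> A ==> f i \<in> C_inf) ==> (%x. \<Prod>i\<in>A. f i x) \<in> C_inf"
 by (induction A rule: finite_induct) auto

lemma C_inf_norm2: "(%x. (norm (x::real^'n::finite))^2) \<in> C_inf"
proof -
 have "(%x. \<Sum>i\<in>UNIV. x $ i * x $ i) \<in> C_inf" by (auto intro!: C_inf_sum)
 then show ?thesis by (simp add: power2_norm_eq_inner inner_vec_def)
qed

lemma Cc_infinityI: "phi \<in> C_inf ==> (!!x. phi x \<noteq> 0 ==> norm x <= R) ==> phi \<in> Cc"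
 unfolding Cc_infinity_def C_inf_def by (auto simp: compact_closure bounded_iff)

lemma Cc_infinityD: "phi \<in> Cc ==> phi \<in> C_inf" "phi \<in> Cc ==> \<exists>R>0. \<forall>x. phi x \<noteq> 0 --> norm x <= R"
proof -
 assume "phi \<in> Cc"
 then show "phi \<in> C_inf" "\<exists>R>0. \<forall>x. phi x \<noteq> 0 --> norm x <= R"
  unfolding Cc_infinity_def C_inf_def by (auto simp: compact_closure bounded_pos)
qed

lemma Cc_infinity_mult: "phi \<in> Cc ==> psi \<in> C_inf ==> (%x. psi x * phi x) \<in> Cc"
 using Cc_infinityD(2)[of phi] by (auto intro!: Cc_infinityI C_inf_intros dest: Cc_infinityD)

lemma Cc_infinity_shift: "phi \<in> Cc ==> (%x. phi (x - a)) \<in> Cc"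
proof -
 assume p: "phi \<in> Cc"
 then obtain R where R: "!!x. phi x \<noteq> 0 ==> norm x <= R" using Cc_infinityD(2) by blast
 show ?thesis
 proof (rule Cc_infinityI)
  show "norm x <= R + norm a" if "phi (x - a) \<noteq> 0" for x
   using R[OF that] norm_triangle_ineq[of "x - a" a] by simp
 qed (use p Cc_infinityD in auto)
qed

lemma C_inf_differentiable: "phi \<in> C_inf ==> phi differentiable (at x)"
 unfolding C_inf_def using C_k.simps(2)[of 0 phi] by blast

lemma C_inf_partial: "phi \<in> C_inf ==> pd i phi \<in> C_inf"
 unfolding C_inf_def using C_k.simps(2) by blast

lemma C_inf_continuous: "phi \<in> C_inf ==> continuous_on UNIV phi"
 unfolding C_inf_def using C_k.simps(1)[of phi] by blast

lemma partial_deriv_eq_0: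
 assumes "phi \<in> C_inf" "open U" "x \<in> U" "!!y. y \<in> U ==> phi y = c"
 shows "pd i phi x = 0"
proof -
 have "(phi has_derivative (%h. 0)) (at x)"
  by (rule has_derivative_transform_within_open[OF has_derivative_const[of c] assms(2,3)]) (use assms(4) in auto)
 then show ?thesis by (rule partial_deriv_eq)
qed

lemma Cc_infinity_partial:
 assumes "phi \<in> Cc" shows "pd i phi \<in> Cc"
proof -
 obtain R where R: "!!x. phi x \<noteq> 0 ==> norm x <= R" using Cc_infinityD(2)[OF assms] by blast
 show ?thesis
 proof (rule Cc_infinityI[OF C_inf_partial[OF Cc_infinityD(1)[OF assms]], of _ R], rule ccontr)
  fix x assume nz: "pd i phi x \<noteq> 0" and "~ norm x <= R"
  then have "x \<in> {y. R < norm y}" by simp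
  moreover have "open {y::real^'n. R < norm y}" by (rule open_Collect_less) (auto intro: continuous_intros)
  ultimately have "pd i phi x = 0"
   using partial_deriv_eq_0[OF Cc_infinityD(1)[OF assms], of _ x 0] R by fastforce
  with nz show False by simp
 qed
qed

section \<open>Smooth cutoff functions\<close>

definition flat1 :: "real => real" where "flat1 = flat_exp [:1:]"

lemma flat1_pos: "flat1 s > 0 \<longleftrightarrow> s > 0" and flat1_nonneg: "flat1 s >= 0" and flat1_0: "s <= 0 ==> flat1 s = 0"
 and flat1_mono: "s <= t ==> flat1 s <= flat1 t" and flat1_le: "flat1 s <= 1"
 by (auto simp: flat1_def flat_exp_def frac_le)

text \<open>Built from \<open>flat1\<close> by composition and division by a constant, so that
  closure of \<open>C_inf\<close> under sums, products and composition with \<open>flat_exp\<close>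
  is enough for smoothness.\<close>

definition smooth_step :: "real => real => real" where
 "smooth_step d s = flat1 (flat1 d - flat1 s) / flat1 (flat1 d)"

lemma smooth_step:
 assumes "d > 0"
 shows "0 <= smooth_step d s" "smooth_step d s <= 1" "s <= 0 ==> smooth_step d s = 1" "s >= d ==> smooth_step d s = 0"
proof -
 have p: "flat1 (flat1 d) > 0" using assms by (simp add: flat1_pos)
 show "0 <= smooth_step d s" "s <= 0 ==> smooth_step d s = 1" using p by (auto simp: smooth_step_def flat1_nonneg flat1_0)
 show "smooth_step d s <= 1" using p flat1_mono[of "flat1 d - flat1 s" "flat1 d"] flat1_nonneg[of s] by (simp add: smooth_step_def)
 show "s >= d ==> smooth_step d s = 0" using flat1_mono[of d s] by (simp add: smooth_step_def flat1_0)
qed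

lemma C_inf_smooth_step: "f \<in> C_inf ==> (%x. smooth_step d (f x)) \<in> C_inf"
proof -
 assume "f \<in> C_inf"
 then have "(%x. (1 / flat1 (flat1 d)) * flat1 (flat1 d - flat1 (f x))) \<in> C_inf"
  unfolding flat1_def by (intro C_inf_intros C_inf_diff)
 then show ?thesis by (simp add: smooth_step_def divide_inverse mult.commute)
qed

lemma ball_cutoff:
 assumes "0 <= r" "r < R"
 shows "\<exists>zeta\<in>Cc. (\<forall>x::real^'n::finite. 0 <= zeta x & zeta x <= 1 & (norm x <= r --> zeta x = 1) & (norm x >= R --> zeta x = 0))"
proof -
 define zeta where "zeta x = smooth_step (R^2 - r^2) ((norm x)^2 - r^2)" for x :: "real^'n"
 have d: "R^2 - r^2 > 0" using assms by (simp add: power_strict_mono)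
 have 0: "zeta x = 0" if "norm x >= R" for x
  unfolding zeta_def using that assms by (intro smooth_step(4)[OF d]) (simp add: power_mono)
 have 1: "zeta x = 1" if "norm x <= r" for x
  unfolding zeta_def using that by (intro smooth_step(3)[OF d]) (simp add: power_mono)
 have "zeta \<in> Cc"
 proof (rule Cc_infinityI[of _ R])
  show "zeta \<in> C_inf" unfolding zeta_def by (intro C_inf_smooth_step C_inf_diff C_inf_norm2 C_inf_intros)
  show "norm x <= R" if "zeta x \<noteq> 0" for x using 0[of x] that by force
 qed
 then show ?thesis using 0 1 smooth_step(1,2)[OF d] by (intro bexI[of _ zeta]) (auto simp: zeta_def)
qed

lemma box_cutoff:
 assumes "d > 0"
 shows "\<exists>zeta\<in>Cc. \<forall>x::real^'n::finite. 0 <= zeta x & zeta x <= 1 & (x \<in> cbox a b --> zeta x = 1) &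
   ((\<exists>i. x $ i <= a $ i - d \<or> x $ i >= b $ i + d) --> zeta x = 0)"
proof -
 define zeta where "zeta x = (\<Prod>i\<in>UNIV. smooth_step d (a $ i - x $ i) * smooth_step d (x $ i - b $ i))" for x :: "real^'n"
 have 0: "zeta x = 0" if "x $ i <= a $ i - d \<or> x $ i >= b $ i + d" for x i
 proof -
  have "smooth_step d (a $ i - x $ i) * smooth_step d (x $ i - b $ i) = 0"
   using that smooth_step(4)[OF assms] by auto
  then show ?thesis unfolding zeta_def by (intro prod_zero) auto
 qed
 have 1: "zeta x = 1" if "x \<in> cbox a b" for x
  unfolding zeta_def using that by (intro prod.neutral) (auto simp: mem_box_cart smooth_step(3)[OF assms])
 have 2: "0 <= zeta x" "zeta x <= 1" for x
  unfolding zeta_def using smooth_step(1,2)[OF assms] by (auto intro!: prod_nonneg prod_le_1 mult_le_one)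
 have "zeta \<in> C_inf"
  unfolding zeta_def by (intro C_inf_prod C_inf_intros C_inf_smooth_step C_inf_diff) auto
 moreover have "norm x <= (\<Sum>i\<in>UNIV. \<bar>a $ i\<bar> + \<bar>b $ i\<bar> + d)" if "zeta x \<noteq> 0" for x
 proof -
  have "norm x <= (\<Sum>i\<in>UNIV. \<bar>x $ i\<bar>)" by (rule norm_le_l1_cart)
  also have "\<dots> <= (\<Sum>i\<in>UNIV. \<bar>a $ i\<bar> + \<bar>b $ i\<bar> + d)"
  proof (rule sum_mono)
   fix i
   have "~ x $ i <= a $ i - d" "~ x $ i >= b $ i + d" using 0[of x i] that by auto
   then show "\<bar>x $ i\<bar> <= \<bar>a $ i\<bar> + \<bar>b $ i\<bar> + d" by linarith
  qed
  finally show ?thesis .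
 qed
 ultimately have "zeta \<in> Cc" by (rule Cc_infinityI)
 then show ?thesis using 0 1 2 by (intro bexI[of _ zeta]) auto
qed

section \<open>Density of test functions and modes of convergence\<close>

lemma test_bounded: 
 assumes "phi \<in> Cc" shows "\<exists>B>0. \<forall>x. \<bar>phi x\<bar> <= B"
proof -
 obtain R where R: "!!x. phi x \<noteq> 0 ==> norm x <= R" using Cc_infinityD(2)[OF assms] by blast
 have "compact (phi ` cball 0 R)"
  by (rule compact_continuous_image) (use C_inf_continuous[OF Cc_infinityD(1)[OF assms]] continuous_on_subset in auto)
 then obtain B where B: "B > 0" "!!y. y \<in> phi ` cball 0 R ==> norm y <= B"
  using compact_imp_bounded bounded_pos by metis
 have "\<bar>phi x\<bar> <= B" for x using R[of x] B by (cases "phi x = 0") auto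
 then show ?thesis using B(1) by blast
qed

lemma C_inf_measurable [measurable_dest]: "phi \<in> C_inf ==> phi \<in> BM"
 by (rule borel_measurable_continuous_onI) (rule C_inf_continuous)

lemma test_measurable [measurable_dest]: "phi \<in> Cc ==> phi \<in> BM"
 by (rule C_inf_measurable) (rule Cc_infinityD)

lemma grad_nth: "grad phi x $ i = pd i phi x"
 by (simp add: grad_def)

lemma borel_measurable_vec_nth [measurable]:
 "(f :: 'x => real^'n::finite) \<in> borel_measurable M ==> (%x. f x $ i) \<in> borel_measurable M"
 by (simp add: cart_eq_inner_axis)

lemma borel_measurable_vec_lambda:
 assumes "!!i. (%x. f x $ i) \<in> borel_measurable M"
 shows "(f :: 'x => real^'n::finite) \<in> borel_measurable M"
 by (subst borel_measurable_euclidean_space) (use assms in \<open>auto simp: Basis_vec_def inner_axis\<close>)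

lemma grad_measurable: "phi \<in> C_inf ==> grad phi \<in> BM"
 by (rule borel_measurable_vec_lambda) (auto simp: grad_nth intro!: C_inf_measurable C_inf_partial)

lemma grad_bounded:
 assumes "phi \<in> Cc" shows "\<exists>B>0. \<forall>x. norm (grad phi x) <= B"
proof -
 have "\<exists>B. \<forall>x. \<bar>pd i phi x\<bar> <= B" for i
  using test_bounded[OF Cc_infinity_partial[OF assms]] by blast
 then obtain B where B: "!!i x. \<bar>pd i phi x\<bar> <= B i" by metis
 have "norm (grad phi x) <= (\<Sum>i\<in>UNIV. B i)" for x
  using norm_le_l1_cart[of "grad phi x"] sum_mono[of UNIV "%i. \<bar>grad phi x $ i\<bar>" B] B
  by (auto simp: grad_nth intro: order_trans)
 then show ?thesis by (intro exI[of _ "max 1 (\<Sum>i\<in>UNIV. B i)"]) (auto simp: le_max_iff_disj)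
qed

lemma emeasure_cball_finite: "emeasure lborel (cball a R :: 'a::euclidean_space set) < \<infinity>"
 by (rule emeasure_bounded_finite) simp

lemma sq_int_bounded_support:
 fixes f :: "'a::euclidean_space => 'b::euclidean_space"
 assumes [measurable]: "f \<in> BM" and B: "!!x. norm (f x) <= B" and R: "!!x. f x \<noteq> 0 ==> norm x <= R"
 shows "sq_int f"
proof -
 have "integrable lborel (%x. (norm (f x))^2)"
 proof (rule integrableI_bounded_set[where A = "cball 0 R" and B = "B^2"])
  show "AE x in lborel. x \<in> cball 0 R --> norm ((norm (f x))^2) <= B^2" using power_mono[OF B norm_ge_zero] by auto
  show "AE x in lborel. x \<notin> cball 0 R --> (norm (f x))^2 = 0" using R by force
 qed (use emeasure_cball_finite in auto)
 then show ?thesis by (simp add: sq_int_def)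
qed

lemma sq_int_test: "phi \<in> Cc ==> sq_int phi"
 using sq_int_bounded_support[of phi] test_bounded[of phi] Cc_infinityD(2)[of phi] test_measurable[of phi]
 by (metis real_norm_def)

lemma grad_support: "phi \<in> C_inf ==> (!!x. phi x \<noteq> 0 ==> norm x <= R) ==> grad phi x \<noteq> 0 ==> norm x <= R"
proof (rule ccontr)
 assume a: "phi \<in> C_inf" "!!x. phi x \<noteq> 0 ==> norm x <= R" "grad phi x \<noteq> 0" "~ norm x <= R"
 have "open {y::real^'a. R < norm y}" by (rule open_Collect_less) (auto intro: continuous_intros)
 then have "pd i phi x = 0" for i
  using partial_deriv_eq_0[OF a(1), of "{y. R < norm y}" x 0] a by fastforce
 then have "grad phi x = 0" by (simp add: vec_eq_iff grad_nth)
 with a(3) show False by simp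
qed

lemma sq_int_grad: "phi \<in> Cc ==> sq_int (grad phi)"
 using sq_int_bounded_support[of "grad phi"] grad_bounded[of phi] Cc_infinityD[of phi] grad_measurable[of phi] grad_support[of phi]
 by metis

text \<open>Cutoffs of slightly smaller boxes carry the orthogonality over to indicators of boxes.
  Boxes are an intersection-stable generator, so the measures with densities \<open>qp\<close> and
  \<open>qm\<close> coincide.\<close>

lemma zero_if_orthogonal_to_tests:
 fixes q :: "real^'n::finite => real"
 assumes q: "sq_int q" and 0: "!!phi. phi \<in> Cc ==> (LBINT x. q x * phi x) = 0"
 shows "AE x in lborel. q x = 0"
proof -
 have [measurable]: "q \<in> BM" using q by (simp add: sq_int_def)
 have sqbox: "sq_int (indicator (box a b) :: real^'n => real)" for a b
 proof -
  obtain R where "box a b \<subseteq> cball 0 R" using bounded_box[of a b] unfolding bounded_def by (metis bounded_box bounded_pos mem_cball_0 subsetI)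
  then show ?thesis by (intro sq_int_bounded_support[of _ 1 R]) (auto simp: indicator_def split: if_splits)
 qed
 have box: "(LBINT x. q x * indicator (box a b) x) = 0" for a b
 proof -
  define d where "d n = inverse (real (Suc n))" for n
  have d: "d n > 0" for n by (simp add: d_def)
  have "\<exists>zeta\<in>Cc. \<forall>x::real^'n. 0 <= zeta x & zeta x <= 1 & (x \<in> cbox (a + (\<chi> i. d n)) (b - (\<chi> i. d n)) --> zeta x = 1) &
    ((\<exists>i. x $ i <= a $ i \<or> x $ i >= b $ i) --> zeta x = 0)" for n
   using box_cutoff[OF d[of n], of "a + (\<chi> i. d n)" "b - (\<chi> i. d n)"] by simp
  then obtain zeta where z: "!!n. zeta n \<in> Cc" "!!n x. 0 <= zeta n x & zeta n x <= 1"
   "!!n x. x \<in> cbox (a + (\<chi> i. d n)) (b - (\<chi> i. d n)) ==> zeta n x = 1"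
   "!!n x i. x $ i <= a $ i \<or> x $ i >= b $ i ==> zeta n x = 0"
   by metis
  have [measurable]: "zeta n \<in> BM" for n using z(1) test_measurable by blast
  have lim: "(%n. zeta n x) ----> indicator (box a b) x" for x
  proof (cases "x \<in> box a b")
   case True
   have "\<forall>\<^sub>F n in sequentially. d n < x $ i - a $ i & d n < b $ i - x $ i" for i
   proof -
    have "d ----> 0" unfolding d_def by (rule LIMSEQ_inverse_real_of_nat)
    then show ?thesis using True by (intro eventually_conj order_tendstoD(2)[of d]) (auto simp: mem_box_cart)
   qed
   then have "\<forall>\<^sub>F n in sequentially. \<forall>i. d n < x $ i - a $ i & d n < b $ i - x $ i"
    by (simp add: eventually_all_finite)
   then have "\<forall>\<^sub>F n in sequentially. zeta n x = 1"
   proof eventually_elim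
    case (elim n)
    then show ?case by (intro z(3)) (auto simp: mem_box_cart less_imp_le algebra_simps intro: less_imp_le)
   qed
   then show ?thesis using True by (simp add: tendsto_eventually)
  next
   case False
   then have "zeta n x = 0" for n using z(4)[of x _ n] by (auto simp: mem_box_cart not_less)
   then show ?thesis using False by simp
  qed
  have "(%n. LBINT x. q x * zeta n x) ----> (LBINT x. q x * indicator (box a b) x)"
  proof (rule integral_dominated_convergence[where w = "%x. \<bar>q x * indicator (box a b) x\<bar>"])
   show "integrable lborel (%x. \<bar>q x * indicator (box a b) x\<bar>)"
    by (intro integrable_abs integrable_sq_mult q sqbox)
   show "AE x in lborel. norm (q x * zeta n x) <= \<bar>q x * indicator (box a b) x\<bar>" for n
   proof (rule AE_I2)
    fix x show "norm (q x * zeta n x) <= \<bar>q x * indicator (box a b) x\<bar>"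
    proof (cases "x \<in> box a b")
     case True
     then show ?thesis using z(2)[of n x] by (auto simp: abs_mult mult_left_le)
    next
     case False
     then obtain i where "x $ i <= a $ i \<or> x $ i >= b $ i" by (auto simp: mem_box_cart not_less)
     from z(4)[OF this, of n] show ?thesis by simp
    qed
   qed
   show "AE x in lborel. (%n. q x * zeta n x) ----> q x * indicator (box a b) x"
    by (intro AE_I2 tendsto_intros lim)
  qed measurable
  then show ?thesis using 0[OF z(1)] by (simp add: LIMSEQ_const_iff)
 qed
 define qp where "qp x = max 0 (q x)" for x
 define qm where "qm x = max 0 (- q x)" for x
 have [measurable]: "qp \<in> BM" "qm \<in> BM" unfolding qp_def[abs_def] qm_def[abs_def] by measurable
 have sqp: "sq_int qp" "sq_int qm"
  by (rule sq_int_bounded_by[OF q, of _ 1]; auto simp: qp_def qm_def)+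
 have em: "emeasure (density lborel (%x. ennreal (r x))) (box a b) = ennreal (LBINT x. r x * indicator (box a b) x)"
  if "sq_int r" "!!x. r x >= 0" for r and a b :: "real^'n"
 proof -
  have [measurable]: "r \<in> BM" using that(1) by (simp add: sq_int_def)
  have "emeasure (density lborel (%x. ennreal (r x))) (box a b) = (\<integral>\<^sup>+x. ennreal (r x * indicator (box a b) x) \<partial>lborel)"
   by (subst emeasure_density) (auto intro!: nn_integral_cong simp: indicator_def)
  also have "\<dots> = ennreal (LBINT x. r x * indicator (box a b) x)"
   by (rule nn_integral_eq_integral[OF integrable_sq_mult[OF that(1) sqbox]]) (use that(2) in auto)
  finally show ?thesis .
 qed
 have "density lborel (%x. ennreal (qp x)) = density lborel (%x. ennreal (qm x))"
 proof (rule measure_eqI_generator_eq[where E = "range (%(a, b). box a b :: (real^'n) set)" and \<Omega> = UNIV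
    and A = "%n. box (\<chi> i. - real n) (\<chi> i. real n)"])
  show "Int_stable (range (%(a, b). box a b :: (real^'n) set))"
   by (auto simp: Int_stable_def box_Int_box)
  fix X :: "(real^'n) set" assume "X \<in> range (%(a, b). box a b)"
  then obtain a b where X: "X = box a b" by auto
  have "(LBINT x. qp x * indicator (box a b) x) - (LBINT x. qm x * indicator (box a b) x)
   = (LBINT x. q x * indicator (box a b) x)"
  proof -
   have "qp x * indicator (box a b) x - qm x * indicator (box a b) x = q x * indicator (box a b) x" for x
    by (auto simp: qp_def qm_def max_def indicator_def)
   then show ?thesis
    using Bochner_Integration.integral_diff[OF integrable_sq_mult[OF sqp(1) sqbox] integrable_sq_mult[OF sqp(2) sqbox], of a b a b]
    by simp
  qed
  then show "emeasure (density lborel (%x. ennreal (qp x))) X = emeasure (density lborel (%x. ennreal (qm x))) X"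
   unfolding X using em[OF sqp(1)] em[OF sqp(2)] box by (simp add: qp_def qm_def)
 next
  show "sets (density lborel (%x. ennreal (qp x))) = sigma_sets UNIV (range (%(a, b). box a b :: (real^'n) set))"
   "sets (density lborel (%x. ennreal (qm x))) = sigma_sets UNIV (range (%(a, b). box a b :: (real^'n) set))"
   by (subst sets_density, subst sets_lborel, subst borel_eq_box, simp add: sets_measure_of)+
 next
  show "(\<Union>n. box (\<chi> i. - real n) (\<chi> i. real n)) = (UNIV :: (real^'n) set)"
  proof -
   have "x \<in> (\<Union>n. box (\<chi> i. - real n) (\<chi> i. real n))" for x :: "real^'n"
   proof -
    obtain n where "norm x < real n" using reals_Archimedean2 by blast
    then have "\<bar>x $ i\<bar> < real n" for i using component_le_norm_cart[of x i] by linarith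
    then show ?thesis by (auto simp: mem_box_cart abs_less_iff intro!: exI[of _ n])
     (metis minus_less_iff)
   qed
   then show ?thesis by blast
  qed
  show "emeasure (density lborel (%x. ennreal (qp x))) (box (\<chi> i. - real n) (\<chi> i. real n)) \<noteq> \<infinity>" for n
   by (subst em) (auto simp: sqp qp_def)
 qed auto
 then have "AE x in lborel. ennreal (qp x) = ennreal (qm x)"
  by (intro sigma_finite_measure.density_unique[OF lborel.sigma_finite_measure_axioms]) measurable
 then show ?thesis by eventually_elim (auto simp: qp_def qm_def max_def split: if_splits)
qed

section \<open>Weak and strong convergence in L^2\<close>

text \<open>This and \<open>l2conv\<close> speak about representatives; \<open>wconv_cls\<close> and
  \<open>l2conv_cls\<close> translate them to the Hilbert space once membership in L^2 is
  known.\<close>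

definition wconv :: "(nat => 'a::euclidean_space => 'b::euclidean_space) => ('a => 'b) => bool" where
 "wconv f g \<longleftrightarrow> (\<forall>psi. sq_int psi --> (%n. LBINT x. f n x \<bullet> psi x) ----> (LBINT x. g x \<bullet> psi x))"

definition l2conv :: "(nat => 'a::euclidean_space => 'b::euclidean_space) => ('a => 'b) => bool" where
 "l2conv f g \<longleftrightarrow> (%n. LBINT x. (norm (f n x - g x))^2) ----> 0"

lemma wconvD: "wconv f g ==> sq_int psi ==> (%n. LBINT x. f n x \<bullet> psi x) ----> (LBINT x. g x \<bullet> psi x)"
 by (simp add: wconv_def)

lemma wconv_subseq: "wconv f g ==> strict_mono r ==> wconv (%n. f (r n)) g"
 unfolding wconv_def using LIMSEQ_subseq_LIMSEQ[of _ _ r] by (fastforce simp: o_def)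

lemma l2conv_subseq: "l2conv f g ==> strict_mono r ==> l2conv (%n. f (r n)) g"
 unfolding l2conv_def using LIMSEQ_subseq_LIMSEQ[of _ _ r] by (fastforce simp: o_def)

lemma l2conv_cls:
 assumes "!!n. sq_int (f n)" "sq_int g"
 shows "l2conv f g \<longleftrightarrow> (%n. cls (f n)) ----> cls g"
proof -
 have e: "(LBINT x. (norm (f n x - g x))^2) = (norm (cls (f n) - cls g))^2" for n
  using norm_cls[OF sq_int_diff[OF assms(1)[of n] assms(2)]] cls_diff[OF assms(1)[of n] assms(2)] by simp
 show ?thesis
 proof
  assume "l2conv f g"
  then have "(%n. sqrt ((norm (cls (f n) - cls g))^2)) ----> sqrt 0"
   unfolding l2conv_def e by (rule tendsto_real_sqrt)
  then show "(%n. cls (f n)) ----> cls g" by (simp add: LIM_zero_iff tendsto_norm_zero_iff)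
 next
  assume "(%n. cls (f n)) ----> cls g"
  then have "(%n. norm (cls (f n) - cls g)) ----> 0" by (simp add: LIM_zero tendsto_norm_zero)
  from tendsto_power[OF this, of 2] show "l2conv f g" unfolding l2conv_def e by simp
 qed
qed

lemma wconv_cls:
 fixes f :: "nat => 'a::euclidean_space => 'b::euclidean_space"
 assumes "!!n. sq_int (f n)" "sq_int g"
 shows "wconv f g \<longleftrightarrow> (\<forall>y. (%n. cls (f n) \<bullet> y) ----> cls g \<bullet> y)"
proof
 assume w: "wconv f g"
 show "\<forall>y. (%n. cls (f n) \<bullet> y) ----> cls g \<bullet> y"
 proof
  fix y :: "('a, 'b) l2"
  have "cls (rep_l2 y) = y" "sq_int (rep_l2 y)" by auto
  then show "(%n. cls (f n) \<bullet> y) ----> cls g \<bullet> y"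
   using wconvD[OF w, of "rep_l2 y"] inner_cls[OF assms(1), of "rep_l2 y"] inner_cls[OF assms(2), of "rep_l2 y"] by simp
 qed
next
 assume a: "\<forall>y. (%n. cls (f n) \<bullet> y) ----> cls g \<bullet> y"
 show "wconv f g" unfolding wconv_def
 proof (intro allI impI)
  fix psi :: "'a => 'b" assume p: "sq_int psi"
  show "(%n. LBINT x. f n x \<bullet> psi x) ----> (LBINT x. g x \<bullet> psi x)"
   using a[rule_format, of "cls psi"] unfolding inner_cls[OF assms(1) p] inner_cls[OF assms(2) p] .
 qed
qed

lemma weak_subsequence:
 fixes f :: "nat => 'a::euclidean_space => 'b::euclidean_space"
 assumes f: "!!n. sq_int (f n)" and M: "!!n. (LBINT x. (norm (f n x))^2) <= M"
 shows "\<exists>r g. strict_mono r & sq_int g & wconv (%n. f (r n)) g"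
proof -
 have "norm (cls (f n)) <= sqrt M" for n
  using M[of n] unfolding norm_cls[OF f, symmetric] by (rule real_le_rsqrt)
 from weak_compactness[of "%n. cls (f n)", OF this] obtain r l where
  r: "strict_mono r" "!!y. (%n. cls (f (r n)) \<bullet> y) ----> l \<bullet> y" by blast
 then have "wconv (%n. f (r n)) (rep_l2 l)" by (subst wconv_cls) (auto intro: f)
 with r(1) show ?thesis by (metis sq_int_rep)
qed

lemma weak_strong_tendsto:
 assumes w: "wconv f g" and s: "l2conv p q" and f: "!!n. sq_int (f n)" and g: "sq_int g"
  and M: "!!n. (LBINT x. (norm (f n x))^2) <= M" and p: "!!n. sq_int (p n)" and q: "sq_int q"
 shows "(%n. LBINT x. f n x \<bullet> p n x) ----> (LBINT x. g x \<bullet> q x)"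
proof -
 have fn: "norm (cls (f n)) <= sqrt M" for n
  using M[of n] unfolding norm_cls[OF f, symmetric] by (rule real_le_rsqrt)
 have "(%n. cls (f n) \<bullet> (cls (p n) - cls q)) ----> 0"
 proof (rule Lim_null_comparison)
  have "(%n. cls (p n)) ----> cls q" using s l2conv_cls[OF p q] by simp
  then have "(%n. norm (cls (p n) - cls q)) ----> 0" by (simp add: LIM_zero tendsto_norm_zero)
  then show "(%n. sqrt M * norm (cls (p n) - cls q)) ----> 0" by (rule tendsto_mult_right_zero)
  show "\<forall>\<^sub>F n in sequentially. norm (cls (f n) \<bullet> (cls (p n) - cls q)) <= sqrt M * norm (cls (p n) - cls q)"
   using fn by (auto intro!: always_eventually order_trans[OF Cauchy_Schwarz_ineq2] mult_right_mono)
 qed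
 moreover have "(%n. cls (f n) \<bullet> cls q) ----> cls g \<bullet> cls q" using w wconv_cls[OF f g] by simp
 ultimately have "(%n. cls (f n) \<bullet> (cls (p n) - cls q) + cls (f n) \<bullet> cls q) ----> 0 + cls g \<bullet> cls q"
  by (rule tendsto_add)
 then show ?thesis by (simp add: inner_diff_right inner_cls f g p q)
qed

lemma l2conv_imp_wconv:
 assumes "l2conv f g" "!!n. sq_int (f n)" "sq_int g"
 shows "wconv f g"
 using assms(1) unfolding l2conv_cls[OF assms(2,3)] wconv_cls[OF assms(2,3)]
 by (auto intro!: tendsto_inner)

lemma l2conv_AE_subseq:
 assumes s: "l2conv f g" and f: "!!n. sq_int (f n)" "sq_int g"
 shows "\<exists>r. strict_mono r & (AE x in lborel. (%n. f (r n) x) ----> g x)"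
proof -
 have "\<exists>r. strict_mono r & (AE x in lborel. (%n. (norm (f (r n) x - g x))^2) ----> 0)"
  by (rule tendsto_L1_AE_subseq[of lborel "%n x. (norm (f n x - g x))^2"])
   (use s sq_int_integrable[OF sq_int_diff[OF f]] in \<open>auto simp: l2conv_def\<close>)
 then obtain r where r: "strict_mono r" "AE x in lborel. (%n. (norm (f (r n) x - g x))^2) ----> 0" by blast
 from r(2) have "AE x in lborel. (%n. f (r n) x) ----> g x"
 proof eventually_elim
  case (elim x)
  from tendsto_real_sqrt[OF this] show ?case by (simp add: LIM_zero_iff tendsto_norm_zero_iff)
 qed
 with r(1) show ?thesis by blast
qed

lemma l2conv_dominated:
 assumes lim: "AE x in lborel. (%n. f n x) ----> g x" and w: "integrable lborel w"
  and le: "!!n. AE x in lborel. (norm (f n x - g x))^2 <= w x"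
  and [measurable]: "!!n. f n \<in> BM" "g \<in> BM"
 shows "l2conv f g"
proof -
 have "(%n. LBINT x. (norm (f n x - g x))^2) ----> (\<integral>x. 0 \<partial>(lborel :: 'a measure))"
 proof (rule integral_dominated_convergence[OF _ _ w])
  show "AE x in lborel. (%n. (norm (f n x - g x))^2) ----> 0"
   using lim
  proof eventually_elim
   case (elim x)
   then have "(%n. norm (f n x - g x)) ----> 0" by (simp add: LIM_zero tendsto_norm_zero)
   from tendsto_power[OF this, of 2] show ?case by simp
  qed
 qed (use le in auto)
 then show ?thesis by (simp add: l2conv_def)
qed

text \<open>By density of the test functions.\<close>

lemma L2_norm_by_duality:
 fixes y :: "real^'n::finite => real"
 assumes y: "sq_int y" and C: "C >= 0"
  and le: "!!phi. phi \<in> Cc ==> \<bar>LBINT x. y x * phi x\<bar> <= C * sqrt (LBINT x. (phi x)^2)"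
 shows "(LBINT x. (y x)^2) <= C^2"
proof -
 define D where "D = closure (cls ` (Cc :: (real^'n => real) set))"
 have sub0: "subspace (cls ` (Cc :: (real^'n => real) set))"
 proof (unfold subspace_def, intro conjI ballI allI)
  have "(%x::real^'n. 0) \<in> Cc" by (rule Cc_infinityI[of _ 0]) auto
  then show "0 \<in> cls ` (Cc :: (real^'n => real) set)" by (metis cls_0 image_eqI)
 next
  fix a b :: "(real^'n, real) l2" assume "a \<in> cls ` Cc" "b \<in> cls ` Cc"
  then obtain phi psi where p: "phi \<in> Cc" "psi \<in> Cc" "a = cls phi" "b = cls psi" by blast
  obtain R S where "!!x. phi x \<noteq> 0 ==> norm x <= R" "!!x. psi x \<noteq> 0 ==> norm x <= S"
   using p Cc_infinityD(2) by metis
  then have "(%x. phi x + psi x) \<in> Cc"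
   using p Cc_infinityD(1) by (intro Cc_infinityI[of _ "max R S"]) (auto simp: le_max_iff_disj, metis add_0_left)
  then show "a + b \<in> cls ` Cc" using p by (auto simp: cls_add sq_int_test)
 next
  fix c :: real and a :: "(real^'n, real) l2" assume "a \<in> cls ` Cc"
  then obtain phi where p: "phi \<in> Cc" "a = cls phi" by blast
  then have "(%x. c * phi x) \<in> Cc" by (intro Cc_infinity_mult) auto
  then show "c *R a \<in> cls ` Cc" using p by (auto simp: cls_scaleR sq_int_test)
 qed
 have sub: "subspace D"
 proof (unfold subspace_def, intro conjI ballI allI)
  show "0 \<in> D" unfolding D_def by (rule subsetD[OF closure_subset subspace_0[OF sub0]])
 next
  fix a b assume ab: "a \<in> D" "b \<in> D"
  obtain X where X: "\<forall>n. X n \<in> cls ` (Cc :: (real^'n => real) set)" "X ----> a"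
   using ab(1) unfolding D_def closure_sequential by auto
  obtain Y where Y: "\<forall>n. Y n \<in> cls ` (Cc :: (real^'n => real) set)" "Y ----> b"
   using ab(2) unfolding D_def closure_sequential by auto
  from X Y show "a + b \<in> D" unfolding D_def closure_sequential
   by (intro exI[of _ "%n. X n + Y n"]) (auto intro!: tendsto_add subspace_add[OF sub0])
 next
  fix a c assume a: "a \<in> D"
  obtain X where X: "\<forall>n. X n \<in> cls ` (Cc :: (real^'n => real) set)" "X ----> a"
   using a unfolding D_def closure_sequential by auto
  from X show "c *R a \<in> D" unfolding D_def closure_sequential
   by (intro exI[of _ "%n. c *R X n"]) (auto intro!: tendsto_scaleR subspace_scale[OF sub0])
 qed
 obtain p where p: "p \<in> D" "!!s. s \<in> D ==> (cls y - p) \<bullet> s = 0"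
  using projection_exists[OF sub, of "cls y"] closed_closure unfolding D_def by metis
 define v where "v = cls y - p"
 have "AE x in lborel. rep_l2 v x = 0"
 proof (rule zero_if_orthogonal_to_tests)
  fix phi :: "real^'n => real" assume f: "phi \<in> Cc"
  then have "cls phi \<in> D" unfolding D_def by (intro subsetD[OF closure_subset] imageI)
  then have v0: "v \<bullet> cls phi = 0" unfolding v_def by (rule p(2))
  have "(LBINT x. rep_l2 v x * phi x) = cls (rep_l2 v) \<bullet> cls phi"
   unfolding inner_cls[OF sq_int_rep[of v] sq_int_test[OF f]] inner_real_def ..
  then show "(LBINT x. rep_l2 v x * phi x) = 0" unfolding cls_rep v0 .
 qed simp
 then have "cls (rep_l2 v) = cls (%x. 0)" by (subst cls_eq_iff) auto
 then have "v = 0" by (simp add: cls_0)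
 then have "cls y \<in> D" using p(1) by (simp add: v_def)
 then obtain X where X: "\<forall>n. X n \<in> cls ` Cc" "X ----> cls y"
  unfolding D_def closure_sequential by auto
 have "\<bar>cls y \<bullet> X n\<bar> <= C * norm (X n)" for n
 proof -
  obtain phi where f: "phi \<in> Cc" "X n = cls phi" using X(1) by blast
  have "norm (X n) = sqrt (LBINT x. (phi x)^2)" using norm_cls[OF sq_int_test[OF f(1)]] f(2) by (simp add: real_sqrt_unique)
  then show ?thesis using le[OF f(1)] f inner_cls[OF y sq_int_test[OF f(1)]] by simp
 qed
 then have "\<bar>cls y \<bullet> cls y\<bar> <= C * norm (cls y)"
  by (intro LIMSEQ_le[OF tendsto_rabs[OF tendsto_inner[OF tendsto_const X(2)]] tendsto_mult[OF tendsto_const tendsto_norm[OF X(2)]]]) auto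
 then have "norm (cls y) * norm (cls y) <= C * norm (cls y)" by (simp flip: power2_norm_eq_inner power2_eq_square)
 then have "norm (cls y) <= C" using C by (cases "norm (cls y) = 0") (auto simp: mult_le_cancel_right)
 then have "(norm (cls y))^2 <= C^2" by (intro power_mono) auto
 then show ?thesis using norm_cls[OF y] by simp
qed

section \<open>Weak gradients\<close>

text \<open>In contrast to \<open>has_weak_gradient\<close>, both functions are square integrable
  Borel representatives; this is the pair of an H^1 function and its gradient.\<close>

definition wgrad :: "(real^'n::finite => real) => (real^'n => real^'n) => bool" where
 "wgrad z g \<longleftrightarrow> sq_int z & sq_int g &
   (\<forall>phi\<in>Cc. \<forall>i. (LBINT x. z x * pd i phi x) = - (LBINT x. g x $ i * phi x))"

lemma wgradD:
 assumes "wgrad z g"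
 shows "sq_int z" "sq_int g" "z \<in> BM" "g \<in> BM"
  "phi \<in> Cc ==> (LBINT x. z x * pd i phi x) = - (LBINT x. g x $ i * phi x)"
 using assms by (auto simp: wgrad_def sq_int_def)

lemma sq_int_nth: "sq_int (g :: _ => real^'n::finite) ==> sq_int (%x. g x $ i)"
 by (rule sq_int_bounded_by[of g _ 1]) (auto simp: sq_int_def component_le_norm_cart borel_measurable_vec_nth)

lemma wgrad_unique:
 assumes "wgrad z g" "wgrad z g'" shows "AE x in lborel. g x = g' x"
proof -
 have "AE x in lborel. g x $ i - g' x $ i = 0" for i
 proof (rule zero_if_orthogonal_to_tests)
  show "sq_int (%x. g x $ i - g' x $ i)" using assms by (auto intro!: sq_int_nth simp: wgrad_def)
  fix phi :: "real^'a => real" assume p: "phi \<in> Cc"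
  have "(LBINT x. (g x $ i - g' x $ i) * phi x) = (LBINT x. g x $ i * phi x - g' x $ i * phi x)"
   by (simp add: left_diff_distrib)
  also have "\<dots> = (LBINT x. g x $ i * phi x) - (LBINT x. g' x $ i * phi x)"
   by (intro Bochner_Integration.integral_diff integrable_sq_mult sq_int_nth sq_int_test p wgradD[OF assms(1)] wgradD[OF assms(2)])
  also have "\<dots> = 0" using wgradD(5)[OF assms(1) p, of i] wgradD(5)[OF assms(2) p, of i] by simp
  finally show "(LBINT x. (g x $ i - g' x $ i) * phi x) = 0" .
 qed
 then have "AE x in lborel. \<forall>i. g x $ i - g' x $ i = 0" by (simp add: AE_all_countable)
 then show ?thesis by eventually_elim (simp add: vec_eq_iff)
qed

lemma wgrad_cong_AE:
 assumes w: "wgrad z g" and z: "AE x in lborel. z' x = z x" "z' \<in> BM"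
  and g: "AE x in lborel. g' x = g x" "g' \<in> BM"
 shows "wgrad z' g'"
proof -
 note [measurable] = z(2) g(2) wgradD(3,4)[OF w]
 have "sq_int z'" by (rule sq_int_bounded_by[OF wgradD(1)[OF w], of _ 1]) (use z in auto)
 moreover have "sq_int g'" by (rule sq_int_bounded_by[OF wgradD(2)[OF w], of _ 1]) (use g in auto)
 moreover have "(LBINT x. z' x * pd i phi x) = - (LBINT x. g' x $ i * phi x)" if p: "phi \<in> Cc" for phi i
 proof -
  have [measurable]: "phi \<in> BM" "pd i phi \<in> BM"
   using p Cc_infinity_partial test_measurable by auto
  have "(LBINT x. z' x * pd i phi x) = (LBINT x. z x * pd i phi x)"
   by (rule integral_cong_AE) (use z in auto)
  moreover have "(LBINT x. g' x $ i * phi x) = (LBINT x. g x $ i * phi x)"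
   by (rule integral_cong_AE) (use g in auto)
  ultimately show ?thesis using wgradD(5)[OF w p] by simp
 qed
 ultimately show ?thesis by (simp add: wgrad_def)
qed

lemma wgrad_lincomb:
 assumes "wgrad z g" "wgrad z' g'"
 shows "wgrad (%x. a * z x + b * z' x) (%x. a *R g x + b *R g' x)"
 unfolding wgrad_def
proof (intro conjI ballI allI)
 note s = wgradD(1,2)[OF assms(1)] wgradD(1,2)[OF assms(2)]
 show "sq_int (%x. a * z x + b * z' x)" "sq_int (%x. a *R g x + b *R g' x)" using s by auto
 fix phi :: "real^'a => real" and i assume p: "phi \<in> Cc"
 note p' = Cc_infinity_partial[OF p]
 have "(LBINT x. (a * z x + b * z' x) * pd i phi x) =
  (LBINT x. a * (z x * pd i phi x) + b * (z' x * pd i phi x))" by (simp add: algebra_simps)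
 also have "\<dots> = a * (LBINT x. z x * pd i phi x) + b * (LBINT x. z' x * pd i phi x)"
  using s by (simp add: integrable_sq_mult sq_int_test p')
 also have "\<dots> = - (a * (LBINT x. g x $ i * phi x) + b * (LBINT x. g' x $ i * phi x))"
  using wgradD(5)[OF assms(1) p] wgradD(5)[OF assms(2) p] by simp
 also have "a * (LBINT x. g x $ i * phi x) + b * (LBINT x. g' x $ i * phi x) =
   (LBINT x. a * (g x $ i * phi x) + b * (g' x $ i * phi x))"
  using s by (simp add: integrable_sq_mult sq_int_test p sq_int_nth)
 finally show "(LBINT x. (a * z x + b * z' x) * pd i phi x) = - (LBINT x. (a *R g x + b *R g' x) $ i * phi x)"
  by (simp add: algebra_simps)
qed

lemma wgrad_scale: "wgrad z g ==> wgrad (%x. a * z x) (%x. a *R g x)"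
 using wgrad_lincomb[of z g z g a 0] by simp

lemma wgrad_0: "wgrad (%x. 0) (%x. 0)"
 by (simp add: wgrad_def)

lemma partial_deriv_mult:
 assumes "f \<in> C_inf" "g \<in> C_inf"
 shows "pd i (%x. f x * g x) x = f x * pd i g x + pd i f x * g x"
 using partial_deriv_eq[OF has_derivative_mult[OF has_derivative_grad has_derivative_grad], OF assms[THEN C_inf_differentiable], of i x]
 by (simp add: grad_def inner_axis)

lemma sq_int_mult_test:
 assumes "sq_int z" "phi \<in> Cc"
 shows "sq_int (%x. phi x *R z x)"
 using test_bounded[OF assms(2)] test_measurable[OF assms(2)] sq_int_mult_bounded[OF assms(1)] by blast

lemma sq_int_scaleR_grad:
 assumes "sq_int (z :: _ => real)" "phi \<in> Cc"
 shows "sq_int (%x. z x *R grad phi x)"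
proof -
 obtain B where B: "!!x. norm (grad phi x) <= B" using grad_bounded[OF assms(2)] by blast
 have [measurable]: "z \<in> BM" "grad phi \<in> BM"
  using assms grad_measurable Cc_infinityD by (auto simp: sq_int_def)
 show ?thesis
  by (rule sq_int_bounded_by[OF assms(1), of _ B])
   (measurable, simp add: mult.commute[of B] mult_left_mono B)
qed

lemma wgrad_mult_test:
 assumes w: "wgrad z g" and f: "phi \<in> Cc"
 shows "wgrad (%x. phi x * z x) (%x. phi x *R g x + z x *R grad phi x)"
 unfolding wgrad_def
proof (intro conjI ballI allI)
 note s = wgradD(1,2)[OF w]
 show "sq_int (%x. phi x * z x)" using sq_int_mult_test[OF s(1) f] by simp
 show "sq_int (%x. phi x *R g x + z x *R grad phi x)"
  by (intro sq_int_add sq_int_mult_test sq_int_scaleR_grad s f)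
 fix psi :: "real^'a => real" and i assume p: "psi \<in> Cc"
 note fc = Cc_infinityD(1)[OF f] and pc = Cc_infinityD(1)[OF p]
 have pf: "(%x. phi x * psi x) \<in> Cc" using Cc_infinity_mult[OF p fc] .
 have pf': "(%x. psi x * pd i phi x) \<in> Cc" using Cc_infinity_mult[OF Cc_infinity_partial[OF f] pc] .
 have "(LBINT x. phi x * z x * pd i psi x) =
   (LBINT x. z x * pd i (%x. phi x * psi x) x - z x * (psi x * pd i phi x))"
  by (simp add: partial_deriv_mult[OF fc pc] algebra_simps)
 also have "\<dots> = (LBINT x. z x * pd i (%x. phi x * psi x) x) - (LBINT x. z x * (psi x * pd i phi x))"
  by (intro Bochner_Integration.integral_diff integrable_sq_mult s sq_int_test Cc_infinity_partial pf pf')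
 also have "\<dots> = - ((LBINT x. g x $ i * (phi x * psi x)) + (LBINT x. z x * (psi x * pd i phi x)))"
  using wgradD(5)[OF w pf] by simp
 also have "(LBINT x. g x $ i * (phi x * psi x)) + (LBINT x. z x * (psi x * pd i phi x)) =
   (LBINT x. g x $ i * (phi x * psi x) + z x * (psi x * pd i phi x))"
  by (intro Bochner_Integration.integral_add[symmetric] integrable_sq_mult s sq_int_nth sq_int_test pf pf')
 finally show "(LBINT x. phi x * z x * pd i psi x) =
   - (LBINT x. (phi x *R g x + z x *R grad phi x) $ i * psi x)"
  by (simp add: grad_nth algebra_simps)
qed

lemma wgrad_directional:
 assumes w: "wgrad z g" and p: "phi \<in> Cc"
 shows "(LBINT x. z x * (grad phi x \<bullet> h)) = - (LBINT x. (g x \<bullet> h) * phi x)"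
proof -
 have "(LBINT x. z x * (grad phi x \<bullet> h)) = (LBINT x. (\<Sum>i\<in>UNIV. h $ i * (z x * pd i phi x)))"
  by (simp add: inner_vec_def grad_nth sum_distrib_left algebra_simps)
 also have "\<dots> = (\<Sum>i\<in>UNIV. h $ i * (LBINT x. z x * pd i phi x))"
  by (subst Bochner_Integration.integral_sum)
   (auto intro!: integrable_sq_mult[OF wgradD(1)[OF w] sq_int_test[OF Cc_infinity_partial[OF p]]])
 also have "\<dots> = - (\<Sum>i\<in>UNIV. h $ i * (LBINT x. g x $ i * phi x))"
  by (simp add: wgradD(5)[OF w p] sum_negf)
 also have "(\<Sum>i\<in>UNIV. h $ i * (LBINT x. g x $ i * phi x)) = (LBINT x. (\<Sum>i\<in>UNIV. h $ i * (g x $ i * phi x)))"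
  by (subst Bochner_Integration.integral_sum)
   (auto intro!: integrable_sq_mult[OF sq_int_nth[OF wgradD(2)[OF w]] sq_int_test[OF p]])
 also have "\<dots> = (LBINT x. (g x \<bullet> h) * phi x)"
  by (simp add: inner_vec_def sum_distrib_left algebra_simps)
 finally show ?thesis .
qed

lemma integral_shift:
 fixes f :: "'a::euclidean_space => 'b::{banach, second_countable_topology}"
 assumes [measurable]: "f \<in> BM"
 shows "(LBINT x. f (x + h)) = (LBINT x. f x)"
  and "integrable lborel (%x. f (x + h)) \<longleftrightarrow> integrable lborel f"
proof -
 have d: "distr lborel borel ((+) h) = lborel" by (rule lborel_distr_plus)
 show "(LBINT x. f (x + h)) = (LBINT x. f x)"
  by (subst (2) d[symmetric], subst integral_distr) (auto simp: add.commute)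
 show "integrable lborel (%x. f (x + h)) \<longleftrightarrow> integrable lborel f"
  by (subst (2) d[symmetric], subst integrable_distr_eq) (auto simp: add.commute)
qed

lemma sq_int_shift: "sq_int f ==> sq_int (%x. f (x + h))"
 unfolding sq_int_def using integral_shift(2)[of "%x. (norm (f x))^2" h] by auto

lemma test_Lipschitz:
 assumes "phi \<in> Cc" "!!x. norm (grad phi x) <= B"
 shows "\<bar>phi x - phi y\<bar> <= B * norm (x - y)"
proof -
 have "norm (phi x - phi y) <= B * norm (x - y)"
 proof (rule differentiable_bound[OF convex_UNIV])
  show "(phi has_derivative (%h. grad phi x \<bullet> h)) (at x within UNIV)" for x
   using has_derivative_grad[OF C_inf_differentiable[OF Cc_infinityD(1)[OF assms(1)]]] by simp
  show "onorm ((\<bullet>) (grad phi x)) <= B" for x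
  proof (rule onorm_le)
   fix h show "norm (grad phi x \<bullet> h) <= B * norm h"
    using order_trans[OF Cauchy_Schwarz_ineq2 mult_right_mono[OF assms(2)[of x] norm_ge_zero]] by simp
  qed
 qed auto
 then show ?thesis by simp
qed

text \<open>The translation sits on the smooth factor, so only \<open>phi\<close> is differentiated;
  the difference quotients are dominated by a Lipschitz bound on a ball containing all supports. The
  translation estimate, the chain rule and integration by parts for test functions rest on
  this.\<close>

lemma shifted_test_derivative:
 assumes z: "sq_int z" and p: "phi \<in> Cc"
 shows "((%t. LBINT x. z x * phi (x - t *R h)) has_real_derivative - (LBINT x. z x * (grad phi (x - t *R h) \<bullet> h))) (at t)"
 unfolding DERIV_def tendsto_at_iff_sequentially
proof (intro allI impI)
 fix X :: "nat => real" assume X: "\<forall>i. X i \<in> UNIV - {0}" "X ----> 0"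
 obtain B where B: "B > 0" "!!x. norm (grad phi x) <= B" using grad_bounded[OF p] by blast
 obtain R where R: "!!x. phi x \<noteq> 0 ==> norm x <= R" using Cc_infinityD(2)[OF p] by blast
 obtain K where K: "!!n. \<bar>X n\<bar> <= K" using convergent_imp_Bseq[OF convergentI[OF X(2)]] by (auto simp: Bseq_def)
 define R' where "R' = R + (\<bar>t\<bar> + K) * norm h"
 have K0: "K >= 0" using K[of 0] by simp
 have [measurable]: "z \<in> BM" "phi \<in> BM" "grad phi \<in> BM"
  using z p test_measurable grad_measurable Cc_infinityD by (auto simp: sq_int_def)
 have shift_int: "integrable lborel (%x. z x * phi (x - a))" for a
  by (intro integrable_sq_mult z sq_int_test Cc_infinity_shift p)
 let ?q = "%n x. z x * ((phi (x - (t + X n) *R h) - phi (x - t *R h)) / X n)"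
 have lim: "(%n. LBINT x. ?q n x) ----> (LBINT x. z x * - (grad phi (x - t *R h) \<bullet> h))"
 proof (rule integral_dominated_convergence[where w = "%x. \<bar>z x * ((B * norm h) * indicator (cball 0 R') x)\<bar>"])
  have "sq_int (%x. (B * norm h) * indicator (cball 0 R') x :: real)"
   by (rule sq_int_bounded_support[of _ "B * norm h" R']) (use B in \<open>auto simp: indicator_def split: if_splits\<close>)
  then show "integrable lborel (%x. \<bar>z x * ((B * norm h) * indicator (cball 0 R') x)\<bar>)"
   by (intro integrable_abs integrable_sq_mult z)
  show "AE x in lborel. norm (?q n x) <= \<bar>z x * ((B * norm h) * indicator (cball 0 R') x)\<bar>" for n
  proof (rule AE_I2)
   fix x
   have "\<bar>(phi (x - (t + X n) *R h) - phi (x - t *R h)) / X n\<bar> <= (B * norm h) * indicator (cball 0 R') x"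
   proof (cases "x \<in> cball 0 R'")
    case True
    have "\<bar>phi (x - (t + X n) *R h) - phi (x - t *R h)\<bar> <= B * norm ((x - (t + X n) *R h) - (x - t *R h))"
     by (rule test_Lipschitz[OF p B(2)])
    also have "(x - (t + X n) *R h) - (x - t *R h) = - (X n *R h)" by (simp add: scaleR_add_left)
    finally have "\<bar>phi (x - (t + X n) *R h) - phi (x - t *R h)\<bar> <= B * norm h * \<bar>X n\<bar>" by (simp add: mult_ac)
    then show ?thesis using True X(1) by (simp add: abs_divide divide_le_eq)
   next
    case False
    have z: "phi (x - s *R h) = 0" if "\<bar>s\<bar> <= \<bar>t\<bar> + K" for s
    proof (rule ccontr)
     assume "phi (x - s *R h) \<noteq> 0"
     from R[OF this] have "norm x <= R + \<bar>s\<bar> * norm h" using norm_triangle_ineq[of "x - s *R h" "s *R h"] by simp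
     also have "\<dots> <= R'" unfolding R'_def using that by (intro add_left_mono mult_right_mono) auto
     finally show False using False by simp
    qed
    have "\<bar>t + X n\<bar> <= \<bar>t\<bar> + K" using abs_triangle_ineq[of t "X n"] K[of n] by linarith
    then show ?thesis using z[of "t + X n"] z[of t] K0 False by simp
   qed
   from mult_left_mono[OF this abs_ge_zero[of "z x"]]
   show "norm (?q n x) <= \<bar>z x * ((B * norm h) * indicator (cball 0 R') x)\<bar>"
    using B by (simp add: abs_mult)
  qed
  show "AE x in lborel. (%n. ?q n x) ----> z x * - (grad phi (x - t *R h) \<bullet> h)"
  proof (intro AE_I2 tendsto_mult tendsto_const)
   fix x
   have "((%s. phi (x - s *R h)) has_derivative (%s. grad phi (x - t *R h) \<bullet> (- (s *R h)))) (at t)"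
    by (rule has_derivative_compose[OF _ has_derivative_grad[OF C_inf_differentiable[OF Cc_infinityD(1)[OF p]]]])
     (auto intro!: derivative_eq_intros)
   then have "((%s. phi (x - s *R h)) has_real_derivative - (grad phi (x - t *R h) \<bullet> h)) (at t)"
    unfolding has_field_derivative_def
    by (rule has_derivative_eq_rhs) (simp add: fun_eq_iff)
   then show "(%n. (phi (x - (t + X n) *R h) - phi (x - t *R h)) / X n) ----> - (grad phi (x - t *R h) \<bullet> h)"
    unfolding DERIV_def tendsto_at_iff_sequentially using X by (simp add: o_def)
  qed
 qed measurable
 have eq: "(LBINT x. ?q n x) = ((LBINT x. z x * phi (x - (t + X n) *R h)) - (LBINT x. z x * phi (x - t *R h))) / X n" for n
  using Bochner_Integration.integral_diff[OF shift_int[of "(t + X n) *R h"] shift_int[of "t *R h"]]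
  by (simp add: right_diff_distrib)
 show "((%s. ((LBINT x. z x * phi (x - (t + s) *R h)) - (LBINT x. z x * phi (x - t *R h))) / s) \<circ> X)
   ----> - (LBINT x. z x * (grad phi (x - t *R h) \<bullet> h))"
  using lim unfolding o_def eq mult_minus_right by simp
qed

text \<open>By translation invariance the integral of a shifted test function is constant in the
  shift, so its derivative vanishes.\<close>

lemma integral_partial_deriv_test:
 fixes eta :: "real^'n::finite => real"
 assumes p: "eta \<in> Cc" shows "(LBINT x. pd i eta x) = 0"
proof -
 obtain R where R: "R > 0" "!!x. eta x \<noteq> 0 ==> norm x <= R" using Cc_infinityD(2)[OF p] by blast
 \<comment> \<open>A square integrable substitute for the constant 1; the margin 1 in the radius
   keeps the support inside for shifts by less than 1.\<close>
 define z :: "real^'n => real" where "z = indicator (cball 0 (R + 1))"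
 have [measurable]: "z \<in> BM" unfolding z_def
  by (rule borel_measurable_indicator[OF borel_closed[OF closed_cball]])
 have z: "sq_int z" by (rule sq_int_bounded_support[of _ 1 "R+1"], fact) (auto simp: z_def indicator_def split: if_splits)
 let ?h = "axis i 1 :: real^'n"
 have [measurable]: "eta \<in> BM" using p test_measurable by blast
 have c: "(LBINT x. z x * eta (x - t *R ?h)) = (LBINT x. eta x)" if "\<bar>t\<bar> < 1" for t
 proof -
  have eq: "z x * eta (x - t *R ?h) = eta (x + - (t *R ?h))" for x
  proof (cases "eta (x - t *R ?h) = 0")
   case False
   from R(2)[OF this] have "norm x <= R + 1" using norm_triangle_ineq[of "x - t *R ?h" "t *R ?h"] that by simp
   then show ?thesis by (simp add: z_def)
  qed simp
  show ?thesis unfolding eq by (rule integral_shift(1)) measurable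
 qed
 have "((%t. LBINT x. eta x) has_real_derivative - (LBINT x. z x * (grad eta (x - 0 *R ?h) \<bullet> ?h))) (at 0)"
  by (rule has_field_derivative_transform_within_open[OF shifted_test_derivative[OF z p], where S = "{-1<..<1}"]) (use c in auto)
 from DERIV_unique[OF this DERIV_const] have "(LBINT x. z x * pd i eta x) = 0" by (simp add: inner_axis grad_nth)
 moreover have "z x * pd i eta x = pd i eta x" for x
 proof (cases "pd i eta x = 0")
  case False
  then have "grad eta x \<noteq> 0" by (metis grad_nth zero_index)
  from grad_support[OF Cc_infinityD(1)[OF p] R(2) this] show ?thesis by (auto simp: z_def)
 qed simp
 ultimately show ?thesis by simp
qed

lemma wgrad_test: "phi \<in> Cc ==> wgrad phi (grad phi)"
 unfolding wgrad_def
proof (intro conjI ballI allI)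
 assume f: "phi \<in> Cc"
 then show "sq_int phi" "sq_int (grad phi)" by (auto intro: sq_int_test sq_int_grad)
 fix psi :: "real^'a => real" and i assume p: "psi \<in> Cc"
 note fc = Cc_infinityD(1)[OF f] and pc = Cc_infinityD(1)[OF p]
 have "0 = (LBINT x. pd i (%x. phi x * psi x) x)"
  using integral_partial_deriv_test[OF Cc_infinity_mult[OF p fc]] by simp
 also have "\<dots> = (LBINT x. phi x * pd i psi x) + (LBINT x. pd i phi x * psi x)"
  unfolding partial_deriv_mult[OF fc pc]
  by (intro Bochner_Integration.integral_add integrable_sq_mult sq_int_test Cc_infinity_partial f p)
 finally show "(LBINT x. phi x * pd i psi x) = - (LBINT x. grad phi x $ i * psi x)"
  by (simp add: grad_nth)
qed

text \<open>By duality it suffices to pair the difference with a test function. The translation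
  moves to \<open>phi\<close>, and the mean value theorem in the shift parameter produces a
  directional derivative, which is then thrown back on \<open>z\<close> as its weak
  gradient.\<close>

theorem translation_estimate:
 assumes w: "wgrad z g"
 shows "(LBINT x. (z (x + h) - z x)^2) <= (norm h)^2 * (LBINT x. (norm (g x))^2)"
proof -
 note s = wgradD(1,2)[OF w]
 have [measurable]: "z \<in> BM" "g \<in> BM" using s by (auto simp: sq_int_def)
 define C where "C = norm h * sqrt (LBINT x. (norm (g x))^2)"
 have "(LBINT x. (z (x + h) - z x)^2) <= C^2"
 proof (rule L2_norm_by_duality)
  show "sq_int (%x. z (x + h) - z x)" by (intro sq_int_diff sq_int_shift s)
  show "C >= 0" by (simp add: C_def)
  fix phi :: "real^'a => real" assume p: "phi \<in> Cc"
  have [measurable]: "phi \<in> BM" using p test_measurable by blast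
  let ?F = "%t. LBINT x. z x * phi (x - t *R h)"
  have "(LBINT x. (z (x + h) - z x) * phi x) = (LBINT x. z (x + h) * phi x) - (LBINT x. z x * phi x)"
   unfolding left_diff_distrib
   by (intro Bochner_Integration.integral_diff integrable_sq_mult sq_int_shift s sq_int_test p)
  also have "(LBINT x. z (x + h) * phi x) = (LBINT x. z x * phi (x - h))"
   using integral_shift(1)[of "%x. z x * phi (x - h)" h] by simp
  finally have eq: "(LBINT x. (z (x + h) - z x) * phi x) = ?F 1 - ?F 0" by simp
  obtain t where t: "?F 1 - ?F 0 = (1 - 0) * - (LBINT x. z x * (grad phi (x - t *R h) \<bullet> h))"
   using MVT2[of 0 1 ?F, OF _ shifted_test_derivative[OF s(1) p]] by auto
  define psi where "psi x = phi (x - t *R h)" for x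
  have psi: "psi \<in> Cc" unfolding psi_def by (rule Cc_infinity_shift[OF p])
  have gp: "grad phi (x - t *R h) = grad psi x" for x
   unfolding psi_def grad_def using partial_deriv_shift[OF C_inf_differentiable[OF Cc_infinityD(1)[OF p]]] by simp
  have "(LBINT x. (z (x + h) - z x) * phi x) = (LBINT x. (g x \<bullet> h) * psi x)"
   unfolding eq t gp wgrad_directional[OF w psi] by simp
  also have "\<bar>\<dots>\<bar> <= sqrt (LBINT x. (g x \<bullet> h)^2) * sqrt (LBINT x. (psi x)^2)"
  proof (rule L2_Cauchy_Schwarz'[OF _ sq_int_test[OF psi]])
   show "sq_int (%x. g x \<bullet> h)"
    by (rule sq_int_bounded_by[OF s(2), of _ "norm h"]) (simp_all add: Cauchy_Schwarz_ineq2 mult.commute[of "norm h"])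
  qed
  also have "(LBINT x. (psi x)^2) = (LBINT x. (phi x)^2)"
   using integral_shift(1)[of "%x. (phi x)^2" "- (t *R h)"] by (simp add: psi_def)
  also have "sqrt (LBINT x. (g x \<bullet> h)^2) <= sqrt ((norm h)^2 * (LBINT x. (norm (g x))^2))"
  proof (rule real_sqrt_le_mono)
   have le: "(g x \<bullet> h)^2 <= (norm h)^2 * (norm (g x))^2" for x
    using power_mono[OF Cauchy_Schwarz_ineq2[of "g x" h], of 2] by (simp add: power_mult_distrib mult.commute)
   have "(LBINT x. (g x \<bullet> h)^2) <= (LBINT x. (norm h)^2 * (norm (g x))^2)"
   proof (rule integral_mono)
    show i: "integrable lborel (%x. (norm h)^2 * (norm (g x))^2)" using s(2) by (simp add: sq_int_def)
    show "integrable lborel (%x. (g x \<bullet> h)^2)"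
     by (rule Bochner_Integration.integrable_bound[OF i]) (use le in auto)
   qed (rule le)
   then show "(LBINT x. (g x \<bullet> h)^2) <= (norm h)^2 * (LBINT x. (norm (g x))^2)" by simp
  qed
  finally show "\<bar>LBINT x. (z (x + h) - z x) * phi x\<bar> <= C * sqrt (LBINT x. (phi x)^2)"
   by (simp add: C_def real_sqrt_mult mult_right_mono)
 qed
 also have "C^2 = (norm h)^2 * (LBINT x. (norm (g x))^2)" by (simp add: C_def power_mult_distrib)
 finally show ?thesis .
qed

lemma wgrad_closed:
 assumes w: "!!n. wgrad (z n) (g n)" and z: "wconv z z'" "sq_int z'" and g: "wconv g g'" "sq_int g'"
 shows "wgrad z' g'"
 unfolding wgrad_def
proof (intro conjI ballI allI z(2) g(2))
 fix phi :: "real^'a => real" and i assume p: "phi \<in> Cc"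
 have "(%n. LBINT x. z n x * pd i phi x) ----> (LBINT x. z' x * pd i phi x)"
  using wconvD[OF z(1) sq_int_test[OF Cc_infinity_partial[OF p]]] by simp
 moreover have "(%n. - (LBINT x. g n x $ i * phi x)) ----> - (LBINT x. g' x $ i * phi x)"
 proof (rule tendsto_minus)
  have "sq_int (%x. phi x *R (axis i 1 :: real^'a))"
   by (rule sq_int_bounded_by[OF sq_int_test[OF p], of _ 1])
    (use test_measurable[OF p] in \<open>auto intro!: borel_measurable_scaleR\<close>)
  from wconvD[OF g(1) this] show "(%n. LBINT x. g n x $ i * phi x) ----> (LBINT x. g' x $ i * phi x)"
   by (simp add: inner_axis mult.commute)
 qed
 ultimately show "(LBINT x. z' x * pd i phi x) = - (LBINT x. g' x $ i * phi x)"
  unfolding wgradD(5)[OF w p] by (rule LIMSEQ_unique)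
qed

section \<open>Chain rule and compactness\<close>

lemma difference_quotient_test:
 assumes z: "sq_int z" and p: "phi \<in> Cc" and t: "t ----> 0" "!!n. t n \<noteq> 0"
 shows "(%n. LBINT x. ((z (x + t n *R axis i 1) - z x) / t n) * phi x) ----> - (LBINT x. z x * pd i phi x)"
proof -
 let ?h = "axis i 1"
 let ?F = "%s. LBINT x. z x * phi (x - s *R ?h)"
 have [measurable]: "z \<in> BM" "phi \<in> BM" using z p test_measurable by (auto simp: sq_int_def)
 have eq: "(LBINT x. ((z (x + s *R ?h) - z x) / s) * phi x) = (?F s - ?F 0) / s" for s
 proof -
  have "(LBINT x. ((z (x + s *R ?h) - z x) / s) * phi x) = (LBINT x. z (x + s *R ?h) * phi x - z x * phi x) / s"
   by (simp add: algebra_simps flip: integral_divide_zero)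
  also have "(LBINT x. z (x + s *R ?h) * phi x - z x * phi x) = (LBINT x. z (x + s *R ?h) * phi x) - (LBINT x. z x * phi x)"
   by (intro Bochner_Integration.integral_diff integrable_sq_mult sq_int_shift z sq_int_test p)
  also have "(LBINT x. z (x + s *R ?h) * phi x) = ?F s"
   using integral_shift(1)[of "%x. z x * phi (x - s *R ?h)" "s *R ?h"] by simp
  finally show ?thesis by simp
 qed
 have "((%s. (?F (0 + s) - ?F 0) / s) \<longlongrightarrow> - (LBINT x. z x * (grad phi (x - 0 *R ?h) \<bullet> ?h))) (at 0)"
  using shifted_test_derivative[OF z p, of ?h 0] unfolding DERIV_def .
 then have "(%n. (?F (t n) - ?F 0) / t n) ----> - (LBINT x. z x * (grad phi x \<bullet> ?h))"
  using t unfolding tendsto_at_iff_sequentially by (auto simp: o_def)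
 then show ?thesis unfolding eq by (simp add: inner_axis grad_nth)
qed

lemma sq_int_compose:
 assumes "sq_int z" "!!s. (F has_real_derivative F' s) (at s)" "!!s. \<bar>F' s\<bar> <= C" "F 0 = 0"
 shows "sq_int (%x. F (z x))" "\<bar>F s - F t\<bar> <= C * \<bar>s - t\<bar>"
proof -
 have L: "\<bar>F s - F t\<bar> <= C * \<bar>s - t\<bar>" for s t
  using field_differentiable_bound[of UNIV F F' C s t] assms(2,3) by auto
 then show "\<bar>F s - F t\<bar> <= C * \<bar>s - t\<bar>" .
 have "continuous_on UNIV F" using assms(2) DERIV_isCont continuous_at_imp_continuous_on by blast
 then have [measurable]: "F \<in> BM" by (rule borel_measurable_continuous_onI)
 note [measurable] = sq_int_measurable[OF assms(1)]
 show "sq_int (%x. F (z x))"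
  by (rule sq_int_bounded_by[OF assms(1), of _ C]) (use L[of _ 0] assms(4) in auto)
qed

text \<open>The difference quotient of \<open>F(z)\<close> is the product of a secant slope of
  \<open>F\<close>, bounded and convergent almost everywhere, and of the difference quotient of
  \<open>z\<close>, which converges weakly to the partial derivative.\<close>

theorem wgrad_chain:
 assumes w: "wgrad z g" and F: "!!s. (F has_real_derivative F' s) (at s)" and cF: "continuous_on UNIV F'"
  and C: "!!s. \<bar>F' s\<bar> <= C" and F0: "F 0 = 0"
 shows "wgrad (%x. F (z x)) (%x. F' (z x) *R g x)"
 unfolding wgrad_def
proof (intro conjI ballI allI)
 note s = wgradD(1,2)[OF w]
 have [measurable]: "z \<in> BM" "g \<in> BM" using s by (auto simp: sq_int_def)
 have "continuous_on UNIV F" using F DERIV_isCont continuous_at_imp_continuous_on by blast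
 then have [measurable]: "F \<in> BM" by (rule borel_measurable_continuous_onI)
 have [measurable]: "F' \<in> BM" using cF by (rule borel_measurable_continuous_onI)
 note sF = sq_int_compose(1)[OF s(1) F C F0] and Lip = sq_int_compose(2)[OF s(1) F C F0]
 show "sq_int (%x. F (z x))" by (rule sF)
 show "sq_int (%x. F' (z x) *R g x)" by (rule sq_int_mult_bounded[OF s(2) _ C]) measurable
 fix phi :: "real^'a => real" and i assume p: "phi \<in> Cc"
 note [measurable] = test_measurable[OF p]
 let ?h = "axis i 1 :: real^'a"
 define t where "t n = inverse (real (Suc n))" for n
 have t0: "t ----> 0" unfolding t_def by (rule LIMSEQ_inverse_real_of_nat)
 have tp: "t n > 0" for n by (simp add: t_def)
 define zn where "zn n x = z (x + t n *R ?h)" for n x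
 have [measurable]: "zn n \<in> BM" for n unfolding zn_def by measurable
 have szn: "sq_int (zn n)" for n unfolding zn_def by (intro sq_int_shift s)
 define G where "G = (LBINT x. (norm (g x))^2)"
 have te: "(LBINT x. (zn n x - z x)^2) <= (t n)^2 * G" for n
  using translation_estimate[OF w, of "t n *R ?h"] by (simp add: zn_def G_def)
 have "l2conv zn z"
  unfolding l2conv_def
 proof (rule tendsto_sandwich[OF _ _ tendsto_const])
  have "(%n. (t n)^2 * G) ----> 0^2 * G" by (intro tendsto_intros t0)
  then show "(%n. (t n)^2 * G) ----> 0" by simp
 qed (use te in auto)
 from l2conv_AE_subseq[OF this szn s(1)] obtain r1 where
  r1: "strict_mono r1" "AE x in lborel. (%n. zn (r1 n) x) ----> z x" by blast
 define dq where "dq n x = (zn n x - z x) / t n" for n x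
 have sdq: "sq_int (dq n)" for n
  using sq_int_cmult[OF sq_int_diff[OF szn[of n] s(1)], of "inverse (t n)"]
  unfolding dq_def[abs_def] divide_inverse mult.commute[of _ "inverse (t n)"] .
 have dqG: "(LBINT x. (norm (dq n x))^2) <= G" for n
  using te[of n] tp[of n] by (simp add: dq_def power_divide divide_le_eq mult.commute)
 from weak_subsequence[of "%n. dq (r1 n)", OF sdq dqG] obtain r2 l where
  r2: "strict_mono r2" "sq_int l" "wconv (%n. dq (r1 (r2 n))) l" by blast
 define r where "r n = r1 (r2 n)" for n
 have r: "strict_mono r" unfolding r_def using r1(1) r2(1) by (simp add: strict_mono_def)
 have tr: "(%n. t (r n)) ----> 0" using LIMSEQ_subseq_LIMSEQ[OF t0 r] by (simp add: o_def)
 have AEr: "AE x in lborel. (%n. zn (r n) x) ----> z x"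
  using r1(2) by eventually_elim (use LIMSEQ_subseq_LIMSEQ[OF _ r2(1)] in \<open>fastforce simp: o_def r_def\<close>)
 \<comment> \<open>The translation estimate bounds the quotients, so a weak limit exists; pairing
   with test functions identifies it with the weak derivative.\<close>
 have lg: "AE x in lborel. l x - g x $ i = 0"
 proof (rule zero_if_orthogonal_to_tests)
  show "sq_int (%x. l x - g x $ i)" by (intro sq_int_diff r2 sq_int_nth s)
  fix psi :: "real^'a => real" assume q: "psi \<in> Cc"
  have "(%n. LBINT x. dq (r n) x * psi x) ----> (LBINT x. l x * psi x)"
   using wconvD[OF r2(3) sq_int_test[OF q]] by (simp add: r_def)
  moreover have "(%n. LBINT x. dq (r n) x * psi x) ----> (LBINT x. g x $ i * psi x)"
  proof -
   have "- (LBINT x. z x * pd i psi x) = (LBINT x. g x $ i * psi x)"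
    using wgradD(5)[OF w q, of i] by simp
   then show ?thesis
    using difference_quotient_test[OF s(1) q tr tp[THEN less_imp_neq, THEN not_sym], of i]
    unfolding dq_def zn_def by (simp only:)
  qed
  ultimately have "(LBINT x. l x * psi x) = (LBINT x. g x $ i * psi x)" by (rule LIMSEQ_unique)
  then show "(LBINT x. (l x - g x $ i) * psi x) = 0"
   unfolding left_diff_distrib
   using Bochner_Integration.integral_diff[OF integrable_sq_mult[OF r2(2) sq_int_test[OF q]] integrable_sq_mult[OF sq_int_nth[OF s(2)] sq_int_test[OF q]], of i]
   by simp
 qed
 \<comment> \<open>Where the increment vanishes the slope is set to the derivative:
   \<open>dq * m\<close> is then the quotient of \<open>F(z)\<close> at every point, and
   \<open>m\<close> converges there too.\<close>
 define m where "m n x = (if zn (r n) x = z x then F' (z x) else (F (zn (r n) x) - F (z x)) / (zn (r n) x - z x))" for n x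
 have [measurable]: "m n \<in> BM" for n unfolding m_def by measurable
 have mC: "\<bar>m n x\<bar> <= C" for n x
 proof (cases "zn (r n) x = z x")
  case False
  then show ?thesis using Lip[of "zn (r n) x" "z x"] by (simp add: m_def abs_divide divide_le_eq)
 qed (use C in \<open>simp add: m_def\<close>)
 have smp: "sq_int (%x. m n x * phi x)" for n by (rule sq_int_mult_bounded'[OF sq_int_test[OF p] _ mC]) measurable
 have sFp: "sq_int (%x. F' (z x) * phi x)" by (rule sq_int_mult_bounded'[OF sq_int_test[OF p] _ C]) measurable
 have mconv: "l2conv (%n x. m n x * phi x) (%x. F' (z x) * phi x)"
 proof (rule l2conv_dominated)
  show "integrable lborel (%x. (2 * C)^2 * (norm (phi x))^2)" using sq_int_integrable[OF sq_int_test[OF p]] by simp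
  have "(norm (m n x * phi x - F' (z x) * phi x))^2 <= (2 * C)^2 * (norm (phi x))^2" for n x
  proof -
   have "\<bar>m n x - F' (z x)\<bar> <= 2 * C" using mC[of n x] C[of "z x"] by linarith
   then have "\<bar>m n x - F' (z x)\<bar> * \<bar>phi x\<bar> <= 2 * C * \<bar>phi x\<bar>" by (rule mult_right_mono) simp
   from power_mono[OF this, of 2] show ?thesis
    by (simp add: power_mult_distrib abs_mult flip: left_diff_distrib)
  qed
  then show "AE x in lborel. (norm (m n x * phi x - F' (z x) * phi x))^2 <= (2 * C)^2 * (norm (phi x))^2" for n by simp
  show "AE x in lborel. (%n. m n x * phi x) ----> F' (z x) * phi x"
   using AEr
  proof eventually_elim
   case (elim x)
   define q where "q y = (if y = z x then F' (z x) else (F y - F (z x)) / (y - z x))" for y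
   have "(q \<longlongrightarrow> F' (z x)) (at (z x))"
    by (rule Lim_transform_eventually[OF F[of "z x", unfolded has_field_derivative_iff]])
     (auto simp: q_def eventually_at_filter)
   then have "isCont q (z x)" by (simp add: isCont_def q_def)
   from isCont_tendsto_compose[OF this elim] have "(%n. m n x) ----> F' (z x)" by (simp add: q_def m_def)
   then show ?case by (intro tendsto_intros)
  qed
 qed measurable
 have "(%n. LBINT x. dq (r n) x * (m n x * phi x)) ----> (LBINT x. l x * (F' (z x) * phi x))"
  using weak_strong_tendsto[OF r2(3) mconv sdq r2(2) dqG smp sFp] by (simp add: r_def)
 moreover have "dq (r n) x * (m n x * phi x) = (F (z (x + t (r n) *R ?h)) - F (z x)) / t (r n) * phi x" for n x
  by (simp add: dq_def m_def zn_def)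
 moreover have "(%n. LBINT x. (F (z (x + t (r n) *R ?h)) - F (z x)) / t (r n) * phi x) ----> - (LBINT x. F (z x) * pd i phi x)"
  using difference_quotient_test[OF sF p tr] tp[THEN less_imp_neq, THEN not_sym] by simp
 ultimately have "(LBINT x. l x * (F' (z x) * phi x)) = - (LBINT x. F (z x) * pd i phi x)"
  by (simp add: LIMSEQ_unique)
 moreover have "(LBINT x. l x * (F' (z x) * phi x)) = (LBINT x. (F' (z x) *R g x) $ i * phi x)"
  by (rule integral_cong_AE) (use lg r2(2) in \<open>auto simp: sq_int_def mult_ac\<close>)
 ultimately show "(LBINT x. F (z x) * pd i phi x) = - (LBINT x. (F' (z x) *R g x) $ i * phi x)" by simp
qed

section \<open>Positive parts\<close>

text \<open>A C^1 approximation of the positive part, as the chain rule requires; it vanishes at 0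
  and its slopes lie between 0 and 1.\<close>

definition smooth_pos :: "nat => real => real" where
 "smooth_pos n s = (sqrt (s^2 + (1 / Suc n)^2) + s - 1 / Suc n) / 2"

definition smooth_pos' :: "nat => real => real" where
 "smooth_pos' n s = (s / sqrt (s^2 + (1 / Suc n)^2) + 1) / 2"

lemma smooth_pos_deriv: "(smooth_pos n has_real_derivative smooth_pos' n s) (at s)"
proof -
 define a :: real where "a = 1 / Suc n"
 have pos: "s^2 + a^2 > 0" by (intro add_nonneg_pos) (auto simp: a_def)
 have 1: "((%s. s^2 + a^2) has_real_derivative 2 * s) (at s)" by (auto intro!: derivative_eq_intros)
 note 2 = DERIV_chain2[OF DERIV_real_sqrt[OF pos] 1]
 have e: "(inverse q / 2 * (2 * s) + 1 - 0) / 2 = (s / q + 1) / 2" for q :: real by (cases "q = 0") (auto simp: field_simps)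
 from DERIV_cdivide[OF DERIV_diff[OF DERIV_add[OF 2 DERIV_ident] DERIV_const[of a]], of 2]
 show ?thesis unfolding e unfolding smooth_pos_def smooth_pos'_def a_def .
qed

lemma smooth_pos'_cont: "continuous_on UNIV (smooth_pos' n)"
proof -
 have "s^2 + (1 / Suc n)^2 \<noteq> 0" for s :: real by (intro less_imp_neq[THEN not_sym] add_nonneg_pos) auto
 then show ?thesis unfolding smooth_pos'_def[abs_def] by (intro continuous_intros) auto
qed

lemma smooth_pos'_bounds: "0 <= smooth_pos' n s" "smooth_pos' n s <= 1" "\<bar>smooth_pos' n s\<bar> <= 1"
proof -
 have p: "sqrt (s^2 + (1 / Suc n)^2) > 0" by (simp add: add_nonneg_pos)
 have "\<bar>s\<bar> <= sqrt (s^2 + (1 / Suc n)^2)" by (rule real_le_rsqrt) simp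
 then have q: "\<bar>s / sqrt (s^2 + (1 / Suc n)^2)\<bar> <= 1" using p by (simp add: abs_divide)
 have "0 <= (y + 1) / 2 & (y + 1) / 2 <= 1" if "\<bar>y\<bar> <= 1" for y :: real using that by auto
 from this[OF q] show b: "0 <= smooth_pos' n s" and "smooth_pos' n s <= 1" unfolding smooth_pos'_def by auto
 with b show "\<bar>smooth_pos' n s\<bar> <= 1" by simp
qed

lemma smooth_pos_lim: "(%n. smooth_pos n s) ----> max 0 s"
 and smooth_pos'_lim: "(%n. smooth_pos' n s) ----> (sgn s + 1) / 2"
proof -
 have e: "(%n. 1 / real (Suc n)) ----> 0" using LIMSEQ_inverse_real_of_nat by (simp add: inverse_eq_divide)
 have q: "(%n. sqrt (s^2 + (1 / Suc n)^2)) ----> sqrt (s^2 + 0^2)" by (intro tendsto_intros e)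
 then have "(%n. smooth_pos n s) ----> (sqrt (s^2 + 0^2) + s - 0) / 2"
  unfolding smooth_pos_def by (intro tendsto_intros e) auto
 then show "(%n. smooth_pos n s) ----> max 0 s" by (auto simp: max_def split: if_splits)
 show "(%n. smooth_pos' n s) ----> (sgn s + 1) / 2"
 proof (cases "s = 0")
  case False
  then have "(%n. smooth_pos' n s) ----> (s / sqrt (s^2 + 0^2) + 1) / 2"
   unfolding smooth_pos'_def by (intro tendsto_intros q) auto
  then show ?thesis by (simp add: sgn_real_def abs_if False split: if_splits)
 qed (simp add: smooth_pos'_def)
qed

text \<open>The weak gradient vanishes almost everywhere on level sets, so the factor \<open>1/2\<close> on \<open>{z = kappa}\<close> is immaterial.\<close>

lemma wgrad_pos_approx:
 assumes w: "wgrad z g" and k: "kappa >= 0"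
 defines "F \<equiv> %n s. smooth_pos n (s - kappa) - smooth_pos n (- kappa)"
 shows "wgrad (%x. F n (z x)) (%x. smooth_pos' n (z x - kappa) *R g x)"
  and "l2conv (%n x. F n (z x)) (%x. max 0 (z x - kappa))"
  and "l2conv (%n x. smooth_pos' n (z x - kappa) *R g x) (%x. ((sgn (z x - kappa) + 1) / 2) *R g x)"
  and "sq_int (%x. max 0 (z x - kappa))" "sq_int (%x. ((sgn (z x - kappa) + 1) / 2) *R g x)"
proof -
 note s = wgradD(1,2)[OF w]
 have [measurable]: "z \<in> BM" "g \<in> BM" using s by (auto simp: sq_int_def)
 have dF: "(F n has_real_derivative smooth_pos' n (s - kappa)) (at s)" for n s
  unfolding F_def
  by (rule DERIV_cong[OF DERIV_diff[OF DERIV_chain2[OF smooth_pos_deriv DERIV_diff[OF DERIV_ident DERIV_const]] DERIV_const]]) simp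
 have cF: "continuous_on UNIV (%s. smooth_pos' n (s - kappa))" for n
  by (rule continuous_on_compose2[OF smooth_pos'_cont]) (auto intro: continuous_intros)
 have F0: "F n 0 = 0" for n by (simp add: F_def)
 show A: "wgrad (%x. F n (z x)) (%x. smooth_pos' n (z x - kappa) *R g x)" for n
  by (rule wgrad_chain[OF w dF cF smooth_pos'_bounds(3) F0])
 have [measurable]: "(%x. F n (z x)) \<in> BM"
   "(%x. smooth_pos' n (z x - kappa) *R g x) \<in> BM" for n
  using wgradD(3,4)[OF A[of n]] by auto
 have sb: "\<bar>(sgn (z x - kappa) + 1) / 2\<bar> <= 1" for x by (simp add: sgn_real_def)
 have mz: "\<bar>max 0 (z x - kappa)\<bar> <= \<bar>z x\<bar>" for x using k by auto
 show "sq_int (%x. max 0 (z x - kappa))"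
  by (rule sq_int_bounded_by[OF s(1), of _ 1]) (use mz in auto)
 show "sq_int (%x. ((sgn (z x - kappa) + 1) / 2) *R g x)"
  by (rule sq_int_mult_bounded[OF s(2) _ sb]) measurable
 show "l2conv (%n x. F n (z x)) (%x. max 0 (z x - kappa))"
 proof (rule l2conv_dominated)
  show "integrable lborel (%x. 4 * (norm (z x))^2)" using sq_int_integrable[OF s(1)] by simp
  have "(norm (F n (z x) - max 0 (z x - kappa)))^2 <= 4 * (norm (z x))^2" for n x
  proof -
   have "\<bar>F n (z x)\<bar> <= \<bar>z x\<bar>"
    using sq_int_compose(2)[OF s(1) dF smooth_pos'_bounds(3) F0, of n "z x" 0] by (simp add: F0)
   then have "norm (F n (z x) - max 0 (z x - kappa)) <= 2 * norm (z x)" using mz[of x] unfolding real_norm_def by linarith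
   from power_mono[OF this, of 2] show ?thesis by simp
  qed
  then show "AE x in lborel. (norm (F n (z x) - max 0 (z x - kappa)))^2 <= 4 * (norm (z x))^2" for n by simp
  have "(%n. F n t) ----> max 0 (t - kappa)" for t
   using tendsto_diff[OF smooth_pos_lim[of "t - kappa"] smooth_pos_lim[of "- kappa"]] k by (simp add: F_def)
  then show "AE x in lborel. (%n. F n (z x)) ----> max 0 (z x - kappa)" by simp
 qed measurable
 show "l2conv (%n x. smooth_pos' n (z x - kappa) *R g x) (%x. ((sgn (z x - kappa) + 1) / 2) *R g x)"
 proof (rule l2conv_dominated)
  show "integrable lborel (%x. 4 * (norm (g x))^2)" using sq_int_integrable[OF s(2)] by simp
  have "(norm (smooth_pos' n (z x - kappa) *R g x - ((sgn (z x - kappa) + 1) / 2) *R g x))^2 <= 4 * (norm (g x))^2" for n x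
  proof -
   have "norm (smooth_pos' n (z x - kappa) *R g x - ((sgn (z x - kappa) + 1) / 2) *R g x) = \<bar>smooth_pos' n (z x - kappa) - (sgn (z x - kappa) + 1) / 2\<bar> * norm (g x)"
    by (simp flip: scaleR_diff_left)
   also have "\<dots> <= 2 * norm (g x)"
    using smooth_pos'_bounds(3)[of n "z x - kappa"] sb[of x] by (intro mult_right_mono) (linarith, simp)
   finally show ?thesis using power_mono[of _ "2 * norm (g x)" 2] by simp
  qed
  then show "AE x in lborel. (norm (smooth_pos' n (z x - kappa) *R g x - ((sgn (z x - kappa) + 1) / 2) *R g x))^2 <= 4 * (norm (g x))^2" for n by simp
 qed (auto intro!: AE_I2 tendsto_intros smooth_pos'_lim)
qed

lemma wgrad_pos:
 assumes w: "wgrad z g" and k: "kappa >= 0"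
 shows "wgrad (%x. max 0 (z x - kappa)) (%x. ((sgn (z x - kappa) + 1) / 2) *R g x)"
proof -
 note A = wgrad_pos_approx[OF w k]
 show ?thesis
  by (rule wgrad_closed[OF A(1) l2conv_imp_wconv[OF A(2)] A(4) l2conv_imp_wconv[OF A(3)] A(5)])
   (use wgradD(1,2)[OF A(1)] A(4,5) in auto)
qed

section \<open>Averages over small cubes: inequality of Faber-Krahn type and local
  compactness\<close>

abbreviation cube :: "real => 'a::euclidean_space set" where "cube rho \<equiv> cbox 0 (rho *R One)"

lemma emeasure_cube: "rho >= 0 ==> emeasure lborel (cube rho :: 'a::euclidean_space set) = ennreal (rho ^ DIM('a))"
 by (subst emeasure_lborel_cbox) auto

lemma norm_le_cube:
 fixes rho :: real
 shows "h \<in> (cube rho :: 'a::euclidean_space set) ==> norm h <= DIM('a) * rho"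
proof -
 assume h: "h \<in> (cube rho :: 'a set)"
 have "norm h <= (\<Sum>b\<in>Basis. \<bar>h \<bullet> b\<bar>)" by (rule norm_le_l1)
 also have "\<dots> <= (\<Sum>b\<in>(Basis :: 'a set). rho)" using h by (intro sum_mono) (auto simp: mem_box)
 finally show ?thesis by simp
qed

text \<open>Increments in \<open>cube rho\<close> have length at most the dimension times
  \<open>rho\<close>. Integrating the translation estimate over them gives the common source of
  \<open>faber_krahn\<close> and \<open>rellich_local\<close>.\<close>

lemma averaged_translation:
 fixes z :: "real^'n::finite => real" and rho :: real
 assumes w: "wgrad z g" and r: "rho > 0"
 shows "(\<integral>\<^sup>+x. (\<integral>\<^sup>+h. ennreal ((z (x + h) - z x)^2) * indicator (cube rho) h \<partial>lborel) \<partial>lborel)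
   <= ennreal (rho ^ CARD('n) * ((CARD('n) * rho)^2 * (LBINT x. (norm (g x))^2)))"
proof -
 note s = wgradD(1,2)[OF w]
 have [measurable]: "z \<in> BM" using s by (auto simp: sq_int_def)
 let ?G = "LBINT x. (norm (g x))^2"
 have "(\<integral>\<^sup>+x. (\<integral>\<^sup>+h. ennreal ((z (x + h) - z x)^2) * indicator (cube rho) h \<partial>lborel) \<partial>lborel) =
   (\<integral>\<^sup>+h. (\<integral>\<^sup>+x. ennreal ((z (x + h) - z x)^2) * indicator (cube rho) h \<partial>lborel) \<partial>lborel)"
  by (rule lborel_pair.Fubini'[symmetric]) measurable
 also have "\<dots> <= (\<integral>\<^sup>+h. ennreal ((CARD('n) * rho)^2 * ?G) * indicator (cube rho :: (real^'n) set) h \<partial>lborel)"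
 proof (rule nn_integral_mono)
  fix h :: "real^'n"
  show "(\<integral>\<^sup>+x. ennreal ((z (x + h) - z x)^2) * indicator (cube rho) h \<partial>lborel) <= ennreal ((CARD('n) * rho)^2 * ?G) * indicator (cube rho) h"
  proof (cases "h \<in> cube rho")
   case True
   have "(\<integral>\<^sup>+x. ennreal ((z (x + h) - z x)^2) \<partial>lborel) = ennreal (LBINT x. (z (x + h) - z x)^2)"
    using sq_int_integrable[OF sq_int_diff[OF sq_int_shift[OF s(1), of h] s(1)]] by (intro nn_integral_eq_integral) auto
   also have "\<dots> <= ennreal ((CARD('n) * rho)^2 * ?G)"
   proof (rule ennreal_leI)
    have "(LBINT x. (z (x + h) - z x)^2) <= (norm h)^2 * ?G" by (rule translation_estimate[OF w])
    also have "\<dots> <= (CARD('n) * rho)^2 * ?G" using norm_le_cube[OF True] by (intro mult_right_mono power_mono) auto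
    finally show "(LBINT x. (z (x + h) - z x)^2) <= (CARD('n) * rho)^2 * ?G" .
   qed
   finally show ?thesis using True by simp
  qed simp
 qed
 also have "\<dots> = ennreal ((CARD('n) * rho)^2 * ?G) * ennreal (rho ^ CARD('n))"
  using emeasure_cube[of rho, where 'a = "real^'n"] r by (simp add: nn_integral_cmult)
 also have "\<dots> = ennreal (rho ^ CARD('n) * ((CARD('n) * rho)^2 * ?G))"
  using r by (subst ennreal_mult[symmetric]) (auto simp: mult.commute)
 finally show ?thesis .
qed

text \<open>Faber--Krahn: at most half of the cube \<open>x + [0, rho]\<^sup>n\<close> can meet the support of \<open>z\<close>.\<close>

theorem faber_krahn:
 fixes z :: "real^'n::finite => real" and rho :: real
 assumes w: "wgrad z g" and r: "rho > 0" and A: "A \<in> sets borel" "emeasure lborel A <= ennreal (rho ^ CARD('n) / 2)"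
  and z: "!!x. x \<notin> A ==> z x = 0"
 shows "(LBINT x. (z x)^2) <= 2 * (CARD('n) * rho)^2 * (LBINT x. (norm (g x))^2)"
proof -
 note s = wgradD(1,2)[OF w]
 have [measurable]: "z \<in> BM" "A \<in> sets borel" using s A by (auto simp: sq_int_def)
 let ?G = "LBINT x. (norm (g x))^2" and ?N = "CARD('n)"
 have half: "ennreal (rho ^ ?N / 2) <= (\<integral>\<^sup>+h. indicator (- A) (x + h) * indicator (cube rho) h \<partial>lborel)" for x :: "real^'n"
 proof -
  have "emeasure lborel (cube rho :: (real^'n) set) = (\<integral>\<^sup>+h. indicator (cube rho :: (real^'n) set) h \<partial>lborel)" by simp
  also have "\<dots> <= (\<integral>\<^sup>+h. indicator (- A) (x + h) * indicator (cube rho) h + indicator A (x + h) \<partial>lborel)"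
   by (intro nn_integral_mono) (auto simp: indicator_def)
  also have "\<dots> = (\<integral>\<^sup>+h. indicator (- A) (x + h) * indicator (cube rho) h \<partial>lborel) + (\<integral>\<^sup>+h. indicator A (x + h) \<partial>lborel)"
   by (rule nn_integral_add) measurable
  also have "(\<integral>\<^sup>+h. indicator A (x + h) \<partial>lborel) = emeasure lborel A"
  proof -
   have "emeasure lborel A = (\<integral>\<^sup>+h. indicator A h \<partial>distr lborel borel ((+) x))"
    using lborel_distr_plus[of x] by simp
   also have "\<dots> = (\<integral>\<^sup>+h. indicator A (x + h) \<partial>lborel)" by (rule nn_integral_distr) measurable
   finally show ?thesis by simp
  qed
  finally have "ennreal (rho ^ ?N) <= (\<integral>\<^sup>+h. indicator (- A) (x + h) * indicator (cube rho) h \<partial>lborel) + ennreal (rho ^ ?N / 2)"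
   using A(2) emeasure_cube[of rho, where 'a = "real^'n"] r by (auto intro: order_trans add_left_mono)
  moreover have "ennreal (rho ^ ?N) = ennreal (rho ^ ?N / 2) + ennreal (rho ^ ?N / 2)"
   using r by (subst ennreal_plus[symmetric]) auto
  ultimately show ?thesis by simp
 qed
 have "ennreal (rho ^ ?N / 2 * (LBINT x. (z x)^2)) = ennreal (rho ^ ?N / 2) * (\<integral>\<^sup>+x. ennreal ((z x)^2) \<partial>lborel)"
  using sq_int_integrable[OF s(1)] r by (subst nn_integral_eq_integral) (auto simp: ennreal_mult[symmetric])
 also have "\<dots> = (\<integral>\<^sup>+x. ennreal (rho ^ ?N / 2) * ennreal ((z x)^2) \<partial>lborel)" by (rule nn_integral_cmult[symmetric]) measurable
 also have "\<dots> <= (\<integral>\<^sup>+x. (\<integral>\<^sup>+h. ennreal ((z (x + h) - z x)^2) * indicator (cube rho) h \<partial>lborel) \<partial>lborel)"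
 proof (rule nn_integral_mono)
  fix x
  have "ennreal (rho ^ ?N / 2) * ennreal ((z x)^2) <= (\<integral>\<^sup>+h. indicator (- A) (x + h) * indicator (cube rho) h \<partial>lborel) * ennreal ((z x)^2)"
   by (intro mult_right_mono half) simp
  also have "\<dots> = (\<integral>\<^sup>+h. indicator (- A) (x + h) * indicator (cube rho) h * ennreal ((z x)^2) \<partial>lborel)"
   by (rule nn_integral_multc[symmetric]) measurable
  also have "\<dots> <= (\<integral>\<^sup>+h. ennreal ((z (x + h) - z x)^2) * indicator (cube rho) h \<partial>lborel)"
   by (intro nn_integral_mono) (auto simp: indicator_def z)
  finally show "ennreal (rho ^ ?N / 2) * ennreal ((z x)^2) <= (\<integral>\<^sup>+h. ennreal ((z (x + h) - z x)^2) * indicator (cube rho) h \<partial>lborel)" .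
 qed
 also have "\<dots> <= ennreal (rho ^ ?N * ((?N * rho)^2 * ?G))" by (rule averaged_translation[OF w r])
 finally have "rho ^ ?N / 2 * (LBINT x. (z x)^2) <= rho ^ ?N * ((?N * rho)^2 * ?G)"
  using r by (subst (asm) ennreal_le_iff) auto
 then have "rho ^ ?N * ((LBINT x. (z x)^2) / 2) <= rho ^ ?N * ((?N * rho)^2 * ?G)" by simp
 then have "(LBINT x. (z x)^2) / 2 <= (?N * rho)^2 * ?G" using r by (subst (asm) mult_le_cancel_left_pos) auto
 then show ?thesis by simp
qed

text \<open>\<open>z n\<close> is compared with its integrals over the cubes
  \<open>x + cube rho\<close>. For fixed \<open>rho\<close> these tend to zero by weak convergence
  and are dominated on the ball; the difference is small with \<open>rho\<close>, uniformly in
  \<open>n\<close>.\<close>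

theorem rellich_local:
 fixes z :: "nat => real^'n::finite => real"
 assumes w: "!!n. wgrad (z n) (g n)" and M: "!!n. (LBINT x. (z n x)^2) <= M" "!!n. (LBINT x. (norm (g n x))^2) <= M"
  and wc: "wconv z (%x. 0)"
 shows "(%n. LBINT x. (z n x)^2 * indicator (cball 0 R) x) ----> 0"
proof -
 note s = wgradD(1,2)[OF w]
 have [measurable]: "z n \<in> BM" for n using s by (auto simp: sq_int_def)
 have [measurable]: "cball 0 R \<in> sets (borel :: (real^'n) measure)" by (simp add: borel_closed)
 let ?N = "CARD('n)"
 have M0: "M >= 0" using M(1)[of 0] by (rule order_trans[rotated]) simp
 have iz: "integrable lborel (%x. (z n x)^2)" for n using s(1)[of n] by (simp add: sq_int_def)
 have iK: "integrable lborel (%x. (z n x)^2 * indicator (cball 0 R) x)" for n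
  by (rule Bochner_Integration.integrable_bound[OF iz[of n]]) (auto simp: indicator_def)
 show ?thesis
 proof (rule LIMSEQ_I)
  fix e :: real assume e: "e > 0"
  \<comment> \<open>Chosen so that the oscillation accounts for less than \<open>3 e / 4\<close>;
    the integrals over cubes contribute at most \<open>e / 4\<close> for large
    \<open>n\<close>.\<close>
  define rho where "rho = min 1 (e / (4 * ((real ?N)^2 * M + 1)))"
  have r: "rho > 0" "rho <= 1" using e M0 by (auto simp: rho_def add_nonneg_pos intro!: divide_pos_pos)
  have small: "2 * ((?N * rho)^2 * M) < e / 2 + e / 4"
  proof -
   have "rho * (4 * ((real ?N)^2 * M + 1)) <= e"
    using M0 by (simp add: rho_def min_def pos_le_divide_eq[symmetric] add_nonneg_pos)
   moreover have "rho^2 <= rho" using r by (simp add: power2_eq_square mult_left_le)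
   then have "(real ?N)^2 * M * rho^2 <= (real ?N)^2 * M * rho" using M0 by (intro mult_left_mono) auto
   ultimately show ?thesis using e r by (simp add: power_mult_distrib algebra_simps)
  qed
  define q where "q = rho ^ ?N"
  have q: "q > 0" using r by (simp add: q_def)
  have cf: "emeasure lborel (cube rho :: (real^'n) set) = ennreal q" using emeasure_cube[of rho, where 'a = "real^'n"] r by (simp add: q_def)
  define Q :: "real^'n => real^'n => real" where "Q x y = indicator (cube rho) (y - x)" for x y
  define I where "I n x = (LBINT h. z n (x + h) * indicator (cube rho) h)" for n x
  have [measurable]: "I n \<in> BM" for n unfolding I_def[abs_def] by measurable
  have si: "sq_int (indicator (cube rho) :: real^'n => real)"
   by (rule sq_int_bounded_support[of _ 1 "?N * rho"]) (use norm_le_cube[where 'a = "real^'n"] in \<open>auto simp: indicator_def split: if_splits\<close>)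
  have i1: "(\<integral>h. (indicator (cube rho) h :: real)^2 \<partial>(lborel :: (real^'n) measure)) = q"
  proof -
   have "(indicator (cube rho) h :: real)^2 = indicator (cube rho) h" for h :: "real^'n" by (simp add: indicator_def)
   then show ?thesis using cf q by (simp add: measure_def)
  qed
  have Ilim: "(%n. I n x) ----> 0" for x
  proof -
   have "sq_int (Q x)" unfolding Q_def using sq_int_shift[OF si, of "- x"] by simp
   from wconvD[OF wc this] have "(%n. LBINT y. z n y * Q x y) ----> 0" by simp
   moreover have "(LBINT y. z n y * Q x y) = I n x" for n
    using integral_shift(1)[of "%y. z n y * Q x y" x] by (simp add: I_def Q_def add.commute)
   ultimately show ?thesis by simp
  qed
  have I2: "(I n x)^2 <= M * q" for n x
  proof -
   have "\<bar>I n x\<bar> <= sqrt (LBINT h. (z n (h + x))^2) * sqrt q"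
    using L2_Cauchy_Schwarz'[OF sq_int_shift[OF s(1)[of n], of x] si] by (simp add: I_def add.commute i1)
   also have "(LBINT h. (z n (h + x))^2) = (LBINT h. (z n h)^2)" by (rule integral_shift(1)) measurable
   also have "sqrt \<dots> * sqrt q <= sqrt M * sqrt q" using M(1)[of n] q by (intro mult_right_mono) auto
   finally have "\<bar>I n x\<bar> <= sqrt (M * q)" by (simp add: real_sqrt_mult)
   then have "\<bar>I n x\<bar>^2 <= (sqrt (M * q))^2" by (intro power_mono) auto
   then show ?thesis using M0 q by simp
  qed
  have "(%n. LBINT x. (I n x)^2 * indicator (cball 0 R) x) ----> (\<integral>x. 0 \<partial>(lborel :: (real^'n) measure))"
  proof (rule integral_dominated_convergence[where w = "%x. M * q * indicator (cball 0 R) x"])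
   show "integrable lborel (%x. M * q * indicator (cball 0 R) x :: real)"
    by (intro integrable_mult_right integrable_real_indicator) (auto simp: emeasure_cball_finite[unfolded infinity_ennreal_def])
   show "AE x in lborel. (%n. (I n x)^2 * indicator (cball 0 R) x) ----> 0"
   proof (rule AE_I2)
    fix x :: "real^'n"
    have "(%n. (I n x)^2 * indicator (cball 0 R) x) ----> 0^2 * indicator (cball 0 R) x" by (intro tendsto_intros Ilim)
    then show "(%n. (I n x)^2 * indicator (cball 0 R) x) ----> 0" by simp
   qed
   show "AE x in lborel. norm ((I n x)^2 * indicator (cball 0 R) x) <= M * q * indicator (cball 0 R) x" for n
    using I2[of n] by (auto simp: indicator_def)
  qed measurable
  then have "(%n. LBINT x. (I n x)^2 * indicator (cball 0 R) x) ----> 0" by simp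
  from LIMSEQ_D[OF this, of "q^2 * (e / 8)"] obtain n0 where n0:
   "!!n. n >= n0 ==> \<bar>LBINT x. (I n x)^2 * indicator (cball 0 R) x\<bar> < q^2 * (e / 8)"
   using e q by auto
  have "(LBINT x. (z n x)^2 * indicator (cball 0 R) x) < e" if n: "n >= n0" for n
  proof -
   let ?G = "LBINT x. (norm (g n x))^2"
   define J where "J x = (LBINT h. (z n (x + h) - z n x)^2 * indicator (cube rho) h)" for x
   have [measurable]: "J \<in> BM" unfolding J_def[abs_def] by measurable
   have shf: "sq_int (%h. z n (x + h))" for x using sq_int_shift[OF s(1)[of n], of x] by (simp add: add.commute)
   have sqd: "sq_int (%h. (z n (x + h) - z n x) * indicator (cube rho) h)" for x
   proof -
    have "sq_int (%h. z n (x + h) * indicator (cube rho) h)"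
     by (rule sq_int_bounded_by[OF shf[of x], of _ 1]) (auto simp: indicator_def)
    from sq_int_diff[OF this sq_int_cmult[OF si, of "z n x"]] show ?thesis by (simp add: left_diff_distrib)
   qed
   have iJ: "integrable lborel (%h. (z n (x + h) - z n x)^2 * indicator (cube rho) h)" for x
   proof -
    have "(norm ((z n (x + h) - z n x) * indicator (cube rho) h))^2 = (z n (x + h) - z n x)^2 * indicator (cube rho) h" for h
     by (auto simp: indicator_def)
    then show ?thesis using sq_int_integrable[OF sqd[of x]] by simp
   qed
   have J0: "J x >= 0" for x unfolding J_def by (intro integral_nonneg_AE) auto
   \<comment> \<open>\<open>q * z n x\<close> is the integral of \<open>z n\<close> over the cube
     minus the integral of the increments, and Cauchy-Schwarz bounds the latter by
     \<open>sqrt (q * J x)\<close>.\<close>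
   have point: "q^2 * (z n x)^2 <= 2 * q * J x + 2 * (I n x)^2" for x
   proof -
    have "(LBINT h. (z n (x + h) - z n x) * indicator (cube rho) h) = I n x - z n x * q"
    proof -
     have "(\<integral>h. indicator (cube rho) h \<partial>(lborel :: (real^'n) measure)) = q" using cf q by (simp add: measure_def)
     then show ?thesis unfolding I_def left_diff_distrib
      by (subst Bochner_Integration.integral_diff)
       (use integrable_sq_mult[OF shf si] cf in \<open>auto intro!: integrable_mult_right integrable_real_indicator\<close>)
    qed
    moreover have "\<bar>LBINT h. (z n (x + h) - z n x) * indicator (cube rho) h\<bar> <= sqrt (J x) * sqrt q"
    proof -
     have "\<bar>LBINT h. ((z n (x + h) - z n x) * indicator (cube rho) h) * indicator (cube rho) h\<bar>
       <= sqrt (LBINT h. ((z n (x + h) - z n x) * indicator (cube rho) h)^2) * sqrt q"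
      using L2_Cauchy_Schwarz'[OF sqd[of x] si] by (simp add: i1)
     moreover have "((z n (x + h) - z n x) * indicator (cube rho) h) * indicator (cube rho) h = (z n (x + h) - z n x) * indicator (cube rho) h"
      "((z n (x + h) - z n x) * indicator (cube rho) h)^2 = (z n (x + h) - z n x)^2 * indicator (cube rho) h" for h
      by (auto simp: indicator_def)
     ultimately show ?thesis by (simp add: J_def)
    qed
    ultimately have "\<bar>I n x - z n x * q\<bar> <= sqrt (J x * q)" by (simp add: real_sqrt_mult)
    then have "\<bar>I n x - z n x * q\<bar>^2 <= (sqrt (J x * q))^2" by (intro power_mono) auto
    then have "(I n x - z n x * q)^2 <= J x * q" using J0[of x] q by simp
    moreover have "(z n x * q)^2 <= 2 * (I n x - z n x * q)^2 + 2 * (I n x)^2"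
     using sum_squares_bound[of "I n x - z n x * q" "- I n x"] zero_le_power2[of "2 * I n x - z n x * q"]
     by (simp add: power2_eq_square algebra_simps)
    ultimately show ?thesis by (simp add: power_mult_distrib mult_ac)
   qed
   have nJ: "(\<integral>\<^sup>+x. ennreal (J x) \<partial>lborel) <= ennreal (q * ((?N * rho)^2 * ?G))"
   proof -
    have "ennreal (J x) = (\<integral>\<^sup>+h. ennreal ((z n (x + h) - z n x)^2) * indicator (cube rho) h \<partial>lborel)" for x
     unfolding J_def by (subst nn_integral_eq_integral[OF iJ, symmetric]) (auto intro!: nn_integral_cong simp: indicator_def)
    then show ?thesis using averaged_translation[OF w[of n] r(1)] by (simp add: q_def)
   qed
   have intJ: "integrable lborel J"
    by (rule integrableI_nonneg) (use J0 nJ in \<open>auto intro: le_less_trans\<close>)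
   have JG: "(LBINT x. J x) <= q * ((?N * rho)^2 * ?G)"
    using nJ J0 intJ q by (subst (asm) nn_integral_eq_integral) auto
   have intI: "integrable lborel (%x. (I n x)^2 * indicator (cball 0 R) x)"
    by (rule integrableI_bounded_set[where A = "cball 0 R" and B = "M * q"]) (use I2 in \<open>auto simp: emeasure_cball_finite[unfolded infinity_ennreal_def]\<close>)
   have "q^2 * (LBINT x. (z n x)^2 * indicator (cball 0 R) x) = (LBINT x. q^2 * ((z n x)^2 * indicator (cball 0 R) x))" by simp
   also have "\<dots> <= (LBINT x. 2 * q * J x + 2 * ((I n x)^2 * indicator (cball 0 R) x))"
    by (rule integral_mono) (use iK[of n] intJ intI point J0 q in \<open>auto simp: indicator_def mult_ac\<close>)
   also have "\<dots> = 2 * q * (LBINT x. J x) + 2 * (LBINT x. (I n x)^2 * indicator (cball 0 R) x)"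
    using intJ intI by simp
   also have "\<dots> <= 2 * q * (q * ((?N * rho)^2 * M)) + 2 * (q^2 * (e / 8))"
   proof (rule add_mono)
    have "(LBINT x. J x) <= q * ((?N * rho)^2 * M)"
     by (rule order_trans[OF JG]) (use M(2)[of n] q in \<open>intro mult_left_mono, auto\<close>)
    then show "2 * q * (LBINT x. J x) <= 2 * q * (q * ((?N * rho)^2 * M))" using q by (intro mult_left_mono) auto
    show "2 * (LBINT x. (I n x)^2 * indicator (cball 0 R) x) <= 2 * (q^2 * (e / 8))"
     using n0[OF n] by linarith
   qed
   also have "\<dots> = q^2 * (2 * ((?N * rho)^2 * M) + e / 4)" by (simp add: power2_eq_square algebra_simps)
   also have "\<dots> < q^2 * e" using small q by simp
   finally show ?thesis using q by simp
  qed
  moreover have "(LBINT x. (z n x)^2 * indicator (cball 0 R) x) >= 0" for n by (intro integral_nonneg_AE) auto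
  ultimately show "\<exists>no. \<forall>n\<ge>no. norm ((LBINT x. (z n x)^2 * indicator (cball 0 R) x) - 0) < e" by auto
 qed
qed

section \<open>The energy space\<close>

text \<open>The normalisation \<open>V + m0 >= 1\<close> makes the energy dominate the squared L^2
  norm and gives \<open>|V| <= (1 + m0) Vm\<close>, the form in which all coefficients will be
  bounded.\<close>

locale coercive_potential =
 fixes V :: "real^'n::finite => real" and m0 :: real
 assumes V_cont: "continuous_on UNIV V" and V_lower: "!!x. V x + m0 >= 1" and m0_nonneg: "m0 >= 0"
  and V_lim: "filterlim V at_top at_infinity"
begin

definition Vm :: "real^'n => real" where "Vm x = V x + m0"

text \<open>Function and weak gradient travel as a pair, as the gradient is determined only up to a
  null set.\<close>

definition inE :: "(real^'n => real) => (real^'n => real^'n) => bool" where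
 "inE z g \<longleftrightarrow> wgrad z g & integrable lborel (%x. Vm x * (z x)^2)"

text \<open>Functions in the energy space whose restriction to \<open>B\<close> may be extended by zero: they vanish on the boundary of \<open>B\<close>.\<close>

definition inX :: "(real^'n) set => (real^'n => real) => (real^'n => real^'n) => bool" where
 "inX B z g \<longleftrightarrow> inE z g & wgrad (%x. indicator B x * z x) (%x. indicator B x *R g x)"

definition en :: "(real^'n => real) => (real^'n => real^'n) => real" where
 "en z g = (LBINT x. (norm (g x))^2) + (LBINT x. Vm x * (z x)^2)"

text \<open>The bilinear form of \<open>- Delta + Q\<close>. The coefficient is a parameter because
  it will depend on the solution and on \<open>rho\<close>.\<close>

definition aform :: "(real^'n => real) => (real^'n => real) => (real^'n => real^'n) => (real^'n => real) => (real^'n => real^'n) => real" where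
 "aform Q z g xi eta = (LBINT x. g x \<bullet> eta x) + (LBINT x. Q x * z x * xi x)"

lemma Vm_ge1: "Vm x >= 1" and Vm_pos: "Vm x > 0" and V_abs_le: "\<bar>V x\<bar> <= (1 + m0) * Vm x"
proof -
 show 1: "Vm x >= 1" using V_lower by (simp add: Vm_def)
 then show "Vm x > 0" by simp
 have "m0 <= m0 * Vm x" using 1 m0_nonneg by (simp add: mult_le_cancel_left1)
 then show "\<bar>V x\<bar> <= (1 + m0) * Vm x" using V_lower[of x] m0_nonneg 1 by (simp add: Vm_def algebra_simps abs_le_iff)
qed

lemma V_measurable [measurable]: "V \<in> BM" "Vm \<in> BM"
proof -
 show [measurable]: "V \<in> BM" using V_cont by (rule borel_measurable_continuous_onI)
 show "Vm \<in> BM" unfolding Vm_def[abs_def] by measurable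
qed

lemma V_large: "\<exists>R>0. \<forall>x. norm x >= R --> V x >= K"
proof -
 have "eventually (%x. V x >= K) at_infinity" using V_lim by (simp add: filterlim_at_top)
 then obtain b where b: "!!x. b <= norm x ==> V x >= K" by (auto simp: eventually_at_infinity)
 then show ?thesis by (intro exI[of _ "max b 1"]) auto
qed

lemma V_bounded_on_ball: "\<exists>K>0. \<forall>x. norm x <= R --> Vm x <= K"
proof -
 have "compact (Vm ` cball 0 R)"
  unfolding Vm_def by (intro compact_continuous_image continuous_intros continuous_on_subset[OF V_cont]) auto
 then obtain K where "K > 0" "!!y. y \<in> Vm ` cball 0 R ==> norm y <= K" using compact_imp_bounded bounded_pos by metis
 then show ?thesis by (intro exI[of _ K]) force
qed

lemma inED:
 assumes "inE z g"
 shows "wgrad z g" "sq_int z" "sq_int g" "z \<in> BM" "g \<in> BM"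
  "integrable lborel (%x. Vm x * (z x)^2)" "sq_int (%x. sqrt (Vm x) * z x)"
proof -
 show 1: "wgrad z g" and 2: "integrable lborel (%x. Vm x * (z x)^2)" using assms by (auto simp: inE_def)
 show "sq_int z" "sq_int g" and [measurable]: "z \<in> BM" "g \<in> BM"
  using wgradD[OF 1] by auto
 have "(norm (sqrt (Vm x) * z x))^2 = Vm x * (z x)^2" for x
  using Vm_pos[of x] by (simp add: power_mult_distrib)
 then show "sq_int (%x. sqrt (Vm x) * z x)" using 2 by (simp add: sq_int_def)
qed

lemma inXD: "inX B z g ==> inE z g" "inX B z g ==> wgrad (%x. indicator B x * z x) (%x. indicator B x *R g x)"
 by (auto simp: inX_def)

lemma inX_empty: "inX {} z g \<longleftrightarrow> inE z g"
 by (simp add: inX_def wgrad_0)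

lemma inE_0: "inE (%x. 0) (%x. 0)"
 by (simp add: inE_def wgrad_0)

lemma inX_0: "inX B (%x. 0) (%x. 0)"
 by (simp add: inX_def inE_0 wgrad_0)

lemma inE_lincomb:
 assumes "inE z g" "inE z' g'"
 shows "inE (%x. a * z x + b * z' x) (%x. a *R g x + b *R g' x)"
proof -
 have "integrable lborel (%x. (norm (a * (sqrt (Vm x) * z x) + b * (sqrt (Vm x) * z' x)))^2)"
  by (intro sq_int_integrable sq_int_add sq_int_cmult inED(7)[OF assms(1)] inED(7)[OF assms(2)])
 moreover have "(norm (a * (sqrt (Vm x) * z x) + b * (sqrt (Vm x) * z' x)))^2 = Vm x * (a * z x + b * z' x)^2" for x
 proof -
  have "a * (sqrt (Vm x) * z x) + b * (sqrt (Vm x) * z' x) = sqrt (Vm x) * (a * z x + b * z' x)" by (simp add: algebra_simps)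
  then show ?thesis using Vm_pos[of x] by (simp add: power_mult_distrib)
 qed
 ultimately show ?thesis using wgrad_lincomb[OF inED(1)[OF assms(1)] inED(1)[OF assms(2)]] by (simp add: inE_def)
qed

lemma inX_lincomb:
 assumes "inX B z g" "inX B z' g'"
 shows "inX B (%x. a * z x + b * z' x) (%x. a *R g x + b *R g' x)"
 using inE_lincomb[OF assms[THEN inXD(1)], of a b] wgrad_lincomb[OF assms[THEN inXD(2)], of a b]
 by (simp add: inX_def algebra_simps)

lemma inX_add: "inX B z g ==> inX B z' g' ==> inX B (%x. z x + z' x) (%x. g x + g' x)"
 using inX_lincomb[of B z g z' g' 1 1] by simp

lemma inX_diff: "inX B z g ==> inX B z' g' ==> inX B (%x. z x - z' x) (%x. g x - g' x)"
 using inX_lincomb[of B z g z' g' 1 "-1"] by simp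

lemma inX_scale: "inX B z g ==> inX B (%x. c * z x) (%x. c *R g x)"
 using inX_lincomb[of B z g z g c 0] by simp

lemma inE_add: "inE z g ==> inE z' g' ==> inE (%x. z x + z' x) (%x. g x + g' x)"
 and inE_diff: "inE z g ==> inE z' g' ==> inE (%x. z x - z' x) (%x. g x - g' x)"
 and inE_scale: "inE z g ==> inE (%x. c * z x) (%x. c *R g x)"
 using inX_add[of "{}"] inX_diff[of "{}"] inX_scale[of "{}"] by (auto simp: inX_empty)

lemma inE_dominated:
 assumes "wgrad y h" "inE z g" "!!x. \<bar>y x\<bar> <= C * \<bar>z x\<bar>"
 shows "inE y h"
 unfolding inE_def
proof (rule conjI[OF assms(1)], rule Bochner_Integration.integrable_bound)
 note [measurable] = wgradD(3)[OF assms(1)]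
 show "integrable lborel (%x. C^2 * (Vm x * (z x)^2))" using inED(6)[OF assms(2)] by simp
 have "Vm x * (y x)^2 <= C^2 * (Vm x * (z x)^2)" for x
  using mult_left_mono[OF power_mono[OF assms(3)[of x], of 2], of "Vm x"] Vm_pos[of x]
  by (simp add: power_mult_distrib mult_ac)
 moreover have "norm (Vm x * (y x)^2) = Vm x * (y x)^2" for x using Vm_pos[of x] by (simp add: abs_mult)
 ultimately show "AE x in lborel. norm (Vm x * (y x)^2) <= norm (C^2 * (Vm x * (z x)^2))"
  by (auto intro!: AE_I2 intro: order_trans[OF _ abs_ge_self])
 show "(%x. Vm x * (y x)^2) \<in> borel_measurable lborel" by measurable
qed

lemma inX_chain:
 assumes x: "inX B z g" and F: "!!s. (F has_real_derivative F' s) (at s)" "continuous_on UNIV F'" "!!s. \<bar>F' s\<bar> <= C" "F 0 = 0"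
 shows "inX B (%x. F (z x)) (%x. F' (z x) *R g x)"
 unfolding inX_def
proof
 note w = inED(1)[OF inXD(1)[OF x]]
 show "inE (%x. F (z x)) (%x. F' (z x) *R g x)"
  by (rule inE_dominated[OF wgrad_chain[OF w F] inXD(1)[OF x], of C])
   (use sq_int_compose(2)[OF wgradD(1)[OF w] F(1,3,4), of _ 0] F(4) in auto)
 have eqs: "F (indicator B x * z x) = indicator B x * F (z x)"
  "F' (indicator B x * z x) *R indicator B x *R g x = indicator B x *R F' (z x) *R g x" for x
  by (auto simp: indicator_def F(4))
 show "wgrad (%x. indicator B x * F (z x)) (%x. indicator B x *R F' (z x) *R g x)"
  using wgrad_chain[OF inXD(2)[OF x] F] unfolding eqs .
qed

lemma inX_pos:
 assumes x: "inX B z g" and k: "kappa >= 0"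
 shows "inX B (%x. max 0 (z x - kappa)) (%x. ((sgn (z x - kappa) + 1) / 2) *R g x)"
 unfolding inX_def
proof
 note w = inED(1)[OF inXD(1)[OF x]]
 show "inE (%x. max 0 (z x - kappa)) (%x. ((sgn (z x - kappa) + 1) / 2) *R g x)"
  by (rule inE_dominated[OF wgrad_pos[OF w k] inXD(1)[OF x], of 1]) (use k in auto)
 have eqs: "max 0 (indicator B x * z x - kappa) = indicator B x * max 0 (z x - kappa)"
  "((sgn (indicator B x * z x - kappa) + 1) / 2) *R indicator B x *R g x = indicator B x *R ((sgn (z x - kappa) + 1) / 2) *R g x" for x
  using k by (auto simp: indicator_def)
 show "wgrad (%x. indicator B x * max 0 (z x - kappa)) (%x. indicator B x *R ((sgn (z x - kappa) + 1) / 2) *R g x)"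
  using wgrad_pos[OF inXD(2)[OF x] k] unfolding eqs .
qed

lemma inX_mult_test:
 assumes x: "inX B z g" and p: "phi \<in> Cc"
 shows "inX B (%x. phi x * z x) (%x. phi x *R g x + z x *R grad phi x)"
 unfolding inX_def
proof
 note w = inED(1)[OF inXD(1)[OF x]]
 obtain C where "!!x. \<bar>phi x\<bar> <= C" using test_bounded[OF p] by blast
 then show "inE (%x. phi x * z x) (%x. phi x *R g x + z x *R grad phi x)"
  by (intro inE_dominated[OF wgrad_mult_test[OF w p] inXD(1)[OF x], of C]) (auto simp: abs_mult intro: mult_right_mono)
 show "wgrad (%x. indicator B x * (phi x * z x)) (%x. indicator B x *R (phi x *R g x + z x *R grad phi x))"
  using wgrad_mult_test[OF inXD(2)[OF x] p] by (simp add: mult_ac scaleR_add_right)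
qed

lemma inE_mult_test: "inE z g ==> phi \<in> Cc ==> inE (%x. phi x * z x) (%x. phi x *R g x + z x *R grad phi x)"
 using inX_mult_test[of "{}"] by (simp add: inX_empty)

lemma inE_bounded_support:
 assumes w: "wgrad z g" and R: "!!x. z x \<noteq> 0 ==> norm x <= R"
 shows "inE z g"
 unfolding inE_def
proof (intro conjI w)
 note [measurable] = wgradD(3)[OF w]
 obtain K where K: "K > 0" "!!x. norm x <= R ==> Vm x <= K" using V_bounded_on_ball[of R] by blast
 show "integrable lborel (%x. Vm x * (z x)^2)"
 proof (rule Bochner_Integration.integrable_bound)
  show "integrable lborel (%x. K * (norm (z x))^2)" using sq_int_integrable[OF wgradD(1)[OF w]] by simp
  have "norm (Vm x * (z x)^2) <= norm (K * (norm (z x))^2)" for x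
   using K R[of x] Vm_pos[of x] by (cases "z x = 0") (auto simp: abs_mult)
  then show "AE x in lborel. norm (Vm x * (z x)^2) <= norm (K * (norm (z x))^2)" by simp
 qed measurable
qed

lemma inE_test: "phi \<in> Cc ==> inE phi (grad phi)"
 using Cc_infinityD(2)[of phi] wgrad_test[of phi] inE_bounded_support by blast

text \<open>The extension by zero of the restriction to \<open>B\<close> is itself zero. This makes
  functions that live away from the ball admissible.\<close>

lemma inX_vanishing: "inE z g ==> (!!x. x \<in> B ==> z x = 0 & g x = 0) ==> inX B z g"
proof -
 assume a: "inE z g" "!!x. x \<in> B ==> z x = 0 & g x = 0"
 then have "(%x. indicator B x * z x) = (%x. 0)" "(%x. indicator B x *R g x) = (%x. 0)"
  by (auto simp: indicator_def fun_eq_iff)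
 then show "inX B z g" using a(1) by (simp add: inX_def wgrad_0)
qed

lemma integrable_form:
 assumes "inE z g" "inE xi eta" and [measurable]: "Q \<in> BM" and Q: "!!x. \<bar>Q x\<bar> <= C * Vm x"
 shows "integrable lborel (%x. Q x * z x * xi x)" "integrable lborel (%x. g x \<bullet> eta x)"
  "\<bar>LBINT x. Q x * z x * xi x\<bar> <= C * (sqrt (LBINT x. Vm x * (z x)^2) * sqrt (LBINT x. Vm x * (xi x)^2))"
proof -
 show "integrable lborel (%x. g x \<bullet> eta x)" by (rule integrable_inner) (use inED assms in auto)
 have C0: "C >= 0" using Q[of 0] Vm_pos[of 0] by (metis abs_ge_zero order_trans zero_le_mult_iff not_le)
 define y where "y x = sqrt (Vm x) * \<bar>z x\<bar>" for x
 define v where "v x = sqrt (Vm x) * \<bar>xi x\<bar>" for x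
 note [measurable] = inED(4)[OF assms(1)] inED(4)[OF assms(2)]
 have sy: "sq_int y" "sq_int v"
  unfolding y_def[abs_def] v_def[abs_def]
  using sq_int_bounded_by[OF inED(7)[OF assms(1)], of "%x. sqrt (Vm x) * \<bar>z x\<bar>" 1]
   sq_int_bounded_by[OF inED(7)[OF assms(2)], of "%x. sqrt (Vm x) * \<bar>xi x\<bar>" 1] by (auto simp: abs_mult)
 have i: "integrable lborel (%x. C * (y x * v x))" by (intro integrable_mult_right integrable_sq_mult sy)
 have le: "\<bar>Q x * z x * xi x\<bar> <= C * (y x * v x)" for x
 proof -
  have "y x * v x = (sqrt (Vm x))^2 * (\<bar>z x\<bar> * \<bar>xi x\<bar>)" by (simp add: y_def v_def power2_eq_square mult_ac)
  then have "y x * v x = Vm x * (\<bar>z x\<bar> * \<bar>xi x\<bar>)" using Vm_pos[of x] by simp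
  moreover have "\<bar>Q x\<bar> * (\<bar>z x\<bar> * \<bar>xi x\<bar>) <= C * Vm x * (\<bar>z x\<bar> * \<bar>xi x\<bar>)" using Q by (intro mult_right_mono) auto
  ultimately show ?thesis by (simp add: abs_mult mult_ac)
 qed
 show i1: "integrable lborel (%x. Q x * z x * xi x)"
  by (rule Bochner_Integration.integrable_bound[OF i]) (use le in \<open>auto intro!: AE_I2 intro: order_trans[OF _ abs_ge_self]\<close>)
 have "\<bar>LBINT x. Q x * z x * xi x\<bar> <= (LBINT x. \<bar>Q x * z x * xi x\<bar>)" by (rule integral_abs_bound)
 also have "\<dots> <= (LBINT x. C * (y x * v x))" by (rule integral_mono[OF integrable_abs[OF i1] i le])
 also have "\<dots> = C * (LBINT x. y x * v x)" by simp
 also have "\<dots> <= C * (sqrt (LBINT x. (y x)^2) * sqrt (LBINT x. (v x)^2))"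
  using L2_Cauchy_Schwarz'[OF sy] C0 by (intro mult_left_mono) auto
 also have "(%x. (y x)^2) = (%x. Vm x * (z x)^2)" by (rule ext) (simp add: y_def power_mult_distrib Vm_pos less_imp_le)
 also have "(%x. (v x)^2) = (%x. Vm x * (xi x)^2)" by (rule ext) (simp add: v_def power_mult_distrib Vm_pos less_imp_le)
 finally show "\<bar>LBINT x. Q x * z x * xi x\<bar> <= C * (sqrt (LBINT x. Vm x * (z x)^2) * sqrt (LBINT x. Vm x * (xi x)^2))" .
qed

lemma en_parts: "(LBINT x. (norm (g x))^2) <= en z g" "(LBINT x. Vm x * (z x)^2) <= en z g" "en z g >= 0"
  "(LBINT x. (norm (g x))^2) >= 0" "(LBINT x. Vm x * (z x)^2) >= 0"
proof -
 have "(LBINT x. (norm (g x))^2) >= 0" "(LBINT x. Vm x * (z x)^2) >= 0"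
  using Vm_pos by (auto intro!: integral_nonneg_AE simp: less_imp_le)
 then show "(LBINT x. (norm (g x))^2) <= en z g" "(LBINT x. Vm x * (z x)^2) <= en z g" "en z g >= 0"
  "(LBINT x. (norm (g x))^2) >= 0" "(LBINT x. Vm x * (z x)^2) >= 0" by (auto simp: en_def)
qed

lemma L2_le_en:
 assumes "inE z g" shows "(LBINT x. (z x)^2) <= en z g"
proof -
 have "(LBINT x. (z x)^2) <= (LBINT x. Vm x * (z x)^2)"
 proof (rule integral_mono)
  show "integrable lborel (%x. (z x)^2)" using sq_int_integrable[OF inED(2)[OF assms]] by simp
  show "(z x)^2 <= Vm x * (z x)^2" for x using mult_right_mono[OF Vm_ge1[of x], of "(z x)^2"] by simp
 qed (rule inED(6)[OF assms])
 then show ?thesis using en_parts by (meson order_trans)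
qed

lemma aform_bound:
 assumes "inE z g" "inE xi eta" "Q \<in> BM" and Q: "!!x. \<bar>Q x\<bar> <= C * Vm x"
 shows "\<bar>aform Q z g xi eta\<bar> <= (1 + C) * (sqrt (en z g) * sqrt (en xi eta))"
proof -
 have C0: "C >= 0" using Q[of 0] Vm_pos[of 0] by (metis abs_ge_zero order_trans zero_le_mult_iff not_le)
 have "\<bar>LBINT x. g x \<bullet> eta x\<bar> <= sqrt (LBINT x. (norm (g x))^2) * sqrt (LBINT x. (norm (eta x))^2)"
  by (rule L2_Cauchy_Schwarz) (use assms inED in auto)
 also have "\<dots> <= sqrt (en z g) * sqrt (en xi eta)"
  by (intro mult_mono real_sqrt_le_mono en_parts real_sqrt_ge_zero)
 finally have 1: "\<bar>LBINT x. g x \<bullet> eta x\<bar> <= sqrt (en z g) * sqrt (en xi eta)" .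
 have "sqrt (LBINT x. Vm x * (z x)^2) * sqrt (LBINT x. Vm x * (xi x)^2) <= sqrt (en z g) * sqrt (en xi eta)"
  by (intro mult_mono real_sqrt_le_mono en_parts real_sqrt_ge_zero)
 from order_trans[OF integrable_form(3)[OF assms] mult_left_mono[OF this C0]]
 have "\<bar>LBINT x. Q x * z x * xi x\<bar> <= C * (sqrt (en z g) * sqrt (en xi eta))" .
 with 1 show ?thesis by (simp add: aform_def algebra_simps)
qed

text \<open>Multiplication by the indicator of \<open>B\<close> can be moved to the test function,
  so vanishing on the boundary survives weak limits.\<close>

lemma inX_closed:
 assumes x: "!!n. inX B (z n) (g n)" and z: "wconv z z'" "wconv g g'" and E: "inE z' g'" and [measurable]: "B \<in> sets borel"
 shows "inX B z' g'"
 unfolding inX_def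
proof (intro conjI E)
 have ind: "wconv (%n x. indicator B x *R f n x) (%x. indicator B x *R f' x)" if "wconv f f'" for f and f' :: "real^'n => 'c::euclidean_space"
  unfolding wconv_def
 proof (intro allI impI)
  fix psi :: "real^'n => 'c" assume p: "sq_int psi"
  have "sq_int (%x. indicator B x *R psi x)" by (rule sq_int_mult_bounded[OF p, of _ 1]) (auto simp: indicator_def)
  from wconvD[OF that this] show "(%n. LBINT x. (indicator B x *R f n x) \<bullet> psi x) ----> (LBINT x. (indicator B x *R f' x) \<bullet> psi x)"
   by simp
 qed
 show "wgrad (%x. indicator B x * z' x) (%x. indicator B x *R g' x)"
 proof (rule wgrad_closed[OF inXD(2)[OF x]])
  show "wconv (%n x. indicator B x * z n x) (%x. indicator B x * z' x)" using ind[OF z(1)] by simp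
  show "wconv (%n x. indicator B x *R g n x) (%x. indicator B x *R g' x)" by (rule ind[OF z(2)])
  show "sq_int (%x. indicator B x * z' x)" using sq_int_mult_bounded'[OF inED(2)[OF E], of "indicator B" 1] by (simp add: indicator_def)
  show "sq_int (%x. indicator B x *R g' x)" using sq_int_mult_bounded[OF inED(3)[OF E], of "indicator B" 1] by (simp add: indicator_def)
 qed
qed

text \<open>On balls, \<open>rellich_local\<close> applies to the difference with the weak limit;
  the tails are controlled because \<open>V\<close> tends to infinity. The weak convergence of
  \<open>sqrt (Vm) z\<close> is recorded too, since it allows limits in zeroth-order terms with
  coefficients of the size of \<open>Vm\<close>.\<close>

theorem energy_compactness:
 assumes E: "!!n. inE (z n) (g n)" and M: "!!n. en (z n) (g n) <= M"
 shows "\<exists>r z' g'. strict_mono (r :: nat => nat) & inE z' g' & l2conv (%n. z (r n)) z' & wconv (%n. g (r n)) g' &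
   wconv (%n x. sqrt (Vm x) * z (r n) x) (%x. sqrt (Vm x) * z' x) & (AE x in lborel. (%n. z (r n) x) ----> z' x)"
proof -
 have gM: "(LBINT x. (norm (g n x))^2) <= M" for n using en_parts(1) M order_trans by blast
 have sV: "(norm (sqrt (Vm x) * y))^2 = Vm x * y^2" for x and y :: real using Vm_pos[of x] by (simp add: power_mult_distrib)
 have zM: "(LBINT x. (norm (sqrt (Vm x) * z n x))^2) <= M" for n
  unfolding sV using en_parts(2) M order_trans by blast
 obtain r1 g' where r1: "strict_mono r1" "sq_int g'" "wconv (%n. g (r1 n)) g'"
  using weak_subsequence[of g, OF inED(3)[OF E] gM] by blast
 obtain r2 y where r2: "strict_mono r2" "sq_int y" "wconv (%n x. sqrt (Vm x) * z (r1 (r2 n)) x) y"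
  using weak_subsequence[of "%n x. sqrt (Vm x) * z (r1 n) x", OF inED(7)[OF E] zM] by blast
 define r3 where "r3 n = r1 (r2 n)" for n
 have r3: "strict_mono r3" using r1(1) r2(1) by (simp add: r3_def strict_mono_def)
 have wg: "wconv (%n. g (r3 n)) g'" unfolding r3_def by (rule wconv_subseq[OF r1(3) r2(1)])
 note [measurable] = sq_int_measurable[OF r2(2)]
 define z' where "z' x = y x / sqrt (Vm x)" for x
 have s1: "sqrt (Vm x) >= 1" for x using Vm_ge1[of x] by simp
 have yz: "y x = sqrt (Vm x) * z' x" for x using s1[of x] by (simp add: z'_def)
 have [measurable]: "z' \<in> BM" unfolding z'_def[abs_def] by measurable
 have inv1: "\<bar>1 / sqrt (Vm x)\<bar> <= 1" for x using s1[of x] by simp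
 have sz': "sq_int z'" using sq_int_mult_bounded'[OF r2(2) _ inv1] by (simp add: z'_def[abs_def])
 have wz: "wconv (%n. z (r3 n)) z'"
  unfolding wconv_def
 proof (intro allI impI)
  fix psi :: "real^'n => real" assume p: "sq_int psi"
  have "sq_int (%x. 1 / sqrt (Vm x) * psi x)" by (rule sq_int_mult_bounded'[OF p _ inv1]) measurable
  from wconvD[OF r2(3) this]
  have "(%n. LBINT x. (sqrt (Vm x) * z (r3 n) x) * (1 / sqrt (Vm x) * psi x)) ----> (LBINT x. y x * (1 / sqrt (Vm x) * psi x))"
   by (simp add: r3_def)
  moreover have "(sqrt (Vm x) * t) * (1 / sqrt (Vm x) * u) = t * u" for x t u using s1[of x] by (simp add: field_simps)
  ultimately show "(%n. LBINT x. z (r3 n) x \<bullet> psi x) ----> (LBINT x. z' x \<bullet> psi x)" by (simp add: yz)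
 qed
 have wgz: "wgrad z' g'" by (rule wgrad_closed[OF inED(1)[OF E] wz sz' wg r1(2)])
 have E': "inE z' g'"
  using sq_int_integrable[OF r2(2)] wgz unfolding inE_def yz sV by simp
 define M' where "M' = 2 * M + 2 * en z' g'"
 have M0: "M >= 0" using en_parts(3) M order_trans by blast
 define d where "d n x = z (r3 n) x - z' x" for n x
 define dg where "dg n x = g (r3 n) x - g' x" for n x
 have Ed: "inE (d n) (dg n)" for n unfolding d_def dg_def by (intro inE_diff E E')
 have dM: "en (d n) (dg n) <= M'" for n
 proof -
  have a: "(norm (x - y))^2 <= 2 * (norm x)^2 + 2 * (norm y)^2" for x y :: "'c::real_inner"
   using parallelogram_law[of x y] by simp
  have "(LBINT x. (norm (dg n x))^2) <= (LBINT x. 2 * (norm (g (r3 n) x))^2 + 2 * (norm (g' x))^2)"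
   by (rule integral_mono) (use sq_int_integrable[OF inED(3)[OF Ed[of n]]] sq_int_integrable[OF inED(3)[OF E[of "r3 n"]]] sq_int_integrable[OF r1(2)] a in \<open>auto simp: dg_def\<close>)
  also have "\<dots> = 2 * (LBINT x. (norm (g (r3 n) x))^2) + 2 * (LBINT x. (norm (g' x))^2)"
   using sq_int_integrable[OF inED(3)[OF E[of "r3 n"]]] sq_int_integrable[OF r1(2)] by simp
  finally have 1: "(LBINT x. (norm (dg n x))^2) <= 2 * (LBINT x. (norm (g (r3 n) x))^2) + 2 * (LBINT x. (norm (g' x))^2)" .
  have "(LBINT x. Vm x * (d n x)^2) <= (LBINT x. 2 * (Vm x * (z (r3 n) x)^2) + 2 * (Vm x * (z' x)^2))"
  proof (rule integral_mono)
   show "Vm x * (d n x)^2 <= 2 * (Vm x * (z (r3 n) x)^2) + 2 * (Vm x * (z' x)^2)" for x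
    using mult_left_mono[OF a[of "z (r3 n) x" "z' x"], of "Vm x"] Vm_pos[of x] by (simp add: d_def algebra_simps)
  qed (use inED(6)[OF Ed[of n]] inED(6)[OF E[of "r3 n"]] inED(6)[OF E'] in auto)
  also have "\<dots> = 2 * (LBINT x. Vm x * (z (r3 n) x)^2) + 2 * (LBINT x. Vm x * (z' x)^2)"
   using inED(6)[OF E[of "r3 n"]] inED(6)[OF E'] by simp
  finally have "en (d n) (dg n) <= 2 * en (z (r3 n)) (g (r3 n)) + 2 * en z' g'" using 1 by (simp add: en_def)
  then show ?thesis using M[of "r3 n"] by (simp add: M'_def)
 qed
 have M'0: "M' >= 0" using M0 en_parts(3)[of z' g'] by (simp add: M'_def)
 have wd: "wconv d (%x. 0)"
  unfolding wconv_def
 proof (intro allI impI)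
  fix psi :: "real^'n => real" assume p: "sq_int psi"
  have "(%n. (LBINT x. z (r3 n) x * psi x) - (LBINT x. z' x * psi x)) ----> 0"
   using wconvD[OF wz p] by (simp add: LIM_zero)
  moreover have "(LBINT x. d n x * psi x) = (LBINT x. z (r3 n) x * psi x) - (LBINT x. z' x * psi x)" for n
   unfolding d_def left_diff_distrib
   by (intro Bochner_Integration.integral_diff integrable_sq_mult inED(2)[OF E] sz' p)
  ultimately show "(%n. LBINT x. d n x \<bullet> psi x) ----> (LBINT x. 0 \<bullet> psi x)" by simp
 qed
 have d2: "integrable lborel (%x. (d n x)^2)" for n using sq_int_integrable[OF inED(2)[OF Ed[of n]]] by simp
 have [measurable]: "d n \<in> BM" for n by (rule inED(4)[OF Ed])
 have "(%n. LBINT x. (d n x)^2) ----> 0"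
 proof (rule LIMSEQ_I)
  fix e :: real assume e: "e > 0"
  \<comment> \<open>Outside a large ball \<open>V >= K\<close>, and there the squared norm of
    \<open>d n\<close> is at most \<open>M' / K\<close>, which this choice makes at most
    \<open>e / 2\<close>.\<close>
  define K where "K = 2 * M' / e + 1"
  have K: "K > 0" using e M'0 by (simp add: K_def add_nonneg_pos)
  obtain R where R: "!!x. norm x >= R ==> V x >= K" using V_large[of K] by blast
  have RV: "norm x >= R ==> Vm x >= K" for x using R[of x] m0_nonneg by (simp add: Vm_def)
  have "(%n. LBINT x. (d n x)^2 * indicator (cball 0 R) x) ----> 0"
   by (rule rellich_local[OF inED(1)[OF Ed] order_trans[OF L2_le_en[OF Ed] dM] order_trans[OF en_parts(1) dM] wd])
  from LIMSEQ_D[OF this, of "e/2"] e obtain n0 where n0: "!!n. n >= n0 ==> \<bar>LBINT x. (d n x)^2 * indicator (cball 0 R) x\<bar> < e / 2"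
   by auto
  have "(LBINT x. (d n x)^2) < e" if "n >= n0" for n
  proof -
   have [measurable]: "cball 0 R \<in> sets (borel :: (real^'n) measure)" by (simp add: borel_closed)
   have i1: "integrable lborel (%x. (d n x)^2 * indicator (cball 0 R) x)"
    by (rule Bochner_Integration.integrable_bound[OF d2[of n]]) (auto simp: indicator_def)
   have "(LBINT x. (d n x)^2) <= (LBINT x. (d n x)^2 * indicator (cball 0 R) x + (1 / K) * (Vm x * (d n x)^2))"
   proof (rule integral_mono[OF d2])
    show "integrable lborel (%x. (d n x)^2 * indicator (cball 0 R) x + (1 / K) * (Vm x * (d n x)^2))"
     by (intro Bochner_Integration.integrable_add integrable_mult_right i1 inED(6)[OF Ed])
    fix x
    show "(d n x)^2 <= (d n x)^2 * indicator (cball 0 R) x + (1 / K) * (Vm x * (d n x)^2)"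
    proof (cases "norm x <= R")
     case True
     then show ?thesis using K Vm_pos[of x] by simp
    next
     case False
     then have "K * (d n x)^2 <= Vm x * (d n x)^2" using RV[of x] by (intro mult_right_mono) auto
     then show ?thesis using False K by (simp add: pos_le_divide_eq mult.commute)
    qed
   qed
   also have "\<dots> = (LBINT x. (d n x)^2 * indicator (cball 0 R) x) + (1 / K) * (LBINT x. Vm x * (d n x)^2)"
    using i1 inED(6)[OF Ed[of n]] by simp
   also have "\<dots> < e / 2 + (1 / K) * M'"
    using n0[OF that] mult_left_mono[OF order_trans[OF en_parts(2) dM[of n]], of "1/K"] K by simp
   also have "(1 / K) * M' <= e / 2"
   proof -
    have "M' <= (e / 2) * K" using e by (simp add: K_def field_simps)
    then show ?thesis using K by (simp add: pos_divide_le_eq)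
   qed
   finally show ?thesis by simp
  qed
  moreover have "(LBINT x. (d n x)^2) >= 0" for n by (intro integral_nonneg_AE) auto
  ultimately show "\<exists>no. \<forall>n\<ge>no. norm ((LBINT x. (d n x)^2) - 0) < e" by auto
 qed
 then have l2: "l2conv (%n. z (r3 n)) z'" by (simp add: l2conv_def d_def)
 obtain r4 where r4: "strict_mono r4" "AE x in lborel. (%n. z (r3 (r4 n)) x) ----> z' x"
  using l2conv_AE_subseq[OF l2 inED(2)[OF E] sz'] by blast
 define r where "r n = r3 (r4 n)" for n
 have "wconv (%n x. sqrt (Vm x) * z (r3 n) x) (%x. sqrt (Vm x) * z' x)" using r2(3) unfolding yz[symmetric] r3_def .
 from wconv_subseq[OF this r4(1)] l2conv_subseq[OF l2 r4(1)] wconv_subseq[OF wg r4(1)] r4 r3 E'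
 show ?thesis by (intro exI[of _ r] exI[of _ z'] exI[of _ g']) (auto simp: r_def strict_mono_def)
qed

end

section \<open>Solvability of the linearised problems\<close>

text \<open>The interface between the Lebesgue measure of the definitions and the Borel functions of
  the proof.\<close>

lemma completion_facts:
 fixes f :: "'a::euclidean_space => 'b::euclidean_space"
 assumes [measurable]: "f \<in> BM"
 shows "f \<in> borel_measurable lebesgue" "integrable lebesgue f \<longleftrightarrow> integrable lborel f"
  "(\<integral>x. f x \<partial>lebesgue) = (LBINT x. f x)"
proof -
 have f: "f \<in> borel_measurable lborel" by simp
 show "f \<in> borel_measurable lebesgue" by (rule measurable_completion[OF f])
 show "integrable lebesgue f \<longleftrightarrow> integrable lborel f" by (rule integrable_completion[OF f])
 show "(\<integral>x. f x \<partial>lebesgue) = (LBINT x. f x)" by (rule integral_completion[OF f])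
qed

lemma sq_int_L2: "sq_int f ==> f \<in> L2"
proof -
 assume f: "sq_int f"
 note [measurable] = sq_int_measurable[OF f]
 have m: "(%x. (norm (f x))^2) \<in> BM" by measurable
 show "f \<in> L2"
  unfolding L2_def mem_Collect_eq completion_facts(2)[OF m]
  using completion_facts(1)[OF sq_int_measurable[OF f]] sq_int_integrable[OF f] by (rule conjI)
qed

lemma sq_int_L1_loc:
 assumes f: "sq_int f" shows "f \<in> L1_loc"
 unfolding L1_loc_def
proof (intro CollectI allI impI)
 fix K :: "'a set" assume K: "compact K"
 note [measurable] = sq_int_measurable[OF f]
 have [measurable]: "K \<in> sets borel" using K by (simp add: borel_closed compact_imp_closed)
 have fin: "emeasure lborel K < \<infinity>" by (rule emeasure_bounded_finite[OF compact_imp_bounded[OF K]])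
 have "integrable lborel (%x. indicator K x *R f x)"
 proof (rule Bochner_Integration.integrable_bound)
  show "integrable lborel (%x. indicator K x + (norm (f x))^2 :: real)"
   by (intro Bochner_Integration.integrable_add integrable_real_indicator sq_int_integrable f) (use fin in auto)
  have "norm (indicator K x *R f x) <= norm (indicator K x + (norm (f x))^2 :: real)" for x
  proof -
   have "norm (f x) <= 1 + (norm (f x))^2"
    using sum_squares_bound[of 1 "norm (f x)"] norm_ge_zero[of "f x"] unfolding power_one by linarith
   then show ?thesis by (auto simp: indicator_def abs_of_nonneg)
  qed
  then show "AE x in lborel. norm (indicator K x *R f x) <= norm (indicator K x + (norm (f x))^2 :: real)" by simp
 qed measurable
 then show "set_integrable lebesgue K f"
  unfolding set_integrable_def by (subst completion_facts(2)) auto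
qed

lemma wgrad_has_weak_gradient:
 assumes w: "wgrad z g" shows "has_weak_gradient z g"
 unfolding has_weak_gradient_def
proof (intro conjI ballI allI sq_int_L1_loc wgradD[OF w])
 fix phi :: "real^'a => real" and i assume p: "phi \<in> Cc"
 note [measurable] = wgradD(3,4)[OF w] test_measurable[OF p] test_measurable[OF Cc_infinity_partial[OF p]]
 show "(\<integral>x. z x * pd i phi x \<partial>lebesgue) = - (\<integral>x. g x $ i * phi x \<partial>lebesgue)"
 proof -
  have m: "(%x. z x * pd i phi x) \<in> BM" "(%x. g x $ i * phi x) \<in> BM"
   by measurable
  show ?thesis unfolding completion_facts(3)[OF m(1)] completion_facts(3)[OF m(2)] by (rule wgradD(5)[OF w p])
 qed
qed

context coercive_potential
begin

lemma inE_space_E: "inE z g ==> z \<in> space_E V"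
proof -
 assume E: "inE z g"
 note [measurable] = inED(4)[OF E]
 have "integrable lborel (%x. Vm x * (z x)^2 - m0 * (norm (z x))^2)"
  by (intro Bochner_Integration.integrable_diff integrable_mult_right inED(6)[OF E] sq_int_integrable inED(2)[OF E])
 then have "integrable lborel (%x. V x * (z x)^2)" by (simp add: Vm_def algebra_simps)
 then have "integrable lebesgue (%x. V x * (z x)^2)" by (subst completion_facts(2)) auto
 then show ?thesis unfolding space_E_def H1_def
  using sq_int_L2[OF inED(2)[OF E]] sq_int_L2[OF inED(3)[OF E]] wgrad_has_weak_gradient[OF inED(1)[OF E]] by blast
qed

lemma no_eigenfunction:
 assumes ne: "~ schroedinger_eigenvalue V 0" and E: "inE z g"
  and 0: "!!phi. phi \<in> Cc ==> aform V z g phi (grad phi) = 0"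
 shows "AE x in lborel. z x = 0"
proof (rule ccontr)
 assume nz: "~ (AE x in lborel. z x = 0)"
 note [measurable] = inED(4,5)[OF E]
 have "~ (AE x in lebesgue. z x = 0)"
  using nz by (subst AE_completion_iff) auto
 moreover have "integrable lebesgue (%x. g x \<bullet> grad phi x + V x * z x * phi x) &
   (\<integral>x. g x \<bullet> grad phi x + V x * z x * phi x \<partial>lebesgue) = (\<integral>x. 0 * z x * phi x \<partial>lebesgue)" if p: "phi \<in> Cc" for phi
 proof -
  note [measurable] = test_measurable[OF p] grad_measurable[OF Cc_infinityD(1)[OF p]]
  note i = integrable_form(1,2)[OF E inE_test[OF p] V_measurable(1) V_abs_le]
  have [measurable]: "(%x. g x \<bullet> grad phi x + V x * z x * phi x) \<in> BM" by measurable
  have "integrable lborel (%x. g x \<bullet> grad phi x + V x * z x * phi x)" using i by (intro Bochner_Integration.integrable_add)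
  moreover have "(LBINT x. g x \<bullet> grad phi x + V x * z x * phi x) = 0"
   using 0[OF p] i by (simp add: aform_def)
  moreover have m: "(%x. g x \<bullet> grad phi x + V x * z x * phi x) \<in> BM" by measurable
  ultimately show ?thesis unfolding completion_facts(2)[OF m] completion_facts(3)[OF m] by simp
 qed
 ultimately have "schroedinger_eigenvalue V 0"
  unfolding schroedinger_eigenvalue_def
  using inE_space_E[OF E] wgrad_has_weak_gradient[OF inED(1)[OF E]] by blast
 with ne show False by simp
qed

lemma en_scale: "en (%x. c * z x) (%x. c *R g x) = c^2 * en z g"
proof -
 have e: "(norm (c *R g x))^2 = c^2 * (norm (g x))^2" "Vm x * (c * z x)^2 = c^2 * (Vm x * (z x)^2)" for x
  by (auto simp: power_mult_distrib)
 show ?thesis unfolding en_def e by (simp add: distrib_left)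
qed

lemma aform_scale: "aform Q z g (%x. c * xi x) (%x. c *R eta x) = c * aform Q z g xi eta"
  "aform Q (%x. c * z x) (%x. c *R g x) xi eta = c * aform Q z g xi eta"
proof -
 have e: "Q x * z x * (c * xi x) = c * (Q x * z x * xi x)" "Q x * (c * z x) * xi x = c * (Q x * z x * xi x)" for x by (auto simp: mult_ac)
 show "aform Q z g (%x. c * xi x) (%x. c *R eta x) = c * aform Q z g xi eta"
  "aform Q (%x. c * z x) (%x. c *R g x) xi eta = c * aform Q z g xi eta"
  unfolding aform_def e by (simp_all add: distrib_left)
qed

lemma aform_add:
 assumes E: "inE z g" "inE z' g'" "inE xi eta" and Q: "Q \<in> BM" "!!x. \<bar>Q x\<bar> <= C * Vm x"
 shows "aform Q (%x. z x + z' x) (%x. g x + g' x) xi eta = aform Q z g xi eta + aform Q z' g' xi eta"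
  "aform Q xi eta (%x. z x + z' x) (%x. g x + g' x) = aform Q xi eta z g + aform Q xi eta z' g'"
proof -
 note i = integrable_form(1,2)[OF E(1,3) Q] integrable_form(1,2)[OF E(2,3) Q]
  integrable_form(1,2)[OF E(3,1) Q] integrable_form(1,2)[OF E(3,2) Q]
 have e: "Q x * (z x + z' x) * xi x = Q x * z x * xi x + Q x * z' x * xi x"
   "Q x * xi x * (z x + z' x) = Q x * xi x * z x + Q x * xi x * z' x" for x by (auto simp: algebra_simps)
 show "aform Q (%x. z x + z' x) (%x. g x + g' x) xi eta = aform Q z g xi eta + aform Q z' g' xi eta"
  "aform Q xi eta (%x. z x + z' x) (%x. g x + g' x) = aform Q xi eta z g + aform Q xi eta z' g'"
  unfolding aform_def inner_add_left inner_add_right e using i by simp_all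
qed

lemma aform_cong_Q:
 assumes "!!x. z x \<noteq> 0 ==> xi x \<noteq> 0 ==> Q x = Q' x"
 shows "aform Q z g xi eta = aform Q' z g xi eta"
proof -
 have "(%x. Q x * z x * xi x) = (%x. Q' x * z x * xi x)" using assms by fastforce
 then show ?thesis unfolding aform_def by simp
qed

section \<open>Linear problems with prescribed boundary values\<close>

text \<open>An isometric image of the energy space in a product of two L^2 spaces, where the
  abstract Hilbert space results apply.\<close>

definition emb :: "(real^'n => real) => (real^'n => real^'n) => (real^'n, real) l2 \<times> (real^'n, real^'n) l2" where
 "emb z g = (cls (%x. sqrt (Vm x) * z x), cls g)"

lemma emb_inner:
 assumes "inE z g" "inE z' g'"
 shows "emb z g \<bullet> emb z' g' = (LBINT x. Vm x * z x * z' x) + (LBINT x. g x \<bullet> g' x)"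
proof -
 have "(sqrt (Vm x) * z x) * (sqrt (Vm x) * z' x) = (sqrt (Vm x) * sqrt (Vm x)) * z x * z' x" for x by (simp add: mult_ac)
 then have e: "(sqrt (Vm x) * z x) * (sqrt (Vm x) * z' x) = Vm x * z x * z' x" for x using Vm_pos[of x] by simp
 show ?thesis unfolding e[symmetric]
  by (simp add: emb_def inner_prod_def inner_cls inED[OF assms(1)] inED[OF assms(2)] del: real_sqrt_mult_self)
qed

lemma emb_norm: "inE z g ==> norm (emb z g) = sqrt (en z g)"
 by (simp add: norm_eq_sqrt_inner emb_inner en_def power2_norm_eq_inner power2_eq_square mult.assoc add.commute)

text \<open>\<open>z0\<close> carries the boundary value, and the correction \<open>z\<close> is
  sought among functions vanishing on the boundary of \<open>B\<close>. The a priori bound follows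
  from the inf-sup inequality with the form of \<open>z0\<close> as right-hand side.\<close>

theorem inf_sup_solve:
 assumes [measurable]: "B \<in> sets borel" "Q \<in> BM" and Q: "!!x. \<bar>Q x\<bar> <= C * Vm x" and c: "c > 0"
  and infsup: "!!z g. inX B z g ==> \<exists>xi eta. inX B xi eta & en xi eta <= 1 & aform Q z g xi eta >= c * sqrt (en z g)"
  and E0: "inE z0 g0"
 shows "\<exists>z g. inX B z g & (\<forall>xi eta. inX B xi eta --> aform Q (%x. z x + z0 x) (%x. g x + g0 x) xi eta = 0) &
   c * sqrt (en z g) <= (1 + C) * sqrt (en z0 g0)"
proof -
 let ?S = "{emb z g | z g. inX B z g}"
 have C0: "C >= 0" using Q[of 0] Vm_pos[of 0] by (metis abs_ge_zero order_trans zero_le_mult_iff not_le)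
 \<comment> \<open>\<open>Q\<close> itself may be unbounded; relative to \<open>Vm\<close> it is a
   bounded multiplier acting on the first component of \<open>emb\<close>.\<close>
 define q where "q x = Q x / Vm x" for x
 have [measurable]: "q \<in> BM" unfolding q_def[abs_def] by measurable
 have qC: "\<bar>q x\<bar> <= C" for x using Q[of x] Vm_pos[of x] by (simp add: q_def abs_divide divide_le_eq)
 have sq: "sq_int (%x. q x * f x)" if "sq_int f" for f :: "real^'n => real" by (rule sq_int_mult_bounded'[OF that _ qC]) measurable
 define mul where "mul Y = cls (%x. q x * rep_l2 Y x)" for Y :: "(real^'n, real) l2"
 have mul_inner: "mul Y \<bullet> Z = (LBINT x. q x * rep_l2 Y x * rep_l2 Z x)" for Y Z
  using inner_cls[OF sq[OF sq_int_rep[of Y]] sq_int_rep[of Z]] by (simp add: mul_def)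
 have mul_cls: "mul (cls f) = cls (%x. q x * f x)" if f: "sq_int f" for f
  unfolding mul_def using rep_cls[OF f] by (subst cls_eq_iff[OF sq[OF sq_int_rep] sq[OF f]]) auto
 have bl: "bounded_linear mul"
 proof (rule bounded_linear_intro)
  show "mul (Y + Z) = mul Y + mul Z" for Y Z
  proof -
   have "mul (cls (rep_l2 Y) + cls (rep_l2 Z)) = mul (cls (rep_l2 Y)) + mul (cls (rep_l2 Z))"
    unfolding cls_add[OF sq_int_rep sq_int_rep]
    by (simp add: mul_cls sq_int_add cls_add sq distrib_left del: cls_rep)
   then show ?thesis by simp
  qed
  show "mul (r *R Y) = r *R mul Y" for r Y
  proof -
   have "mul (r *R cls (rep_l2 Y)) = r *R mul (cls (rep_l2 Y))"
    unfolding cls_scaleR[OF sq_int_rep]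
    by (simp add: mul_cls sq_int_cmult cls_scaleR sq mult_ac del: cls_rep)
   then show ?thesis by simp
  qed
  show "norm (mul Y) <= norm Y * C" for Y
  proof -
   have "(norm (mul Y))^2 = (LBINT x. (q x * rep_l2 Y x)^2)"
    unfolding mul_def by (subst norm_cls[OF sq[OF sq_int_rep]]) simp
   also have "\<dots> <= (LBINT x. C^2 * (rep_l2 Y x)^2)"
   proof (rule integral_mono)
    show "integrable lborel (%x. (q x * rep_l2 Y x)^2)" using sq_int_integrable[OF sq[OF sq_int_rep[of Y]]] by simp
    show "integrable lborel (%x. C^2 * (rep_l2 Y x)^2)" using sq_int_integrable[OF sq_int_rep[of Y]] by simp
    show "(q x * rep_l2 Y x)^2 <= C^2 * (rep_l2 Y x)^2" for x
     using mult_right_mono[OF power_mono[OF qC[of x], of 2], of "(rep_l2 Y x)^2"] by (simp add: power_mult_distrib)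
   qed
   also have "\<dots> = C^2 * (norm Y)^2" using norm_cls[OF sq_int_rep[of Y]] by simp
   also have "\<dots> = (norm Y * C)^2" by (simp add: power_mult_distrib mult.commute)
   finally show ?thesis by (rule power2_le_imp_le) (use C0 in auto)
  qed
 qed
 define A where "A x y = snd x \<bullet> snd y + mul (fst x) \<bullet> fst y" for x y :: "(real^'n, real) l2 \<times> (real^'n, real^'n) l2"
 have bA: "bounded_bilinear A"
 proof -
  have 1: "bounded_bilinear (%x y :: (real^'n, real) l2 \<times> (real^'n, real^'n) l2. snd x \<bullet> snd y)"
   by (rule bounded_bilinear.comp[OF bounded_bilinear_inner bounded_linear_snd bounded_linear_snd])
  have 2: "bounded_bilinear (%x y :: (real^'n, real) l2 \<times> (real^'n, real^'n) l2. mul (fst x) \<bullet> fst y)"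
   by (rule bounded_bilinear.comp[OF bounded_bilinear_inner bounded_linear_compose[OF bl bounded_linear_fst] bounded_linear_fst])
  interpret b1: bounded_bilinear "%x y :: (real^'n, real) l2 \<times> (real^'n, real^'n) l2. snd x \<bullet> snd y" by (rule 1)
  interpret b2: bounded_bilinear "%x y :: (real^'n, real) l2 \<times> (real^'n, real^'n) l2. mul (fst x) \<bullet> fst y" by (rule 2)
  obtain K1 where K1: "!!x y. norm (snd (x :: (real^'n, real) l2 \<times> (real^'n, real^'n) l2) \<bullet> snd (y :: (real^'n, real) l2 \<times> (real^'n, real^'n) l2)) <= norm x * norm y * K1"
   using b1.bounded by blast
  obtain K2 where K2: "!!x y. norm (mul (fst (x :: (real^'n, real) l2 \<times> (real^'n, real^'n) l2)) \<bullet> fst (y :: (real^'n, real) l2 \<times> (real^'n, real^'n) l2)) <= norm x * norm y * K2"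
   using b2.bounded by blast
  show ?thesis
  proof
   show "A (a + a') b = A a b + A a' b" for a a' b unfolding A_def b1.add_left b2.add_left by simp
   show "A a (b + b') = A a b + A a b'" for a b b' unfolding A_def b1.add_right b2.add_right by simp
   show "A (r *R a) b = r *R A a b" for r a b unfolding A_def b1.scaleR_left b2.scaleR_left by (simp add: distrib_left)
   show "A a (r *R b) = r *R A a b" for r a b unfolding A_def b1.scaleR_right b2.scaleR_right by (simp add: distrib_left)
   show "\<exists>K. \<forall>a b. norm (A a b) <= norm a * norm b * K"
   proof (intro exI allI)
    fix a b show "norm (A a b) <= norm a * norm b * (K1 + K2)"
     unfolding A_def using norm_triangle_le[OF add_mono[OF K1[of a b] K2[of a b]]] by (simp add: distrib_left)
   qed
  qed
 qed
 have symA: "A x y = A y x" for x y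
 proof -
  have "mul (fst x) \<bullet> fst y = mul (fst y) \<bullet> fst x" unfolding mul_inner by (simp add: mult_ac)
  then show ?thesis unfolding A_def by (simp add: inner_commute[of "snd x"])
 qed
 have Aform: "A (emb z g) (emb xi eta) = aform Q z g xi eta" if E: "inE z g" "inE xi eta" for z g xi eta
 proof -
  note s = inED(7)[OF E(1)] inED(7)[OF E(2)]
  have "mul (cls (%x. sqrt (Vm x) * z x)) \<bullet> cls (%x. sqrt (Vm x) * xi x) = (LBINT x. (q x * (sqrt (Vm x) * z x)) * (sqrt (Vm x) * xi x))"
   unfolding mul_cls[OF s(1)] by (subst inner_cls[OF sq[OF s(1)] s(2)]) simp
  also have "(%x. (q x * (sqrt (Vm x) * z x)) * (sqrt (Vm x) * xi x)) = (%x. Q x * z x * xi x)"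
  proof
   fix x
   have "(q x * (sqrt (Vm x) * z x)) * (sqrt (Vm x) * xi x) = q x * (sqrt (Vm x) * sqrt (Vm x)) * z x * xi x" by (simp only: mult_ac)
   then show "(q x * (sqrt (Vm x) * z x)) * (sqrt (Vm x) * xi x) = Q x * z x * xi x" using Vm_pos[of x] by (simp add: q_def)
  qed
  finally show ?thesis by (simp add: A_def emb_def aform_def inner_cls inED[OF E(1)] inED[OF E(2)])
 qed
 have emb_add: "emb z g + emb z' g' = emb (%x. z x + z' x) (%x. g x + g' x)" if "inE z g" "inE z' g'" for z g z' g'
  using inED[OF that(1)] inED[OF that(2)] by (simp add: emb_def cls_add distrib_left)
 have emb_scale: "r *R emb z g = emb (%x. r * z x) (%x. r *R g x)" if "inE z g" for z g r
  using inED[OF that] by (simp add: emb_def cls_scaleR mult_ac)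
 have sS: "subspace ?S"
 proof (unfold subspace_def, intro conjI ballI allI)
  have "emb (%x. 0) (%x. 0) = 0" by (simp add: emb_def cls_0 zero_prod_def)
  then show "0 \<in> ?S" using inX_0[of B] by (metis (mono_tags, lifting) mem_Collect_eq)
  show "x + y \<in> ?S" if "x \<in> ?S" "y \<in> ?S" for x y
   using that emb_add inX_add inXD(1) by (smt (verit, best) mem_Collect_eq)
  show "r *R x \<in> ?S" if "x \<in> ?S" for r x
   using that emb_scale inX_scale inXD(1) by (smt (verit, best) mem_Collect_eq)
 qed
 \<comment> \<open>Strong limits in the product are weak limits as well, so the function and
   gradient found by \<open>energy_compactness\<close> must be the components of
   \<open>l\<close>.\<close>
 have cS: "closed ?S"
 proof (subst closed_sequential_limits, intro allI impI)
  fix x l assume "(\<forall>n. x n \<in> ?S) & x ----> l"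
  then have xS: "\<forall>n. \<exists>z g. x n = emb z g & inX B z g" and xl: "x ----> l" by auto
  then obtain z g where zg: "!!n. x n = emb (z n) (g n)" "!!n. inX B (z n) (g n)" by metis
  note E = inXD(1)[OF zg(2)]
  have "en (z n) (g n) = (norm (x n))^2" for n using emb_norm[OF E[of n]] zg(1)[of n] en_parts(3) by simp
  moreover obtain K where K: "!!n. norm (x n) <= K" using convergent_imp_Bseq[OF convergentI[OF xl]] by (auto simp: Bseq_def)
  ultimately have enK: "en (z n) (g n) <= K^2" for n using power_mono[OF K[of n], of 2] by simp
  from energy_compactness[of z g, OF E enK] obtain r z' g' where r: "strict_mono (r :: nat => nat)" "inE z' g'" "l2conv (%n. z (r n)) z'" "wconv (%n. g (r n)) g'"
   "wconv (%n x. sqrt (Vm x) * z (r n) x) (%x. sqrt (Vm x) * z' x)" by blast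
  have X: "inX B z' g'"
   by (rule inX_closed[OF zg(2) l2conv_imp_wconv[OF r(3) inED(2)[OF E] inED(2)[OF r(2)]] r(4,2)]) measurable
  have "(%n. x (r n)) ----> l" using LIMSEQ_subseq_LIMSEQ[OF xl r(1)] by (simp add: o_def)
  then have f: "(%n. fst (x (r n))) ----> fst l" and s: "(%n. snd (x (r n))) ----> snd l" by (auto intro: tendsto_fst tendsto_snd)
  have "fst l \<bullet> y = fst (emb z' g') \<bullet> y" for y
  proof (rule LIMSEQ_unique)
   show "(%n. fst (x (r n)) \<bullet> y) ----> fst l \<bullet> y" by (intro tendsto_intros f)
   show "(%n. fst (x (r n)) \<bullet> y) ----> fst (emb z' g') \<bullet> y"
    using r(5) unfolding wconv_cls[OF inED(7)[OF E] inED(7)[OF r(2)]] by (simp add: zg(1) emb_def)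
  qed
  then have 1: "fst l = fst (emb z' g')" using vector_eq_rdot by metis
  have "snd l \<bullet> y = snd (emb z' g') \<bullet> y" for y
  proof (rule LIMSEQ_unique)
   show "(%n. snd (x (r n)) \<bullet> y) ----> snd l \<bullet> y" by (intro tendsto_intros s)
   show "(%n. snd (x (r n)) \<bullet> y) ----> snd (emb z' g') \<bullet> y"
    using r(4) unfolding wconv_cls[OF inED(3)[OF E] inED(3)[OF r(2)]] by (simp add: zg(1) emb_def)
  qed
  then have "snd l = snd (emb z' g')" using vector_eq_rdot by metis
  with 1 X show "l \<in> ?S" by (auto simp: prod_eq_iff)
 qed
 have "\<exists>z\<in>?S. \<forall>xi\<in>?S. A z xi = - A (emb z0 g0) xi"
 proof (rule symmetric_inf_sup_solvable[OF sS cS bA symA c])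
  show "bounded_linear (%xi. - A (emb z0 g0) xi)"
   by (rule bounded_linear_minus[OF bounded_bilinear.bounded_linear_right[OF bA]])
  fix x assume "x \<in> ?S"
  then obtain z g where zg: "x = emb z g" "inX B z g" by blast
  from infsup[OF zg(2)] obtain xi eta where t: "inX B xi eta" "en xi eta <= 1" "aform Q z g xi eta >= c * sqrt (en z g)" by blast
  show "\<exists>xi\<in>?S. norm xi <= 1 & A x xi >= c * norm x"
   using t zg inXD(1)[OF t(1)] inXD(1)[OF zg(2)] by (intro bexI[of _ "emb xi eta"]) (auto simp: emb_norm Aform)
 qed
 then obtain z g where zg: "inX B z g" "!!xi eta. inX B xi eta ==> A (emb z g) (emb xi eta) = - A (emb z0 g0) (emb xi eta)" by blast
 have eq: "aform Q z g xi eta = - aform Q z0 g0 xi eta" if "inX B xi eta" for xi eta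
  using zg(2)[OF that] Aform inXD(1)[OF zg(1)] inXD(1)[OF that] E0 by simp
 have "aform Q (%x. z x + z0 x) (%x. g x + g0 x) xi eta = 0" if "inX B xi eta" for xi eta
  using eq[OF that] aform_add(1)[OF inXD(1)[OF zg(1)] E0 inXD(1)[OF that] assms(2) Q] by simp
 moreover have "c * sqrt (en z g) <= (1 + C) * sqrt (en z0 g0)"
 proof -
  from infsup[OF zg(1)] obtain xi eta where t: "inX B xi eta" "en xi eta <= 1" "aform Q z g xi eta >= c * sqrt (en z g)" by blast
  have "c * sqrt (en z g) <= \<bar>aform Q z0 g0 xi eta\<bar>" using t(3) eq[OF t(1)] by simp
  also have "\<dots> <= (1 + C) * (sqrt (en z0 g0) * sqrt (en xi eta))" by (rule aform_bound[OF E0 inXD(1)[OF t(1)] assms(2) Q])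
  also have "\<dots> <= (1 + C) * (sqrt (en z0 g0) * 1)"
   using t(2) C0 en_parts(3)[of z0 g0] by (intro mult_left_mono) auto
  finally show ?thesis by simp
 qed
 ultimately show ?thesis using zg(1) by blast
qed

section \<open>Coefficients close to \<open>V\<close> away from a distant ball\<close>

text \<open>The constant \<open>C\<close> is only asserted to exist and enters no later constant:
  near contact the actual coefficients may grow as \<open>rho\<close> tends to 1. For this reason
  inside \<open>cball c 2\<close> a lower bound replaces closeness.\<close>

definition admissible :: "real => real^'n => (real^'n => real) => bool" where
 "admissible epsilon c Q \<longleftrightarrow> Q \<in> BM & (\<exists>C. \<forall>x. \<bar>Q x\<bar> <= C * Vm x) &
   (\<forall>x. x \<notin> cball c 2 --> \<bar>Q x - V x\<bar> <= epsilon * Vm x) & (\<forall>x\<in>cball c 2. Q x >= V x / 2)"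

lemma admissible_lower:
 assumes "admissible epsilon c Q" "epsilon <= 1/2" shows "Q x >= Vm x / 2 - m0"
proof (cases "x \<in> cball c 2")
 case True
 then have "Q x >= V x / 2" using assms by (auto simp: admissible_def)
 then show ?thesis using m0_nonneg by (simp add: Vm_def)
next
 case False
 then have "\<bar>Q x - V x\<bar> <= epsilon * Vm x" using assms by (auto simp: admissible_def)
 moreover have "epsilon * Vm x <= 1/2 * Vm x" using assms(2) Vm_pos[of x] by (intro mult_right_mono) auto
 ultimately show ?thesis by (simp add: Vm_def abs_le_iff)
qed

lemma aform_self_lower:
 assumes E: "inE z g" and Q: "Q \<in> BM" "!!x. \<bar>Q x\<bar> <= C * Vm x" and lo: "!!x. Q x >= Vm x / 2 - m0"
 shows "aform Q z g z g >= en z g / 2 - m0 * (LBINT x. (z x)^2)"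
proof -
 note i = integrable_form(1,2)[OF E E Q]
 have z2: "integrable lborel (%x. (z x)^2)" using sq_int_integrable[OF inED(2)[OF E]] by simp
 have "(LBINT x. (1/2) * (Vm x * (z x)^2) - m0 * (z x)^2) <= (LBINT x. Q x * z x * z x)"
 proof (rule integral_mono)
  show "integrable lborel (%x. (1/2) * (Vm x * (z x)^2) - m0 * (z x)^2)" using inED(6)[OF E] z2 by simp
  show "(1/2) * (Vm x * (z x)^2) - m0 * (z x)^2 <= Q x * z x * z x" for x
   using mult_right_mono[OF lo[of x], of "(z x)^2"] by (simp add: power2_eq_square algebra_simps)
 qed (rule i)
 also have "(LBINT x. (1/2) * (Vm x * (z x)^2) - m0 * (z x)^2) = (1/2) * (LBINT x. Vm x * (z x)^2) - m0 * (LBINT x. (z x)^2)"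
  using inED(6)[OF E] z2 by simp
 finally have 1: "(1/2) * (LBINT x. Vm x * (z x)^2) - m0 * (LBINT x. (z x)^2) <= (LBINT x. Q x * z x * z x)" .
 have "(a + b) / 2 - m <= a + q" if "(1/2) * b - m <= q" "0 <= a" for a b m q :: real
  using that by (simp add: field_simps)
 from this[OF 1 en_parts(4)[of g]] show ?thesis unfolding aform_def en_def dot_square_norm .
qed

text \<open>By contradiction and compactness. Normalised functions on which the form tends to zero,
  with centres going to infinity, have a weak limit that solves the eigenvalue equation for
  \<open>0\<close> and hence vanishes. Convergence in L^2 is strong, and this contradicts the
  normalisation through \<open>aform_self_lower\<close>.\<close>

theorem uniform_inf_sup:
 assumes ne: "~ schroedinger_eigenvalue V 0"
 shows "\<exists>epsilon>0. \<exists>R. \<exists>kappa>0. epsilon <= 1/2 & (\<forall>c Q z g. norm c >= R --> admissible epsilon c Q --> inX (ball c 1) z g -->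
   (\<exists>xi eta. inX (ball c 1) xi eta & en xi eta <= 1 & aform Q z g xi eta >= kappa * sqrt (en z g)))"
proof (rule ccontr)
 assume con: "~ ?thesis"
 define e where "e n = inverse (real (Suc (Suc n)))" for n :: nat
 have e: "e n > 0" "e n <= 1/2" for n by (auto simp: e_def field_simps)
 have e0: "e ----> 0" unfolding e_def by (rule LIMSEQ_Suc[OF LIMSEQ_inverse_real_of_nat])
 have "\<exists>c Q z g. norm c >= real n & admissible (e n) c Q & inX (ball c 1) z g &
   (\<forall>xi eta. inX (ball c 1) xi eta --> en xi eta <= 1 --> aform Q z g xi eta < e n * sqrt (en z g))" for n
  using con e[of n] by (metis (no_types, opaque_lifting) not_le)
 then obtain c Q z1 g1 where cQ: "!!n. norm (c n) >= real n" "!!n. admissible (e n) (c n) (Q n)" "!!n. inX (ball (c n) 1) (z1 n) (g1 n)"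
  "!!n xi eta. inX (ball (c n) 1) xi eta ==> en xi eta <= 1 ==> aform (Q n) (z1 n) (g1 n) xi eta < e n * sqrt (en (z1 n) (g1 n))"
  by metis
 have en1: "en (z1 n) (g1 n) > 0" for n
 proof -
  have "0 < e n * sqrt (en (z1 n) (g1 n))" using cQ(4)[OF inX_0, of n] by (simp add: en_def aform_def)
  then show ?thesis using e[of n] by (simp add: zero_less_mult_iff)
 qed
 define s where "s n = 1 / sqrt (en (z1 n) (g1 n))" for n
 have s: "s n > 0" for n using en1[of n] by (simp add: s_def)
 define z where "z n x = s n * z1 n x" for n x
 define g where "g n x = s n *R g1 n x" for n x
 have X: "inX (ball (c n) 1) (z n) (g n)" for n unfolding z_def g_def by (rule inX_scale[OF cQ(3)])
 note E = inXD(1)[OF X]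
 have en_1: "en (z n) (g n) = 1" for n
  unfolding z_def g_def en_scale using en1[of n] by (simp add: s_def power_divide)
 have small: "aform (Q n) (z n) (g n) xi eta < e n" if "inX (ball (c n) 1) xi eta" "en xi eta <= 1" for n xi eta
 proof -
  have "aform (Q n) (z n) (g n) xi eta = s n * aform (Q n) (z1 n) (g1 n) xi eta" unfolding z_def g_def aform_scale ..
  also have "\<dots> < s n * (e n * sqrt (en (z1 n) (g1 n)))" using cQ(4)[OF that] s[of n] by simp
  also have "\<dots> = e n" using en1[of n] by (simp add: s_def)
  finally show ?thesis .
 qed
 \<comment> \<open>Homogeneity and the two signs turn the one-sided bound on the unit ball into a
   bound for all admissible test functions.\<close>
 have small': "\<bar>aform (Q n) (z n) (g n) xi eta\<bar> <= e n * (1 + sqrt (en xi eta))" if xi: "inX (ball (c n) 1) xi eta" for n xi eta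
 proof -
  define t where "t = 1 / (1 + sqrt (en xi eta))"
  have p: "1 + sqrt (en xi eta) > 0" using en_parts(3)[of xi eta] by (simp add: add_pos_nonneg)
  have t: "t > 0" "t * (1 + sqrt (en xi eta)) = 1" using p by (auto simp: t_def)
  have le: "en (%x. \<sigma> * t * xi x) (%x. (\<sigma> * t) *R eta x) <= 1" if "\<bar>\<sigma>\<bar> = 1" for \<sigma>
  proof -
   have "(\<sigma> * t)^2 * en xi eta = (t * sqrt (en xi eta))^2" using that en_parts(3)[of xi eta] by (simp add: power_mult_distrib abs_square_eq_1)
   also have "\<dots> <= 1^2" using t en_parts(3)[of xi eta] by (intro power_mono) (auto simp: algebra_simps)
   finally show ?thesis by (simp add: en_scale)
  qed
  have "\<sigma> * t * aform (Q n) (z n) (g n) xi eta < e n" if "\<bar>\<sigma>\<bar> = 1" for \<sigma>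
   using small[OF inX_scale[OF xi, of "\<sigma> * t"] le[OF that]] by (simp add: aform_scale)
  from this[of 1] this[of "-1"] have "\<bar>t * aform (Q n) (z n) (g n) xi eta\<bar> <= e n" by (simp add: abs_le_iff)
  then have "t * \<bar>aform (Q n) (z n) (g n) xi eta\<bar> <= e n" using t(1) by (simp add: abs_mult)
  then show ?thesis using p by (simp add: t_def divide_le_eq mult.commute)
 qed
 obtain r z' g' where r: "strict_mono (r :: nat => nat)" "inE z' g'" "l2conv (%n. z (r n)) z'" "wconv (%n. g (r n)) g'"
  using energy_compactness[of z g 1, OF E] en_1 by (metis order_refl)
 have er: "(%n. e (r n)) ----> 0" using LIMSEQ_subseq_LIMSEQ[OF e0 r(1)] by (simp add: o_def)
 have "AE x in lborel. z' x = 0"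
 proof (rule no_eigenfunction[OF ne r(2)])
  fix phi :: "real^'n => real" assume p: "phi \<in> Cc"
  note [measurable] = test_measurable[OF p]
  obtain R where R: "R > 0" "!!x. phi x \<noteq> 0 ==> norm x <= R" using Cc_infinityD(2)[OF p] by blast
  have "(%n. aform V (z (r n)) (g (r n)) phi (grad phi)) ----> aform V z' g' phi (grad phi)"
   unfolding aform_def
  proof (rule tendsto_add)
   show "(%n. LBINT x. g (r n) x \<bullet> grad phi x) ----> (LBINT x. g' x \<bullet> grad phi x)"
    by (rule wconvD[OF r(4) sq_int_grad[OF p]])
   obtain K where K: "!!x. norm x <= R ==> Vm x <= K" using V_bounded_on_ball[of R] by blast
   obtain C where C: "!!x. \<bar>phi x\<bar> <= C" using test_bounded[OF p] by blast
   have "sq_int (%x. V x * phi x)"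
   proof (rule sq_int_bounded_support[of _ "((1 + m0) * K) * C" R])
    show "norm (V x * phi x) <= ((1 + m0) * K) * C" for x
    proof (cases "phi x = 0")
     case True
     have "(1 + m0) * K >= 0" using K[of 0] Vm_pos[of 0] R(1) m0_nonneg by simp
     then show ?thesis using True C[of x] by simp
    next
     case False
     have "\<bar>V x\<bar> <= (1 + m0) * K" using V_abs_le[of x] mult_left_mono[OF K[OF R(2)[OF False]], of "1 + m0"] m0_nonneg by linarith
     then show ?thesis using C[of x] by (simp add: abs_mult mult_mono)
    qed
   qed (use R in auto)
   from wconvD[OF l2conv_imp_wconv[OF r(3) inED(2)[OF E] inED(2)[OF r(2)]] this]
   show "(%n. LBINT x. V x * z (r n) x * phi x) ----> (LBINT x. V x * z' x * phi x)" by (simp add: mult_ac)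
  qed
  moreover have "(%n. aform V (z (r n)) (g (r n)) phi (grad phi)) ----> 0"
  proof (rule Lim_null_comparison)
   let ?b = "sqrt (en phi (grad phi))"
   have "(%n. e (r n) * (1 + ?b) + e (r n) * (1 * ?b)) ----> 0 * (1 + ?b) + 0 * (1 * ?b)" by (intro tendsto_intros er)
   then show "(%n. e (r n) * (1 + ?b) + e (r n) * (1 * ?b)) ----> 0" by simp
   \<comment> \<open>For these \<open>n\<close> the support of \<open>phi\<close> misses
     \<open>cball (c n) 2\<close>: so \<open>phi\<close> is admissible, and \<open>Q n\<close> may
     be replaced by \<open>V\<close> at a cost proportional to \<open>e n\<close>.\<close>
   have "norm (aform V (z n) (g n) phi (grad phi)) <= e n * (1 + ?b) + e n * (1 * ?b)" if n: "real n > R + 2" for n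
   proof -
    have far: "phi x = 0 & grad phi x = 0" if "x \<in> cball (c n) 2" for x
    proof -
     have "norm x > R" using that cQ(1)[of n] n norm_triangle_ineq2[of "c n" "c n - x"] by (auto simp: dist_norm norm_minus_commute)
     then show ?thesis using R(2)[of x] grad_support[OF Cc_infinityD(1)[OF p] R(2), of x] by force
    qed
    have Xp: "inX (ball (c n) 1) phi (grad phi)" by (rule inX_vanishing[OF inE_test[OF p]]) (use far in auto)
    define Q' where "Q' x = (if x \<in> cball (c n) 2 then 0 else V x - Q n x)" for x
    have [measurable]: "Q n \<in> BM" using cQ(2)[of n] by (simp add: admissible_def)
    have [measurable]: "cball (c n) 2 \<in> sets borel" by (simp add: borel_closed)
    have [measurable]: "Q' \<in> BM" unfolding Q'_def[abs_def] by measurable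
    have Q'le: "\<bar>Q' x\<bar> <= e n * Vm x" for x
     using cQ(2)[of n] e(1)[of n] Vm_pos[of x] by (auto simp: Q'_def admissible_def abs_minus_commute less_imp_le)
    obtain C where QC: "!!x. \<bar>Q n x\<bar> <= C * Vm x" using cQ(2)[of n] by (auto simp: admissible_def)
    have "aform V (z n) (g n) phi (grad phi) = aform (%x. Q n x + Q' x) (z n) (g n) phi (grad phi)"
     by (rule aform_cong_Q) (use far in \<open>auto simp: Q'_def\<close>)
    also have "\<dots> = aform (Q n) (z n) (g n) phi (grad phi) + (LBINT x. Q' x * z n x * phi x)"
     unfolding aform_def
     using integrable_form(1)[OF E[of n] inE_test[OF p] _ QC] integrable_form(1)[OF E[of n] inE_test[OF p] _ Q'le]
     by (simp add: distrib_right)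
    finally have eq: "aform V (z n) (g n) phi (grad phi) = aform (Q n) (z n) (g n) phi (grad phi) + (LBINT x. Q' x * z n x * phi x)" .
    have "\<bar>LBINT x. Q' x * z n x * phi x\<bar> <= e n * (sqrt (LBINT x. Vm x * (z n x)^2) * sqrt (LBINT x. Vm x * (phi x)^2))"
     by (rule integrable_form(3)[OF E[of n] inE_test[OF p] _ Q'le]) measurable
    also have "\<dots> <= e n * (sqrt (en (z n) (g n)) * ?b)"
     using e(1)[of n] by (intro mult_left_mono mult_mono real_sqrt_le_mono en_parts real_sqrt_ge_zero) auto
    finally show ?thesis using small'[OF Xp] eq en_1[of n] by simp
   qed
   moreover have "\<forall>\<^sub>F n in sequentially. real (r n) > R + 2"
    using filterlim_compose[OF filterlim_real_sequentially filterlim_subseq[OF r(1)]] by (simp add: filterlim_at_top_dense)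
   ultimately show "\<forall>\<^sub>F n in sequentially. norm (aform V (z (r n)) (g (r n)) phi (grad phi)) <= e (r n) * (1 + ?b) + e (r n) * (1 * ?b)"
    by (auto elim!: eventually_mono)
  qed
  ultimately show "aform V z' g' phi (grad phi) = 0" by (rule LIMSEQ_unique)
 qed
 then have "(LBINT x. (norm (z (r n) x - z' x))^2) = (LBINT x. (z (r n) x)^2)" for n
  by (intro integral_cong_AE) (use inED(4)[OF E] inED(4)[OF r(2)] in auto)
 with r(3) have z0: "(%n. LBINT x. (z (r n) x)^2) ----> 0" by (simp add: l2conv_def)
 \<comment> \<open>Garding inequality: the form plus \<open>m0\<close> times the squared L^2 norm
   controls half of the energy, which is normalised to 1.\<close>
 have "1 / 2 <= e n + m0 * (LBINT x. (z n x)^2)" for n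
 proof -
  obtain C where QC: "!!x. \<bar>Q n x\<bar> <= C * Vm x" using cQ(2)[of n] by (auto simp: admissible_def)
  have "en (z n) (g n) / 2 - m0 * (LBINT x. (z n x)^2) <= aform (Q n) (z n) (g n) (z n) (g n)"
   by (rule aform_self_lower[OF E _ QC admissible_lower[OF cQ(2) e(2)]]) (use cQ(2)[of n] in \<open>simp add: admissible_def\<close>)
  also have "\<dots> <= e n" using small[OF X[of n]] en_1[of n] by simp
  finally show ?thesis using en_1[of n] by simp
 qed
 moreover have "(%n. e (r n) + m0 * (LBINT x. (z (r n) x)^2)) ----> 0 + m0 * 0" by (intro tendsto_intros er z0)
 ultimately have "(1::real) / 2 <= 0 + m0 * 0" by (intro LIMSEQ_le_const) auto
 then show False by simp
qed

end

section \<open>A De Giorgi type bound\<close>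

lemma superlevel_integrable:
 fixes y :: "'a::euclidean_space => real"
 assumes y: "sq_int y" and k: "k > 0"
 shows "integrable lborel (indicator {x. y x > k} :: 'a => real)" "integrable lborel (%x. max 0 (y x - k))"
  "emeasure lborel {x. y x > k} < \<infinity>"
proof -
 note [measurable] = sq_int_measurable[OF y]
 have i: "integrable lborel (%x. inverse (k^2) * (norm (y x))^2)" "integrable lborel (%x. inverse k * (norm (y x))^2)"
  using sq_int_integrable[OF y] by auto
 have le: "norm (indicator {x. y x > k} x :: real) <= norm (inverse (k^2) * (norm (y x))^2)" for x
 proof (cases "y x > k")
  case True
  then have "k^2 <= (y x)^2" using k by (intro power_mono) auto
  then show ?thesis using k True by (simp add: field_simps)
 qed auto
 show i1: "integrable lborel (indicator {x. y x > k} :: 'a => real)"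
  by (rule Bochner_Integration.integrable_bound[OF i(1)]) (use le in auto)
 then show "emeasure lborel {x. y x > k} < \<infinity>" by (subst (asm) integrable_indicator_iff) auto
 have le: "norm (max 0 (y x - k)) <= norm (inverse k * (norm (y x))^2)" for x
 proof (cases "y x > k")
  case True
  then have "y x - k <= y x" "k * y x <= y x * y x" using k by (auto intro: mult_right_mono)
  then have "k * (y x - k) <= (y x)^2" using k by (simp add: power2_eq_square algebra_simps) (smt (verit) zero_le_square)
  then show ?thesis using k True by (simp add: field_simps)
 qed auto
 show "integrable lborel (%x. max 0 (y x - k))"
  by (rule Bochner_Integration.integrable_bound[OF i(2)]) (use le in auto)
qed

text \<open>De Giorgi iteration based on \<open>faber_krahn\<close>. Small superlevel sets give a
  small constant there; it absorbs part of the energy estimate and makes the next superlevel set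
  smaller by the very factor that the next, smaller radius requires. The inequality is homogeneous
  in \<open>y\<close> and \<open>kappa\<close>, hence \<open>c0\<close> depends on \<open>C\<close>
  and the dimension only.\<close>

theorem de_giorgi:
 fixes C :: real
 assumes C: "C > 0"
 shows "\<exists>c0>0. \<forall>(y :: real^'n::finite => real) g kappa. wgrad y g --> kappa > 0 --> measure lborel {x. y x > kappa} <= c0 -->
   (\<forall>k\<ge>kappa. (LBINT x. (norm (((sgn (y x - k) + 1) / 2) *R g x))^2)
    <= C * (LBINT x. (max 0 (y x - k))^2) + C * k * (LBINT x. max 0 (y x - k))) -->
   (AE x in lborel. y x <= 2 * kappa)"
proof -
 define N where "N = real CARD('n)"
 have N1: "N >= 1" by (simp add: N_def Suc_leI)
 define s where "s = sqrt (1/2 :: real)"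
 have s: "0 < s" "s < 1" "s^2 = 1/2" by (auto simp: s_def)
 have sN: "0 < s ^ CARD('n)" "s ^ CARD('n) <= 1" using s by (auto intro: power_le_one)
 \<comment> \<open>Fixed by the wish \<open>theta i = s^N / 8 * 2^-i\<close>: then
   \<open>theta i <= 1/2\<close> can be absorbed, and in Chebyshev's inequality the factor
   \<open>4^-(i+1)\<close> cancels against \<open>16 * theta^2\<close> and leaves
   \<open>s^(2 N)\<close>.\<close>
 define t where "t = s ^ CARD('n) / (16 * N^2 * C)"
 have t: "t > 0" using sN C N1 by (simp add: t_def)
 define rho0 where "rho0 = sqrt t"
 have r0: "rho0 > 0" "rho0^2 = t" using t by (auto simp: rho0_def)
 define rho where "rho i = rho0 * s ^ i" for i :: nat
 have r: "rho i > 0" for i using r0 s by (simp add: rho_def)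
 have s2i: "(s ^ i)^2 = (1/2)^i" for i using s(3) by (metis power_even_eq power_mult mult.commute)
 have r2: "(rho i)^2 = t * (1/2)^i" for i using r0(2) s2i by (simp add: rho_def power_mult_distrib)
 define theta where "theta i = 2 * N^2 * (rho i)^2 * C" for i
 have th: "theta i = s ^ CARD('n) / 8 * (1/2)^i" for i using C N1 by (simp add: theta_def r2 t_def field_simps)
 have th0: "theta i > 0" for i unfolding th using sN by simp
 have th_half: "theta i <= 1/2" for i
 proof -
  have "s ^ CARD('n) / 8 * (1/2)^i <= (1/8) * 1" using sN by (intro mult_mono power_le_one) auto
  then show ?thesis using th[of i] by linarith
 qed
 show ?thesis
 proof (intro exI[of _ "rho0 ^ CARD('n) / 2"] conjI allI impI)
  show "rho0 ^ CARD('n) / 2 > 0" using r0 by simp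
  fix y :: "real^'n => real" and g kappa
  assume w: "wgrad y g" and k: "kappa > 0" and m0: "measure lborel {x. y x > kappa} <= rho0 ^ CARD('n) / 2"
   and ineq: "\<forall>k\<ge>kappa. (LBINT x. (norm (((sgn (y x - k) + 1) / 2) *R g x))^2)
    <= C * (LBINT x. (max 0 (y x - k))^2) + C * k * (LBINT x. max 0 (y x - k))"
  note [measurable] = wgradD(3,4)[OF w]
  define K where "K i = kappa * (2 - (1/2)^i)" for i :: nat
  have Kge: "kappa <= K i" "K i <= 2 * kappa" "K i > 0" for i
  proof -
   have "(1/2::real)^i <= 1" "(0::real) < (1/2)^i" by (auto intro: power_le_one)
   then show "kappa <= K i" "K i <= 2 * kappa" using k by (auto simp: K_def)
   then show "K i > 0" using k by simp
  qed
  define A where "A i = {x. y x > K i}" for i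
  have [measurable]: "A i \<in> sets borel" for i unfolding A_def by measurable
  note fin = superlevel_integrable[OF wgradD(1)[OF w] Kge(3), folded A_def]
  have step: "measure lborel (A (Suc i)) <= s ^ CARD('n) * measure lborel (A i)" if mi: "measure lborel (A i) <= rho i ^ CARD('n) / 2" for i
  proof -
   define z where "z x = max 0 (y x - K i)" for x
   define Z where "Z = (LBINT x. (z x)^2)"
   define L where "L = (LBINT x. z x)"
   have wz: "wgrad z (%x. ((sgn (y x - K i) + 1) / 2) *R g x)"
    unfolding z_def[abs_def] by (rule wgrad_pos[OF w less_imp_le[OF Kge(3)]])
   note sz = wgradD(1)[OF wz]
   have z2: "integrable lborel (%x. (z x)^2)" using sq_int_integrable[OF sz] by simp
   have Z0: "Z >= 0" unfolding Z_def by (intro integral_nonneg_AE) auto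
   have L0: "L >= 0" unfolding L_def z_def by (intro integral_nonneg_AE) auto
   have "Z <= 2 * (N * rho i)^2 * (LBINT x. (norm (((sgn (y x - K i) + 1) / 2) *R g x))^2)"
    unfolding Z_def N_def
   proof (rule faber_krahn[OF wz r])
    show "emeasure lborel (A i) <= ennreal (rho i ^ CARD('n) / 2)"
     using mi fin(3)[of i] by (subst emeasure_eq_ennreal_measure) (auto intro: ennreal_leI)
   qed (auto simp: A_def z_def)
   also have "\<dots> <= 2 * (N * rho i)^2 * (C * Z + C * K i * L)"
    using ineq[rule_format, OF Kge(1)[of i]] by (intro mult_left_mono) (auto simp: Z_def L_def z_def)
   also have "\<dots> = theta i * Z + theta i * K i * L" by (simp add: theta_def power_mult_distrib algebra_simps)
   also have "\<dots> <= (1/2) * Z + theta i * (2 * kappa) * L"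
    using th_half[of i] th0[of i] Kge[of i] Z0 L0 by (intro add_mono mult_right_mono mult_left_mono) auto
   finally have ZL: "Z <= 4 * theta i * kappa * L" by simp
   have LZ: "L <= sqrt (measure lborel (A i)) * sqrt Z"
   proof -
    have si: "sq_int (indicator (A i) :: real^'n => real)"
    proof -
     have "(norm (indicator (A i) x :: real))^2 = indicator (A i) x" for x by (simp add: indicator_def)
     then show ?thesis using fin(1)[of i] by (simp add: sq_int_def)
    qed
    have e: "(indicator (A i) x :: real)^2 = indicator (A i) x" "indicator (A i) x * z x = z x" for x
     by (auto simp: indicator_def A_def z_def)
    then show ?thesis using L2_Cauchy_Schwarz'[OF si sz, unfolded e] by (simp add: L_def Z_def)
   qed
   have Zb: "Z <= 16 * (theta i)^2 * kappa^2 * measure lborel (A i)"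
   proof (cases "Z = 0")
    case False
    then have Zp: "sqrt Z > 0" using Z0 by simp
    have "sqrt Z * sqrt Z <= 4 * theta i * kappa * (sqrt (measure lborel (A i)) * sqrt Z)"
     using order_trans[OF ZL mult_left_mono[OF LZ]] th0[of i] k Z0 by simp
    then have "sqrt Z * sqrt Z <= (4 * theta i * kappa * sqrt (measure lborel (A i))) * sqrt Z" by (simp add: mult_ac)
    then have "sqrt Z <= 4 * theta i * kappa * sqrt (measure lborel (A i))" using Zp by (subst (asm) mult_le_cancel_right_pos) auto
    then have "(sqrt Z)^2 <= (4 * theta i * kappa * sqrt (measure lborel (A i)))^2" using Z0 by (intro power_mono) auto
    then show ?thesis using Z0 by (simp add: power_mult_distrib)
   qed simp
   have "(kappa * (1/2)^Suc i)^2 * measure lborel (A (Suc i)) = (LBINT x. (kappa * (1/2)^Suc i)^2 * indicator (A (Suc i)) x)"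
    using fin(3)[of "Suc i"] by simp
   also have "\<dots> <= Z"
    unfolding Z_def
   proof (rule integral_mono)
    show "integrable lborel (%x. (kappa * (1/2)^Suc i)^2 * indicator (A (Suc i)) x)" using fin(1)[of "Suc i"] by simp
    fix x
    show "(kappa * (1/2)^Suc i)^2 * indicator (A (Suc i)) x <= (z x)^2"
    proof (cases "x \<in> A (Suc i)")
     case True
     then have "kappa * (1/2)^Suc i <= y x - K i" by (simp add: A_def K_def algebra_simps)
     then have "kappa * (1/2)^Suc i <= z x" unfolding z_def by linarith
     then show ?thesis using True k by (simp add: power_mono)
    qed simp
   qed (rule z2)
   also note Zb
   also have "16 * (theta i)^2 * kappa^2 * measure lborel (A i) = (kappa * (1/2)^Suc i)^2 * ((s ^ CARD('n))^2 * measure lborel (A i))"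
    unfolding th by (simp add: power_mult_distrib power_divide)
   finally have "measure lborel (A (Suc i)) <= (s ^ CARD('n))^2 * measure lborel (A i)" using k by simp
   also have "\<dots> <= s ^ CARD('n) * measure lborel (A i)"
    using sN by (intro mult_right_mono) (auto simp: power2_eq_square mult_left_le)
   finally show ?thesis .
  qed
  have bound: "measure lborel (A i) <= rho i ^ CARD('n) / 2" for i
  proof (induction i)
   case 0
   then show ?case using m0 by (simp add: A_def K_def rho_def)
  next
   case (Suc i)
   have "measure lborel (A (Suc i)) <= s ^ CARD('n) * (rho i ^ CARD('n) / 2)"
    by (rule order_trans[OF step[OF Suc] mult_left_mono[OF Suc]]) (use sN in auto)
   then show ?case by (simp add: rho_def power_mult_distrib mult_ac)
  qed
  have "measure lborel {x. y x > 2 * kappa} <= rho i ^ CARD('n) / 2" for i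
  proof -
   have "measure lborel {x. y x > 2 * kappa} <= measure lborel (A i)"
    by (rule measure_mono_fmeasurable) (use Kge(2)[of i] fin(3)[of i] in \<open>auto simp: A_def fmeasurable_def\<close>)
   then show ?thesis using bound[of i] by simp
  qed
  moreover have "(%i. rho i ^ CARD('n) / 2) ----> (rho0 * 0) ^ CARD('n) / 2"
   unfolding rho_def using s by (intro tendsto_intros LIMSEQ_realpow_zero) auto
  ultimately have "measure lborel {x. y x > 2 * kappa} <= (rho0 * 0) ^ CARD('n) / 2" by (intro LIMSEQ_le_const) auto
  then have "measure lborel {x. y x > 2 * kappa} = 0" by (simp add: zero_power measure_nonneg order_antisym)
  then have "emeasure lborel {x. y x > 2 * kappa} = 0"
   using superlevel_integrable(3)[OF wgradD(1)[OF w], of "2 * kappa"] k by (simp add: emeasure_eq_ennreal_measure)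
  then have "{x. ~ y x <= 2 * kappa} \<in> null_sets lborel" by (simp add: null_sets_def not_le)
  then show "AE x in lborel. y x <= 2 * kappa" by (intro AE_I') auto
 qed
qed

section \<open>Solutions of semilinear problems by Schauder's theorem\<close>

lemma tendsto_if_subsequences:
 fixes X :: "nat => 'a::metric_space"
 assumes "!!r :: nat => nat. strict_mono r ==> \<exists>s :: nat => nat. strict_mono s & (%n. X (r (s n))) ----> L"
 shows "X ----> L"
proof (rule ccontr)
 assume "~ X ----> L"
 then obtain e where e: "e > 0" "!!N. \<exists>n\<ge>N. dist (X n) L >= e"
  unfolding lim_sequentially by (meson not_le)
 then have inf: "infinite {n. dist (X n) L >= e}" by (auto simp: infinite_nat_iff_unbounded_le)
 obtain r :: "nat => nat" where r: "strict_mono r" "!!n. r n \<in> {n. dist (X n) L >= e}"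
  using infinite_enumerate[OF inf] by blast
 obtain s :: "nat => nat" where s: "strict_mono s" "(%n. X (r (s n))) ----> L" using assms[OF r(1)] by blast
 then obtain n where "dist (X (r (s n))) L < e" using e(1) unfolding lim_sequentially by blast
 with r(2)[of "s n"] show False by simp
qed

context coercive_potential
begin

text \<open>Weak lower semicontinuity of the norm, by pairing the sequence with its limit.\<close>

lemma en_weak_limit:
 assumes E: "!!n. inE (z n) (g n)" "inE z' g'" and M: "!!n. en (z n) (g n) <= M"
  and w: "wconv g g'" "wconv (%n x. sqrt (Vm x) * z n x) (%x. sqrt (Vm x) * z' x)"
 shows "en z' g' <= M"
proof -
 have M0: "M >= 0" using en_parts(3) M order_trans by blast
 have "(%n. fst (emb (z n) (g n)) \<bullet> fst (emb z' g') + snd (emb (z n) (g n)) \<bullet> snd (emb z' g'))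
   ----> fst (emb z' g') \<bullet> fst (emb z' g') + snd (emb z' g') \<bullet> snd (emb z' g')"
  using w unfolding wconv_cls[OF inED(3)[OF E(1)] inED(3)[OF E(2)]] wconv_cls[OF inED(7)[OF E(1)] inED(7)[OF E(2)]]
  by (intro tendsto_add) (auto simp: emb_def)
 then have "(%n. emb (z n) (g n) \<bullet> emb z' g') ----> emb z' g' \<bullet> emb z' g'" by (simp add: inner_prod_def)
 moreover have "emb (z n) (g n) \<bullet> emb z' g' <= sqrt M * sqrt (en z' g')" for n
 proof -
  have "emb (z n) (g n) \<bullet> emb z' g' <= norm (emb (z n) (g n)) * norm (emb z' g')" by (rule norm_cauchy_schwarz)
  also have "\<dots> <= sqrt M * sqrt (en z' g')"
   unfolding emb_norm[OF E(1)] emb_norm[OF E(2)] using M en_parts(3) by (intro mult_right_mono) auto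
  finally show ?thesis .
 qed
 ultimately have "emb z' g' \<bullet> emb z' g' <= sqrt M * sqrt (en z' g')" by (intro LIMSEQ_le_const2) auto
 moreover have "emb z' g' \<bullet> emb z' g' = (sqrt (en z' g'))^2"
  using emb_norm[OF E(2)] by (metis power2_norm_eq_inner)
 ultimately have le: "sqrt (en z' g') * sqrt (en z' g') <= sqrt M * sqrt (en z' g')" by (simp add: power2_eq_square)
 show ?thesis
 proof (cases "en z' g' = 0")
  case False
  then have "sqrt (en z' g') > 0" using en_parts(3)[of z' g'] by simp
  then have "sqrt (en z' g') <= sqrt M" using le by (rule mult_right_le_imp_le[rotated])
  then show ?thesis by simp
 qed (use M0 in simp)
qed

text \<open>Freezing the coefficient at a given function leaves a linear problem, uniquely solvable
  by the inf-sup inequality with bounds independent of that function. The solution operator on L^2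
  takes values in a translate of an energy ball, which is compact in L^2.\<close>

theorem semilinear_solution:
 fixes q :: "real^'n => real => real"
 assumes q_meas: "!!w. w \<in> BM ==> (%x. q x (w x)) \<in> BM"
  and q_cont: "!!x. continuous_on UNIV (q x)" and q_bd: "!!x s. \<bar>q x s\<bar> <= C * Vm x"
  and B[measurable]: "B \<in> sets borel" and k: "kappa > 0"
  and infsup: "!!w z g. w \<in> BM ==> inX B z g ==>
   \<exists>xi eta. inX B xi eta & en xi eta <= 1 & aform (%x. q x (w x)) z g xi eta >= kappa * sqrt (en z g)"
  and E0: "inE z0 g0"
 shows "\<exists>z g. inX B z g & (\<forall>xi eta. inX B xi eta -->
   aform (%x. q x (z x + z0 x)) (%x. z x + z0 x) (%x. g x + g0 x) xi eta = 0)"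
proof -
 have C0: "C >= 0" using q_bd[of 0 0] Vm_pos[of 0] by (metis abs_ge_zero order_trans zero_le_mult_iff not_le)
 define sol where "sol w z g \<longleftrightarrow> inX B z g & (\<forall>xi eta. inX B xi eta -->
   aform (%x. q x (w x)) (%x. z x + z0 x) (%x. g x + g0 x) xi eta = 0) & kappa * sqrt (en z g) <= (1 + C) * sqrt (en z0 g0)" for w z g
 define M where "M = ((1 + C) * sqrt (en z0 g0) / kappa)^2"
 have solM: "en z g <= M" if "sol w z g" for w z g
 proof -
  have "sqrt (en z g) <= (1 + C) * sqrt (en z0 g0) / kappa" using that k by (simp add: sol_def pos_le_divide_eq mult.commute)
  then have "(sqrt (en z g))^2 <= M" unfolding M_def using en_parts(3) by (intro power_mono) auto
  then show ?thesis using en_parts(3) by simp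
 qed
 have ex: "\<exists>z g. sol w z g" if "w \<in> BM" for w
  using inf_sup_solve[OF B q_meas[OF that] q_bd k infsup[OF that] E0] unfolding sol_def by blast
 have uniq: "AE x in lborel. z x = z' x"
  if w: "w \<in> BM" and s: "inX B z g" "inX B z' g'"
   "!!xi eta. inX B xi eta ==> aform (%x. q x (w x)) (%x. z x + z0 x) (%x. g x + g0 x) xi eta = 0"
   "!!xi eta. inX B xi eta ==> aform (%x. q x (w x)) (%x. z' x + z0 x) (%x. g' x + g0 x) xi eta = 0" for w z g z' g'
 proof -
  note X = inX_diff[OF s(1,2)]
  obtain xi eta where t: "inX B xi eta" "aform (%x. q x (w x)) (%x. z x - z' x) (%x. g x - g' x) xi eta >= kappa * sqrt (en (%x. z x - z' x) (%x. g x - g' x))"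
   using infsup[OF w X] by blast
  have "aform (%x. q x (w x)) (%x. (z x - z' x) + (z' x + z0 x)) (%x. (g x - g' x) + (g' x + g0 x)) xi eta =
    aform (%x. q x (w x)) (%x. z x - z' x) (%x. g x - g' x) xi eta + aform (%x. q x (w x)) (%x. z' x + z0 x) (%x. g' x + g0 x) xi eta"
   by (rule aform_add(1)[OF inXD(1)[OF X] inE_add[OF inXD(1)[OF s(2)] E0] inXD(1)[OF t(1)] q_meas[OF w] q_bd])
  then have "aform (%x. q x (w x)) (%x. z x - z' x) (%x. g x - g' x) xi eta = 0" using s(3,4)[OF t(1)] by simp
  then have "en (%x. z x - z' x) (%x. g x - g' x) <= 0"
   using t(2) k by (simp add: mult_le_0_iff)
  then have "(LBINT x. (z x - z' x)^2) <= 0" using L2_le_en[OF inXD(1)[OF X]] by linarith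
  moreover have i: "integrable lborel (%x. (z x - z' x)^2)" using sq_int_integrable[OF inED(2)[OF inXD(1)[OF X]]] by simp
  ultimately have "(LBINT x. (z x - z' x)^2) = 0" by (intro antisym integral_nonneg_AE) auto
  then have "AE x in lborel. (z x - z' x)^2 = 0" using integral_nonneg_eq_0_iff_AE[OF i] by simp
  then show ?thesis by eventually_elim simp
 qed
 have cl0: "sq_int z0" by (rule inED(2)[OF E0])
 have wrep: "rep_l2 W \<in> BM" for W :: "(real^'n, real) l2" by (rule sq_int_measurable) simp
 obtain Z G where ZG: "!!W :: (real^'n, real) l2. sol (rep_l2 W) (Z W) (G W)" using ex[OF wrep] by metis
 note XZ = ZG[unfolded sol_def, THEN conjunct1]
 note EZ = inXD(1)[OF XZ]
 have resZ: "inX B xi eta ==> aform (%x. q x (rep_l2 W x)) (%x. Z W x + z0 x) (%x. G W x + g0 x) xi eta = 0" for W xi eta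
  using ZG[of W, unfolded sol_def] by blast
 define T where "T W = cls (%x. Z W x + z0 x)" for W
 define K where "K = {cls (%x. z x + z0 x) | z g. inX B z g & en z g <= M}"
 have TK: "T W \<in> K" for W unfolding T_def K_def using XZ solM[OF ZG] by blast
 have conv: "\<exists>r z g. strict_mono (r :: nat => nat) & inX B z g & en z g <= M & (%n. cls (%x. zn (r n) x + z0 x)) ----> cls (%x. z x + z0 x) &
   wconv (%n. gn (r n)) g & wconv (%n x. sqrt (Vm x) * zn (r n) x) (%x. sqrt (Vm x) * z x)"
  if X: "!!n. inX B (zn n) (gn n)" "!!n. en (zn n) (gn n) <= M" for zn gn
 proof -
  note E = inXD(1)[OF X(1)]
  obtain r z g where r: "strict_mono (r :: nat => nat)" "inE z g" "l2conv (%n. zn (r n)) z" "wconv (%n. gn (r n)) g"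
   "wconv (%n x. sqrt (Vm x) * zn (r n) x) (%x. sqrt (Vm x) * z x)"
   using energy_compactness[of zn gn, OF E X(2)] by blast
  have "inX B z g" by (rule inX_closed[OF X(1) l2conv_imp_wconv[OF r(3) inED(2)[OF E] inED(2)[OF r(2)]] r(4,2) B])
  moreover have "en z g <= M" by (rule en_weak_limit[OF E r(2) X(2) r(4,5)])
  moreover have "(%n. cls (%x. zn (r n) x + z0 x)) ----> cls (%x. z x + z0 x)"
   using r(3) unfolding l2conv_cls[OF inED(2)[OF E] inED(2)[OF r(2)]]
   by (simp add: cls_add[symmetric] inED(2)[OF E] inED(2)[OF r(2)] cl0 tendsto_add)
  ultimately show ?thesis using r by blast
 qed
 have cK: "compact K"
  unfolding compact_def
 proof (intro allI impI)
  fix f :: "nat => (real^'n, real) l2" assume "\<forall>n. f n \<in> K"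
  then have "\<forall>n. \<exists>z g. f n = cls (%x. z x + z0 x) & inX B z g & en z g <= M" by (auto simp: K_def)
  then obtain zn gn where f: "!!n. f n = cls (%x. zn n x + z0 x)" "!!n. inX B (zn n) (gn n)" "!!n. en (zn n) (gn n) <= M" by metis
  from conv[of zn gn, OF f(2,3)] obtain r z g where r: "strict_mono (r :: nat => nat)" "inX B z g" "en z g <= M"
   "(%n. cls (%x. zn (r n) x + z0 x)) ----> cls (%x. z x + z0 x)" by blast
  then show "\<exists>l\<in>K. \<exists>r. strict_mono r & (f \<circ> r) ----> l"
   by (intro bexI[of _ "cls (%x. z x + z0 x)"] exI[of _ r]) (auto simp: o_def f(1) K_def)
 qed
 have cT: "continuous_on UNIV T"
  unfolding continuous_on_sequentially
 proof (intro allI ballI impI)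
  fix X :: "nat => (real^'n, real) l2" and W assume "(\<forall>n. X n \<in> UNIV) & X ----> W"
  then have XW: "X ----> W" by simp
  have "(%n. T (X n)) ----> T W"
  \<comment> \<open>Every subsequence has a further one along which the solutions converge to a
    solution of the limit problem; uniqueness identifies it with the value of
    \<open>T\<close>.\<close>
  proof (rule tendsto_if_subsequences)
   fix r :: "nat => nat" assume r: "strict_mono r"
   have "(%n. cls (rep_l2 (X (r n)))) ----> cls (rep_l2 W)" using LIMSEQ_subseq_LIMSEQ[OF XW r] by (simp add: o_def)
   then have "l2conv (%n. rep_l2 (X (r n))) (rep_l2 W)" by (subst l2conv_cls) auto
   from l2conv_AE_subseq[OF this] obtain r1 where r1: "strict_mono (r1 :: nat => nat)"
    "AE x in lborel. (%n. rep_l2 (X (r (r1 n))) x) ----> rep_l2 W x" by auto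
   define Y where "Y n = X (r (r1 n))" for n
   from conv[of "%n. Z (Y n)" "%n. G (Y n)", OF XZ solM[OF ZG]] obtain r2 z g where
    r2: "strict_mono (r2 :: nat => nat)" "inX B z g" "en z g <= M"
    "(%n. cls (%x. Z (Y (r2 n)) x + z0 x)) ----> cls (%x. z x + z0 x)" "wconv (%n. G (Y (r2 n))) g"
    "wconv (%n x. sqrt (Vm x) * Z (Y (r2 n)) x) (%x. sqrt (Vm x) * z x)" by blast
   define U where "U n = Y (r2 n)" for n
   have AEU: "AE x in lborel. (%n. rep_l2 (U n) x) ----> rep_l2 W x"
    using r1(2) by eventually_elim (use LIMSEQ_subseq_LIMSEQ[OF _ r2(1)] in \<open>fastforce simp: o_def U_def Y_def\<close>)
   have "aform (%x. q x (rep_l2 W x)) (%x. z x + z0 x) (%x. g x + g0 x) xi eta = 0" if xi: "inX B xi eta" for xi eta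
   proof -
    note Exi = inXD(1)[OF xi] and Ez = inXD(1)[OF r2(2)]
    have "(%n. aform (%x. q x (rep_l2 (U n) x)) (Z (U n)) (G (U n)) xi eta) ----> aform (%x. q x (rep_l2 W x)) z g xi eta"
     unfolding aform_def
    proof (rule tendsto_add)
     show "(%n. LBINT x. G (U n) x \<bullet> eta x) ----> (LBINT x. g x \<bullet> eta x)"
      using wconvD[OF r2(5) inED(3)[OF Exi]] by (simp add: U_def)
     define p where "p V' x = q x (rep_l2 V' x) / Vm x * (sqrt (Vm x) * xi x)" for V' x
     have [measurable]: "(%x. q x (rep_l2 V' x)) \<in> BM" for V' by (rule q_meas[OF wrep])
     note [measurable] = inED(4)[OF Exi]
     have qV: "\<bar>q x s / Vm x\<bar> <= C" for x s using q_bd[of x s] Vm_pos[of x] by (simp add: abs_divide divide_le_eq)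
     have sp: "sq_int (p V')" for V' unfolding p_def[abs_def] by (rule sq_int_mult_bounded'[OF inED(7)[OF Exi] _ qV]) measurable
     have [measurable]: "p V' \<in> BM" for V' by (rule sq_int_measurable[OF sp])
     have lp: "l2conv (%n. p (U n)) (p W)"
     proof (rule l2conv_dominated)
      show "integrable lborel (%x. (2 * C)^2 * (norm (sqrt (Vm x) * xi x))^2)" using sq_int_integrable[OF inED(7)[OF Exi]] by simp
      have "(norm (p (U n) x - p W x))^2 <= (2 * C)^2 * (norm (sqrt (Vm x) * xi x))^2" for n x
      proof -
       have "\<bar>q x (rep_l2 (U n) x) / Vm x - q x (rep_l2 W x) / Vm x\<bar> <= 2 * C"
        using qV[of x "rep_l2 (U n) x"] qV[of x "rep_l2 W x"] by linarith
       from mult_right_mono[OF this abs_ge_zero[of "sqrt (Vm x) * xi x"]]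
       have "norm (p (U n) x - p W x) <= 2 * C * norm (sqrt (Vm x) * xi x)"
        unfolding p_def by (simp add: abs_mult[symmetric] left_diff_distrib)
       from power_mono[OF this, of 2] show ?thesis by (simp add: power_mult_distrib)
      qed
      then show "AE x in lborel. (norm (p (U n) x - p W x))^2 <= (2 * C)^2 * (norm (sqrt (Vm x) * xi x))^2" for n by simp
      show "AE x in lborel. (%n. p (U n) x) ----> p W x"
       using AEU
      proof eventually_elim
       case (elim x)
       have "(%n. q x (rep_l2 (U n) x)) ----> q x (rep_l2 W x)"
        using continuous_on_tendsto_compose[OF q_cont[of x] elim] by simp
       then show ?case unfolding p_def by (intro tendsto_intros) (use Vm_pos[of x] in auto)
      qed
     qed measurable
     have bd: "(LBINT x. (norm (sqrt (Vm x) * Z (U n) x))^2) <= M" for n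
     proof -
      have "(norm (sqrt (Vm x) * Z (U n) x))^2 = Vm x * (Z (U n) x)^2" for x using Vm_pos[of x] by (simp add: power_mult_distrib)
      then show ?thesis using order_trans[OF en_parts(2) solM[OF ZG[of "U n"]]] by simp
     qed
     have "(%n. LBINT x. (sqrt (Vm x) * Z (U n) x) * p (U n) x) ----> (LBINT x. (sqrt (Vm x) * z x) * p W x)"
      using weak_strong_tendsto[OF r2(6)[folded U_def] lp inED(7)[OF EZ] inED(7)[OF Ez] bd sp sp] by simp
     moreover have "(sqrt (Vm x) * a) * p V' x = q x (rep_l2 V' x) * a * xi x" for a V' x
     proof -
      have "(sqrt (Vm x) * a) * p V' x = (sqrt (Vm x) * sqrt (Vm x)) / Vm x * (q x (rep_l2 V' x) * a * xi x)" by (simp add: p_def)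
      then show ?thesis using Vm_pos[of x] by simp
     qed
     ultimately show "(%n. LBINT x. q x (rep_l2 (U n) x) * Z (U n) x * xi x) ----> (LBINT x. q x (rep_l2 W x) * z x * xi x)"
      by simp
    qed
    moreover have "(%n. aform (%x. q x (rep_l2 (U n) x)) z0 g0 xi eta) ----> aform (%x. q x (rep_l2 W x)) z0 g0 xi eta"
     unfolding aform_def
    proof (intro tendsto_add tendsto_const integral_dominated_convergence[where w = "%x. norm (C * Vm x * z0 x * xi x)"])
     have [measurable]: "(%x. q x (rep_l2 V' x)) \<in> BM" for V' by (rule q_meas[OF wrep])
     note [measurable] = inED(4)[OF Exi] inED(4)[OF E0]
     show "(%x. q x (rep_l2 W x) * z0 x * xi x) \<in> borel_measurable lborel"
      "(%x. q x (rep_l2 (U n) x) * z0 x * xi x) \<in> borel_measurable lborel" for n by measurable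
     have Ca: "\<bar>C * Vm x\<bar> <= C * Vm x" for x using C0 Vm_pos[of x] by simp
     show "integrable lborel (%x. norm (C * Vm x * z0 x * xi x))"
      by (intro integrable_norm integrable_form(1)[OF E0 Exi _ Ca]) measurable
     show "AE x in lborel. (%n. q x (rep_l2 (U n) x) * z0 x * xi x) ----> q x (rep_l2 W x) * z0 x * xi x"
      using AEU
     proof eventually_elim
      case (elim x)
      have "(%n. q x (rep_l2 (U n) x)) ----> q x (rep_l2 W x)"
       using continuous_on_tendsto_compose[OF q_cont[of x] elim] by simp
      then show ?case by (intro tendsto_intros)
     qed
     show "AE x in lborel. norm (q x (rep_l2 (U n) x) * z0 x * xi x) <= norm (C * Vm x * z0 x * xi x)" for n
     proof (rule AE_I2)
      fix x
      have "\<bar>q x (rep_l2 (U n) x)\<bar> <= \<bar>C * Vm x\<bar>" using q_bd[of x "rep_l2 (U n) x"] by linarith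
      then have "\<bar>q x (rep_l2 (U n) x)\<bar> * \<bar>z0 x\<bar> * \<bar>xi x\<bar> <= \<bar>C * Vm x\<bar> * \<bar>z0 x\<bar> * \<bar>xi x\<bar>"
       by (intro mult_right_mono) auto
      then show "norm (q x (rep_l2 (U n) x) * z0 x * xi x) <= norm (C * Vm x * z0 x * xi x)"
       unfolding real_norm_def abs_mult[symmetric] .
     qed
    qed
    ultimately have "(%n. aform (%x. q x (rep_l2 (U n) x)) (Z (U n)) (G (U n)) xi eta + aform (%x. q x (rep_l2 (U n) x)) z0 g0 xi eta)
      ----> aform (%x. q x (rep_l2 W x)) z g xi eta + aform (%x. q x (rep_l2 W x)) z0 g0 xi eta" by (rule tendsto_add)
    moreover have "aform (%x. q x (rep_l2 (U n) x)) (Z (U n)) (G (U n)) xi eta + aform (%x. q x (rep_l2 (U n) x)) z0 g0 xi eta = 0" for n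
     using resZ[OF xi, of "U n"] aform_add(1)[OF EZ E0 Exi q_meas[OF wrep] q_bd, of "U n" "U n"] by simp
    ultimately show ?thesis
     using aform_add(1)[OF Ez E0 Exi q_meas[OF wrep] q_bd, of W] by (simp add: LIMSEQ_const_iff)
   qed
   from uniq[OF wrep r2(2) XZ this resZ] have "AE x in lborel. z x = Z W x" .
   then have "AE x in lborel. z x + z0 x = Z W x + z0 x" by eventually_elim simp
   then have "cls (%x. z x + z0 x) = T W"
    unfolding T_def by (subst cls_eq_iff) (auto intro!: sq_int_add inED(2)[OF inXD(1)[OF r2(2)]] inED(2)[OF EZ] cl0)
   with r2(4) have "(%n. T (Y (r2 n))) ----> T W" by (simp add: T_def)
   then show "\<exists>s :: nat => nat. strict_mono s & (%n. T (X (r (s n)))) ----> T W"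
    using r1(1) r2(1) by (intro exI[of _ "%n. r1 (r2 n)"]) (auto simp: Y_def strict_mono_def)
  qed
  then show "(T \<circ> X) ----> T W" by (simp add: o_def)
 qed
 obtain W where W: "T W = W" using schauder[OF cT cK TK] by blast
 define z g where "z = Z W" and "g = G W"
 have Ez: "inE z g" using EZ[of W] by (simp add: z_def g_def)
 have szz: "sq_int (%x. z x + z0 x)" by (intro sq_int_add inED(2)[OF Ez] cl0)
 have "AE x in lborel. rep_l2 W x = z x + z0 x"
  using rep_cls[OF szz] W by (simp add: T_def z_def)
 then have AEW: "AE x in lborel. q x (rep_l2 W x) = q x (z x + z0 x)" by eventually_elim simp
 note [measurable] = inED(4)[OF Ez] inED(4)[OF E0]
 have [measurable]: "(%x. q x (rep_l2 W x)) \<in> BM" "(%x. q x (z x + z0 x)) \<in> BM"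
  by (rule q_meas[OF wrep]) (rule q_meas, measurable)
 have "aform (%x. q x (z x + z0 x)) (%x. z x + z0 x) (%x. g x + g0 x) xi eta = 0" if xi: "inX B xi eta" for xi eta
 proof -
  note [measurable] = inED(4)[OF inXD(1)[OF xi]]
  have "(LBINT x. q x (z x + z0 x) * (z x + z0 x) * xi x) = (LBINT x. q x (rep_l2 W x) * (z x + z0 x) * xi x)"
   by (rule integral_cong_AE) (measurable, use AEW in eventually_elim, simp)
  then show ?thesis using resZ[OF xi, of W] by (simp add: aform_def z_def g_def)
 qed
 then show ?thesis using XZ[of W] unfolding z_def g_def by blast
qed

end

section \<open>The regularised change of variables\<close>

lemma antiderivative_exists:
 fixes phi :: "real => real"
 assumes "continuous_on UNIV phi"
 shows "\<exists>H. H 0 = 0 & (\<forall>t. (H has_real_derivative phi t) (at t))"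
proof -
 have "isCont phi x" for x using assms by (simp add: continuous_on_eq_continuous_at)
 then obtain F where F: "!!x. (F has_vector_derivative phi x) (at x)"
  using einterval_antiderivative[of "-\<infinity>" "\<infinity>" phi] by auto
 then have "((%t. F t - F 0) has_real_derivative phi t) (at t)" for t
  by (auto intro!: derivative_eq_intros simp: has_real_derivative_iff_has_vector_derivative)
 then show ?thesis by (intro exI[of _ "%t. F t - F 0"]) auto
qed

text \<open>The chain rule wants C^1 functions on the line with bounded derivative, while the
  compositions below are C^1 only on the range of the solution. Continuing the derivative by
  constants reconciles the two.\<close>

lemma C1_extension:
 fixes F F' :: "real => real"
 assumes ab: "a <= 0" "0 <= b" and F: "!!t. t \<in> {a..b} ==> (F has_real_derivative F' t) (at t within {a..b})"
  and c: "continuous_on {a..b} F'" and F0: "F 0 = 0"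
 obtains G G' C where "!!t. (G has_real_derivative G' t) (at t)" "continuous_on UNIV G'" "!!t. \<bar>G' t\<bar> <= C" "G 0 = 0"
  "!!t. t \<in> {a..b} ==> G t = F t & G' t = F' t"
proof -
 define cl where "cl t = max a (min b t)" for t
 have cl: "cl t \<in> {a..b}" "t \<in> {a..b} ==> cl t = t" for t using ab by (auto simp: cl_def)
 have G': "continuous_on UNIV (%t. F' (cl t))"
  by (rule continuous_on_compose2[OF c]) (use cl in \<open>auto simp: cl_def[abs_def] intro!: continuous_intros\<close>)
 then obtain G where G: "G 0 = 0" "!!t. (G has_real_derivative F' (cl t)) (at t)" using antiderivative_exists by blast
 have "bounded (F' ` {a..b})" by (rule compact_imp_bounded[OF compact_continuous_image[OF c]]) auto
 then have "\<exists>C. \<forall>t\<in>{a..b}. \<bar>F' t\<bar> <= C" by (auto simp: bounded_iff)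
 then obtain C where C: "!!t. t \<in> {a..b} ==> \<bar>F' t\<bar> <= C" by blast
 have "((%t. G t - F t) has_real_derivative 0) (at t within {a..b})" if "t \<in> {a..b}" for t
  using DERIV_diff[OF has_field_derivative_at_within[OF G(2)] F[OF that]] cl(2)[OF that] by simp
 then obtain k where "!!t. t \<in> {a..b} ==> G t - F t = k"
  using has_field_derivative_zero_constant[of "{a..b}" "%t. G t - F t"] by auto
 from this this[of 0] have "!!t. t \<in> {a..b} ==> G t = F t" using ab G F0 by force
 then show thesis using that[OF G(2) G' C[OF cl(1)] G(1)] cl(2) by simp
qed

text \<open>The weight \<open>hh 1\<close> is that of the substitution \<open>w = H(u)\<close>; for \<open>rho < 1\<close> it does not degenerate at \<open>1\<close>.
 Outside \<open>[- 1, 1]\<close> it is continued by constants, so that \<open>HH rho\<close> is a bijection of the line. The zeroth-order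
 term \<open>(V - r(u)) u / h(u)\<close> is written as \<open>alpha(w) (V - r(u)) w\<close>.\<close>

definition hh :: "real => real => real" where "hh rho t = sqrt (1 - rho * min 1 (t^2))"

definition HH :: "real => real => real" where
 "HH rho = (SOME H. H 0 = 0 & (\<forall>t. (H has_real_derivative hh rho t) (at t)))"

definition UU :: "real => real => real" where "UU rho = inv (HH rho)"

definition alpha :: "real => real => real" where
 "alpha rho s = (if s = 0 then 1 else UU rho s / (hh rho (UU rho s) * s))"

lemma hh_cont: "continuous_on UNIV (hh rho)" "isCont (hh rho) t"
proof -
 show c: "continuous_on UNIV (hh rho)" unfolding hh_def[abs_def] by (intro continuous_intros)
 then show "isCont (hh rho) t" by (simp add: continuous_on_eq_continuous_at)
qed

lemma HH_0: "HH rho 0 = 0" and HH_deriv: "(HH rho has_real_derivative hh rho t) (at t)"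
 using someI_ex[OF antiderivative_exists[OF hh_cont(1)[of rho]]] by (auto simp: HH_def)

lemma HH_cont: "continuous_on A (HH rho)" "isCont (HH rho) t"
 using DERIV_isCont[OF HH_deriv] by (simp_all add: continuous_at_imp_continuous_on)

lemma hh_le_mono: "0 <= rho ==> \<bar>s\<bar> <= \<bar>t\<bar> ==> hh rho t <= hh rho s"
 unfolding hh_def by (intro real_sqrt_le_mono diff_left_mono mult_left_mono min.mono) (auto simp: abs_le_square_iff)

lemma hh_0 [simp]: "hh rho 0 = 1" by (simp add: hh_def)

lemma hh_le_1: "0 <= rho ==> hh rho t <= 1" using hh_le_mono[of rho 0 t] by simp

lemma hh_1: "hh rho 1 = sqrt (1 - rho)" by (simp add: hh_def)

lemma hh_ge: "0 <= rho ==> hh rho t >= sqrt (1 - rho)"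
 unfolding hh_def by (intro real_sqrt_le_mono diff_left_mono) (auto simp: mult_left_le)

lemma hh_nonneg: "0 <= rho ==> rho <= 1 ==> hh rho t >= 0" 
 using hh_ge[of rho t] by (meson diff_ge_0_iff_ge order_trans real_sqrt_ge_zero)

lemma hh_pos: "0 <= rho ==> rho < 1 ==> hh rho t > 0" 
 using hh_ge[of rho t] by (smt (verit) real_sqrt_gt_0_iff)

lemma hh_square:
 assumes "0 <= rho" "rho <= 1" "\<bar>t\<bar> <= 1" shows "(hh rho t)^2 = 1 - rho * t^2"
proof -
 have t: "t^2 <= 1" using assms by (simp add: abs_square_le_1)
 then have "rho * t^2 <= 1 * 1" using assms by (intro mult_mono) auto
 then show ?thesis using t by (simp add: hh_def min_absorb2)
qed

lemma hh_ge_half: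
 assumes "0 <= rho" "rho <= 1" "\<bar>t\<bar> <= 1/2" shows "hh rho t >= 1/2" "1 - t^2 <= (hh rho t)^2" "t^2 <= 1/4"
proof -
 have t: "t^2 <= (1/2)^2" using power_mono[OF assms(3), of 2] by simp
 then show t2: "t^2 <= 1/4" by (simp add: power2_eq_square)
 have "rho * t^2 <= 1 * t^2" using assms by (intro mult_right_mono) auto
 then show h2: "1 - t^2 <= (hh rho t)^2" using hh_square[of rho t] assms by auto
 then have "(1/2)^2 <= (hh rho t)^2" using t2 by (simp add: power2_eq_square)
 then show "hh rho t >= 1/2" by (rule power2_le_imp_le) (use hh_nonneg assms in auto)
qed

lemma HH_mvt:
 obtains tau where "\<bar>tau\<bar> <= \<bar>t\<bar>" "HH rho t = t * hh rho tau"
proof (cases t "0::real" rule: linorder_cases)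
 case less
 then obtain z where "t < z" "z < 0" "HH rho 0 - HH rho t = (0 - t) * hh rho z" using MVT2[of t 0 "HH rho" "hh rho"] HH_deriv by blast
 then show ?thesis using that[of z] by (simp add: HH_0)
next
 case greater
 then obtain z where "0 < z" "z < t" "HH rho t - HH rho 0 = (t - 0) * hh rho z" using MVT2[of 0 t "HH rho" "hh rho"] HH_deriv by blast
 then show ?thesis using that[of z] by (simp add: HH_0)
qed (use that[of 0] in \<open>simp add: HH_0\<close>)

lemma HH_abs_le: "0 <= rho ==> rho <= 1 ==> \<bar>HH rho t\<bar> <= \<bar>t\<bar>"
 by (rule HH_mvt[of t rho]) (use hh_le_1 hh_nonneg in \<open>auto simp: abs_mult mult_left_le\<close>)

lemma HH_mono: "0 <= rho ==> rho <= 1 ==> s <= t ==> HH rho s <= HH rho t"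
 by (rule DERIV_nonneg_imp_nondecreasing) (auto intro!: exI conjI HH_deriv hh_nonneg)

text \<open>\<open>HH rho\<close> is concave on \<open>[0, 1]\<close> because \<open>hh rho\<close>
  decreases there. The factor \<open>hh rho t\<close> on the right is what later cancels the
  \<open>1 / h\<close> singularity of the zeroth-order term.\<close>

lemma HH_concave:
 assumes "0 <= rho" "rho <= 1" "0 <= t" "t <= 1" shows "HH rho 1 - HH rho t <= hh rho t * (1 - t)"
proof (cases "t = 1")
 case False
 then obtain z where z: "t < z" "z < 1" "HH rho 1 - HH rho t = (1 - t) * hh rho z" using MVT2[of t 1 "HH rho" "hh rho"] HH_deriv assms by force
 then show ?thesis using hh_le_mono[of rho t z] assms mult_left_mono[of "hh rho z" "hh rho t" "1 - t"] by (simp add: mult.commute)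
qed simp

text \<open>Subadditivity of the square root makes the comparison uniform in \<open>t\<close>; so
  \<open>rho\<close> may vary along the sequence when limits are taken.\<close>

lemma hh_compare:
 assumes "0 <= rho" "rho <= 1" shows "hh 1 t <= hh rho t" "hh rho t <= hh 1 t + sqrt (1 - rho)"
proof -
 let ?m = "min 1 (t^2)"
 have m: "0 <= ?m" "?m <= 1" by auto
 have "rho * ?m <= 1 * ?m" using m assms by (intro mult_right_mono) auto
 then show "hh 1 t <= hh rho t" unfolding hh_def by (intro real_sqrt_le_mono) auto
 have "(1 - rho) * ?m <= (1 - rho) * 1" using m assms by (intro mult_left_mono) auto
 then have "1 - rho * ?m <= (1 - ?m) + (1 - rho)" by (simp add: algebra_simps)
 then have "hh rho t <= sqrt ((1 - ?m) + (1 - rho))" unfolding hh_def by (rule real_sqrt_le_mono)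
 also have "\<dots> <= sqrt (1 - ?m) + sqrt (1 - rho)" using m assms by (intro sqrt_add_le_add_sqrt) auto
 finally show "hh rho t <= hh 1 t + sqrt (1 - rho)" by (simp add: hh_def)
qed

lemma HH_compare:
 assumes r: "0 <= rho" "rho <= 1" shows "\<bar>HH rho t - HH 1 t\<bar> <= sqrt (1 - rho) * \<bar>t\<bar>" "HH 1 1 <= HH rho 1"
proof -
 have d: "((%t. HH rho t - HH 1 t) has_real_derivative hh rho t - hh 1 t) (at t)" for t
  by (intro DERIV_diff HH_deriv)
 have "\<bar>(HH rho t - HH 1 t) - (HH rho 0 - HH 1 0)\<bar> <= sqrt (1 - rho) * \<bar>t - 0\<bar>"
  by (rule field_differentiable_bound[where S = UNIV and f = "%t. HH rho t - HH 1 t", unfolded real_norm_def, OF _ has_field_derivative_at_within[OF d]])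
   (use hh_compare[OF r] in \<open>auto simp: abs_le_iff algebra_simps intro: order_trans\<close>)
 then show "\<bar>HH rho t - HH 1 t\<bar> <= sqrt (1 - rho) * \<bar>t\<bar>" by (simp add: HH_0)
 have "HH rho 0 - HH 1 0 <= HH rho 1 - HH 1 1"
  by (rule DERIV_nonneg_imp_nondecreasing[OF zero_le_one]) (use hh_compare[OF r] in \<open>auto intro!: exI conjI d\<close>)
 then show "HH 1 1 <= HH rho 1" by (simp add: HH_0)
qed

text \<open>For \<open>|t| <= 1/2\<close> the weight is at least \<open>1/2\<close>, whatever
  \<open>rho\<close> is. The thresholds \<open>1/2\<close>, \<open>1/4\<close> and
  \<open>1/8\<close> in the bounds for \<open>u\<close> and \<open>w\<close> stem from this.\<close>

lemma HH_half:
 assumes r: "0 <= rho" "rho <= 1" shows "\<bar>t\<bar> <= 1/2 ==> \<bar>t\<bar> <= 2 * \<bar>HH rho t\<bar>" "\<bar>t\<bar> >= 1/2 ==> \<bar>HH rho t\<bar> >= 1/4"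
proof -
 show a: "\<bar>t\<bar> <= 2 * \<bar>HH rho t\<bar>" if "\<bar>t\<bar> <= 1/2" for t
 proof (rule HH_mvt[of t rho])
  fix tau assume "\<bar>tau\<bar> <= \<bar>t\<bar>" "HH rho t = t * hh rho tau"
  moreover have "\<bar>t\<bar> * (1/2) <= \<bar>t\<bar> * hh rho tau" using calculation(1) that hh_ge_half(1)[OF r, of tau] by (intro mult_left_mono) auto
  ultimately show ?thesis using hh_nonneg[OF r, of tau] by (simp add: abs_mult)
 qed
 show "\<bar>HH rho t\<bar> >= 1/4" if t: "\<bar>t\<bar> >= 1/2"
  using a[of "1/2"] a[of "- (1/2)"] t HH_mono[OF r, of 0 "1/2"] HH_mono[OF r, of "1/2" t] HH_mono[OF r, of t "- (1/2)"] HH_mono[OF r, of "- (1/2)" 0]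
  by (cases "t >= 0") (auto simp: HH_0)
qed

lemma HH_1_bounds: "0 <= rho ==> rho <= 1 ==> 1/4 <= HH rho 1" "0 <= rho ==> rho <= 1 ==> HH rho 1 <= 1"
 using HH_half(2)[of rho 1] HH_mono[of rho 0 1] HH_abs_le[of rho 1] by (auto simp: HH_0)

context
 fixes rho :: real
 assumes r: "0 <= rho" "rho < 1"
begin

lemma HH_strict_mono: "strict_mono (HH rho)"
 by (rule strict_monoI, erule DERIV_pos_imp_increasing) (auto intro!: exI conjI HH_deriv hh_pos[OF r])

lemma HH_abs_ge: "\<bar>HH rho t\<bar> >= sqrt (1 - rho) * \<bar>t\<bar>"
proof (rule HH_mvt[of t rho])
 fix tau assume "HH rho t = t * hh rho tau"
 then show ?thesis using mult_right_mono[OF hh_ge[OF r(1), of tau], of "\<bar>t\<bar>"] hh_pos[OF r, of tau] by (simp add: abs_mult mult.commute)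
qed

lemma HH_UU [simp]: "HH rho (UU rho s) = s" and UU_HH [simp]: "UU rho (HH rho t) = t"
proof -
 have i: "inj (HH rho)" using HH_strict_mono by (rule strict_mono_imp_inj_on)
 then show "UU rho (HH rho t) = t" by (simp add: UU_def)
 define e where "e = sqrt (1 - rho)"
 have e: "e > 0" using r by (simp add: e_def)
 define T where "T = \<bar>s\<bar> / e"
 have T: "T >= 0" "e * T = \<bar>s\<bar>" using e by (auto simp: T_def)
 have "HH rho (- T) <= 0" "0 <= HH rho T" using HH_mono[of rho "-T" 0] HH_mono[of rho 0 T] r T by (auto simp: HH_0)
 then have "HH rho (- T) <= s" "s <= HH rho T" using HH_abs_ge[of "-T"] HH_abs_ge[of T] T by (auto simp: e_def[symmetric])
 then obtain t where "HH rho t = s" using IVT'[of "HH rho" "-T" s T] T HH_cont by auto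
 then show "HH rho (UU rho s) = s" unfolding UU_def by (metis UNIV_I f_inv_into_f rangeI)
qed

lemma UU_mono: "s <= t ==> UU rho s <= UU rho t"
 using HH_strict_mono by (metis HH_UU strict_mono_less_eq)

lemma UU_0 [simp]: "UU rho 0 = 0" using UU_HH[of 0] by (simp add: HH_0)

lemma UU_cont: "isCont (UU rho) s"
 using isCont_inverse_function[of 1 "UU rho s" "UU rho" "HH rho"] HH_cont by simp

lemma UU_deriv: "(UU rho has_real_derivative 1 / hh rho (UU rho s)) (at s)"
proof -
 have "(UU rho has_real_derivative inverse (hh rho (UU rho s))) (at s)"
  by (rule DERIV_inverse_function[where a = "s - 1" and b = "s + 1", OF HH_deriv])
   (use hh_pos[OF r, of "UU rho s"] UU_cont in auto)
 then show ?thesis by (simp add: inverse_eq_divide)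
qed

lemma UU_small: 
 assumes "\<bar>s\<bar> < 1/4" shows "\<bar>UU rho s\<bar> <= 1/2" "\<bar>UU rho s\<bar> <= 2 * \<bar>s\<bar>"
proof -
 show a: "\<bar>UU rho s\<bar> <= 1/2" using HH_half(2)[of rho "UU rho s"] r assms by fastforce
 then show "\<bar>UU rho s\<bar> <= 2 * \<bar>s\<bar>" using HH_half(1)[OF _ _ a] r by fastforce
qed

lemma UU_range:
 assumes "- (1/8) <= s" "s <= HH rho 1" shows "- (1/4) <= UU rho s" "UU rho s <= 1"
 using UU_mono[OF assms(1)] UU_mono[OF assms(2)] UU_small(2)[of "- (1/8)"] by auto

lemma alpha_eq: "alpha rho s * s * hh rho (UU rho s) = UU rho s" "alpha rho s * s = UU rho s / hh rho (UU rho s)"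
 using hh_pos[OF r, of "UU rho s"] by (auto simp: alpha_def)

text \<open>By the mean value theorem \<open>HH rho u = u * hh rho tau\<close> with
  \<open>|tau| <= |u|\<close>, so \<open>alpha\<close> is \<open>1 / (hh rho u * hh rho tau)\<close>
  with both factors at most 1.\<close>

lemma alpha_bounds: "1 <= alpha rho s" "alpha rho s <= 1 / (hh rho (UU rho s))^2"
proof -
 define u where "u = UU rho s"
 have h: "hh rho u > 0" "hh rho u <= 1" using hh_pos[OF r] hh_le_1 r by auto
 obtain tau where t: "\<bar>tau\<bar> <= \<bar>u\<bar>" "HH rho u = u * hh rho tau" by (rule HH_mvt)
 have h': "hh rho tau > 0" "hh rho tau <= 1" "hh rho u <= hh rho tau" using hh_pos[OF r] hh_le_1 hh_le_mono[OF r(1) t(1)] r by auto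
 have su: "s = u * hh rho tau" using t(2) by (simp add: u_def)
 have a: "alpha rho s = 1 / (hh rho u * hh rho tau)" if "s \<noteq> 0"
 proof -
  have "alpha rho s = u / (hh rho u * (u * hh rho tau))" using that by (simp add: alpha_def u_def[symmetric] su[symmetric])
  moreover have "u \<noteq> 0" using that su by auto
  ultimately show ?thesis by simp
 qed
 have p: "hh rho u * hh rho tau <= 1" "hh rho u * hh rho u <= hh rho u * hh rho tau" "hh rho u * hh rho tau > 0" "hh rho u * hh rho u > 0"
  using h h' by (auto intro: mult_le_one mult_left_mono)
 show "1 <= alpha rho s" using p a by (cases "s = 0") (auto simp: alpha_def)
 show "alpha rho s <= 1 / (hh rho (UU rho s))^2"
  unfolding u_def[symmetric] power2_eq_square using p a h by (cases "s = 0") (auto simp: alpha_def u_def intro: frac_le)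
qed

lemma alpha_le: "alpha rho s <= 1 / (1 - rho)"
proof -
 have "1 - rho = (sqrt (1 - rho))^2" using r by simp
 also have "\<dots> <= (hh rho (UU rho s))^2" using hh_ge[OF r(1)] r by (intro power_mono) auto
 finally have "1 / (hh rho (UU rho s))^2 <= 1 / (1 - rho)" using r by (intro frac_le) auto
 then show ?thesis using alpha_bounds(2)[of s] by linarith
qed

text \<open>Uniform in \<open>rho\<close>: away from the sphere, where \<open>w\<close> is small,
  the coefficient is a small perturbation of \<open>V\<close>.\<close>

lemma alpha_small: 
 assumes s: "\<bar>s\<bar> < 1/4" shows "\<bar>alpha rho s - 1\<bar> <= 8 * s^2"
proof -
 define u where "u = UU rho s"
 note u = UU_small[OF s, folded u_def]
 note h = hh_ge_half(2,3)[OF r(1) less_imp_le[OF r(2)] u(1)]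
 have "alpha rho s <= 1 / (1 - u^2)"
  by (rule order_trans[OF alpha_bounds(2)]) (use h in \<open>auto intro!: frac_le simp: u_def[symmetric]\<close>)
 also have "\<dots> <= 1 + 2 * u^2"
 proof -
  have "(u^2) * (2 * u^2) <= u^2 * 1" using h by (intro mult_left_mono) auto
  then have "1 <= (1 + 2 * u^2) * (1 - u^2)" by (simp add: algebra_simps)
  then show ?thesis using h by (subst pos_divide_le_eq) auto
 qed
 also have "u^2 <= (2 * \<bar>s\<bar>)^2" using power_mono[OF u(2), of 2] by simp
 finally show ?thesis using alpha_bounds(1)[of s] by (simp add: power_mult_distrib)
qed

lemma alpha_cont: "continuous_on UNIV (alpha rho)"
proof -
 have "isCont (alpha rho) s" for s
 proof (cases "s = 0")
  case True
  have "((%s. alpha rho s - 1) \<longlongrightarrow> 0) (at 0)"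
  proof (rule Lim_null_comparison)
   show "\<forall>\<^sub>F s in at 0. norm (alpha rho s - 1) <= 8 * s^2"
    unfolding eventually_at by (intro exI[of _ "1/4"]) (use alpha_small in \<open>auto simp: dist_real_def\<close>)
   show "((%s::real. 8 * s^2) \<longlongrightarrow> 0) (at 0)" by (auto intro!: tendsto_eq_intros)
  qed
  from LIM_zero_cancel[OF this] show ?thesis using True by (simp add: isCont_def alpha_def[of rho 0])
 next
  case False
  have c: "isCont (%s. UU rho s / (hh rho (UU rho s) * s)) s"
   using False hh_pos[OF r, of "UU rho s"] by (intro continuous_intros UU_cont isCont_o2[OF UU_cont hh_cont(2)]) auto
  have "\<forall>\<^sub>F t in nhds s. alpha rho t = UU rho t / (hh rho (UU rho t) * t)"
   using t1_space_nhds[OF False] by eventually_elim (auto simp: alpha_def)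
  then show ?thesis using c by (simp add: isCont_cong)
 qed
 then show ?thesis by (simp add: continuous_at_imp_continuous_on)
qed

end

section \<open>Uniform bounds\<close>

definition lap :: "(real^'n::finite => real) => real^'n => real" where
 "lap phi x = (\<Sum>i\<in>UNIV. pd i (pd i phi) x)"

lemma lap_C_inf: "phi \<in> C_inf ==> lap phi \<in> C_inf"
 unfolding lap_def[abs_def] by (intro C_inf_sum C_inf_partial) auto

lemma grad_lap_eq_0:
 assumes "phi \<in> C_inf" "open U" "x \<in> U" "!!y. y \<in> U ==> phi y = c"
 shows "grad phi x = 0" "lap phi x = 0"
proof -
 have p: "pd i phi y = 0" if "y \<in> U" for i y by (rule partial_deriv_eq_0[OF assms(1,2) that assms(4)])
 then show "grad phi x = 0" using assms(3) by (simp add: vec_eq_iff grad_nth)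
 show "lap phi x = 0"
  unfolding lap_def using partial_deriv_eq_0[OF C_inf_partial[OF assms(1)] assms(2,3) p] by simp
qed

lemma weak_laplacian:
 assumes w: "wgrad xi eta" and z: "zeta \<in> Cc"
 shows "(LBINT x. grad zeta x \<bullet> eta x) = - (LBINT x. lap zeta x * xi x)"
  "integrable lborel (%x. lap zeta x * xi x)"
proof -
 note p = Cc_infinity_partial[OF z]
 have i1: "integrable lborel (%x. eta x $ i * pd i zeta x)" for i
  using integrable_sq_mult[OF sq_int_nth[OF wgradD(2)[OF w]] sq_int_test[OF p]] .
 have i2: "integrable lborel (%x. xi x * pd i (pd i zeta) x)" for i
  using integrable_sq_mult[OF wgradD(1)[OF w] sq_int_test[OF Cc_infinity_partial[OF p]]] .
 have e1: "grad zeta x \<bullet> eta x = (\<Sum>i\<in>UNIV. eta x $ i * pd i zeta x)" for x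
  by (simp add: inner_vec_def grad_nth mult.commute)
 have e2: "lap zeta x * xi x = (\<Sum>i\<in>UNIV. xi x * pd i (pd i zeta) x)" for x
  by (simp add: lap_def sum_distrib_left mult.commute)
 show "integrable lborel (%x. lap zeta x * xi x)" unfolding e2 using i2 by simp
 show "(LBINT x. grad zeta x \<bullet> eta x) = - (LBINT x. lap zeta x * xi x)"
  unfolding e1 e2 using i1 i2 wgradD(5)[OF w p] by (simp add: sum_negf)
qed

definition cutoff :: "real^'n::finite => real => real => real => (real^'n => real) => bool" where
 "cutoff c r R G zeta \<longleftrightarrow> zeta \<in> Cc & (\<forall>x. 0 <= zeta x & zeta x <= 1 & (dist c x <= r --> zeta x = 1) & (dist c x >= R --> zeta x = 0) &
  norm (grad zeta x) <= G & \<bar>lap zeta x\<bar> <= G & (dist c x < r \<or> dist c x > R --> grad zeta x = 0 & lap zeta x = 0))"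

text \<open>All cutoffs are translates of a single one, so \<open>G\<close> does not depend on the
  centre, which will be chosen after \<open>G\<close>.\<close>

lemma shifted_cutoffs:
 assumes rR: "0 <= r" "r < R" shows "\<exists>G>0. \<forall>c::real^'n::finite. \<exists>zeta. cutoff c r R G zeta"
proof -
 obtain zeta :: "real^'n => real" where z: "zeta \<in> Cc" "!!x. 0 <= zeta x & zeta x <= 1 & (norm x <= r --> zeta x = 1) & (norm x >= R --> zeta x = 0)"
  using ball_cutoff[OF rR] by blast
 have zC: "zeta \<in> C_inf" by (rule Cc_infinityD(1)[OF z(1)])
 have out: "grad zeta x = 0 & lap zeta x = 0" if "norm x < r \<or> norm x > R" for x
  using that grad_lap_eq_0[OF zC open_ball[of 0 r], of x 1] grad_lap_eq_0[OF zC open_Compl[OF closed_cball[of 0 R]], of x 0] z(2) by auto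
 have "lap zeta \<in> Cc" by (rule Cc_infinityI[OF lap_C_inf[OF zC], of R]) (use out in force)
 then obtain G1 G2 where G: "G1 > 0" "!!x. norm (grad zeta x) <= G1" "!!x. \<bar>lap zeta x\<bar> <= G2"
  using grad_bounded[OF z(1)] test_bounded by metis
 have d: "zeta differentiable (at x)" "pd i zeta differentiable (at x)" for i x
  using C_inf_differentiable[OF zC] C_inf_differentiable[OF C_inf_partial[OF zC]] by auto
 have s: "pd i (%x. zeta (x - c)) = (%x. pd i zeta (x - c))" for i c
  using partial_deriv_shift[OF d(1)] by auto
 have g: "grad (%x. zeta (x - c)) x = grad zeta (x - c)" "lap (%x. zeta (x - c)) x = lap zeta (x - c)" for c x
  by (auto simp: grad_def lap_def s partial_deriv_shift[OF d(2)])
 show ?thesis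
 proof (intro exI[of _ "max G1 G2"] conjI allI)
  fix c :: "real^'n"
  show "\<exists>zeta. cutoff c r R (max G1 G2) zeta"
   unfolding cutoff_def using G z(2) out by (intro exI[of _ "%x. zeta (x - c)"] conjI Cc_infinity_shift[OF z(1)])
    (auto simp: g dist_norm norm_minus_commute le_max_iff_disj)
 qed (use G in auto)
qed

lemma sq_int_indicator_cball: "sq_int (indicator (cball c r) :: _ => real)"
proof (rule sq_int_bounded_support[where B = 1 and R = "norm c + r"])
 fix x assume "(indicator (cball c r) x :: real) \<noteq> 0"
 then show "norm x <= norm c + r" using norm_triangle_sub[of x c] by (simp add: indicator_def dist_norm norm_minus_commute split: if_splits)
qed (auto simp: indicator_def borel_closed intro!: borel_measurable_indicator)

lemma grad_square: "psi \<in> C_inf ==> grad (%x. psi x * psi x) x = (2 * psi x) *R grad psi x"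
 by (simp add: vec_eq_iff grad_nth partial_deriv_mult)

context coercive_potential
begin

lemma inX_cong_on:
 assumes "inE xi eta" "inX B xi' eta'" "!!x. x \<in> B ==> xi x = xi' x & eta x = eta' x"
 shows "inX B xi eta"
proof -
 have "(%x. indicator B x * xi x) = (%x. indicator B x * xi' x)" "(%x. indicator B x *R eta x) = (%x. indicator B x *R eta' x)"
  using assms(3) by (auto simp: indicator_def fun_eq_iff)
 then show ?thesis using assms(1,2) by (simp add: inX_def)
qed

section \<open>Subsolutions and sup bounds uniform in \<open>rho\<close>\<close>

abbreviation pg :: "(real^'n => real) => (real^'n => real^'n) => real => real^'n => real^'n" where
 "pg y g k x \<equiv> ((sgn (y x - k) + 1) / 2) *R g x"

text \<open>One notion for both one-sided bounds. It will hold for \<open>w\<close> minus the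
  lifting of its boundary value, where the Laplacian of the lifting causes the source of size
  \<open>S\<close> in \<open>cball c 2\<close>, and for \<open>- w\<close>. In both cases the
  truncations vanish on the sphere.\<close>

definition subsol :: "real^'n => (real^'n => real) => real => (real^'n => real) => (real^'n => real^'n) => bool" where
 "subsol c Q S y g \<longleftrightarrow> inE y g & (\<forall>k\<ge>0. inX (ball c 1) (%x. max 0 (y x - k)) (pg y g k)) &
   (\<forall>xi eta. inX (ball c 1) xi eta --> (\<forall>x. 0 <= xi x & (xi x \<noteq> 0 --> y x > 0)) -->
    aform Q y g xi eta <= S * (LBINT x. indicator (cball c 2) x * xi x))"

text \<open>Testing with \<open>max 0 (y - k)\<close>. In \<open>cball c 2\<close> the large
  coefficient times the level absorbs the source, and elsewhere \<open>Q >= - m0\<close> suffices;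
  the result is the hypothesis of \<open>de_giorgi\<close>, with a constant free of
  \<open>C\<close>.\<close>

lemma subsol_energy:
 assumes sub: "subsol c Q S y g" and Q: "Q \<in> BM" "!!x. \<bar>Q x\<bar> <= C * Vm x" "!!x. Q x >= Vm x / 2 - m0"
  and L: "!!x. x \<in> cball c 2 ==> Q x >= L" "L * kappa >= S" "L >= 0" and k: "kappa > 0" "k >= kappa"
 shows "(LBINT x. (norm (pg y g k x))^2)
  <= m0 * (LBINT x. (max 0 (y x - k))^2) + m0 * k * (LBINT x. max 0 (y x - k))"
proof -
 let ?I = "%x. indicator (cball c 2) x :: real"
 define xi where "xi = (%x. max 0 (y x - k))"
 define eta where "eta = pg y g k"
 have Ey: "inE y g" using sub by (simp add: subsol_def)
 have X: "inX (ball c 1) xi eta" using sub k by (simp add: subsol_def xi_def eta_def)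
 note E = inXD(1)[OF X]
 note i = integrable_form(1,2)[OF Ey E Q(1,2)]
 have ix: "integrable lborel xi" unfolding xi_def by (rule superlevel_integrable(2)[OF inED(2)[OF Ey]]) (use k in simp)
 have ix2: "integrable lborel (%x. (xi x)^2)" using sq_int_integrable[OF inED(2)[OF E]] by simp
 have iI: "integrable lborel (%x. ?I x * xi x)" by (rule integrable_sq_mult[OF sq_int_indicator_cball inED(2)[OF E]])
 have a: "aform Q y g xi eta <= S * (LBINT x. ?I x * xi x)"
 proof -
  have "\<forall>x. 0 <= xi x & (xi x \<noteq> 0 --> y x > 0)" using k by (auto simp: xi_def max_def split: if_splits)
  then show ?thesis using sub X unfolding subsol_def by blast
 qed
 have "(LBINT x. (norm (eta x))^2) <= (LBINT x. g x \<bullet> eta x)"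
 proof (rule integral_mono[OF sq_int_integrable[OF inED(3)[OF E]] i(2)])
  fix x
  define t where "t = (sgn (y x - k) + 1) / 2"
  have "0 <= t" "t <= 1" by (simp_all add: t_def sgn_real_def)
  then have "t * t <= 1 * t" by (intro mult_right_mono) auto
  then have "t * t * (norm (g x))^2 <= 1 * t * (norm (g x))^2" by (rule mult_right_mono) simp
  then show "(norm (eta x))^2 <= g x \<bullet> eta x"
   by (simp add: eta_def t_def[symmetric] power_mult_distrib dot_square_norm power2_eq_square[of t])
 qed
 also have "\<dots> <= S * (LBINT x. ?I x * xi x) - (LBINT x. Q x * y x * xi x)" using a by (simp add: aform_def)
 also have "\<dots> = (LBINT x. S * (?I x * xi x) - Q x * y x * xi x)" using i iI by simp
 also have "\<dots> <= (LBINT x. m0 * (xi x)^2 + m0 * k * xi x)"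
 proof (rule integral_mono)
  show "integrable lborel (%x. S * (?I x * xi x) - Q x * y x * xi x)" using i iI by simp
  show "integrable lborel (%x. m0 * (xi x)^2 + m0 * k * xi x)" using ix ix2 by simp
  fix x
  show "S * (?I x * xi x) - Q x * y x * xi x <= m0 * (xi x)^2 + m0 * k * xi x"
  proof (cases "y x > k")
   case True
   then have p: "xi x > 0" "y x = xi x + k" by (auto simp: xi_def)
   have r: "0 <= m0 * (xi x + k)" using m0_nonneg p k by simp
   have "S * ?I x - Q x * (xi x + k) <= m0 * (xi x + k)"
   proof (cases "x \<in> cball c 2")
    case True
    have "L * kappa <= Q x * (xi x + k)" using L(1)[OF True] L(3) p k by (intro mult_mono) auto
    then show ?thesis using True L(2) r by simp
   next
    case False
    have "- m0 * (xi x + k) <= Q x * (xi x + k)" using Q(3)[of x] Vm_pos[of x] p k by (intro mult_right_mono) auto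
    then show ?thesis using False by simp
   qed
   then have "(S * ?I x - Q x * (xi x + k)) * xi x <= (m0 * (xi x + k)) * xi x" using p by (intro mult_right_mono) auto
   then show ?thesis unfolding p(2) by (simp add: algebra_simps power2_eq_square)
  qed (simp add: xi_def)
 qed
 also have "\<dots> = m0 * (LBINT x. (xi x)^2) + m0 * k * (LBINT x. xi x)" using ix ix2 by simp
 finally show ?thesis by (simp add: xi_def eta_def)
qed

text \<open>Caccioppoli inequality with the test function \<open>psi^2 * max 0 y\<close>. As
  \<open>Q >= L\<close> on the support of \<open>psi\<close>, the bound for the mass gains a factor
  \<open>1 / L\<close> over that for the gradient; this gain drives the halving argument in
  \<open>uniform_sup_bound\<close>.\<close>

lemma subsol_local:
 assumes sub: "subsol c Q S y g" and Q: "Q \<in> BM" "!!x. \<bar>Q x\<bar> <= C * Vm x"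
  and L: "\<forall>x\<in>cball c 5. Q x >= L" "L > 0" "S >= 0" and M: "AE x in lborel. y x <= M" "M > 0"
  and psi: "psi \<in> Cc" "!!x. 0 <= psi x & psi x <= 1 & norm (grad psi x) <= G & (x \<notin> cball c 5 --> psi x = 0 & grad psi x = 0)"
 defines "P \<equiv> (2 * M^2 * G^2 + S * M) * measure lborel (cball c 5)"
 shows "(LBINT x. (psi x)^2 * (norm (pg y g 0 x))^2) <= 2 * P" "(LBINT x. (psi x)^2 * (max 0 (y x))^2) <= P / L"
  "integrable lborel (%x. (psi x)^2 * (norm (pg y g 0 x))^2)" "integrable lborel (%x. (psi x)^2 * (max 0 (y x))^2)"
proof -
 let ?I = "%x. indicator (cball c 2) x :: real" and ?J = "%x. indicator (cball c 5) x :: real"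
 define xi where "xi = (%x. max 0 (y x))"
 define eta where "eta = pg y g 0"
 have Ey: "inE y g" using sub by (simp add: subsol_def)
 have "inX (ball c 1) (%x. max 0 (y x - 0)) (pg y g 0)" using sub unfolding subsol_def by blast
 then have X: "inX (ball c 1) xi eta" by (simp add: xi_def eta_def)
 note E = inXD(1)[OF X]
 define phi where "phi x = psi x * psi x" for x
 have psiC: "psi \<in> C_inf" by (rule Cc_infinityD(1)[OF psi(1)])
 have phi: "phi \<in> Cc" unfolding phi_def[abs_def] by (rule Cc_infinity_mult[OF psi(1) psiC])
 have gphi: "grad phi x = (2 * psi x) *R grad psi x" for x unfolding phi_def[abs_def] by (rule grad_square[OF psiC])
 define eta' where "eta' x = phi x *R eta x + xi x *R grad phi x" for x
 have X': "inX (ball c 1) (%x. phi x * xi x) eta'" unfolding eta'_def by (rule inX_mult_test[OF X phi])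
 note E' = inXD(1)[OF X']
 have phi0: "phi x >= 0" for x by (simp add: phi_def)
 have "\<forall>x. 0 <= phi x * xi x & (phi x * xi x \<noteq> 0 --> y x > 0)" using phi0 by (auto simp: xi_def max_def)
 then have a: "aform Q y g (%x. phi x * xi x) eta' <= S * (LBINT x. ?I x * (phi x * xi x))"
  using sub X' unfolding subsol_def by blast
 note i = integrable_form(1,2)[OF Ey E' Q]
 have iI: "integrable lborel (%x. ?I x * (phi x * xi x))" by (rule integrable_sq_mult[OF sq_int_indicator_cball inED(2)[OF E']])
 have iJ: "integrable lborel ?J" using emeasure_cball_finite[of c 5] by (simp add: borel_closed)
 have s1: "sq_int (%x. psi x *R eta x)" "sq_int (%x. psi x *R xi x)"
  using sq_int_mult_test[OF inED(3)[OF E] psi(1)] sq_int_mult_test[OF inED(2)[OF E] psi(1)] by auto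
 have s2: "integrable lborel (%x. (psi x)^2 * (norm (eta x))^2)" "integrable lborel (%x. (psi x)^2 * (xi x)^2)"
  using sq_int_integrable[OF s1(1)] sq_int_integrable[OF s1(2)] by (auto simp: power_mult_distrib)
 then show "integrable lborel (%x. (psi x)^2 * (norm (pg y g 0 x))^2)" "integrable lborel (%x. (psi x)^2 * (max 0 (y x))^2)"
  by (auto simp: xi_def eta_def)
 have pw: "(1/2) * ((psi x)^2 * (norm (eta x))^2) + L * ((psi x)^2 * (xi x)^2) - (2 * M^2 * G^2 + S * M) * ?J x
   <= g x \<bullet> eta' x + Q x * y x * (phi x * xi x) - S * (?I x * (phi x * xi x))" if yM: "y x <= M" for x
 proof (cases "x \<in> cball c 5")
  case True
  have MG: "2 * M^2 * G^2 + S * M >= 0" using M L by simp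
  show ?thesis
  proof (cases "y x > 0")
   case y: True
   then have e: "xi x = y x" "eta x = g x" by (auto simp: xi_def eta_def)
   have "\<bar>grad psi x \<bullet> g x\<bar> <= G * norm (g x)"
    using Cauchy_Schwarz_ineq2[of "grad psi x" "g x"] mult_right_mono[of "norm (grad psi x)" G "norm (g x)"] psi(2)[of x] by simp
   then have "psi x * y x * \<bar>grad psi x \<bullet> g x\<bar> <= psi x * y x * (G * norm (g x))" using psi(2)[of x] y by (intro mult_left_mono) auto
   moreover have "psi x * y x * (- (grad psi x \<bullet> g x)) <= psi x * y x * \<bar>grad psi x \<bullet> g x\<bar>"
    using psi(2)[of x] y by (intro mult_left_mono abs_ge_minus_self) auto
   moreover have "2 * (psi x * norm (g x)) * (2 * y x * G) <= (psi x * norm (g x))^2 + (2 * y x * G)^2"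
    using sum_squares_bound[of "psi x * norm (g x)" "2 * y x * G"] by simp
   moreover have "(y x)^2 * G^2 <= M^2 * G^2" using yM y by (intro mult_right_mono power_mono) auto
   moreover have "(psi x)^2 * (L * (y x)^2) <= (psi x)^2 * (Q x * (y x)^2)" using bspec[OF L(1) True] by (intro mult_left_mono mult_right_mono) auto
   moreover have "S * (?I x * (phi x * y x)) <= S * M"
   proof (intro mult_left_mono L)
    have "phi x <= 1" using psi(2)[of x] unfolding phi_def by (intro mult_le_one) auto
    then have "phi x * y x <= 1 * y x" using y by (intro mult_right_mono) auto
    then show "?I x * (phi x * y x) <= M" using yM M by (auto simp: indicator_def)
   qed
   moreover have "g x \<bullet> eta' x = (psi x)^2 * (norm (g x))^2 + 2 * (psi x * y x * (grad psi x \<bullet> g x))"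
    unfolding eta'_def gphi e phi_def power2_norm_eq_inner by (simp add: inner_add_right power2_eq_square inner_commute)
   ultimately show ?thesis using True unfolding e by (simp add: phi_def power_mult_distrib power2_eq_square algebra_simps)
  next
   case False
   then have e: "xi x = 0" by (auto simp: xi_def)
   \<comment> \<open>At points with \<open>y x = 0\<close> the expression \<open>pg\<close> is half
     of the gradient, so \<open>t\<close> may be \<open>1/2\<close> here.\<close>
   define t where "t = (sgn (y x - 0) + 1) / 2"
   have t: "0 <= t" "t <= 1" "eta x = t *R g x" by (auto simp: t_def eta_def sgn_real_def)
   have "t * t <= 1 * t" using t by (intro mult_right_mono) auto
   then have "(1/2) * (t * t) <= t" using t by linarith
   then have "((1/2) * (t * t)) * ((psi x)^2 * (norm (g x))^2) <= t * ((psi x)^2 * (norm (g x))^2)" by (intro mult_right_mono) auto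
   moreover have "g x \<bullet> eta' x = t * ((psi x)^2 * (norm (g x))^2)"
    unfolding eta'_def e t(3) phi_def power2_norm_eq_inner by (simp add: power2_eq_square)
   moreover have "(norm (eta x))^2 = t * t * (norm (g x))^2" unfolding t(3) by (simp add: power_mult_distrib power2_eq_square)
   ultimately show ?thesis using MG True by (simp add: e mult_ac)
  qed
 next
  case False
  then show ?thesis using psi(2)[of x] by (auto simp: phi_def eta'_def gphi indicator_def)
 qed
 have "(LBINT x. (1/2) * ((psi x)^2 * (norm (eta x))^2) + L * ((psi x)^2 * (xi x)^2) - (2 * M^2 * G^2 + S * M) * ?J x)
   <= (LBINT x. g x \<bullet> eta' x + Q x * y x * (phi x * xi x) - S * (?I x * (phi x * xi x)))"
 proof (rule integral_mono_AE)
  show "AE x in lborel. (1/2) * ((psi x)^2 * (norm (eta x))^2) + L * ((psi x)^2 * (xi x)^2) - (2 * M^2 * G^2 + S * M) * ?J x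
   <= g x \<bullet> eta' x + Q x * y x * (phi x * xi x) - S * (?I x * (phi x * xi x))" using M(1) by eventually_elim (rule pw)
 qed (use i iI iJ s2 in auto)
 also have "\<dots> <= 0" using a i iI by (simp add: aform_def)
 finally have fin: "(1/2) * (LBINT x. (psi x)^2 * (norm (eta x))^2) + L * (LBINT x. (psi x)^2 * (xi x)^2) <= P"
  using iJ s2 by (simp add: P_def borel_closed)
 have n1: "(LBINT x. (psi x)^2 * (norm (eta x))^2) >= 0" and n2: "(LBINT x. (psi x)^2 * (xi x)^2) >= 0"
  by (rule integral_nonneg_AE, simp)+
 have "(LBINT x. (psi x)^2 * (norm (eta x))^2) <= 2 * P"
  using fin mult_nonneg_nonneg[OF less_imp_le[OF L(2)] n2] by linarith
 moreover have "(LBINT x. (psi x)^2 * (xi x)^2) <= P / L"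
 proof -
  have "L * (LBINT x. (psi x)^2 * (xi x)^2) <= P" using fin n1 by linarith
  then show ?thesis using L(2) by (simp add: pos_le_divide_eq mult.commute)
 qed
 ultimately show "(LBINT x. (psi x)^2 * (norm (pg y g 0 x))^2) <= 2 * P" "(LBINT x. (psi x)^2 * (max 0 (y x))^2) <= P / L"
  by (simp_all add: xi_def eta_def)
qed


definition infsup :: "real^'n => real => (real^'n => real) => bool" where
 "infsup c kappa Q \<longleftrightarrow> (\<forall>z g. inX (ball c 1) z g -->
   (\<exists>xi eta. inX (ball c 1) xi eta & en xi eta <= 1 & aform Q z g xi eta >= kappa * sqrt (en z g)))"

text \<open>Away from the ball, the solution solves a linear equation whose operator is uniformly invertible;
 the right-hand side produced by the cutoff lives on a shell where the potential is large.\<close>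

lemma exterior_estimate:
 fixes c :: "real^'n"
 assumes kappa0: "kappa0 > 0" and isup: "infsup c kappa0 Q" and Q: "Q \<in> BM" "!!x. \<bar>Q x\<bar> <= C * Vm x"
  and L: "!!x. x \<in> cball c 5 ==> V x >= L" "L > 0"
  and w: "inE w gw" "!!xi eta. inX (ball c 1) xi eta ==> aform Q w gw xi eta = 0"
  and chi: "omega \<in> Cc" "!!x. dist c x <= 3 ==> omega x = 1" "!!x. norm (grad omega x) <= G"
   "!!x. dist c x < 3 \<or> dist c x > 4 ==> grad omega x = 0"
  and A: "(LBINT x. indicator (cball c 4 - ball c 3) x * (w x)^2) <= A"
  and D: "(LBINT x. indicator (cball c 4 - ball c 3) x * (norm (gw x))^2) <= D"
 shows "(LBINT x. ((1 - omega x) * w x)^2) <= (G * (sqrt A + sqrt (D / L)) / kappa0)^2"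
proof -
 let ?s = "%x. indicator (cball c 4 - ball c 3) x :: real"
 have [measurable]: "cball c 4 \<in> sets borel" "ball c 3 \<in> sets borel" by (simp_all add: borel_closed)
 have sb: "\<bar>?s x\<bar> <= 1" "?s x * ?s x = ?s x" for x by (auto simp: indicator_def)
 have G0: "G >= 0" using chi(3)[of 0] norm_ge_zero order_trans by blast
 define z where "z x = w x - omega x * w x" for x
 define g where "g x = gw x - (omega x *R gw x + w x *R grad omega x)" for x
 have Ez: "inE z g" unfolding z_def[abs_def] g_def[abs_def] by (rule inE_diff[OF w(1) inE_mult_test[OF w(1) chi(1)]])
 have Xz: "inX (ball c 1) z g"
  by (rule inX_vanishing[OF Ez]) (use chi(2,4) in \<open>auto simp: z_def g_def\<close>)
 obtain xi eta where t: "inX (ball c 1) xi eta" "en xi eta <= 1" "kappa0 * sqrt (en z g) <= aform Q z g xi eta"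
  using isup Xz unfolding infsup_def by blast
 note E = inXD(1)[OF t(1)]
 note Xt = inX_mult_test[OF t(1) chi(1)]
 note Et = inXD(1)[OF Xt]
 note Ew = inE_mult_test[OF w(1) chi(1)]
 have sw: "sq_int (%x. ?s x * w x)" "sq_int (%x. ?s x *R gw x)" "sq_int (%x. ?s x * xi x)"
  by (rule sq_int_mult_bounded'[OF inED(2)[OF w(1)] _ sb(1)] sq_int_mult_bounded[OF inED(3)[OF w(1)] _ sb(1)]
    sq_int_mult_bounded'[OF inED(2)[OF E] _ sb(1)]; measurable)+
 have le: "norm (f x *R grad omega x) <= G * norm (?s x * f x)" for f :: "real^'n => real" and x
  using mult_left_mono[OF chi(3)[of x], of "\<bar>f x\<bar>"] chi(4)[of x] G0 by (auto simp: indicator_def mult.commute)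
 have sg: "sq_int (%x. w x *R grad omega x)" "sq_int (%x. xi x *R grad omega x)"
  using sq_int_scaleR_grad[OF inED(2) chi(1)] w(1) E by auto
 have nle: "sqrt (LBINT x. (norm (f x *R grad omega x))^2) <= G * sqrt (LBINT x. ?s x * (f x)^2)"
  if f: "sq_int (f :: real^'n => real)" "sq_int (%x. ?s x * f x)" "sq_int (%x. f x *R grad omega x)" for f
 proof -
  have e: "(norm (?s x * f x))^2 = ?s x * (f x)^2" for x by (auto simp: indicator_def)
  have "(LBINT x. (norm (f x *R grad omega x))^2) <= (LBINT x. G^2 * (?s x * (f x)^2))"
  proof (rule integral_mono[OF sq_int_integrable[OF f(3)]])
   show "integrable lborel (%x. G^2 * (?s x * (f x)^2))" using sq_int_integrable[OF f(2)] unfolding e by simp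
   show "(norm (f x *R grad omega x))^2 <= G^2 * (?s x * (f x)^2)" for x
    using power_mono[OF le[of f x], of 2] unfolding e[symmetric] by (simp only: power_mult_distrib norm_ge_zero)
  qed
  then have "sqrt (LBINT x. (norm (f x *R grad omega x))^2) <= sqrt (G^2 * (LBINT x. ?s x * (f x)^2))"
   by (simp del: norm_scaleR real_sqrt_le_iff) (rule real_sqrt_le_mono, simp)
  then show ?thesis using G0 by (simp add: real_sqrt_mult)
 qed
 have i: "integrable lborel (%x. gw x \<bullet> eta x)" "integrable lborel (%x. (omega x *R gw x + w x *R grad omega x) \<bullet> eta x)"
  "integrable lborel (%x. gw x \<bullet> (omega x *R eta x + xi x *R grad omega x))"
  "integrable lborel (%x. (w x *R grad omega x) \<bullet> eta x)" "integrable lborel (%x. gw x \<bullet> (xi x *R grad omega x))"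
  by (rule integrable_inner; fact inED(3)[OF w(1)] inED(3)[OF E] inED(3)[OF Ew] inED(3)[OF Et] sg)+
 \<comment> \<open>Shifting the cutoff from \<open>w\<close> to the test function leaves the
   equation tested with an admissible function, which is zero, and commutator terms with
   \<open>grad omega\<close> on the shell.\<close>
 have "aform Q z g xi eta = aform Q w gw (%x. xi x - omega x * xi x) (%x. eta x - (omega x *R eta x + xi x *R grad omega x))
   + ((LBINT x. gw x \<bullet> (xi x *R grad omega x)) - (LBINT x. (w x *R grad omega x) \<bullet> eta x))"
 proof -
  have "(LBINT x. g x \<bullet> eta x) = (LBINT x. gw x \<bullet> (eta x - (omega x *R eta x + xi x *R grad omega x)) + (gw x \<bullet> (xi x *R grad omega x) - (w x *R grad omega x) \<bullet> eta x))"
   by (rule Bochner_Integration.integral_cong) (auto simp: g_def inner_simps)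
  also have "\<dots> = (LBINT x. gw x \<bullet> (eta x - (omega x *R eta x + xi x *R grad omega x))) + ((LBINT x. gw x \<bullet> (xi x *R grad omega x)) - (LBINT x. (w x *R grad omega x) \<bullet> eta x))"
  proof -
   have "integrable lborel (%x. gw x \<bullet> (eta x - (omega x *R eta x + xi x *R grad omega x)))"
    unfolding inner_diff_right[of _ "eta _"] by (rule Bochner_Integration.integrable_diff[OF i(1,3)])
   then show ?thesis using i by simp
  qed
  finally have "(LBINT x. g x \<bullet> eta x) = \<dots>" .
  moreover have "(LBINT x. Q x * z x * xi x) = (LBINT x. Q x * w x * (xi x - omega x * xi x))"
   by (rule Bochner_Integration.integral_cong) (auto simp: z_def algebra_simps)
  ultimately show ?thesis by (simp add: aform_def)
 qed
 also have "aform Q w gw (%x. xi x - omega x * xi x) (%x. eta x - (omega x *R eta x + xi x *R grad omega x)) = 0"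
  by (rule w(2)[OF inX_diff[OF t(1) Xt]])
 finally have a: "aform Q z g xi eta = (LBINT x. gw x \<bullet> (xi x *R grad omega x)) - (LBINT x. (w x *R grad omega x) \<bullet> eta x)" by simp
 have b1: "\<bar>LBINT x. (w x *R grad omega x) \<bullet> eta x\<bar> <= G * sqrt A"
 proof -
  have "\<bar>LBINT x. (w x *R grad omega x) \<bullet> eta x\<bar> <= sqrt (LBINT x. (norm (w x *R grad omega x))^2) * sqrt (LBINT x. (norm (eta x))^2)"
   by (rule L2_Cauchy_Schwarz[OF sg(1) inED(3)[OF E]])
  also have "\<dots> <= (G * sqrt A) * sqrt 1"
  proof (intro mult_mono order_trans[OF nle[OF inED(2)[OF w(1)] sw(1) sg(1)]] mult_left_mono real_sqrt_le_mono A G0)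
   show "(LBINT x. (norm (eta x))^2) <= 1" using en_parts(1) t(2) order_trans by blast
   have "0 <= (LBINT x. ?s x * (w x)^2)" by (rule integral_nonneg_AE) simp
   then have "A >= 0" using A by linarith
   then show "0 <= G * sqrt A" using G0 by simp
  qed (auto intro!: integral_nonneg_AE)
  finally show ?thesis by simp
 qed
 \<comment> \<open>The bound \<open>D\<close> for the gradient of \<open>w\<close> on the shell
   carries no factor \<open>1 / L\<close>; the gain comes from the test function, whose energy is at
   most 1 while the potential is at least \<open>L\<close>.\<close>
 have xiL: "(LBINT x. ?s x * (xi x)^2) <= 1 / L"
 proof -
  have e: "(norm (?s x * xi x))^2 = ?s x * (xi x)^2" for x by (auto simp: indicator_def)
  have "(LBINT x. L * (?s x * (xi x)^2)) <= (LBINT x. Vm x * (xi x)^2)"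
  proof (rule integral_mono[OF _ inED(6)[OF E]])
   show "integrable lborel (%x. L * (?s x * (xi x)^2))" using sq_int_integrable[OF sw(3)] unfolding e by simp
   show "L * (?s x * (xi x)^2) <= Vm x * (xi x)^2" for x
    using L(1)[of x] m0_nonneg Vm_pos[of x] by (auto simp: indicator_def Vm_def intro!: mult_right_mono)
  qed
  also have "\<dots> <= 1" using en_parts(2) t(2) order_trans by blast
  finally show ?thesis using L(2) by (simp add: pos_le_divide_eq mult.commute)
 qed
 have b2: "\<bar>LBINT x. gw x \<bullet> (xi x *R grad omega x)\<bar> <= G * sqrt (D / L)"
 proof -
  have "gw x \<bullet> (xi x *R grad omega x) = (?s x *R gw x) \<bullet> (xi x *R grad omega x)" for x
   using chi(4)[of x] by (cases "dist c x < 3 \<or> dist c x > 4") (auto simp: indicator_def)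
  then have "\<bar>LBINT x. gw x \<bullet> (xi x *R grad omega x)\<bar> = \<bar>LBINT x. (?s x *R gw x) \<bullet> (xi x *R grad omega x)\<bar>" by presburger
  also have "\<dots> <= sqrt (LBINT x. (norm (?s x *R gw x))^2) * sqrt (LBINT x. (norm (xi x *R grad omega x))^2)"
   by (rule L2_Cauchy_Schwarz[OF sw(2) sg(2)])
  also have "(%x. (norm (?s x *R gw x))^2) = (%x. ?s x * (norm (gw x))^2)" by (auto simp: indicator_def fun_eq_iff)
  also have "sqrt (LBINT x. ?s x * (norm (gw x))^2) * sqrt (LBINT x. (norm (xi x *R grad omega x))^2) <= sqrt D * (G * sqrt (1 / L))"
  proof (intro mult_mono order_trans[OF nle[OF inED(2)[OF E] sw(3) sg(2)]] mult_left_mono real_sqrt_le_mono D G0 xiL)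
   have "0 <= (LBINT x. ?s x * (norm (gw x))^2)" by (rule integral_nonneg_AE) simp
   then have "0 <= D" using D by linarith
   then show "0 <= sqrt D" by simp
  qed (auto intro!: integral_nonneg_AE)
  finally show ?thesis by (simp add: real_sqrt_divide mult_ac)
 qed
 have "kappa0 * sqrt (en z g) <= G * (sqrt A + sqrt (D / L))" using t(3) a b1 b2 by (simp add: algebra_simps abs_le_iff)
 then have "sqrt (en z g) <= G * (sqrt A + sqrt (D / L)) / kappa0" using kappa0 by (simp add: pos_le_divide_eq mult.commute)
 then have "(sqrt (en z g))^2 <= (G * (sqrt A + sqrt (D / L)) / kappa0)^2" using en_parts(3) by (intro power_mono) auto
 then have "en z g <= (G * (sqrt A + sqrt (D / L)) / kappa0)^2" using en_parts(3) by simp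
 moreover have "(1 - omega x) * w x = z x" for x by (simp add: z_def algebra_simps)
 ultimately show ?thesis using L2_le_en[OF Ez] by simp
qed

text \<open>\<open>L\<close> is chosen before \<open>C\<close>, hence it does not see
  \<open>rho\<close>. If the superlevel sets at \<open>kappa\<close> are small,
  \<open>de_giorgi\<close> gives the bound \<open>2 * kappa\<close>; then the mass near the ball is
  of order \<open>kappa^2 / L\<close>, \<open>exterior_estimate\<close> extends this to the whole
  space, and the superlevel sets at \<open>kappa / 2\<close> are small again, as long as
  \<open>kappa >= delta\<close>.\<close>

theorem uniform_sup_bound:
 assumes kappa0: "kappa0 > 0" and delta: "delta > 0" and S: "S >= 0"
 shows "\<exists>L. \<forall>c Q C z gz w gw. (\<forall>x\<in>cball c 5. V x >= L) --> Q \<in> BM --> (\<forall>x. \<bar>Q x\<bar> <= C * Vm x) -->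
  (\<forall>x. Q x >= Vm x / 2 - m0) --> (\<forall>x\<in>cball c 2. Q x >= V x / 2) --> infsup c kappa0 Q -->
  subsol c Q S z gz --> subsol c Q S (%x. - w x) (%x. - gw x) --> (\<forall>x. x \<notin> cball c 2 --> z x = w x & gz x = gw x) -->
  (\<forall>xi eta. inX (ball c 1) xi eta --> aform Q w gw xi eta = 0) -->
  (AE x in lborel. z x <= delta) & (AE x in lborel. - w x <= delta)"
proof -
 have m1: "m0 + 1 > 0" using m0_nonneg by simp
 obtain c0 where c0: "c0 > 0" and dg: "!!(y :: real^'n => real) g kappa. wgrad y g ==> kappa > 0 ==> measure lborel {x. y x > kappa} <= c0 ==>
   (!!k. k >= kappa ==> (LBINT x. (norm (pg y g k x))^2) <= (m0 + 1) * (LBINT x. (max 0 (y x - k))^2) + (m0 + 1) * k * (LBINT x. max 0 (y x - k))) ==>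
   AE x in lborel. y x <= 2 * kappa" using de_giorgi[OF m1] by blast
 obtain G1 where G1: "G1 > 0" and cut1: "!!c::real^'n. \<exists>zeta. cutoff c 4 5 G1 zeta"
  using shifted_cutoffs[of 4 5] by auto
 obtain G2 where G2: "G2 > 0" and cut2: "!!c::real^'n. \<exists>zeta. cutoff c 3 4 G2 zeta"
  using shifted_cutoffs[of 3 4] by auto
 define vol where "vol = measure lborel (cball (0::real^'n) 5)"
 have vol: "measure lborel (cball c 5) = vol" for c :: "real^'n" by (simp add: vol_def content_cball)
 have vol0: "vol >= 0" by (simp add: vol_def)
 \<comment> \<open>Under the bound \<open>2 * kappa\<close> the constant \<open>P\<close> of
   \<open>subsol_local\<close> is at most \<open>C1 * kappa^2\<close>; for
   \<open>kappa >= delta\<close> its linear source term is dominated by the quadratic one.\<close>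
 define C1 where "C1 = (8 * G1^2 + 2 * S / delta) * vol"
 have C10: "C1 >= 0" using vol0 S delta by (simp add: C1_def)
 define C2 where "C2 = 4 * (4 * C1 + 128 * G2^2 * C1 / kappa0^2)"
 have C20: "C2 >= 0" using C10 by (simp add: C2_def)
 \<comment> \<open>The term \<open>2 * m0\<close> turns \<open>Q >= Vm / 2 - m0\<close> into
   \<open>Q >= L / 4\<close> on the ball of radius 5, \<open>4 * S / delta\<close> absorbs the
   source at all levels from \<open>delta / 2\<close> on, and \<open>C2 / c0\<close> pushes the
   measure of superlevel sets below \<open>c0\<close>.\<close>
 define L where "L = 1 + 2 * m0 + 4 * S / delta + C2 / c0"
 have L: "L > 0" "L >= 2 * m0" "L / 2 * (delta / 2) >= S" "C2 / L <= c0"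
 proof -
  have p: "0 <= 4 * S / delta" "0 <= C2 / c0" using S delta C20 c0 by auto
  then show L0: "L > 0" and "L >= 2 * m0" using m0_nonneg by (auto simp: L_def)
  have "L * delta >= (4 * S / delta) * delta" using p m0_nonneg delta by (intro mult_right_mono) (auto simp: L_def)
  then show "L / 2 * (delta / 2) >= S" using delta by simp
  have "L * c0 >= (C2 / c0) * c0" using p m0_nonneg c0 by (intro mult_right_mono) (auto simp: L_def)
  then show "C2 / L <= c0" using c0 L0 by (simp add: pos_divide_le_eq mult.commute)
 qed
 have main: "(AE x in lborel. z x <= delta) & (AE x in lborel. - w x <= delta)"
  if VL: "!!x. x \<in> cball c 5 ==> V x >= L" and Q: "Q \<in> BM" "!!x. \<bar>Q x\<bar> <= C * Vm x" "!!x. Q x >= Vm x / 2 - m0"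
   "!!x. x \<in> cball c 2 ==> Q x >= V x / 2" and isup: "infsup c kappa0 Q" and sub: "subsol c Q S z gz" "subsol c Q S (%x. - w x) (%x. - gw x)"
   and out: "!!x. x \<notin> cball c 2 ==> z x = w x & gz x = gw x" and eq: "!!xi eta. inX (ball c 1) xi eta ==> aform Q w gw xi eta = 0"
  for c Q C z gz w gw
 proof -
  obtain psi where psi: "psi \<in> Cc" "!!x. 0 <= psi x & psi x <= 1 & (dist c x <= 4 --> psi x = 1) & (dist c x >= 5 --> psi x = 0) &
   norm (grad psi x) <= G1 & (dist c x > 5 --> grad psi x = 0)" using cut1[of c] unfolding cutoff_def by blast
  obtain omega where om: "omega \<in> Cc" "!!x. (dist c x <= 3 --> omega x = 1) & (dist c x >= 4 --> omega x = 0) &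
   norm (grad omega x) <= G2 & (dist c x < 3 \<or> dist c x > 4 --> grad omega x = 0)" using cut2[of c] unfolding cutoff_def by blast
  have Ez: "inE z gz" and Emw: "inE (%x. - w x) (%x. - gw x)" using sub by (auto simp: subsol_def)
  have Ew: "inE w gw" using inE_scale[OF Emw, of "-1"] by simp
  note [measurable] = inED(4,5)[OF Ez] inED(4,5)[OF Ew]
  have Q2: "Q x >= L / 2" if "x \<in> cball c 2" for x using Q(4)[OF that] VL[of x] that by auto
  have Q5: "\<forall>x\<in>cball c 5. Q x >= L / 4"
  proof
   fix x assume "x \<in> cball c 5"
   then show "Q x >= L / 4" using Q(3)[of x] VL[of x] L(2) by (simp add: Vm_def)
  qed
  have energy: "(LBINT x. (norm (pg y g k x))^2) <= (m0 + 1) * (LBINT x. (max 0 (y x - k))^2) + (m0 + 1) * k * (LBINT x. max 0 (y x - k))"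
   if "subsol c Q S y g" "kappa >= delta / 2" "k >= kappa" for y g kappa k
  proof -
   have Lk: "L / 2 * kappa >= S" using L(3) mult_left_mono[OF that(2), of "L / 2"] L(1) by linarith
   have "(LBINT x. (norm (pg y g k x))^2) <= m0 * (LBINT x. (max 0 (y x - k))^2) + m0 * k * (LBINT x. max 0 (y x - k))"
    by (rule subsol_energy[OF that(1) Q(1-3) Q2 Lk]) (use L delta that in auto)
   also have "\<dots> <= (m0 + 1) * (LBINT x. (max 0 (y x - k))^2) + (m0 + 1) * k * (LBINT x. max 0 (y x - k))"
    using m0_nonneg delta that by (intro add_mono mult_right_mono integral_nonneg_AE) auto
   finally show ?thesis .
  qed
  define small where "small kappa \<longleftrightarrow> measure lborel {x. z x > kappa} <= c0 & measure lborel {x. - w x > kappa} <= c0" for kappa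
  have bound: "(AE x in lborel. z x <= 2 * kappa) & (AE x in lborel. - w x <= 2 * kappa)" if "small kappa" "kappa >= delta / 2" for kappa
   using dg[OF inED(1)[OF Ez], of kappa] dg[OF inED(1)[OF Emw], of kappa] energy[OF sub(1) that(2)] energy[OF sub(2) that(2)] that delta
   unfolding small_def by auto
  have step: "small (kappa / 2)" if sm: "small kappa" and k: "kappa >= delta" for kappa
  proof -
   have k0: "kappa > 0" "2 * kappa > 0" "kappa >= delta / 2" using k delta by auto
   have AEb: "AE x in lborel. z x <= 2 * kappa" "AE x in lborel. - w x <= 2 * kappa" using bound[OF sm k0(3)] by auto
   define P where "P = (2 * (2 * kappa)^2 * G1^2 + S * (2 * kappa)) * measure lborel (cball c 5)"
   have P: "P <= C1 * kappa^2"
   proof -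
    have "kappa * delta <= kappa * kappa" using k k0 by (intro mult_left_mono) auto
    then have "kappa <= kappa^2 / delta" using delta by (simp add: pos_le_divide_eq power2_eq_square)
    then have "S * (2 * kappa) <= S * (2 * (kappa^2 / delta))" using S by (intro mult_left_mono) auto
    then have "P <= (2 * (2 * kappa)^2 * G1^2 + S * (2 * (kappa^2 / delta))) * vol" unfolding P_def vol using vol0 by (intro mult_right_mono) auto
    also have "\<dots> = C1 * kappa^2" by (simp add: C1_def algebra_simps power2_eq_square)
    finally show ?thesis .
   qed
   have psi': "0 <= psi x & psi x <= 1 & norm (grad psi x) <= G1 & (x \<notin> cball c 5 --> psi x = 0 & grad psi x = 0)" for x
    using psi(2)[of x] by auto
   have L4: "L / 4 > 0" using L by simp
   note lz = subsol_local[OF sub(1) Q(1,2) Q5 L4 S AEb(1) k0(2) psi(1) psi', folded P_def]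
   note lw = subsol_local[OF sub(2) Q(1,2) Q5 L4 S AEb(2) k0(2) psi(1) psi', folded P_def]
   let ?s = "%x. indicator (cball c 4 - ball c 3) x :: real"
   have [measurable]: "cball c 4 \<in> sets borel" "ball c 3 \<in> sets borel" by (simp_all add: borel_closed)
   have shell: "?s x * (w x)^2 <= (psi x)^2 * (max 0 (z x))^2 + (psi x)^2 * (max 0 (- w x))^2"
    "?s x * (norm (gw x))^2 <= 2 * ((psi x)^2 * (norm (pg z gz 0 x))^2) + 2 * ((psi x)^2 * (norm (pg (%x. - w x) (%x. - gw x) 0 x))^2)" for x
   proof -
    have "?s x * (w x)^2 <= (psi x)^2 * (max 0 (z x))^2 + (psi x)^2 * (max 0 (- w x))^2 &
     ?s x * (norm (gw x))^2 <= 2 * ((psi x)^2 * (norm (pg z gz 0 x))^2) + 2 * ((psi x)^2 * (norm (pg (%x. - w x) (%x. - gw x) 0 x))^2)"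
    proof (cases "x \<in> cball c 4 - ball c 3")
     case True
     then have s: "psi x = 1" "z x = w x" "gz x = gw x" using psi(2)[of x] out[of x] by auto
     show ?thesis using True s by (cases "w x" "0::real" rule: linorder_cases) (auto simp: max_def power_mult_distrib power_divide)
    qed auto
    then show "?s x * (w x)^2 <= (psi x)^2 * (max 0 (z x))^2 + (psi x)^2 * (max 0 (- w x))^2"
     "?s x * (norm (gw x))^2 <= 2 * ((psi x)^2 * (norm (pg z gz 0 x))^2) + 2 * ((psi x)^2 * (norm (pg (%x. - w x) (%x. - gw x) 0 x))^2)" by auto
   qed
   have sb: "\<bar>?s x\<bar> <= 1" for x by (auto simp: indicator_def)
   have sm: "?s \<in> BM" by measurable
   have e: "(norm (?s x * w x))^2 = ?s x * (w x)^2" "(norm (?s x *R gw x))^2 = ?s x * (norm (gw x))^2" for x by (auto simp: indicator_def)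
   have si: "integrable lborel (%x. ?s x * (w x)^2)" "integrable lborel (%x. ?s x * (norm (gw x))^2)"
    using sq_int_integrable[OF sq_int_mult_bounded'[OF inED(2)[OF Ew] sm sb]] sq_int_integrable[OF sq_int_mult_bounded[OF inED(3)[OF Ew] sm sb]]
    unfolding e by auto
   have A: "(LBINT x. ?s x * (w x)^2) <= 8 * C1 * kappa^2 / L"
   proof -
    have "(LBINT x. ?s x * (w x)^2) <= (LBINT x. (psi x)^2 * (max 0 (z x))^2 + (psi x)^2 * (max 0 (- w x))^2)"
     by (rule integral_mono[OF si(1) Bochner_Integration.integrable_add[OF lz(4) lw(4)] shell(1)])
    also have "\<dots> <= P / (L / 4) + P / (L / 4)"
     unfolding Bochner_Integration.integral_add[OF lz(4) lw(4)] using lz(2) lw(2) by (rule add_mono)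
    also have "\<dots> = 8 * P / L" by simp
    also have "\<dots> <= 8 * C1 * kappa^2 / L" using P L by (intro divide_right_mono) auto
    finally show ?thesis .
   qed
   have D: "(LBINT x. ?s x * (norm (gw x))^2) <= 8 * C1 * kappa^2"
   proof -
    have "(LBINT x. ?s x * (norm (gw x))^2) <= (LBINT x. 2 * ((psi x)^2 * (norm (pg z gz 0 x))^2) + 2 * ((psi x)^2 * (norm (pg (%x. - w x) (%x. - gw x) 0 x))^2))"
     by (rule integral_mono[OF si(2) Bochner_Integration.integrable_add[OF integrable_mult_right[OF lz(3)] integrable_mult_right[OF lw(3)]] shell(2)])
    also have "\<dots> = 2 * (LBINT x. (psi x)^2 * (norm (pg z gz 0 x))^2) + 2 * (LBINT x. (psi x)^2 * (norm (pg (%x. - w x) (%x. - gw x) 0 x))^2)"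
     by (subst Bochner_Integration.integral_add[OF integrable_mult_right[OF lz(3)] integrable_mult_right[OF lw(3)]]) (simp only: integral_mult_right_zero)
    also have "\<dots> <= 2 * (2 * P) + 2 * (2 * P)" using lz(1) lw(1) by (intro add_mono mult_left_mono) auto
    also have "\<dots> <= 8 * C1 * kappa^2" using P by simp
    finally show ?thesis .
   qed
   have ext: "(LBINT x. ((1 - omega x) * w x)^2) <= 32 * G2^2 * C1 * kappa^2 / (kappa0^2 * L)"
   proof -
    have "(LBINT x. ((1 - omega x) * w x)^2) <= (G2 * (sqrt (8 * C1 * kappa^2 / L) + sqrt (8 * C1 * kappa^2 / L)) / kappa0)^2"
     by (rule exterior_estimate[OF kappa0 isup Q(1,2) VL L(1) Ew eq om(1) _ _ _ A D]) (use om(2) in auto)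
    also have "\<dots> = (2 * G2 / kappa0)^2 * (sqrt (8 * C1 * kappa^2 / L))^2" by (simp add: power_mult_distrib power_divide)
    also have "(sqrt (8 * C1 * kappa^2 / L))^2 = 8 * C1 * kappa^2 / L" by (rule real_sqrt_pow2) (use C10 L in simp)
    finally show ?thesis by (simp add: power_mult_distrib power_divide)
   qed
   have ie: "integrable lborel (%x. ((1 - omega x) * w x)^2)"
    using sq_int_integrable[OF inED(2)[OF inE_diff[OF Ew inE_mult_test[OF Ew om(1)]]]] by (simp add: algebra_simps)
   \<comment> \<open>Chebyshev's inequality with two sources of mass: up to radius 4 one has
     \<open>psi = 1\<close> and the local bound applies; beyond, \<open>omega = 0\<close> and the
     exterior bound applies, because there \<open>y\<close> is \<open>w\<close> up to sign.\<close>
   have meas: "measure lborel {x. y x > kappa / 2} <= c0"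
    if y: "sq_int y" and ly: "(LBINT x. (psi x)^2 * (max 0 (y x))^2) <= P / (L / 4)" "integrable lborel (%x. (psi x)^2 * (max 0 (y x))^2)"
     and yo: "!!x. x \<notin> cball c 2 ==> \<bar>y x\<bar> = \<bar>w x\<bar>" for y
   proof -
    have k2: "kappa / 2 > 0" using k0 by simp
    note s = superlevel_integrable[OF y k2]
    have [measurable]: "{x. y x > kappa / 2} \<in> sets borel" using sq_int_measurable[OF y] by measurable
    have "(kappa / 2)^2 * measure lborel {x. y x > kappa / 2} = (LBINT x. (kappa / 2)^2 * indicator {x. y x > kappa / 2} x)" using s by simp
    also have "\<dots> <= (LBINT x. (psi x)^2 * (max 0 (y x))^2 + ((1 - omega x) * w x)^2)"
    proof (rule integral_mono[OF integrable_mult_right[OF s(1)] Bochner_Integration.integrable_add[OF ly(2) ie]])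
     fix x
     show "(kappa / 2)^2 * indicator {x. y x > kappa / 2} x <= (psi x)^2 * (max 0 (y x))^2 + ((1 - omega x) * w x)^2"
     proof (cases "y x > kappa / 2")
      case True
      then have k: "(kappa / 2)^2 <= (y x)^2" using k2 by (intro power_mono) auto
      show ?thesis
      proof (cases "x \<in> cball c 4")
       case T: True
       then show ?thesis using psi(2)[of x] True k k2 by (simp add: add_increasing2)
      next
       case False
       then have "omega x = 0" "\<bar>y x\<bar> = \<bar>w x\<bar>" using om(2)[of x] yo[of x] by auto
       then have "((1 - omega x) * w x)^2 = (y x)^2" by (metis diff_zero mult_1 power2_abs)
       then show ?thesis using True k by (simp add: add_increasing)
      qed
     qed simp
    qed
    also have "\<dots> = (LBINT x. (psi x)^2 * (max 0 (y x))^2) + (LBINT x. ((1 - omega x) * w x)^2)"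
     by (rule Bochner_Integration.integral_add[OF ly(2) ie])
    also have "\<dots> <= 4 * (C1 * kappa^2) / L + 32 * G2^2 * C1 * kappa^2 / (kappa0^2 * L)"
    proof (rule add_mono[OF order_trans[OF ly(1)] ext])
     have "P / (L / 4) = 4 * P / L" by simp
     also have "\<dots> <= 4 * (C1 * kappa^2) / L" using P L by (intro divide_right_mono) auto
     finally show "P / (L / 4) <= 4 * (C1 * kappa^2) / L" .
    qed
    also have "\<dots> <= (kappa / 2)^2 * (C2 / L)"
    proof -
     have "(kappa / 2)^2 * (C2 / L) = 4 * (C1 * kappa^2) / L + 128 * G2^2 * C1 * kappa^2 / (kappa0^2 * L)"
      using kappa0 L by (simp add: C2_def power_divide field_simps)
     moreover have "32 * G2^2 * C1 * kappa^2 / (kappa0^2 * L) <= 128 * G2^2 * C1 * kappa^2 / (kappa0^2 * L)"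
      using C10 L by (intro divide_right_mono mult_right_mono) auto
     ultimately show ?thesis by linarith
    qed
    finally have "measure lborel {x. y x > kappa / 2} <= C2 / L" by (rule mult_left_le_imp_le) (use k0 in simp)
    then show ?thesis using L(4) by linarith
   qed
   show ?thesis unfolding small_def
    using meas[OF inED(2)[OF Ez] lz(2,4)] meas[OF inED(2)[OF Emw] lw(2,4)] out by auto
  qed
  \<comment> \<open>The starting level depends on the solution. This is harmless: the estimates
    scale with \<open>kappa\<close>, so the number of halvings does not enter the result.\<close>
  have ex: "\<exists>n. small (delta / 2 * 2 ^ n)"
  proof -
   define I where "I = (LBINT x. (z x)^2 + (w x)^2)"
   have ii: "integrable lborel (%x. (z x)^2 + (w x)^2)"
    using sq_int_integrable[OF inED(2)[OF Ez]] sq_int_integrable[OF inED(2)[OF Ew]] by simp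
   have m: "measure lborel {x. y x > kappa} <= c0" if y: "sq_int y" "!!x. (y x)^2 <= (z x)^2 + (w x)^2" and k: "kappa > 0" "I <= kappa^2 * c0" for y kappa
   proof -
    note s = superlevel_integrable[OF y(1) k(1)]
    have [measurable]: "{x. y x > kappa} \<in> sets borel" using sq_int_measurable[OF y(1)] by measurable
    have "kappa^2 * measure lborel {x. y x > kappa} = (LBINT x. kappa^2 * indicator {x. y x > kappa} x)" using s by simp
    also have "\<dots> <= I" unfolding I_def
    proof (rule integral_mono[OF integrable_mult_right[OF s(1)] ii])
     show "kappa^2 * indicator {x. y x > kappa} x <= (z x)^2 + (w x)^2" for x
      using order_trans[OF power_mono[of kappa "y x" 2] y(2)[of x]] k by (auto simp: indicator_def)
    qed
    also note k(2)
    finally show ?thesis using k(1) by simp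
   qed
   obtain n where n: "I / c0 * (4 / delta^2) <= 2 ^ n" using real_arch_pow[of 2 "I / c0 * (4 / delta^2)"] by (auto intro: less_imp_le)
   have "(2::real) ^ n <= (2 ^ n)^2" by (simp add: power2_eq_square)
   then have "I / c0 * (4 / delta^2) <= (2 ^ n)^2" using n by linarith
   then have "I <= (delta / 2 * 2 ^ n)^2 * c0" using c0 delta by (simp add: field_simps)
   moreover have "delta / 2 * 2 ^ n > 0" using delta by simp
   ultimately show ?thesis
    using m[OF inED(2)[OF Ez], of "delta / 2 * 2 ^ n"] m[OF inED(2)[OF Emw], of "delta / 2 * 2 ^ n"] unfolding small_def by auto
  qed
  have "small (delta / 2 * 2 ^ n) ==> small (delta / 2)" for n
  proof (induction n)
   case (Suc n)
   have "delta / 2 * 2 ^ Suc n >= delta * 1" using delta by (simp del: mult_1_right)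
   from step[OF Suc(2)] this have "small (delta / 2 * 2 ^ Suc n / 2)" by simp
   then show ?case using Suc(1) by simp
  qed simp
  then have "small (delta / 2)" using ex by blast
  then show ?thesis using bound[of "delta / 2"] by simp
 qed
 show ?thesis by (intro exI[of _ L] allI impI, rule main) auto
qed


section \<open>Existence for \<open>rho < 1\<close>\<close>

lemma inX_cong_AE:
 assumes x: "inX B z g" and z: "AE x in lborel. z' x = z x" "z' \<in> BM" and [measurable]: "B \<in> sets borel"
 shows "inX B z' g"
proof -
 note E = inXD(1)[OF x]
 note [measurable] = z(2) inED(4,5)[OF E]
 have "integrable lborel (%x. Vm x * (z' x)^2)"
  using inED(6)[OF E] z(1) by (subst integrable_cong_AE[of _ _ "%x. Vm x * (z x)^2"]) auto
 moreover have "wgrad z' g" by (rule wgrad_cong_AE[OF inED(1)[OF E] z]) auto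
 moreover have "wgrad (%x. indicator B x * z' x) (%x. indicator B x *R g x)"
  by (rule wgrad_cong_AE[OF inXD(2)[OF x]]) (use z(1) in auto)
 ultimately show ?thesis by (simp add: inX_def inE_def)
qed

text \<open>The boundary value \<open>HH rho 1\<close> corresponds to \<open>u = 1\<close>, and
  \<open>|w| <= 1/8\<close> gives \<open>|u| <= 1/4\<close>. The bounds are required at every point,
  so that facts on \<open>UU\<close> and \<open>hh\<close> apply without exceptional sets.\<close>

definition approx :: "(real => real) => real^'n => (real^'n => real) => real => (real^'n => real) => (real^'n => real^'n) => bool" where
 "approx r c zeta rho w g \<longleftrightarrow> inX (ball c 1) (%x. w x - HH rho 1 * zeta x) (%x. g x - HH rho 1 *R grad zeta x) &
   (\<forall>x. - (1/8) <= w x & w x <= HH rho 1 & (x \<notin> cball c 2 --> w x <= 1/8)) &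
   (\<forall>xi eta. inX (ball c 1) xi eta --> aform (%x. alpha rho (w x) * (V x - r (UU rho (w x)))) w g xi eta = 0)"

text \<open>The argument of the coefficient is truncated so that the coefficient is admissible for
  every function inserted. \<open>uniform_sup_bound\<close> and a weak maximum principle then keep
  the solution within the truncation. The centre depends on constants that do not involve
  \<open>rho\<close>, so one sphere serves all \<open>rho\<close>.\<close>

theorem regularized_solution:
 fixes r :: "real => real"
 assumes ne: "~ schroedinger_eigenvalue V 0" and r: "continuous_on UNIV r" "r 0 = 0" "!!t. \<bar>r t\<bar> <= Cf"
 shows "\<exists>c zeta. zeta \<in> Cc & (\<forall>x. 0 <= zeta x & zeta x <= 1 & (dist c x <= 1 --> zeta x = 1) & (dist c x >= 2 --> zeta x = 0)) &
  (\<forall>x\<in>cball c 5. V x >= Cf + 1) & (\<forall>rho. 0 <= rho --> rho < 1 --> (\<exists>w g. approx r c zeta rho w g))"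
proof -
 obtain epsilon0 R kappa0 where epsilon0: "0 < epsilon0" "epsilon0 <= 1/2" and kappa0: "kappa0 > 0"
  and is0: "!!c Q. norm c >= R ==> admissible epsilon0 c Q ==> infsup c kappa0 Q"
  using uniform_inf_sup[OF ne] unfolding infsup_def by metis
 have Cf0: "Cf >= 0" using r(3)[of 0] by simp
 obtain d where d: "d > 0" "!!t. \<bar>t\<bar> < d ==> \<bar>r t\<bar> < epsilon0 / 4"
 proof -
  have "isCont r 0" using r(1) by (simp add: continuous_on_eq_continuous_at)
  then show thesis using that epsilon0 r(2) unfolding continuous_at_eps_delta by (metis diff_zero dist_real_def zero_less_divide_iff zero_less_numeral)
 qed
 \<comment> \<open>For \<open>|s| <= delta\<close> one has \<open>|UU s| <= 2 * delta < d\<close>,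
   which makes \<open>r\<close> small, and \<open>8 * s^2 <= delta\<close>, which makes
   \<open>alpha\<close> close to 1; the last entry pays for the factor \<open>1 + m0\<close> in the
   bound of \<open>|V|\<close>.\<close>
 define delta where "delta = min (1/8) (min (d / 4) (epsilon0 / (2 * (1 + m0))))"
 have delta: "delta > 0" "delta <= 1/8" "2 * delta < d" "delta * (1 + m0) <= epsilon0 / 2"
 proof -
  have "delta <= epsilon0 / (2 * (1 + m0))" by (simp add: delta_def)
  then show "delta * (1 + m0) <= epsilon0 / 2" using m0_nonneg by (simp add: field_simps)
  have "delta <= d / 4" unfolding delta_def by (rule min.coboundedI2[OF min.cobounded1])
  then show "2 * delta < d" using d by simp
  show "delta > 0" using d epsilon0 m0_nonneg by (auto simp: delta_def)
  show "delta <= 1/8" unfolding delta_def by (rule min.cobounded1)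
 qed
 obtain G where G: "G > 0" and cut: "!!c::real^'n. \<exists>zeta. cutoff c 1 2 G zeta"
  using shifted_cutoffs[of 1 2] by auto
 obtain L where L: "!!c Q C z gz w gw. (\<forall>x\<in>cball c 5. V x >= L) ==> Q \<in> BM ==> (\<forall>x. \<bar>Q x\<bar> <= C * Vm x) ==>
  (\<forall>x. Q x >= Vm x / 2 - m0) ==> (\<forall>x\<in>cball c 2. Q x >= V x / 2) ==> infsup c kappa0 Q ==>
  subsol c Q G z gz ==> subsol c Q G (%x. - w x) (%x. - gw x) ==> (\<forall>x. x \<notin> cball c 2 --> z x = w x & gz x = gw x) ==>
  (\<forall>xi eta. inX (ball c 1) xi eta --> aform Q w gw xi eta = 0) ==>
  (AE x in lborel. z x <= delta) & (AE x in lborel. - w x <= delta)"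
  using uniform_sup_bound[OF kappa0 delta(1) less_imp_le[OF G]] by blast
 \<comment> \<open>\<open>L\<close> serves the sup bound, and \<open>V >= 2 * Cf + 1\<close> gives
   \<open>V - r >= V / 2 > 0\<close>.\<close>
 define L' where "L' = max L (2 * Cf + 1)"
 obtain R' where R': "R' > 0" "!!x. norm x >= R' ==> V x >= L'" using V_large by blast
 \<comment> \<open>\<open>R\<close> comes from the inf-sup theorem; the margin 5 keeps
   \<open>cball c 5\<close> in the region where \<open>V >= L'\<close>.\<close>
 have "0 <= max R (R' + 5)" using R' by simp
 then obtain c :: "real^'n" where c: "norm c = max R (R' + 5)" using vector_choose_size by blast
 have VL: "V x >= L'" if "x \<in> cball c 5" for x
  using R'(2)[of x] norm_triangle_sub[of c x] c that by (simp add: dist_norm)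
 have VC: "V x >= 2 * Cf + 1" "V x >= L" if "x \<in> cball c 5" for x using VL[OF that] by (auto simp: L'_def)
 obtain zeta where z: "zeta \<in> Cc" "!!x. 0 <= zeta x & zeta x <= 1 & (dist c x <= 1 --> zeta x = 1) & (dist c x >= 2 --> zeta x = 0) &
  \<bar>lap zeta x\<bar> <= G & (dist c x < 1 \<or> dist c x > 2 --> grad zeta x = 0 & lap zeta x = 0)" using cut[of c] unfolding cutoff_def by blast
 note [measurable] = test_measurable[OF z(1)] grad_measurable[OF Cc_infinityD(1)[OF z(1)]]
 have cb[measurable]: "cball c 2 \<in> sets borel" "ball c 1 \<in> sets borel" by (simp_all add: borel_closed)
 let ?X = "inX (ball c 1)" and ?O = "cball c 2"
 have "\<exists>w g. approx r c zeta rho w g" if rho: "0 <= rho" "rho < 1" for rho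
 proof -
  define ws where "ws = HH rho 1"
  have ws: "1/4 <= ws" "ws <= 1" using HH_1_bounds[of rho] rho by (auto simp: ws_def)
  \<comment> \<open>Outside \<open>cball c 2\<close> values are cut at \<open>delta\<close>, which
    makes the coefficient close to \<open>V\<close>; inside they may rise to the boundary value
    \<open>ws\<close>.\<close>
  define theta where "theta x s = (if x \<in> ?O then max (- delta) (min ws s) else max (- delta) (min delta s))" for x s
  define q where "q x s = alpha rho (theta x s) * (V x - r (UU rho (theta x s)))" for x s
  have cU: "continuous_on UNIV (UU rho)" using UU_cont[OF rho] by (simp add: continuous_at_imp_continuous_on)
  note bm = borel_measurable_continuous_onI[OF alpha_cont[OF rho]] borel_measurable_continuous_onI[OF cU] borel_measurable_continuous_onI[OF r(1)]
  note [measurable] = bm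
  have q_meas: "(%x. q x (w x)) \<in> BM" if [measurable]: "w \<in> BM" for w
   unfolding q_def theta_def by measurable
  have q_cont: "continuous_on UNIV (q x)" for x
  proof -
   have ct: "continuous_on UNIV (theta x)" by (cases "x \<in> ?O") (auto simp: theta_def intro!: continuous_intros)
   show ?thesis unfolding q_def[abs_def]
    by (intro continuous_intros continuous_on_compose2[OF alpha_cont[OF rho] ct] continuous_on_compose2[OF r(1)] continuous_on_compose2[OF cU ct]) auto
  qed
  have al: "alpha rho s >= 1" "alpha rho s <= 1 / (1 - rho)" for s using alpha_bounds(1) alpha_le rho by auto
  define C where "C = (1 + m0 + Cf) / (1 - rho)"
  have q_bd: "\<bar>q x s\<bar> <= C * Vm x" for x s
  proof -
   have "\<bar>V x - r (UU rho (theta x s))\<bar> <= (1 + m0) * Vm x + Cf * 1" using V_abs_le[of x] r(3)[of "UU rho (theta x s)"] by linarith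
   also have "\<dots> <= (1 + m0 + Cf) * Vm x" using mult_left_mono[OF Vm_ge1[of x] Cf0] by (simp add: algebra_simps)
   finally have "\<bar>q x s\<bar> <= (1 / (1 - rho)) * ((1 + m0 + Cf) * Vm x)"
    unfolding q_def abs_mult using al[of "theta x s"] rho by (intro mult_mono) auto
   then show ?thesis by (simp add: C_def)
  qed
  have adm: "admissible epsilon0 c (%x. q x (w x))" if w: "w \<in> BM" for w
   unfolding admissible_def
  proof (intro conjI allI impI ballI exI[of _ C] q_meas[OF w] q_bd)
   fix x assume "x \<notin> ?O"
   then have th: "\<bar>theta x (w x)\<bar> <= delta" using delta by (auto simp: theta_def)
   define s where "s = theta x (w x)"
   have s: "\<bar>s\<bar> <= delta" "\<bar>s\<bar> < 1/4" using th delta by (auto simp: s_def)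
   have "\<bar>s\<bar> * \<bar>s\<bar> <= delta * (1/8)" using s delta by (intro mult_mono) auto
   then have "s^2 <= delta * (1/8)" by (simp add: power2_eq_square)
   then have a: "\<bar>alpha rho s - 1\<bar> <= delta" using alpha_small[OF rho s(2)] by linarith
   have rr: "\<bar>r (UU rho s)\<bar> <= epsilon0 / 4" using d(2)[of "UU rho s"] UU_small(2)[OF rho s(2)] s delta by auto
   have "\<bar>q x (w x) - V x\<bar> = \<bar>(alpha rho s - 1) * V x - alpha rho s * r (UU rho s)\<bar>" by (simp add: q_def s_def algebra_simps)
   also have "\<dots> <= \<bar>alpha rho s - 1\<bar> * \<bar>V x\<bar> + \<bar>alpha rho s\<bar> * \<bar>r (UU rho s)\<bar>" by (metis abs_mult abs_triangle_ineq4)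
   also have "\<dots> <= delta * ((1 + m0) * Vm x) + 2 * (epsilon0 / 4)"
    using a rr delta V_abs_le[of x] by (intro add_mono mult_mono) auto
   also have "\<dots> <= epsilon0 / 2 * Vm x + epsilon0 / 2 * Vm x"
   proof (rule add_mono)
    show "delta * ((1 + m0) * Vm x) <= epsilon0 / 2 * Vm x"
     using mult_right_mono[OF delta(4) less_imp_le[OF Vm_pos[of x]]] by (simp only: mult.assoc)
    show "2 * (epsilon0 / 4) <= epsilon0 / 2 * Vm x" using Vm_ge1[of x] epsilon0 by simp
   qed
   finally show "\<bar>q x (w x) - V x\<bar> <= epsilon0 * Vm x" by simp
  next
   fix x assume x: "x \<in> ?O"
   then have V: "V x >= 2 * Cf + 1" using VC(1)[of x] by auto
   have "V x / 2 <= 1 * (V x - r (UU rho (theta x (w x))))" using V abs_le_D1[OF r(3)[of "UU rho (theta x (w x))"]] by simp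
   also have "\<dots> <= q x (w x)" unfolding q_def using al(1) V r(3)[of "UU rho (theta x (w x))"] Cf0 by (intro mult_right_mono) (auto simp: abs_le_iff)
   finally show "q x (w x) >= V x / 2" .
  qed
  have isup: "infsup c kappa0 (%x. q x (w x))" if "w \<in> BM" for w
   using is0[OF _ adm[OF that]] c by simp
  define z0 where "z0 x = ws * zeta x" for x
  define g0 where "g0 x = ws *R grad zeta x" for x
  have E0: "inE z0 g0" unfolding z0_def[abs_def] g0_def[abs_def] by (rule inE_scale[OF inE_test[OF z(1)]])
  obtain y g where y: "?X y g" "!!xi eta. ?X xi eta ==> aform (%x. q x (y x + z0 x)) (%x. y x + z0 x) (%x. g x + g0 x) xi eta = 0"
   using semilinear_solution[OF q_meas q_cont q_bd cb(2) kappa0 _ E0] isup unfolding infsup_def by blast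
  define w where "w x = y x + z0 x" for x
  define gw where "gw x = g x + g0 x" for x
  define Q where "Q x = q x (w x)" for x
  note Ey = inXD(1)[OF y(1)]
  have Ew: "inE w gw" unfolding w_def[abs_def] gw_def[abs_def] by (rule inE_add[OF Ey E0])
  note [measurable] = inED(4,5)[OF Ey] inED(4,5)[OF Ew]
  have Qm: "Q \<in> BM" unfolding Q_def[abs_def] by (rule q_meas) measurable
  note [measurable] = Qm
  have Qb: "!!x. \<bar>Q x\<bar> <= C * Vm x" using q_bd by (simp add: Q_def)
  have eq: "aform Q w gw xi eta = 0" if "?X xi eta" for xi eta using y(2)[OF that] by (simp add: Q_def[abs_def] w_def[abs_def] gw_def[abs_def])
  have adm': "admissible epsilon0 c Q" using adm[OF inED(4)[OF Ew]] by (simp add: Q_def[abs_def])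
  have Q2: "Q x >= V x / 2" if "x \<in> ?O" for x using adm' that by (auto simp: admissible_def)
  have V2: "V x >= 1" if "x \<in> ?O" for x using VC(1)[of x] that Cf0 by auto
  have wB: "w x = y x + ws" "gw x = g x" "z0 x = ws" "g0 x = 0" if "x \<in> ball c 1" for x
   using that z(2)[of x] by (auto simp: w_def gw_def z0_def g0_def)
  have wO: "w x = y x" "gw x = g x" if "x \<notin> ?O" for x
   using that z(2)[of x] by (auto simp: w_def gw_def z0_def g0_def)
  have sub1: "subsol c Q G y g"
   unfolding subsol_def
  proof (intro conjI allI impI Ey inX_pos[OF y(1)])
   fix xi eta assume X: "?X xi eta" and p: "\<forall>x. 0 <= xi x & (xi x \<noteq> 0 --> y x > 0)"
   note E = inXD(1)[OF X]
   note i = integrable_form(1)[OF E0 E Qm Qb] weak_laplacian(2)[OF inED(1)[OF E] z(1)] integrable_sq_mult[OF sq_int_indicator_cball[of c 2] inED(2)[OF E]]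
   have "aform Q y g xi eta + aform Q z0 g0 xi eta = 0"
    using eq[OF X] aform_add(1)[OF Ey E0 E Qm Qb] by (simp add: w_def[abs_def] gw_def[abs_def])
   moreover have "(LBINT x. g0 x \<bullet> eta x) = - (ws * (LBINT x. lap zeta x * xi x))"
    using weak_laplacian(1)[OF inED(1)[OF E] z(1)] by (simp add: g0_def)
   ultimately have "aform Q y g xi eta = (LBINT x. ws * (lap zeta x * xi x) - Q x * z0 x * xi x)"
    using i by (simp add: aform_def)
   also have "\<dots> <= (LBINT x. G * (indicator ?O x * xi x))"
   proof (rule integral_mono)
    show "integrable lborel (%x. ws * (lap zeta x * xi x) - Q x * z0 x * xi x)" "integrable lborel (%x. G * (indicator ?O x * xi x))"
     using i by simp_all
    fix x
    show "ws * (lap zeta x * xi x) - Q x * z0 x * xi x <= G * (indicator ?O x * xi x)"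
    proof (cases "x \<in> ?O")
     case True
     have "ws * lap zeta x <= 1 * G"
      by (rule order_trans[OF mult_left_mono[of "lap zeta x" G ws]]) (use z(2)[of x] ws G in \<open>auto simp: abs_le_iff intro: mult_right_mono\<close>)
     then have "ws * lap zeta x * xi x <= G * xi x" using p by (simp add: mult_right_mono)
     moreover have "0 <= Q x * z0 x * xi x" using Q2[OF True] V2[OF True] z(2)[of x] ws p by (simp add: z0_def)
     ultimately show ?thesis using True by (simp add: mult.assoc)
    next
     case False
     then show ?thesis using z(2)[of x] by (auto simp: z0_def)
    qed
   qed
   finally show "aform Q y g xi eta <= G * (LBINT x. indicator ?O x * xi x)" by simp
  qed
  \<comment> \<open>A truncation of \<open>a * w\<close> vanishes on the sphere if its level is at
    least the boundary value \<open>a * ws\<close>. On the ball it is a truncation of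
    \<open>a * y\<close> at a nonnegative level, which gives admissibility.\<close>
  have pos_cong: "?X (%x. max 0 (a * w x - k)) (%x. ((sgn (a * w x - k) + 1) / 2) *R (a *R gw x))"
   if "k >= 0" "k >= a * ws" for a k
  proof (rule inX_cong_on)
   show "inE (%x. max 0 (a * w x - k)) (%x. ((sgn (a * w x - k) + 1) / 2) *R (a *R gw x))"
    using inX_pos[of "{}" "%x. a * w x" "%x. a *R gw x" k] inE_scale[OF Ew, of a] that by (simp add: inX_empty)
   show "?X (%x. max 0 (a * y x - (k - a * ws))) (%x. ((sgn (a * y x - (k - a * ws)) + 1) / 2) *R (a *R g x))"
    by (rule inX_pos[OF inX_scale[OF y(1)]]) (use that in simp)
  qed (simp add: wB algebra_simps)
  have sub2: "subsol c Q G (%x. - w x) (%x. - gw x)"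
   unfolding subsol_def
  proof (intro conjI allI impI)
   show "inE (%x. - w x) (%x. - gw x)" using inE_scale[OF Ew, of "-1"] by simp
   show "?X (%x. max 0 (- w x - k)) (pg (%x. - w x) (%x. - gw x) k)" if "k >= 0" for k
    using pos_cong[of k "-1"] that ws by simp
   fix xi eta assume X: "?X xi eta" and p: "\<forall>x. 0 <= xi x & (xi x \<noteq> 0 --> - w x > 0)"
   have "aform Q (%x. - w x) (%x. - gw x) xi eta = 0" using aform_scale(2)[of Q "-1" w gw xi eta] eq[OF X] by simp
   moreover have "0 <= (LBINT x. indicator ?O x * xi x)" by (rule integral_nonneg_AE) (use p in simp)
   ultimately show "aform Q (%x. - w x) (%x. - gw x) xi eta <= G * (LBINT x. indicator ?O x * xi x)" using G by simp
  qed
  have "(AE x in lborel. y x <= delta) & (AE x in lborel. - w x <= delta)"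
   by (rule L[OF _ Qm _ _ _ _ sub1 sub2])
    (use VC(2) Qb admissible_lower[OF adm' epsilon0(2)] Q2 isup[OF inED(4)[OF Ew], folded Q_def] wO eq in auto)
  then have AE1: "AE x in lborel. y x <= delta" and AE2: "AE x in lborel. - w x <= delta" by auto
  \<comment> \<open>Weak maximum principle: in \<open>cball c 2\<close> the coefficient is positive,
    and outside \<open>w <= delta < ws\<close> makes the test function vanish.\<close>
  define xi where "xi x = max 0 (w x - ws)" for x
  define eta where "eta x = ((sgn (w x - ws) + 1) / 2) *R gw x" for x
  have X: "?X xi eta" using pos_cong[of ws 1] ws by (simp add: xi_def[abs_def] eta_def[abs_def])
  note i = integrable_form(1)[OF Ew inXD(1)[OF X] Qm Qb]
  have pw: "AE x in lborel. 0 <= Q x * w x * xi x & (Q x * w x * xi x = 0 --> w x <= ws)"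
   using AE1
  proof eventually_elim
   case (elim x)
   show ?case
   proof (cases "x \<in> ?O & w x > ws")
    case True
    then have "Q x > 0" "w x > 0" "xi x > 0" using Q2[of x] V2[of x] ws by (auto simp: xi_def)
    then show ?thesis by simp
   next
    case False
    then have "w x <= ws" using wO[of x] elim delta ws by (cases "x \<in> ?O") auto
    then show ?thesis by (simp add: xi_def)
   qed
  qed
  have "(LBINT x. gw x \<bullet> eta x) >= 0"
  proof (rule integral_nonneg_AE, rule AE_I2)
   fix x
   have "(sgn (w x - ws) + 1) / 2 >= 0" by (simp add: sgn_real_def)
   then show "0 <= gw x \<bullet> eta x" unfolding eta_def inner_scaleR_right by (rule mult_nonneg_nonneg) simp
  qed
  then have "(LBINT x. Q x * w x * xi x) <= 0" using eq[OF X] by (simp add: aform_def)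
  moreover have "(LBINT x. Q x * w x * xi x) >= 0" by (rule integral_nonneg_AE) (use pw in auto)
  ultimately have "(LBINT x. Q x * w x * xi x) = 0" by simp
  then have "AE x in lborel. Q x * w x * xi x = 0" by (subst (asm) integral_nonneg_eq_0_iff_AE[OF i]) (use pw in auto)
  then have AE3: "AE x in lborel. w x <= ws" using pw by eventually_elim blast
  define good where "good x \<longleftrightarrow> - delta <= w x & w x <= ws & (x \<notin> ?O --> w x <= delta)" for x
  have good: "AE x in lborel. good x"
   using AE1 AE2 AE3 by eventually_elim (use wO in \<open>auto simp: good_def\<close>)
  have [measurable]: "Measurable.pred borel good" unfolding good_def[abs_def] by measurable
  \<comment> \<open>On the exceptional null set the solution is replaced by the lifting, which obeys
    all the bounds.\<close>
  define w' where "w' x = (if good x then w x else z0 x)" for x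
  have [measurable]: "z0 \<in> BM" "w' \<in> BM" unfolding w'_def[abs_def] z0_def[abs_def] by measurable
  have ww: "AE x in lborel. w' x = w x" using good by eventually_elim (simp add: w'_def)
  have b: "- delta <= w' x & w' x <= ws & (x \<notin> ?O --> w' x <= delta)" for x
  proof (cases "good x")
   case False
   have "ws * zeta x <= ws * 1" using z(2)[of x] ws by (intro mult_left_mono) auto
   moreover have "0 <= ws * zeta x" using z(2)[of x] ws by simp
   ultimately show ?thesis using False delta z(2)[of x] by (auto simp: w'_def z0_def)
  qed (auto simp: w'_def good_def)
  have th: "theta x (w' x) = w' x" for x using b[of x] by (auto simp: theta_def)
  show ?thesis
   unfolding approx_def
  proof (intro exI[of _ w'] exI[of _ gw] conjI allI impI)
   have e: "(%x. gw x - HH rho 1 *R grad zeta x) = g" by (auto simp: gw_def g0_def ws_def)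
   show "?X (%x. w' x - HH rho 1 * zeta x) (%x. gw x - HH rho 1 *R grad zeta x)" unfolding e
   proof (rule inX_cong_AE[OF y(1)])
    show "AE x in lborel. w' x - HH rho 1 * zeta x = y x" using ww by eventually_elim (simp add: w_def z0_def ws_def)
   qed auto
   show "- (1/8) <= w' x" "w' x <= HH rho 1" "x \<notin> ?O ==> w' x <= 1/8" for x using b[of x] delta by (auto simp: ws_def)
   fix xi eta assume X: "?X xi eta"
   note [measurable] = inED(4,5)[OF inXD(1)[OF X]]
   have "(LBINT x. (alpha rho (w' x) * (V x - r (UU rho (w' x)))) * w' x * xi x) = (LBINT x. Q x * w x * xi x)"
   proof (rule integral_cong_AE)
    show "AE x in lborel. (alpha rho (w' x) * (V x - r (UU rho (w' x)))) * w' x * xi x = Q x * w x * xi x"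
     using ww by eventually_elim (metis th Q_def q_def)
   qed measurable
   then show "aform (%x. alpha rho (w' x) * (V x - r (UU rho (w' x)))) w' gw xi eta = 0" using eq[OF X] by (simp add: aform_def)
  qed
 qed
 note main = this
 show ?thesis
 proof (rule exI[of _ c], rule exI[of _ zeta], intro conjI)
  show "\<forall>x\<in>cball c 5. V x >= Cf + 1" using VC(1) Cf0 by force
 qed (use main z in blast)+
qed

end

section \<open>Energy bounds uniform in \<open>rho\<close>\<close>

text \<open>The derivative is taken within the interval because \<open>hh\<close> has a corner at 1,
  the image of the right endpoint. Its factor \<open>1 / h^2\<close> is the one by which
  \<open>|grad u|^2\<close> exceeds \<open>|grad w|^2\<close>, so testing with \<open>h\<close>
  controls the gradient of \<open>u\<close>.\<close>

lemma hh_UU_deriv: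
 assumes rho: "0 <= rho" "rho < 1"
 shows "s \<in> {- (1/8)..HH rho 1} ==> ((%s. hh rho (UU rho s)) has_real_derivative - (rho * UU rho s) / (hh rho (UU rho s))^2) (at s within {- (1/8)..HH rho 1})"
  "continuous_on {- (1/8)..HH rho 1} (%s. - (rho * UU rho s) / (hh rho (UU rho s))^2)"
proof -
 let ?I = "{- (1/8)..HH rho 1}"
 show "((%s. hh rho (UU rho s)) has_real_derivative - (rho * UU rho s) / (hh rho (UU rho s))^2) (at s within ?I)" if s: "s \<in> ?I"
  unfolding has_field_derivative_def
 proof (rule has_derivative_transform[OF s])
  have r1: "\<bar>UU rho t\<bar> <= 1" if "t \<in> ?I" for t using UU_range[OF rho, of t] that by auto
  have sq: "sqrt (1 - rho * (UU rho t)^2) = hh rho (UU rho t)" if "t \<in> ?I" for t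
   unfolding hh_def using r1[OF that] by (simp add: abs_square_le_1 min_absorb2)
  then show "t \<in> ?I ==> hh rho (UU rho t) = sqrt (1 - rho * (UU rho t)^2)" for t by simp
  have p: "hh rho (UU rho s) > 0" by (rule hh_pos[OF rho])
  then have "1 - rho * (UU rho s)^2 > 0" using sq[OF s] by (metis real_sqrt_gt_0_iff)
  then have "((%t. sqrt (1 - rho * (UU rho t)^2)) has_real_derivative (- (rho * (2 * UU rho s * (1 / hh rho (UU rho s))))) * (inverse (hh rho (UU rho s)) / 2)) (at s)"
   unfolding sq[OF s, symmetric] by (auto intro!: derivative_eq_intros UU_deriv[OF rho] simp: hh_def) (use sq[OF s] in \<open>auto simp: hh_def\<close>)
  moreover have "(- (rho * (2 * UU rho s * (1 / hh rho (UU rho s))))) * (inverse (hh rho (UU rho s)) / 2) = - (rho * UU rho s) / (hh rho (UU rho s))^2"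
   using p by (simp add: field_simps power2_eq_square)
  ultimately show "((%t. sqrt (1 - rho * (UU rho t)^2)) has_derivative (*) (- (rho * UU rho s) / (hh rho (UU rho s))^2)) (at s within ?I)"
   unfolding has_field_derivative_def by (metis has_derivative_at_withinI)
 qed
 show "continuous_on ?I (%s. - (rho * UU rho s) / (hh rho (UU rho s))^2)"
  using hh_pos[OF rho] UU_cont[OF rho]
  by (intro continuous_intros continuous_on_compose2[OF hh_cont(1)] continuous_at_imp_continuous_on) (auto simp: less_imp_neq[symmetric])
qed

context coercive_potential
begin

text \<open>\<open>w\<close> equals \<open>a\<close> on the sphere, so \<open>G(w) - G(a)\<close>
  vanishes there. On the ball \<open>zeta = 1\<close>, hence the function agrees there with a
  composition with \<open>w - a * zeta\<close>; outside, membership in the energy space is all that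
  is asked.\<close>

lemma test_compose:
 assumes X: "inX (ball c 1) (%x. w x - a * zeta x) (%x. g x - a *R grad zeta x)"
  and z: "zeta \<in> Cc" "!!x. dist c x <= 1 ==> zeta x = 1"
  and G: "!!t. (G has_real_derivative G' t) (at t)" "continuous_on UNIV G'" "!!t. \<bar>G' t\<bar> <= C" "G 0 = 0" and p: "phi \<in> Cc"
 shows "inX (ball c 1) (%x. phi x * (G (w x) - G a)) (%x. phi x *R (G' (w x) *R g x) + (G (w x) - G a) *R grad phi x)"
  and "inE w g"
proof -
 have "inE (%x. (w x - a * zeta x) + a * zeta x) (%x. (g x - a *R grad zeta x) + a *R grad zeta x)"
  by (rule inE_add[OF inXD(1)[OF X] inE_scale[OF inE_test[OF z(1)]]])
 then show E: "inE w g" by simp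
 show "inX (ball c 1) (%x. phi x * (G (w x) - G a)) (%x. phi x *R (G' (w x) *R g x) + (G (w x) - G a) *R grad phi x)"
 proof (rule inX_cong_on)
  have "inE (%x. phi x * G (w x) + (- G a) * phi x) (%x. (phi x *R (G' (w x) *R g x) + G (w x) *R grad phi x) + (- G a) *R grad phi x)"
   using inX_chain[of "{}", OF _ G] E by (intro inE_add inE_scale inE_test p inE_mult_test) (simp add: inX_empty)
  then show "inE (%x. phi x * (G (w x) - G a)) (%x. phi x *R (G' (w x) *R g x) + (G (w x) - G a) *R grad phi x)"
   by (simp add: algebra_simps)
  have d: "((%t. G (t + a) - G a) has_real_derivative G' (t + a)) (at t)" for t
   using DERIV_shift[of G "G' (t + a)" t a] G(1) by (auto intro!: derivative_eq_intros)
  show "inX (ball c 1) (%x. phi x * (G (w x - a * zeta x + a) - G a))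
   (%x. phi x *R (G' (w x - a * zeta x + a) *R (g x - a *R grad zeta x)) + (G (w x - a * zeta x + a) - G a) *R grad phi x)"
   by (rule inX_mult_test[OF inX_chain[OF X d _ G(3)] p]) (auto intro!: continuous_on_compose2[OF G(2)] continuous_intros)
  have "grad zeta x = 0" if "x \<in> ball c 1" for x
   by (rule grad_lap_eq_0(1)[OF Cc_infinityD(1)[OF z(1)] open_ball[of c 1] that, of 1]) (use z(2) in auto)
  then show "phi x * (G (w x) - G a) = phi x * (G (w x - a * zeta x + a) - G a) &
   phi x *R (G' (w x) *R g x) + (G (w x) - G a) *R grad phi x =
   phi x *R (G' (w x - a * zeta x + a) *R (g x - a *R grad zeta x)) + (G (w x - a * zeta x + a) - G a) *R grad phi x"
   if "x \<in> ball c 1" for x using that z(2)[of x] by simp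
 qed
qed

text \<open>The regularised problem in terms of \<open>u\<close>: the product
  \<open>alpha * w\<close> is \<open>u / h\<close>, and the bounds on \<open>w\<close> become bounds
  on \<open>u\<close> that do not depend on \<open>rho\<close>.\<close>

lemma approx_facts:
 assumes a: "approx r c zeta rho w g" and rho: "0 <= rho" "rho < 1" and z: "zeta \<in> Cc"
  and r: "continuous_on UNIV r" "!!t. \<bar>r t\<bar> <= Cf"
 defines "u \<equiv> %x. UU rho (w x)"
 shows "inE w g" "inE u (%x. (1 / hh rho (u x)) *R g x)" "- (1/4) <= u x" "u x <= 1" "x \<notin> cball c 2 ==> \<bar>u x\<bar> <= 1/4"
  "w x = HH rho (u x)" "\<bar>u x\<bar> <= 4 * \<bar>w x\<bar>" "\<bar>w x\<bar> <= 1"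
  "inX (ball c 1) xi eta ==> (LBINT x. g x \<bullet> eta x) + (LBINT x. (V x - r (u x)) * u x / hh rho (u x) * xi x) = 0"
  "inX (ball c 1) xi eta ==> integrable lborel (%x. (V x - r (u x)) * u x / hh rho (u x) * xi x)"
  "u \<in> BM"
proof -
 let ?Q = "%x. alpha rho (w x) * (V x - r (UU rho (w x)))"
 have E: "inE (%x. (w x - HH rho 1 * zeta x) + HH rho 1 * zeta x) (%x. (g x - HH rho 1 *R grad zeta x) + HH rho 1 *R grad zeta x)"
  using a unfolding approx_def by (intro inE_add inE_scale inE_test z) (blast dest: inXD(1))
 then show E: "inE w g" by simp
 note [measurable] = inED(4,5)[OF E]
 have cU: "continuous_on UNIV (UU rho)" using UU_cont[OF rho] by (simp add: continuous_at_imp_continuous_on)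
 note [measurable] = borel_measurable_continuous_onI[OF alpha_cont[OF rho]] borel_measurable_continuous_onI[OF cU] borel_measurable_continuous_onI[OF r(1)]
 show "u \<in> BM" unfolding u_def by measurable
 have b: "- (1/8) <= w x" "w x <= HH rho 1" "x \<notin> cball c 2 ==> w x <= 1/8" for x using a by (auto simp: approx_def)
 show "- (1/4) <= u x" "u x <= 1" using UU_range[OF rho b(1,2)] by (auto simp: u_def)
 show "\<bar>u x\<bar> <= 1/4" if "x \<notin> cball c 2"
 proof -
  have "\<bar>w x\<bar> <= 1/8" using b(1)[of x] b(3)[OF that] by (auto simp: abs_le_iff)
  then show ?thesis using UU_small(2)[OF rho, of "w x"] by (simp add: u_def)
 qed
 show "w x = HH rho (u x)" using rho by (simp add: u_def)
 show "\<bar>w x\<bar> <= 1" using b(1,2)[of x] HH_1_bounds[of rho] rho by auto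
 show "\<bar>u x\<bar> <= 4 * \<bar>w x\<bar>"
  using UU_small(2)[OF rho, of "w x"] UU_range[OF rho b(1,2), of x] by (cases "\<bar>w x\<bar> < 1/4") (auto simp: u_def)
 have bd: "\<bar>1 / hh rho (UU rho s)\<bar> <= 1 / sqrt (1 - rho)" for s
  using hh_ge[OF rho(1), of "UU rho s"] hh_pos[OF rho, of "UU rho s"] rho by (simp add: frac_le)
 have ct: "continuous_on UNIV (%s. 1 / hh rho (UU rho s))"
  using hh_pos[OF rho] by (intro continuous_intros continuous_on_compose2[OF hh_cont(1) cU]) (auto simp: less_imp_neq[symmetric])
 have "inX {} (%x. UU rho (w x)) (%x. (1 / hh rho (UU rho (w x))) *R g x)"
  by (rule inX_chain[OF _ UU_deriv[OF rho] ct bd UU_0[OF rho]]) (simp add: inX_empty E)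
 then show "inE u (%x. (1 / hh rho (u x)) *R g x)" by (simp add: inX_empty u_def)
 have e: "?Q x * w x * xi x = (V x - r (u x)) * u x / hh rho (u x) * xi x" for xi x
 proof -
  have "?Q x * w x * xi x = (alpha rho (w x) * w x) * ((V x - r (u x)) * xi x)" by (simp add: u_def mult_ac)
  then show ?thesis by (simp add: alpha_eq(2)[OF rho] u_def)
 qed
 assume X: "inX (ball c 1) xi eta"
 then show "(LBINT x. g x \<bullet> eta x) + (LBINT x. (V x - r (u x)) * u x / hh rho (u x) * xi x) = 0"
  using a unfolding approx_def aform_def e by blast
 have Qb: "\<bar>?Q x\<bar> <= (1 / (1 - rho) * (1 + m0 + Cf)) * Vm x" for x
 proof -
  have "Cf * 1 <= Cf * Vm x" using Vm_ge1[of x] r(2)[of 0] by (intro mult_left_mono) auto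
  then have "\<bar>V x - r (UU rho (w x))\<bar> <= (1 + m0 + Cf) * Vm x"
   using V_abs_le[of x] r(2)[of "UU rho (w x)"] by (simp add: algebra_simps)
  then have "\<bar>?Q x\<bar> <= (1 / (1 - rho)) * ((1 + m0 + Cf) * Vm x)"
   unfolding abs_mult using alpha_bounds(1)[OF rho, of "w x"] alpha_le[OF rho, of "w x"] rho by (intro mult_mono) auto
  then show ?thesis by (simp only: mult.assoc)
 qed
 show "integrable lborel (%x. (V x - r (u x)) * u x / hh rho (u x) * xi x)"
  unfolding e[symmetric] by (rule integrable_form(1)[OF E inXD(1)[OF X] _ Qb]) measurable
qed

text \<open>Two test functions. The first, \<open>w - ws * zeta\<close>, bounds the energy of
  \<open>w\<close>. The second, \<open>phi * (h(u) - h(1))\<close>, bounds the gradient of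
  \<open>u\<close> where \<open>u > 1/2\<close>; elsewhere \<open>h >= 1/2\<close>, so the gradient
  of \<open>w\<close> controls it.\<close>

theorem uniform_energy_bound:
 assumes z: "zeta \<in> Cc" "!!x. 0 <= zeta x & zeta x <= 1 & (dist c x <= 1 --> zeta x = 1) & (dist c x >= 2 --> zeta x = 0)"
  and r: "continuous_on UNIV r" "!!t. \<bar>r t\<bar> <= Cf" and Vc: "!!x. x \<in> cball c 5 ==> V x >= Cf + 1"
 shows "\<exists>M. \<forall>rho w g. 1/2 <= rho --> rho < 1 --> approx r c zeta rho w g --> en w g <= M & en (%x. UU rho (w x)) (%x. (1 / hh rho (UU rho (w x))) *R g x) <= M"
proof -
 \<comment> \<open>This threshold yields \<open>V - r(u) >= Vm / 4\<close> outside the ball of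
   radius \<open>R\<close>.\<close>
 obtain R0 where R0: "!!x. norm x >= R0 ==> V x >= 4 * Cf + m0" using V_large by blast
 define R where "R = max R0 (norm c + 5)"
 obtain K where K: "K > 0" "!!x. norm x <= R ==> Vm x <= K" using V_bounded_on_ball by blast
 have Cf0: "Cf >= 0" using r(2)[of 0] by simp
 define C where "C = (1 + m0) * K + Cf"
 have C: "\<bar>V x\<bar> + Cf <= C" if "norm x <= R" for x
 proof -
  have "(1 + m0) * Vm x <= (1 + m0) * K" using K(2)[OF that] m0_nonneg by (intro mult_left_mono) auto
  then show ?thesis using V_abs_le[of x] by (simp add: C_def)
 qed
 have C0: "C >= 0" using K m0_nonneg Cf0 by (simp add: C_def)
 define W where "W = 4 * C + K"
 have inR: "norm x <= R" if "x \<in> cball c 5" for x using that norm_triangle_sub[of x c] by (simp add: R_def dist_norm norm_minus_commute)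
 have VR: "V x >= 4 * Cf + m0" if "norm x > R" for x using R0[of x] that by (simp add: R_def)
 let ?J = "%x::real^'n. indicator (cball 0 R) x :: real"
 have iJ: "integrable lborel ?J" using emeasure_cball_finite[of "0::real^'n" R] by (simp add: borel_closed)
 obtain phi where p: "phi \<in> Cc" "!!x. 0 <= phi x & phi x <= 1 & (dist c x <= 2 --> phi x = 1) & (dist c x >= 3 --> phi x = 0)"
  using shifted_cutoffs[of 2 3] unfolding cutoff_def by simp blast
 define Z where "Z = (LBINT x. (norm (grad zeta x))^2)"
 define Z' where "Z' = (LBINT x. (norm (grad phi x))^2)"
 note iz = sq_int_integrable[OF sq_int_grad[OF z(1)]] sq_int_integrable[OF sq_int_grad[OF p(1)]]
 define M1 where "M1 = 2 * Z + 4 * W * (LBINT x. ?J x)"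
 define M where "M = M1 + (14 * M1 + 2 * Z' + 4 * C * (LBINT x. ?J x)) + 16 * M1"
 have "en w g <= M & en (%x. UU rho (w x)) (%x. (1 / hh rho (UU rho (w x))) *R g x) <= M"
  if rho2: "1/2 <= rho" and rho1: "rho < 1" and a: "approx r c zeta rho w g" for rho w g
 proof -
  have rho: "0 <= rho" "rho <= 1" "rho < 1" using rho1 rho2 by auto
  define u where "u x = UU rho (w x)" for x
  define h where "h x = hh rho (u x)" for x
  define b where "b x = (V x - r (u x)) * u x / h x" for x
  define ws where "ws = HH rho 1"
  define v where "v x = (1 / h x) *R g x" for x
  note F = approx_facts[OF a rho(1,3) z(1) r, folded u_def h_def, folded b_def v_def, folded u_def[abs_def] v_def[abs_def]]
  have h: "0 < h x" "h x <= 1" for x using hh_pos[OF rho(1,3)] hh_le_1[OF rho(1)] by (auto simp: h_def)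
  have h2: "h x >= 1/2" if "u x <= 1/2" for x unfolding h_def using F(3)[of x] that rho by (intro hh_ge_half(1)) auto
  have ws: "1/4 <= ws" "ws <= 1" using HH_1_bounds[OF rho(1,2)] by (auto simp: ws_def)
  define y where "y x = w x - ws * zeta x" for x
  define gy where "gy x = g x - ws *R grad zeta x" for x
  have X: "inX (ball c 1) y gy" using a by (simp add: approx_def y_def[abs_def] gy_def[abs_def] ws_def)
  note i = F(10)[OF X] integrable_inner[OF inED(3)[OF F(1)] inED(3)[OF inXD(1)[OF X]]]
   inED(6)[OF F(1)] sq_int_integrable[OF inED(3)[OF F(1)]]
  have bb: "\<bar>b x\<bar> * h x <= C" if "norm x <= R" for x
  proof -
   have "\<bar>V x - r (u x)\<bar> * \<bar>u x\<bar> <= C * 1" using C[OF that] r(2)[of "u x"] F(3,4)[of x] C0 by (intro mult_mono) auto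
   then show ?thesis using h[of x] by (simp add: b_def abs_mult)
  qed
  have bu: "\<bar>b x\<bar> <= 2 * C" if "norm x <= R" "u x <= 1/2" for x
  proof -
   have "\<bar>b x\<bar> * (1/2) <= \<bar>b x\<bar> * h x" using h2[OF that(2)] by (intro mult_left_mono) auto
   then show ?thesis using bb[OF that(1)] by simp
  qed
  \<comment> \<open>For \<open>u >= 0\<close> in \<open>cball c 2\<close> the factor
    \<open>b\<close> is nonnegative, and concavity bounds \<open>ws - w\<close> by \<open>h\<close>,
    which cancels the singularity of \<open>b\<close>. In the rest of the ball of radius
    \<open>R\<close> one has \<open>u <= 1/2\<close> and \<open>b\<close> is bounded; beyond it the
    potential dominates \<open>r\<close>.\<close>
  have low: "Vm x / 4 * (w x)^2 - W * ?J x <= b x * y x" for x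
  proof (cases "norm x <= R")
   case True
   have "Vm x * (w x)^2 <= K * 1" using K True Vm_pos[of x] F(8)[of x] by (intro mult_mono) (auto simp: abs_square_le_1)
   then have Kw: "Vm x / 4 * (w x)^2 <= K" using K by simp
   have "- (4 * C) <= b x * y x"
   proof (cases "u x >= 0 & x \<in> cball c 2")
    case u: True
    then have "V x - r (u x) >= 0" using Vc[of x] r(2)[of "u x"] by (simp add: abs_le_iff)
    then have b0: "b x >= 0" using u h[of x] by (simp add: b_def)
    have "ws - w x <= h x * (1 - u x)" unfolding ws_def F(6)[of x] h_def using HH_concave[OF rho(1,2)] u F(4) by blast
    also have "\<dots> <= h x * 1" using h[of x] u by (intro mult_left_mono) auto
    finally have "b x * (ws - w x) <= b x * h x" using b0 by (simp add: mult_left_mono)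
    then have "b x * (ws - w x) <= C" using bb[OF True] b0 by simp
    moreover have "b x * (ws * zeta x - w x) <= b x * (ws - w x)"
     using b0 z(2)[of x] ws by (intro mult_left_mono) (auto simp: mult_left_le)
    ultimately show ?thesis using C0 by (simp add: y_def algebra_simps)
   next
    case False
    have "u x <= 1/2" using False F(5)[of x] by (cases "x \<in> cball c 2") auto
    moreover have "\<bar>y x\<bar> <= 2"
    proof -
     have "\<bar>ws * zeta x\<bar> <= 1" using z(2)[of x] ws by (simp add: abs_mult mult_le_one)
     then show ?thesis using F(8)[of x] by (simp add: y_def)
    qed
    ultimately have "\<bar>b x * y x\<bar> <= (2 * C) * 2" unfolding abs_mult using bu[OF True] C0 by (intro mult_mono) auto
    then show ?thesis by (simp add: abs_le_iff)
   qed
   then show ?thesis using True Kw by (simp add: W_def)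
  next
   case False
   then have o: "x \<notin> cball c 2" using inR[of x] by auto
   then have "zeta x = 0" using z(2)[of x] by auto
   then have yw: "y x = w x" by (simp add: y_def)
   have V: "V x - r (u x) >= Vm x / 4" using VR[of x] False r(2)[of "u x"] m0_nonneg Cf0 by (auto simp: Vm_def abs_le_iff)
   have e: "b x * w x = (V x - r (u x)) * (alpha rho (w x) * (w x)^2)"
    unfolding b_def h_def u_def using alpha_eq(2)[OF rho(1,3), of "w x"] by (simp add: power2_eq_square mult.assoc[symmetric])
   have "Vm x / 4 * (1 * (w x)^2) <= b x * w x" unfolding e
    using V Vm_pos[of x] alpha_bounds(1)[OF rho(1,3), of "w x"] by (intro mult_mono mult_right_mono) auto
   then show ?thesis using False yw by simp
  qed
  have M1: "en w g <= M1"
  proof -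
   have "(LBINT x. (1/2) * (norm (g x))^2 - (1/2) * (norm (grad zeta x))^2 + ((1/4) * (Vm x * (w x)^2) - W * ?J x)) <= (LBINT x. g x \<bullet> gy x + b x * y x)"
   proof (rule integral_mono)
    show "(1/2) * (norm (g x))^2 - (1/2) * (norm (grad zeta x))^2 + ((1/4) * (Vm x * (w x)^2) - W * ?J x) <= g x \<bullet> gy x + b x * y x" for x
    proof (rule add_mono)
     have "ws * (g x \<bullet> grad zeta x) <= norm (g x) * norm (grad zeta x)"
      using mult_mono[OF ws(2) norm_cauchy_schwarz[of "g x" "grad zeta x"]] ws
      by (cases "g x \<bullet> grad zeta x >= 0") (auto intro: order_trans[OF mult_nonneg_nonpos])
     moreover have "2 * norm (g x) * norm (grad zeta x) <= (norm (g x))^2 + (norm (grad zeta x))^2" by (rule sum_squares_bound)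
     ultimately show "(1/2) * (norm (g x))^2 - (1/2) * (norm (grad zeta x))^2 <= g x \<bullet> gy x"
      by (simp add: gy_def inner_diff_right power2_norm_eq_inner)
     show "(1/4) * (Vm x * (w x)^2) - W * ?J x <= b x * y x" using low[of x] by simp
    qed
   qed (use i iz iJ in auto)
   also have "\<dots> = 0" using F(9)[OF X] i by simp
   finally have "(1/2) * (LBINT x. (norm (g x))^2) - (1/2) * Z + ((1/4) * (LBINT x. Vm x * (w x)^2) - W * (LBINT x. ?J x)) <= 0"
    using i iz iJ by (simp add: Z_def)
   then show ?thesis unfolding en_def M1_def using en_parts(4)[of g] by linarith
  qed
  have ws0: "- (1/8) <= (0::real)" "0 <= ws" using ws by auto
  \<comment> \<open>Data for the C^1 continuation of \<open>h(UU s) - 1\<close>. The constant makes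
    the function vanish at 0 and drops out of the difference with the boundary value.\<close>
  note der = DERIV_diff[OF hh_UU_deriv(1)[OF rho(1,3), folded ws_def] DERIV_const[of 1], unfolded diff_0_right]
  note ct = hh_UU_deriv(2)[OF rho(1,3), folded ws_def]
  have z0: "hh rho (UU rho 0) - 1 = 0" using UU_0[OF rho(1,3)] by simp
  have "\<exists>G G' B. (\<forall>t. (G has_real_derivative G' t) (at t)) & continuous_on UNIV G' & (\<forall>t. \<bar>G' t\<bar> <= B) & G 0 = 0 &
   (\<forall>t\<in>{- (1/8)..ws}. G t = hh rho (UU rho t) - 1 & G' t = - (rho * UU rho t) / (hh rho (UU rho t))^2)"
   by (rule C1_extension[OF ws0 der ct z0]) (assumption, blast)
  then obtain G G' B where G: "!!t. (G has_real_derivative G' t) (at t)" "continuous_on UNIV G'" "!!t. \<bar>G' t\<bar> <= B" "G 0 = 0"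
   and Ge: "!!t. t \<in> {- (1/8)..ws} ==> G t = hh rho (UU rho t) - 1 & G' t = - (rho * UU rho t) / (hh rho (UU rho t))^2" by blast
  have Gw: "G (w x) = h x - 1" "G' (w x) = - (rho * u x) / (h x)^2" for x
   using Ge[of "w x"] a by (auto simp: approx_def ws_def h_def u_def)
  have Ga: "G (HH rho 1) = hh rho 1 - 1" using Ge[of ws] ws UU_HH[OF rho(1,3), of 1] by (simp add: ws_def)
  define \<Phi> where "\<Phi> x = h x - hh rho 1" for x
  have Phi: "0 <= \<Phi> x" "\<Phi> x <= h x" "\<Phi> x <= 1" for x
   using hh_le_mono[of rho "u x" 1] F(3,4)[of x] rho hh_nonneg[OF rho(1,2), of 1] h[of x] by (auto simp: \<Phi>_def h_def)
  define eta where "eta x = phi x *R (G' (w x) *R g x) + \<Phi> x *R grad phi x" for x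
  have "G (w x) - G (HH rho 1) = \<Phi> x" for x by (simp add: Gw Ga \<Phi>_def)
  then have X': "inX (ball c 1) (%x. phi x * \<Phi> x) eta"
   using test_compose(1)[OF _ z(1) _ G p(1), of c w "HH rho 1" g] a z(2) by (simp add: approx_def eta_def[abs_def])
  note j = F(10)[OF X'] integrable_inner[OF inED(3)[OF F(1)] inED(3)[OF inXD(1)[OF X']]]
  \<comment> \<open>For \<open>u > 1/2\<close> one has \<open>phi = 1\<close> and
    \<open>rho * u >= 1/4\<close>, whence the factor \<open>- 4\<close>. For \<open>u <= 1/2\<close>
    one has \<open>|v|^2 <= 4 |g|^2\<close>, which costs \<open>12 |g|^2\<close>; Young's inequality
    for the cutoff term costs another \<open>2 |g|^2\<close>.\<close>
  have pw: "(norm (v x))^2 <= - 4 * (g x \<bullet> eta x + b x * (phi x * \<Phi> x)) + 4 * C * ?J x + 14 * (norm (g x))^2 + 2 * (norm (grad phi x))^2" for x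
  proof -
   define T where "T = phi x * (G' (w x) * (norm (g x))^2)"
   have vg: "(norm (v x))^2 = (norm (g x))^2 / (h x)^2" using h[of x] by (simp add: v_def power_divide)
   have T: "T = - (rho * (phi x * (u x * (norm (v x))^2)))" unfolding T_def Gw vg by simp
   have e: "g x \<bullet> eta x = T + \<Phi> x * (g x \<bullet> grad phi x)" by (simp add: eta_def T_def inner_add_right power2_norm_eq_inner)
   have vT: "(norm (v x))^2 <= - 4 * T + 12 * (norm (g x))^2"
   proof (cases "u x <= 1/2")
    case True
    have "(1/2)^2 <= (h x)^2" using h2[OF True] by (intro power_mono) auto
    then have "(norm (g x))^2 / (h x)^2 <= (norm (g x))^2 / (1/2)^2" using h[of x] by (intro divide_left_mono) auto
    then have v4: "(norm (v x))^2 <= 4 * (norm (g x))^2" unfolding vg by (simp add: power2_eq_square[of "1/2"])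
    have "rho * (phi x * (- u x * (norm (v x))^2)) <= 1 * (1 * ((1/2) * (4 * (norm (g x))^2)))"
    proof (cases "u x <= 0")
     case True
     then show ?thesis using rho p(2)[of x] F(3)[of x] v4 by (intro mult_mono mult_nonneg_nonneg) auto
    next
     case False
     then have "rho * (phi x * (- u x * (norm (v x))^2)) <= 0" using rho p(2)[of x] by (simp add: mult_nonneg_nonneg)
     then show ?thesis by (rule order_trans) simp
    qed
    then show ?thesis using v4 unfolding T by simp
   next
    case False
    then have "x \<in> cball c 2" using F(5)[of x] by auto
    then have "phi x = 1" using p(2)[of x] by simp
    moreover have "(1/2) * ((1/2) * (norm (v x))^2) <= rho * (u x * (norm (v x))^2)" using False rho2 by (intro mult_mono mult_right_mono) auto
    ultimately show ?thesis unfolding T by (simp add: add_increasing2)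
   qed
   have "\<bar>\<Phi> x * (g x \<bullet> grad phi x)\<bar> <= 1 * (norm (g x) * norm (grad phi x))"
    unfolding abs_mult using Phi[of x] by (intro mult_mono Cauchy_Schwarz_ineq2) auto
   then have c1: "4 * (\<Phi> x * (g x \<bullet> grad phi x)) <= 2 * (norm (g x))^2 + 2 * (norm (grad phi x))^2"
    using sum_squares_bound[of "norm (g x)" "norm (grad phi x)"] by (simp add: abs_le_iff)
   have c2: "b x * (phi x * \<Phi> x) <= C * ?J x"
   proof (cases "dist c x <= 3")
    case True
    then have n: "norm x <= R" using inR[of x] by auto
    have "phi x * \<Phi> x <= 1 * h x" using p(2)[of x] Phi[of x] by (intro mult_mono) auto
    then have "\<bar>b x\<bar> * (phi x * \<Phi> x) <= C" using mult_left_mono[of "phi x * \<Phi> x" "h x" "\<bar>b x\<bar>"] bb[OF n] by simp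
    moreover have "b x * (phi x * \<Phi> x) <= \<bar>b x\<bar> * (phi x * \<Phi> x)" using p(2)[of x] Phi[of x] by (intro mult_right_mono) auto
    ultimately show ?thesis using n by simp
   next
    case False
    then show ?thesis using p(2)[of x] C0 by simp
   qed
   show ?thesis using vT c1 c2 e by simp
  qed
  have gv: "(LBINT x. (norm (v x))^2) <= 14 * M1 + 2 * Z' + 4 * C * (LBINT x. ?J x)"
  proof -
   have "(LBINT x. (norm (v x))^2) <= (LBINT x. - 4 * (g x \<bullet> eta x + b x * (phi x * \<Phi> x)) + 4 * C * ?J x + 14 * (norm (g x))^2 + 2 * (norm (grad phi x))^2)"
    by (rule integral_mono[OF sq_int_integrable[OF inED(3)[OF F(2)]] _ pw]) (use j iJ i iz in auto)
   also have "\<dots> = 4 * C * (LBINT x. ?J x) + 14 * (LBINT x. (norm (g x))^2) + 2 * Z'"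
    using F(9)[OF X'] j iJ i iz by (simp add: Z'_def)
   finally show ?thesis using en_parts(1)[of g w] M1 by linarith
  qed
  have "(LBINT x. Vm x * (u x)^2) <= (LBINT x. 16 * (Vm x * (w x)^2))"
  proof (rule integral_mono[OF inED(6)[OF F(2)]])
   fix x
   have "(u x)^2 <= 16 * (w x)^2" using power_mono[OF F(7)[of x], of 2] by (simp add: power_mult_distrib)
   then show "Vm x * (u x)^2 <= 16 * (Vm x * (w x)^2)" using Vm_pos[of x] by simp
  qed (use i in simp)
  then have "en u v <= (14 * M1 + 2 * Z' + 4 * C * (LBINT x. ?J x)) + 16 * M1"
   unfolding en_def[of u v] using gv en_parts(2)[of w g] M1 by (simp only: integral_mult_right_zero)
  moreover have "M1 >= 0" "0 <= 14 * M1 + 2 * Z' + 4 * C * (LBINT x. ?J x)"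
   using M1 gv en_parts(3)[of w g] en_parts(4)[of v] by linarith+
  moreover have "en (%x. UU rho (w x)) (%x. (1 / hh rho (UU rho (w x))) *R g x) = en u v" unfolding v_def[abs_def] h_def u_def[abs_def] ..
  ultimately show ?thesis using M1 unfolding M_def by linarith
 qed
 then show ?thesis by blast
qed

end

section \<open>Removing the regularisation\<close>

text \<open>The multiplier is moved to the test function, where dominated convergence makes it
  converge strongly.\<close>

lemma wconv_mult_bounded:
 fixes v :: "nat => 'a::euclidean_space => 'b::euclidean_space"
 assumes w: "wconv v v'" and v: "!!n. sq_int (v n)" "sq_int v'" and M: "!!n. (LBINT x. (norm (v n x))^2) <= M"
  and a: "AE x in lborel. (%n. a n x) ----> a' x" "!!n x. \<bar>a n x\<bar> <= C" "!!x. \<bar>a' x\<bar> <= C"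
  and [measurable]: "!!n. a n \<in> BM" "a' \<in> BM"
 shows "wconv (%n x. a n x *R v n x) (%x. a' x *R v' x)"
 unfolding wconv_def
proof (intro allI impI)
 fix psi :: "'a => 'b" assume psi: "sq_int psi"
 note [measurable] = sq_int_measurable[OF psi]
 have "l2conv (%n x. a n x *R psi x) (%x. a' x *R psi x)"
 proof (rule l2conv_dominated)
  show "AE x in lborel. (%n. a n x *R psi x) ----> a' x *R psi x" using a(1) by eventually_elim (intro tendsto_intros)
  show "integrable lborel (%x. (2 * C)^2 * (norm (psi x))^2)" using sq_int_integrable[OF psi] by simp
  have "\<bar>a n x - a' x\<bar>^2 <= (2 * C)^2" for n x using a(2)[of n x] a(3)[of x] by (intro power_mono) auto
  then show "AE x in lborel. (norm (a n x *R psi x - a' x *R psi x))^2 <= (2 * C)^2 * (norm (psi x))^2" for n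
   by (simp add: scaleR_diff_left[symmetric] power_mult_distrib mult_right_mono)
 qed measurable
 from weak_strong_tendsto[OF w this v M sq_int_mult_bounded[OF psi _ a(2)] sq_int_mult_bounded[OF psi _ a(3)]]
 show "(%n. LBINT x. (a n x *R v n x) \<bullet> psi x) ----> (LBINT x. (a' x *R v' x) \<bullet> psi x)" by simp
qed

lemma wconv_unique:
 fixes g :: "'a::euclidean_space => 'b::euclidean_space"
 assumes "wconv f g" "wconv f g'" and g: "sq_int g" "sq_int g'"
 shows "AE x in lborel. g x = g' x"
proof -
 have d: "sq_int (%x. g x - g' x)" using g by (rule sq_int_diff)
 have "(LBINT x. g x \<bullet> (g x - g' x)) = (LBINT x. g' x \<bullet> (g x - g' x))"
  using wconvD[OF assms(1) d] wconvD[OF assms(2) d] by (rule LIMSEQ_unique)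
 then have "(LBINT x. (norm (g x - g' x))^2) = 0"
  unfolding power2_norm_eq_inner inner_diff_left using integrable_inner[OF g(1) d] integrable_inner[OF g(2) d] by simp
 then have "AE x in lborel. (norm (g x - g' x))^2 = 0" by (subst (asm) integral_nonneg_eq_0_iff_AE[OF sq_int_integrable[OF d]]) auto
 then show ?thesis by eventually_elim simp
qed

lemma grad_min_eq_0:
 assumes "phi \<in> C_inf" "!!y. phi y >= 0" "phi x = 0" shows "grad phi x = 0"
proof -
 have "(%h. grad phi x \<bullet> h) = (%h. 0)"
  by (rule differential_zero_maxmin[OF _ open_UNIV has_derivative_grad[OF C_inf_differentiable[OF assms(1)]]]) (use assms in auto)
 then have "grad phi x \<bullet> grad phi x = 0" by metis
 then show ?thesis by simp
qed

text \<open>Two weak limits of gradients are kept: \<open>g'\<close> for \<open>w\<close> and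
  \<open>v\<close> for \<open>u\<close>. The strong convergence is obtained for the first, the final
  equation is written with the second, and \<open>g'_eq\<close> relates them.\<close>

locale cusp_sequence = coercive_potential V m0 for V :: "real^'n::finite => real" and m0 +
 fixes r :: "real => real" and Cf M :: real and c :: "real^'n" and zeta :: "real^'n => real" and rho :: "nat => real" and w g w' g' u v
 assumes r: "continuous_on UNIV r" "!!t. \<bar>r t\<bar> <= Cf"
  and z: "zeta \<in> Cc" "!!x. 0 <= zeta x & zeta x <= 1 & (dist c x <= 1 --> zeta x = 1) & (dist c x >= 2 --> zeta x = 0)"
  and Vc: "!!x. x \<in> cball c 5 ==> V x >= Cf + 1"
  and rho: "!!n. 0 <= rho n" "!!n. rho n < 1" "rho ----> 1"
  and appr: "!!n. approx r c zeta (rho n) (w n) (g n)"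
  and M: "!!n. en (w n) (g n) <= M" "!!n. en (%x. UU (rho n) (w n x)) (%x. (1 / hh (rho n) (UU (rho n) (w n x))) *R g n x) <= M"
  and lim: "inE w' g'" "l2conv w w'" "AE x in lborel. (%n. w n x) ----> w' x" "wconv g g'"
  and limu: "inE u v" "AE x in lborel. (%n. UU (rho n) (w n x)) ----> u x" "wconv (%n x. (1 / hh (rho n) (UU (rho n) (w n x))) *R g n x) v"
  and ub: "!!x. - (1/4) <= u x & u x <= 1"
begin

definition un where "un n x = UU (rho n) (w n x)"
definition hn where "hn n x = hh (rho n) (un n x)"
definition vn where "vn n x = (1 / hn n x) *R g n x"
definition bn where "bn n x = (V x - r (un n x)) * un n x / hn n x"
definition ws where "ws n = HH (rho n) 1"
definition zn where "zn n x = w n x - ws n * zeta x"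
definition z' where "z' x = w' x - HH 1 1 * zeta x"

abbreviation X where "X \<equiv> inX (ball c 1)"

lemmas F = approx_facts[OF appr rho(1,2) z(1) r, folded un_def, folded hn_def, folded vn_def bn_def]

lemma rho1: "rho n <= 1" and hn: "0 < hn n x" "hn n x <= 1"
 using rho(1,2)[of n] hh_pos[OF rho(1,2)] hh_le_1[OF rho(1)] by (auto simp: hn_def)

lemma hn_half: "un n x <= 1/2 ==> hn n x >= 1/2"
 unfolding hn_def using F(3)[of n x] by (intro hh_ge_half(1) rho(1) rho1) auto

lemma meas [measurable]: "w n \<in> BM" "g n \<in> BM" "w' \<in> BM" "g' \<in> BM"
  "u \<in> BM" "v \<in> BM" "un n \<in> BM" "hn n \<in> BM" "zeta \<in> BM"
  "bn n \<in> BM" "(%x. hh 1 (u x)) \<in> BM" "(%x. r (u x)) \<in> BM"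
proof -
 show [measurable]: "w n \<in> BM" "g n \<in> BM" "w' \<in> BM" "g' \<in> BM"
  "u \<in> BM" "v \<in> BM" "un n \<in> BM" "zeta \<in> BM"
  using inED(4,5)[OF F(1)] inED(4,5)[OF lim(1)] inED(4,5)[OF limu(1)] F(11) test_measurable[OF z(1)] by auto
 note [measurable] = borel_measurable_continuous_onI[OF hh_cont(1)] borel_measurable_continuous_onI[OF r(1)]
 show [measurable]: "hn n \<in> BM" "(%x. hh 1 (u x)) \<in> BM" "(%x. r (u x)) \<in> BM"
  unfolding hn_def[abs_def] by measurable
 show "bn n \<in> BM" unfolding bn_def[abs_def] by measurable
qed

lemma sqrt_rho: "(%n. sqrt (1 - rho n)) ----> 0"
proof -
 have "(%n. sqrt (1 - rho n)) ----> sqrt (1 - 1)" by (intro tendsto_intros rho(3))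
 then show ?thesis by simp
qed

lemma ws_lim: "ws ----> HH 1 1" and ws_ge: "HH 1 1 <= ws n" and ws_le: "ws n <= 1" "1/4 <= HH 1 1"
proof -
 show "HH 1 1 <= ws n" "ws n <= 1" "1/4 <= HH 1 1" using HH_compare(2)[OF rho(1) rho1] HH_1_bounds[OF rho(1) rho1] HH_1_bounds(1)[of 1] by (auto simp: ws_def)
 have "(%n. ws n - HH 1 1) ----> 0"
  by (rule Lim_null_comparison[OF _ sqrt_rho]) (use HH_compare(1)[OF rho(1) rho1, of _ 1] in \<open>simp add: ws_def\<close>)
 then show "ws ----> HH 1 1" by (rule LIM_zero_cancel)
qed

text \<open>\<open>hh_compare\<close> and \<open>HH_compare\<close> are uniform in the argument, so
  pointwise convergence of \<open>un\<close> passes to \<open>hn\<close> and to \<open>w\<close>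
  although \<open>rho\<close> varies with \<open>n\<close>.\<close>

lemma AE_lim: "AE x in lborel. (%n. un n x) ----> u x & (%n. w n x) ----> w' x & (%n. hn n x) ----> hh 1 (u x) & w' x = HH 1 (u x) & (x \<notin> cball c 2 --> u x <= 1/4)"
 using limu(2) lim(3)
proof eventually_elim
 case (elim x)
 then have u: "(%n. un n x) ----> u x" by (simp add: un_def)
 have un1: "\<bar>un n x\<bar> <= 1" for n using F(3,4)[of n x] by auto
 have "(%n. hn n x - hh 1 (un n x)) ----> 0"
 proof (rule Lim_null_comparison[OF _ sqrt_rho], intro always_eventually allI)
  show "norm (hn n x - hh 1 (un n x)) <= sqrt (1 - rho n)" for n
   using hh_compare(1)[OF rho(1) rho1, of "un n x" n] hh_compare(2)[OF rho(1) rho1, of n "un n x"] by (simp add: hn_def)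
 qed
 from tendsto_add[OF this isCont_tendsto_compose[OF hh_cont(2)[where rho = 1] u]] have h: "(%n. hn n x) ----> hh 1 (u x)" by simp
 have "(%n. w n x - HH 1 (un n x)) ----> 0"
 proof (rule Lim_null_comparison[OF _ sqrt_rho], intro always_eventually allI)
  fix n
  have "\<bar>HH (rho n) (un n x) - HH 1 (un n x)\<bar> <= sqrt (1 - rho n) * \<bar>un n x\<bar>" by (rule HH_compare(1)[OF rho(1) rho1])
  also have "\<dots> <= sqrt (1 - rho n) * 1" using un1 rho1 by (intro mult_left_mono) auto
  finally show "norm (w n x - HH 1 (un n x)) <= sqrt (1 - rho n)" using F(6)[of n x] by simp
 qed
 from tendsto_add[OF this isCont_tendsto_compose[OF HH_cont(2)[where rho = 1] u]] have "(%n. w n x) ----> HH 1 (u x)" by simp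
 with elim have "w' x = HH 1 (u x)" using LIMSEQ_unique by blast
 moreover have "u x <= 1/4" if "x \<notin> cball c 2" by (rule LIMSEQ_le_const2[OF u]) (use abs_le_D1[OF F(5)[OF that]] in auto)
 ultimately show ?case using u h elim by simp
qed

lemma g'_eq: "AE x in lborel. g' x = hh 1 (u x) *R v x"
proof (rule wconv_unique[OF lim(4)])
 have "wconv (%n x. hn n x *R vn n x) (%x. hh 1 (u x) *R v x)"
 proof (rule wconv_mult_bounded[of _ _ M _ _ 1])
  show "wconv vn v" using limu(3) by (simp add: vn_def[abs_def] hn_def un_def)
  show "(LBINT x. (norm (vn n x))^2) <= M" for n
   using M(2)[of n] en_parts(1)[of "vn n" "un n"] by (simp add: vn_def[abs_def] hn_def un_def[abs_def])
  show "AE x in lborel. (%n. hn n x) ----> hh 1 (u x)" using AE_lim by eventually_elim simp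
  show "\<bar>hn n x\<bar> <= 1" for n x using hn[of n x] by simp
  show "\<bar>hh 1 (u x)\<bar> <= 1" for x using hh_le_1[of 1 "u x"] hh_nonneg[of 1 "u x"] by simp
 qed (use inED(3)[OF F(2)] inED(3)[OF limu(1)] in auto)
 moreover have "hn n x *R vn n x = g n x" for n x using hn[of n x] by (simp add: vn_def)
 ultimately show "wconv g (%x. hh 1 (u x) *R v x)" by simp
 have "\<bar>hh 1 (u x)\<bar> <= 1" for x using hh_le_1[of 1 "u x"] hh_nonneg[of 1 "u x"] by simp
 then show "sq_int (%x. hh 1 (u x) *R v x)" by (intro sq_int_mult_bounded[OF inED(3)[OF limu(1)]]) auto
qed (rule inED(3)[OF lim(1)])

lemma Xn: "X (zn n) (%x. g n x - ws n *R grad zeta x)"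
 using appr[of n] by (simp add: approx_def zn_def[abs_def] ws_def)

lemma wconv_diff_scaled:
 fixes f :: "nat => real^'n => 'b::euclidean_space"
 assumes f: "wconv f f'" "!!n. sq_int (f n)" "sq_int f'" "sq_int p"
 shows "wconv (%n x. f n x - ws n *R p x) (%x. f' x - HH 1 1 *R p x)"
 unfolding wconv_def
proof (intro allI impI)
 fix psi :: "real^'n => 'b" assume psi: "sq_int psi"
 note i = integrable_inner[OF f(2) psi] integrable_inner[OF f(3) psi] integrable_inner[OF f(4) psi]
 have "(%n. (LBINT x. f n x \<bullet> psi x) - ws n * (LBINT x. p x \<bullet> psi x)) ----> (LBINT x. f' x \<bullet> psi x) - HH 1 1 * (LBINT x. p x \<bullet> psi x)"
  by (intro tendsto_intros wconvD[OF f(1) psi] ws_lim)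
 then show "(%n. LBINT x. (f n x - ws n *R p x) \<bullet> psi x) ----> (LBINT x. (f' x - HH 1 1 *R p x) \<bullet> psi x)"
  unfolding inner_diff_left inner_scaleR_left using i by simp
qed

lemma X': "X z' (%x. g' x - HH 1 1 *R grad zeta x)"
proof (rule inX_closed[OF Xn])
 show "wconv zn z'"
  using wconv_diff_scaled[OF l2conv_imp_wconv[OF lim(2) inED(2)[OF F(1)] inED(2)[OF lim(1)]] inED(2)[OF F(1)] inED(2)[OF lim(1)] sq_int_test[OF z(1)]]
  by (simp add: zn_def[abs_def] z'_def[abs_def])
 show "wconv (%n x. g n x - ws n *R grad zeta x) (%x. g' x - HH 1 1 *R grad zeta x)"
  by (rule wconv_diff_scaled[OF lim(4) inED(3)[OF F(1)] inED(3)[OF lim(1)] sq_int_grad[OF z(1)]])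
 show "inE z' (%x. g' x - HH 1 1 *R grad zeta x)" unfolding z'_def[abs_def] by (rule inE_diff[OF lim(1) inE_scale[OF inE_test[OF z(1)]]])
qed simp

text \<open>If \<open>u = 0\<close>, then \<open>w' = 0\<close> while the boundary value persists:
  \<open>- HH 1 1 * zeta\<close> would be admissible, so a nonzero multiple of the indicator of the
  ball would have weak gradient zero and, by the translation estimate, be translation
  invariant.\<close>

lemma nontrivial: "~ (AE x in lborel. u x = 0)"
proof
 assume "AE x in lborel. u x = 0"
 then have e: "AE x in lborel. z' x = - HH 1 1 * zeta x" using AE_lim by eventually_elim (simp add: z'_def HH_0)
 note [measurable] = inED(4)[OF inXD(1)[OF X']] grad_measurable[OF Cc_infinityD(1)[OF z(1)]]
 have "wgrad z' (%x. (- HH 1 1) *R grad zeta x)" by (rule wgrad_cong_AE[OF wgrad_scale[OF wgrad_test[OF z(1)]] e]) auto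
 from wgrad_unique[OF inED(1)[OF inXD(1)[OF X']] this] have ge: "AE x in lborel. g' x - HH 1 1 *R grad zeta x = (- HH 1 1) *R grad zeta x" .
 have [measurable]: "ball c 1 \<in> sets borel" by simp
 have "grad zeta x = 0" if "x \<in> ball c 1" for x
  by (rule grad_lap_eq_0(1)[OF Cc_infinityD(1)[OF z(1)] open_ball[of c 1] that, of 1]) (use z(2) in auto)
 then have "wgrad (%x. - HH 1 1 * indicator (ball c 1) x) (%x. 0)"
 proof (intro wgrad_cong_AE[OF inXD(2)[OF X']])
  show "AE x in lborel. - HH 1 1 * indicator (ball c 1) x = indicator (ball c 1) x * z' x"
   using e by eventually_elim (use z(2) in \<open>auto simp: indicator_def\<close>)
  show "AE x in lborel. 0 = indicator (ball c 1) x *R (g' x - HH 1 1 *R grad zeta x)"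
   using ge by eventually_elim (use \<open>!!x. x \<in> ball c 1 ==> grad zeta x = 0\<close> in \<open>auto simp: indicator_def\<close>)
 qed measurable
 note W = this
 \<comment> \<open>Length 3 exceeds the diameter, so the shifted ball is disjoint from the
   ball.\<close>
 let ?h = "3 *R axis undefined 1 :: real^'n" and ?k = "%x. - HH 1 1 * indicator (ball c 1) x :: real"
 have sq: "sq_int (%x. ?k (x + ?h) - ?k x)" by (rule sq_int_diff[OF sq_int_shift wgradD(1)]; rule wgradD(1)[OF W] W)
 have "(LBINT x. (norm (?k (x + ?h) - ?k x))^2) <= 0" using translation_estimate[OF W, of ?h] by simp
 then have "(LBINT x. (norm (?k (x + ?h) - ?k x))^2) = 0" by (simp add: order_antisym)
 then have "AE x in lborel. (norm (?k (x + ?h) - ?k x))^2 = 0" by (subst (asm) integral_nonneg_eq_0_iff_AE[OF sq_int_integrable[OF sq]]) auto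
 moreover have "?k (x + ?h) - ?k x \<noteq> 0" if "x \<in> ball c 1" for x
 proof -
  have "norm ?h <= norm (x + ?h - c) + norm (x - c)" using norm_triangle_ineq4[of "x + ?h - c" "x - c"] by simp
  then have "x + ?h \<notin> ball c 1" using that by (simp add: dist_norm norm_minus_commute norm_axis_1)
  then show ?thesis using that ws_le(2) by simp
 qed
 ultimately have "AE x in lborel. x \<notin> ball c 1" by (auto elim!: eventually_mono)
 then have "ball c 1 \<in> null_sets lborel" by (subst AE_iff_null_sets) auto
 then show False using content_ball_pos[of 1 c] by (simp add: null_sets_def measure_def)
qed

end

context cusp_sequence
begin

lemma integrable_dominated_test:
 assumes p: "phi \<in> Cc" and [measurable]: "f \<in> BM" and le: "!!x. \<bar>f x\<bar> <= K * (\<bar>V x\<bar> + Cf) * \<bar>phi x\<bar>"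
 shows "integrable lborel (f :: real^'n => real)" "integrable lborel (%x. K * (\<bar>V x\<bar> + Cf) * \<bar>phi x\<bar>)"
proof -
 obtain R where R: "!!x. phi x \<noteq> 0 ==> norm x <= R" using Cc_infinityD(2)[OF p] by blast
 obtain B where B: "B > 0" "!!x. \<bar>phi x\<bar> <= B" using test_bounded[OF p] by blast
 obtain K' where K: "K' > 0" "!!x. norm x <= R ==> Vm x <= K'" using V_bounded_on_ball by blast
 have Cf: "Cf >= 0" using r(2)[of 0] by simp
 note [measurable] = test_measurable[OF p]
 let ?F = "%x. K * (\<bar>V x\<bar> + Cf) * \<bar>phi x\<bar>"
 have F: "norm (?F x) <= \<bar>K\<bar> * ((1 + m0) * K' + Cf) * B" for x
 proof (cases "phi x = 0")
  case False
  have "(1 + m0) * Vm x <= (1 + m0) * K'" using K(2)[OF R[OF False]] m0_nonneg by (intro mult_left_mono) auto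
  then have "\<bar>V x\<bar> + Cf <= (1 + m0) * K' + Cf" using V_abs_le[of x] by simp
  then show ?thesis unfolding real_norm_def abs_mult using B Cf by (intro mult_mono) auto
 qed (use B K m0_nonneg Cf in simp)
 have s: "sq_int ?F" by (rule sq_int_bounded_support[OF _ F, where R = R]) (use R in \<open>auto\<close>)
 have "integrable lborel (%x. indicator (cball 0 R) x * ?F x)" by (rule integrable_sq_mult[OF sq_int_indicator_cball s])
 moreover have "indicator (cball 0 R) x * ?F x = ?F x" for x using R[of x] by (cases "phi x = 0") (auto simp: indicator_def)
 ultimately show i: "integrable lborel ?F" by simp
 show "integrable lborel f"
  by (rule Bochner_Integration.integrable_bound[OF i]) (use le in \<open>auto intro!: order_trans[OF _ abs_ge_self]\<close>)
qed

text \<open>The singular factor is bounded after multiplication with \<open>h\<close>. For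
  \<open>u >= 0\<close> near the sphere \<open>V - r(u) >= 1\<close> fixes its sign and gives the
  lower bound \<open>u / h\<close> by which contact is detected.\<close>

lemma bn_bounds: "\<bar>bn n x\<bar> * hn n x <= \<bar>V x\<bar> + Cf" "un n x <= 1/2 ==> \<bar>bn n x\<bar> <= 2 * (\<bar>V x\<bar> + Cf)"
 "un n x >= 0 ==> x \<in> cball c 5 ==> bn n x * hn n x >= un n x" "un n x >= 0 ==> x \<in> cball c 5 ==> bn n x >= 0"
proof -
 have Cf: "Cf >= 0" using r(2)[of 0] by simp
 have "\<bar>V x - r (un n x)\<bar> * \<bar>un n x\<bar> <= (\<bar>V x\<bar> + Cf) * 1" using r(2)[of "un n x"] F(3,4)[of n x] Cf by (intro mult_mono) auto
 then show a: "\<bar>bn n x\<bar> * hn n x <= \<bar>V x\<bar> + Cf" using hn[of n x] by (simp add: bn_def abs_mult)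
 show "\<bar>bn n x\<bar> <= 2 * (\<bar>V x\<bar> + Cf)" if "un n x <= 1/2"
  using mult_left_mono[OF hn_half[OF that], of "\<bar>bn n x\<bar>"] a by simp
 assume u: "un n x >= 0" "x \<in> cball c 5"
 have V: "V x - r (un n x) >= 1" using Vc[OF u(2)] abs_le_D1[OF r(2)[of "un n x"]] by simp
 show "bn n x * hn n x >= un n x" using mult_right_mono[OF V u(1)] hn[of n x] by (simp add: bn_def)
 show "bn n x >= 0" using V u hn[of n x] by (simp add: bn_def)
qed

text \<open>The zeroth-order term is singular at the contact set \<open>{u = 1}\<close>. Only the part \<open>Rn\<close> of its product with
 the test function that has the wrong sign must tend to zero, and there concavity of \<open>H\<close> absorbs the singularity.\<close>

lemma strong_local:
 assumes chi: "omega \<in> Cc"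
 shows "l2conv (%n x. omega x *R g n x) (%x. omega x *R g' x)"
proof -
 define phi where "phi x = omega x * omega x" for x
 have phi: "phi \<in> Cc" unfolding phi_def[abs_def] by (rule Cc_infinity_mult[OF chi Cc_infinityD(1)[OF chi]])
 have phi0: "phi x >= 0" for x by (simp add: phi_def)
 note [measurable] = test_measurable[OF phi] grad_measurable[OF Cc_infinityD(1)[OF phi]] inED(4)[OF inXD(1)[OF Xn]] inED(4)[OF inXD(1)[OF X']]
 \<comment> \<open>Gradient of the test function \<open>phi * (zn - z')\<close>. The difference with
   the limit is admissible because \<open>zn\<close> and \<open>z'\<close> both vanish on the
   sphere.\<close>
 define eta where "eta n x = phi x *R ((g n x - ws n *R grad zeta x) - (g' x - HH 1 1 *R grad zeta x)) + (zn n x - z' x) *R grad phi x" for n x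
 have T: "X (%x. phi x * (zn n x - z' x)) (eta n)" for n unfolding eta_def[abs_def] by (rule inX_mult_test[OF inX_diff[OF Xn X'] phi])
 define Rn where "Rn n x = phi x * max 0 (bn n x * (z' x - zn n x))" for n x
 have [measurable]: "Rn n \<in> BM" for n unfolding Rn_def[abs_def] by measurable
 have Cf: "Cf >= 0" using r(2)[of 0] by simp
 have key: "Rn n x <= 8 * (\<bar>V x\<bar> + Cf) * phi x" "un n x >= 0 ==> x \<in> cball c 2 ==> Rn n x <= (\<bar>V x\<bar> + Cf) * (1 - un n x) * phi x" "\<bar>z' x - zn n x\<bar> <= 4"
  if w': "w' x = HH 1 (u x)" and uo: "x \<notin> cball c 2 --> u x <= 1/4" for n x
 proof -
  have w1: "w' x <= HH 1 1" "\<bar>w' x\<bar> <= 1" using w' ub[of x] HH_mono[of 1 "u x" 1] HH_abs_le[of 1 "u x"] by auto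
  have "\<bar>ws n * zeta x\<bar> <= 1" "\<bar>HH 1 1 * zeta x\<bar> <= 1"
   using z(2)[of x] ws_le HH_1_bounds(2)[of 1] ws_ge[of n] by (auto simp: abs_mult intro!: mult_le_one)
  then show z4: "\<bar>z' x - zn n x\<bar> <= 4" using w1 F(8)[of n x] by (simp add: z'_def zn_def)
  have VC: "0 <= \<bar>V x\<bar> + Cf" using Cf by simp
  have b1: "Rn n x <= (\<bar>V x\<bar> + Cf) * (1 - un n x) * phi x" if u0: "un n x >= 0" "x \<in> cball c 2"
  proof -
   have b0: "bn n x >= 0" using bn_bounds(4) u0 by auto
   have "(HH 1 1 - ws n) * (1 - zeta x) <= 0" using ws_ge[of n] z(2)[of x] by (intro mult_nonpos_nonneg) auto
   then have "z' x - zn n x <= ws n - w n x" using w1 by (simp add: z'_def zn_def algebra_simps)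
   also have "\<dots> <= hn n x * (1 - un n x)" unfolding ws_def hn_def F(6)[of n x] using HH_concave[OF rho(1) rho1 u0(1) F(4)] .
   finally have "bn n x * (z' x - zn n x) <= bn n x * (hn n x * (1 - un n x))" using b0 by (rule mult_left_mono)
   also have "\<dots> <= (\<bar>V x\<bar> + Cf) * (1 - un n x)"
    unfolding mult.assoc[symmetric] using bn_bounds(1)[of n x] b0 F(4)[of n x] by (intro mult_right_mono) auto
   finally have "max 0 (bn n x * (z' x - zn n x)) <= (\<bar>V x\<bar> + Cf) * (1 - un n x)" using VC F(4)[of n x] by simp
   then show ?thesis unfolding Rn_def using phi0[of x] by (simp add: mult.commute mult_left_mono)
  qed
  then show "un n x >= 0 ==> x \<in> cball c 2 ==> Rn n x <= (\<bar>V x\<bar> + Cf) * (1 - un n x) * phi x" .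
  show "Rn n x <= 8 * (\<bar>V x\<bar> + Cf) * phi x"
  proof (cases "un n x >= 0 & x \<in> cball c 2")
   case True
   have "(\<bar>V x\<bar> + Cf) * (1 - un n x) <= (\<bar>V x\<bar> + Cf) * 8" using True VC by (intro mult_left_mono) auto
   then have "(\<bar>V x\<bar> + Cf) * (1 - un n x) * phi x <= (\<bar>V x\<bar> + Cf) * 8 * phi x" using phi0 by (rule mult_right_mono)
   then show ?thesis using b1 True by (simp add: mult.commute)
  next
   case False
   then have "un n x <= 1/2" using F(5)[of x n] by (cases "x \<in> cball c 2") auto
   then have "\<bar>bn n x * (z' x - zn n x)\<bar> <= (2 * (\<bar>V x\<bar> + Cf)) * 4" unfolding abs_mult using bn_bounds(2) z4 VC by (intro mult_mono) auto
   then have "max 0 (bn n x * (z' x - zn n x)) <= 8 * (\<bar>V x\<bar> + Cf)" using VC by (simp add: abs_le_iff)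
   then show ?thesis unfolding Rn_def using phi0[of x] by (simp add: mult.commute mult_left_mono)
  qed
 qed
 have Rn0: "0 <= Rn n x" for n x using phi0 by (simp add: Rn_def)
 have AEz: "AE x in lborel. (%n. z' x - zn n x) ----> 0"
  using AE_lim
 proof eventually_elim
  case (elim x)
  then have "(%n. z' x - zn n x) ----> z' x - (w' x - HH 1 1 * zeta x)" unfolding zn_def by (intro tendsto_intros ws_lim) auto
  then show ?case by (simp add: z'_def)
 qed
 have iR: "integrable lborel (%x. 8 * (\<bar>V x\<bar> + Cf) * \<bar>phi x\<bar>)" by (rule integrable_dominated_test(2)[OF phi, of "%x. 0"]) (use Cf in auto)
 have Rn_bd: "AE x in lborel. norm (Rn n x) <= 8 * (\<bar>V x\<bar> + Cf) * \<bar>phi x\<bar>" for n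
  using AE_lim by eventually_elim (use key(1) Rn0 phi0 in auto)
 have Rn_lim: "(%n. LBINT x. Rn n x) ----> (LBINT x::real^'n. (0::real))"
 proof (rule integral_dominated_convergence[where w = "%x. 8 * (\<bar>V x\<bar> + Cf) * \<bar>phi x\<bar>"])
  show "AE x in lborel. (%n. Rn n x) ----> 0"
   using AE_lim AEz
  proof eventually_elim
   case (elim x)
   then have un: "(%n. un n x) ----> u x" and hl: "(%n. hn n x) ----> hh 1 (u x)" by auto
   show ?case
   \<comment> \<open>At contact the bound with the factor \<open>1 - un\<close> tends to zero; away
     from it \<open>h\<close> has a positive limit, so \<open>bn\<close> converges and is multiplied
     by a null sequence.\<close>
   proof (cases "u x = 1")
    case True
    then have x: "x \<in> cball c 2" using elim(1) by (cases "x \<in> cball c 2") auto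
    have "(%n. (\<bar>V x\<bar> + Cf) * (1 - un n x) * phi x) ----> (\<bar>V x\<bar> + Cf) * (1 - u x) * phi x" by (intro tendsto_intros un)
    then have l: "(%n. (\<bar>V x\<bar> + Cf) * (1 - un n x) * phi x) ----> 0" using True by simp
    have "\<forall>\<^sub>F n in sequentially. un n x > 0" using order_tendstoD(1)[OF un, of 0] True by simp
    then have "\<forall>\<^sub>F n in sequentially. norm (Rn n x) <= (\<bar>V x\<bar> + Cf) * (1 - un n x) * phi x"
     by eventually_elim (use key(2) elim(1) x Rn0 in auto)
    then show ?thesis using l by (rule Lim_null_comparison)
   next
    case False
    have "\<bar>u x\<bar> < 1" using False ub[of x] by linarith
    then have "(u x)^2 < 1" "\<bar>u x\<bar> <= 1" by (simp_all add: abs_square_less_1)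
    then have h0: "hh 1 (u x) \<noteq> 0" using hh_square[of 1 "u x"] by auto
    have "(%n. phi x * max 0 (bn n x * (z' x - zn n x))) ----> phi x * max 0 ((V x - r (u x)) * u x / hh 1 (u x) * 0)"
     unfolding bn_def using elim(2) h0
     by (intro tendsto_intros un hl continuous_on_tendsto_compose[OF r(1) un]) auto
    then show ?thesis by (simp add: Rn_def)
   qed
  qed
 qed (use iR Rn_bd in auto)
 have sqz: "sq_int (%x. (zn n x - z' x) *R grad phi x)" for n
  by (rule sq_int_scaleR_grad[OF sq_int_diff[OF inED(2)[OF inXD(1)[OF Xn]] inED(2)[OF inXD(1)[OF X']]] phi])
 have T1: "(%n. LBINT x. g n x \<bullet> ((zn n x - z' x) *R grad phi x)) ----> (LBINT x. g' x \<bullet> (0 :: real^'n))"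
 proof (rule weak_strong_tendsto[OF lim(4) _ inED(3)[OF F(1)] inED(3)[OF lim(1)] order_trans[OF en_parts(1) M(1)] sqz sq_int_0])
  show "l2conv (%n x. (zn n x - z' x) *R grad phi x) (%x. 0)"
  proof (rule l2conv_dominated)
   show "AE x in lborel. (%n. (zn n x - z' x) *R grad phi x) ----> 0"
    using AEz
   proof eventually_elim
    case (elim x)
    from tendsto_scaleR[OF tendsto_minus[OF elim] tendsto_const[of "grad phi x"]] show ?case by simp
   qed
   show "integrable lborel (%x. 4^2 * (norm (grad phi x))^2)" using sq_int_integrable[OF sq_int_grad[OF phi]] by simp
   show "AE x in lborel. (norm ((zn n x - z' x) *R grad phi x - 0))^2 <= 4^2 * (norm (grad phi x))^2" for n
    using AE_lim
   proof eventually_elim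
    case (elim x)
    then have "\<bar>zn n x - z' x\<bar> <= 4" using key(3)[of x n] by (simp add: abs_minus_commute)
    then have "\<bar>zn n x - z' x\<bar>^2 <= 4^2" by (rule power_mono) simp
    then show ?case by (simp add: power_mult_distrib mult_right_mono)
   qed
  qed measurable
 qed
 have s2: "sq_int (%x. phi x *R grad zeta x)" "sq_int (%x. phi x *R g' x)"
  by (rule sq_int_mult_test[OF sq_int_grad[OF z(1)] phi] sq_int_mult_test[OF inED(3)[OF lim(1)] phi])+
 have T2: "(%n. (ws n - HH 1 1) * (LBINT x. g n x \<bullet> (phi x *R grad zeta x))) ----> (HH 1 1 - HH 1 1) * (LBINT x. g' x \<bullet> (phi x *R grad zeta x))"
  by (intro tendsto_intros ws_lim wconvD[OF lim(4) s2(1)])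
 have T3: "(%n. (LBINT x. g n x \<bullet> (phi x *R g' x)) - (LBINT x. g' x \<bullet> (phi x *R g' x))) ----> (LBINT x. g' x \<bullet> (phi x *R g' x)) - (LBINT x. g' x \<bullet> (phi x *R g' x))"
  by (intro tendsto_intros wconvD[OF lim(4) s2(2)])
 \<comment> \<open>The first term bounds the zeroth-order contribution; the others are errors that
   vanish by the weak convergence of \<open>g\<close> together with the convergence of
   \<open>zn\<close> and \<open>ws\<close>.\<close>
 define En where "En n = (LBINT x. Rn n x) - (LBINT x. g n x \<bullet> ((zn n x - z' x) *R grad phi x)) + (ws n - HH 1 1) * (LBINT x. g n x \<bullet> (phi x *R grad zeta x))
   - ((LBINT x. g n x \<bullet> (phi x *R g' x)) - (LBINT x. g' x \<bullet> (phi x *R g' x)))" for n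
 have En: "En ----> 0" using tendsto_diff[OF tendsto_add[OF tendsto_diff[OF Rn_lim T1] T2] T3] by (simp add: En_def[abs_def])
 have le: "(LBINT x. (norm (omega x *R g n x - omega x *R g' x))^2) <= En n" for n
 proof -
  note i = integrable_inner[OF inED(3)[OF F(1)[of n]] inED(3)[OF inXD(1)[OF T[of n]]]] integrable_inner[OF inED(3)[OF F(1)[of n]] sqz[of n]]
   integrable_inner[OF inED(3)[OF F(1)[of n]] s2(1)] integrable_inner[OF inED(3)[OF F(1)[of n]] s2(2)] integrable_inner[OF inED(3)[OF lim(1)] s2(2)]
  have iRn: "integrable lborel (Rn n)" by (rule Bochner_Integration.integrable_bound[OF iR]) (use Rn_bd[of n] in auto)
  have e: "(norm (omega x *R g n x - omega x *R g' x))^2 = g n x \<bullet> eta n x - g n x \<bullet> ((zn n x - z' x) *R grad phi x)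
    + (ws n - HH 1 1) * (g n x \<bullet> (phi x *R grad zeta x)) - (g n x \<bullet> (phi x *R g' x) - g' x \<bullet> (phi x *R g' x))" for x
   unfolding scaleR_diff_right[symmetric] norm_scaleR power_mult_distrib power2_norm_eq_inner[of "g n x - g' x"] eta_def phi_def
   by (simp add: inner_simps inner_commute algebra_simps power2_eq_square)
  have "(LBINT x. g n x \<bullet> eta n x) = (LBINT x. - (bn n x * (phi x * (zn n x - z' x))))" using F(9)[OF T[of n], of n] by simp
  also have "\<dots> <= (LBINT x. Rn n x)"
  proof (rule integral_mono[OF _ iRn])
   show "integrable lborel (%x. - (bn n x * (phi x * (zn n x - z' x))))" using F(10)[OF T[of n], of n] by simp
   fix x
   have "- (bn n x * (phi x * (zn n x - z' x))) = phi x * (bn n x * (z' x - zn n x))" by (simp add: algebra_simps)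
   also have "\<dots> <= Rn n x" unfolding Rn_def using phi0 by (intro mult_left_mono) auto
   finally show "- (bn n x * (phi x * (zn n x - z' x))) <= Rn n x" .
  qed
  finally show ?thesis unfolding e En_def using i by simp
 qed
 show ?thesis unfolding l2conv_def
  by (rule tendsto_sandwich[OF _ _ tendsto_const En]) (use le in \<open>auto intro!: always_eventually integral_nonneg_AE\<close>)
qed

text \<open>The smooth test function \<open>flat1 (1 - q) + flat1 (q - 1) flat1 (9 - q)\<close> is admissible because near the ball it
 vanishes only on the sphere; the zeroth-order term, which blows up at contact, has bounded integral against it.\<close>

lemma contact_null: "AE x in lborel. u x \<noteq> 1"
proof -
 define q where "q x = (norm (x - c))^2" for x
 have qC: "q \<in> C_inf" unfolding q_def[abs_def] using C_inf_intros(6)[OF C_inf_norm2, of c] .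
 have C: "(%x. flat1 (1 - q x)) \<in> C_inf" "(%x. flat1 (q x - 1) * flat1 (9 - q x)) \<in> C_inf"
  unfolding flat1_def by (intro C_inf_intros C_inf_diff qC)+
 have q2: "q x < 1 \<longleftrightarrow> dist c x < 1" "q x <= 9 \<longleftrightarrow> dist c x <= 3" "q x = 1 \<longleftrightarrow> dist c x = 1" for x
  using abs_le_square_iff[of "dist c x" 3] abs_square_less_1[of "dist c x"] by (auto simp: q_def dist_norm norm_minus_commute power2_eq_1_iff)
 have bd: "norm x <= norm c + 3" if "dist c x <= 3" for x using that norm_triangle_sub[of x c] by (simp add: dist_norm norm_minus_commute)
 have z1: "flat1 (1 - q x) = 0" if "x \<notin> ball c 1" for x using that q2(1)[of x] flat1_0[of "1 - q x"] by auto
 have T: "(%x. flat1 (1 - q x)) \<in> Cc" "(%x. flat1 (q x - 1) * flat1 (9 - q x)) \<in> Cc"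
 proof -
  show "(%x. flat1 (1 - q x)) \<in> Cc" by (rule Cc_infinityI[OF C(1) bd]) (use z1 in force)
  show "(%x. flat1 (q x - 1) * flat1 (9 - q x)) \<in> Cc"
   by (rule Cc_infinityI[OF C(2) bd]) (use flat1_0 q2(2) in \<open>metis diff_ge_0_iff_ge linear mult_zero_right diff_le_0_iff_le\<close>)
 qed
 define phi where "phi x = flat1 (1 - q x) + flat1 (q x - 1) * flat1 (9 - q x)" for x
 define eta where "eta x = grad (%x. flat1 (1 - q x)) x + grad (%x. flat1 (q x - 1) * flat1 (9 - q x)) x" for x
 have "X (%x. flat1 (1 - q x)) (grad (%x. flat1 (1 - q x)))"
 proof -
  have "grad (%x. flat1 (1 - q x)) x = 0" if "x \<notin> ball c 1" for x by (rule grad_min_eq_0[OF C(1)]) (use z1[OF that] flat1_nonneg in auto)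
  then have "(%x. indicator (ball c 1) x *R grad (%x. flat1 (1 - q x)) x) = grad (%x. flat1 (1 - q x))"
   "(%x. indicator (ball c 1) x * flat1 (1 - q x)) = (%x. flat1 (1 - q x))" using z1 by (auto simp: indicator_def fun_eq_iff)
  then show ?thesis using inE_test[OF T(1)] by (simp add: inX_def inED(1))
 qed
 moreover have "X (%x. flat1 (q x - 1) * flat1 (9 - q x)) (grad (%x. flat1 (q x - 1) * flat1 (9 - q x)))"
 proof (rule inX_vanishing[OF inE_test[OF T(2)]])
  fix x assume "x \<in> ball c 1"
  then have "flat1 (q x - 1) * flat1 (9 - q x) = 0" using q2(1)[of x] flat1_0[of "q x - 1"] by simp
  then show "flat1 (q x - 1) * flat1 (9 - q x) = 0 & grad (%x. flat1 (q x - 1) * flat1 (9 - q x)) x = 0"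
   using grad_min_eq_0[OF C(2), of x] flat1_nonneg by simp
 qed
 ultimately have Xp: "X phi eta" unfolding phi_def[abs_def] eta_def[abs_def] by (rule inX_add)
 have phi0: "phi x >= 0" for x using flat1_nonneg by (simp add: phi_def)
 have supp: "phi x = 0" if "x \<notin> cball c 3" for x
  using that q2[of x] z1[of x] flat1_0[of "9 - q x"] by (simp add: phi_def)
 have pos: "phi x > 0" if "x \<in> cball c 2" "dist c x \<noteq> 1" for x
 proof -
  have "q x <= 2^2" using that(1) power_mono[of "dist c x" 2 2] by (simp add: q_def dist_norm norm_minus_commute)
  moreover have "q x \<noteq> 1" using that(2) q2(3) by blast
  ultimately show ?thesis using flat1_pos flat1_nonneg unfolding phi_def by (cases "q x < 1") (auto intro: add_pos_nonneg add_nonneg_pos)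
 qed
 have phiT: "phi \<in> Cc"
  by (rule Cc_infinityI[of _ "norm c + 3"]) (use supp bd in \<open>auto simp: phi_def[abs_def] intro: C_inf_intros C\<close>)
 note [measurable] = test_measurable[OF phiT]
 have Cf: "Cf >= 0" using r(2)[of 0] by simp
 have iC: "integrable lborel (%x. 2 * (\<bar>V x\<bar> + Cf) * \<bar>phi x\<bar>)" by (rule integrable_dominated_test(2)[OF phiT, of "%x. 0"]) (use Cf in auto)
 have e: "indicator (cball c 3) x * phi x = phi x" for x using supp[of x] by (auto simp: indicator_def)
 have ip: "integrable lborel phi" using integrable_sq_mult[OF sq_int_indicator_cball[of c 3] sq_int_test[OF phiT], unfolded e] .
 \<comment> \<open>A bound for the zeroth-order term tested with \<open>phi\<close> plus what its
   part with \<open>u <= 1/2\<close> may subtract. It depends neither on \<open>n\<close> nor on the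
   parameter \<open>e\<close> below.\<close>
 define D where "D = sqrt M * sqrt (LBINT x. (norm (eta x))^2) + (LBINT x. 2 * (\<bar>V x\<bar> + Cf) * \<bar>phi x\<bar>)"
 \<comment> \<open>Restricts to \<open>u > 1/2\<close>, where \<open>bn\<close> is at least
   \<open>u / h\<close>, and has the value 1 at contact. With the denominator
   \<open>2 * h + e\<close> the integrand is bounded, so the limit in \<open>n\<close> is taken
   first; at contact it becomes \<open>1 / e\<close>, which forces the integral of
   \<open>phi\<close> over \<open>{u = 1}\<close> below \<open>e * D\<close>.\<close>
 define tau where "tau t = max 0 (2 * t - 1)" for t :: real
 have qb: "\<bar>p * (T / (2 * h + e))\<bar> <= inverse e * p" if "0 <= T" "T <= 1" "0 <= h" "0 < e" "0 <= p" for p T h e :: real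
 proof -
  have "T / (2 * h + e) <= 1 / e" using that by (intro frac_le) auto
  then have "p * (T / (2 * h + e)) <= p * (1 / e)" using that by (intro mult_left_mono)
  moreover have "0 <= p * (T / (2 * h + e))" using that by simp
  ultimately show ?thesis by (simp add: divide_inverse mult.commute)
 qed
 have D: "(LBINT x. phi x * (tau (u x) / (2 * hh 1 (u x) + e))) <= D" if e: "e > 0" for e :: real
 proof -
  let ?f = "%n x. phi x * (tau (un n x) / (2 * hn n x + e))"
  have f: "0 <= tau t" "t <= 1 ==> tau t <= 1" for t by (auto simp: tau_def)
  have fb: "norm (?f n x) <= inverse e * phi x" for n x
   unfolding real_norm_def using f[of "un n x"] F(4)[of n x] hn[of n x] e phi0 by (intro qb) auto
  have m[measurable]: "tau \<in> BM" unfolding tau_def[abs_def] by measurable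
  have ip: "integrable lborel (%x. inverse e * phi x)" using ip by simp
  have "(%n. LBINT x. ?f n x) ----> (LBINT x. phi x * (tau (u x) / (2 * hh 1 (u x) + e)))"
  proof (rule integral_dominated_convergence[OF _ _ ip _ AE_I2[OF fb]])
   show "AE x in lborel. (%n. ?f n x) ----> phi x * (tau (u x) / (2 * hh 1 (u x) + e))"
    using AE_lim by eventually_elim (use e hh_nonneg[of 1] in \<open>auto simp: tau_def intro!: tendsto_intros add_nonneg_pos less_imp_neq[symmetric]\<close>)
  qed measurable
  moreover have "(LBINT x. ?f n x) <= D" for n
  proof -
   have pw: "?f n x <= bn n x * phi x + 2 * (\<bar>V x\<bar> + Cf) * \<bar>phi x\<bar>" for x
   proof (cases "un n x > 1/2")
    case True
    then have "x \<in> cball c 5" using F(5)[of x n] by (cases "x \<in> cball c 2") auto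
    then have "un n x / hn n x <= bn n x" using bn_bounds(3)[of n x] True hn[of n x] by (simp add: pos_divide_le_eq)
    moreover have "tau (un n x) / (2 * hn n x + e) <= un n x / hn n x"
     using True hn[of n x] e F(4)[of n x] by (intro frac_le) (auto simp: tau_def)
    ultimately have "phi x * (tau (un n x) / (2 * hn n x + e)) <= phi x * bn n x" using phi0 by (intro mult_left_mono) auto
    moreover have "0 <= 2 * (\<bar>V x\<bar> + Cf) * \<bar>phi x\<bar>" using Cf by simp
    ultimately show ?thesis by (simp add: mult.commute)
   next
    case False
    then have "- (2 * (\<bar>V x\<bar> + Cf)) * phi x <= bn n x * phi x" using bn_bounds(2)[of n x] phi0 by (intro mult_right_mono) (auto simp: abs_le_iff)
    then show ?thesis using False phi0[of x] by (simp add: tau_def algebra_simps)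
   qed
   have "integrable lborel (?f n)" by (rule Bochner_Integration.integrable_bound[OF ip _ AE_I2]) (use fb in \<open>auto intro: order_trans[OF _ abs_ge_self]\<close>)
   then have "(LBINT x. ?f n x) <= (LBINT x. bn n x * phi x + 2 * (\<bar>V x\<bar> + Cf) * \<bar>phi x\<bar>)"
    using F(10)[OF Xp] iC pw by (intro integral_mono) auto
   also have "\<dots> = - (LBINT x. g n x \<bullet> eta x) + (LBINT x. 2 * (\<bar>V x\<bar> + Cf) * \<bar>phi x\<bar>)"
    using F(9)[OF Xp, of n] F(10)[OF Xp, of n] iC by simp
   also have "- (LBINT x. g n x \<bullet> eta x) <= sqrt M * sqrt (LBINT x. (norm (eta x))^2)"
    using L2_Cauchy_Schwarz[OF inED(3)[OF F(1)[of n]] inED(3)[OF inXD(1)[OF Xp]]]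
     mult_right_mono[OF real_sqrt_le_mono[OF order_trans[OF en_parts(1) M(1)[of n]]], of "sqrt (LBINT x. (norm (eta x))^2)"]
    by (simp add: abs_le_iff)
   finally show ?thesis by (simp add: D_def)
  qed
  ultimately show ?thesis by (intro LIMSEQ_le_const2) auto
 qed
 let ?I = "%x. indicator {x. u x = 1} x * phi x :: real"
 have iI: "integrable lborel ?I" by (rule Bochner_Integration.integrable_bound[OF ip]) (auto simp: indicator_def)
 have "(LBINT x. ?I x) <= e * D" if e: "e > 0" for e
 proof -
  have t0: "0 <= tau (u x)" "tau (u x) <= 1" "hh 1 (u x) >= 0" for x using ub[of x] hh_nonneg[of 1] by (auto simp: tau_def)
  have m[measurable]: "tau \<in> BM" unfolding tau_def[abs_def] by measurable
  have fb: "\<bar>phi x * (tau (u x) / (2 * hh 1 (u x) + e))\<bar> <= \<bar>inverse e * phi x\<bar>" for x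
   using qb[OF t0 e phi0, of x x] by (rule order_trans) simp
  have "(LBINT x. inverse e * ?I x) <= (LBINT x. phi x * (tau (u x) / (2 * hh 1 (u x) + e)))"
  proof (rule integral_mono)
   have "integrable lborel (%x. inverse e * phi x)" using ip by simp
   then show "integrable lborel (%x. phi x * (tau (u x) / (2 * hh 1 (u x) + e)))"
    by (rule Bochner_Integration.integrable_bound) (use fb in auto)
   show "inverse e * ?I x <= phi x * (tau (u x) / (2 * hh 1 (u x) + e))" for x
    using t0[of x] phi0[of x] e by (cases "u x = 1") (auto simp: tau_def hh_1 divide_inverse mult.commute)
  qed (use iI in simp)
  also have "\<dots> <= D" by (rule D[OF e])
  finally show ?thesis using e by (simp add: field_simps)
 qed
 note eD = this
 have "(LBINT x. ?I x) <= 0"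
 proof (rule field_le_epsilon)
  fix e :: real assume e: "e > 0"
  have "D <= \<bar>D\<bar> + 1" by simp
  then have "e / (\<bar>D\<bar> + 1) * D <= e / (\<bar>D\<bar> + 1) * (\<bar>D\<bar> + 1)" using e by (intro mult_left_mono) auto
  then show "(LBINT x. ?I x) <= 0 + e" using eD[of "e / (\<bar>D\<bar> + 1)"] e by simp
 qed
 moreover have "(LBINT x. ?I x) >= 0" by (rule integral_nonneg_AE) (use phi0 in simp)
 ultimately have "(LBINT x. ?I x) = 0" by simp
 then have a: "AE x in lborel. ?I x = 0" by (subst (asm) integral_nonneg_eq_0_iff_AE[OF iI]) (use phi0 in auto)
 have "sphere c 1 \<in> null_sets lborel" using negligible_sphere[of c 1] by (simp add: negligible_iff_null_sets null_sets_completion_iff)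
 then have b: "AE x in lborel. dist c x \<noteq> 1" by (intro AE_I') auto
 show ?thesis using a b AE_lim
 proof eventually_elim
  case (elim x)
  show ?case
  proof
   assume "u x = 1"
   then have "x \<in> cball c 2" using elim(3) by (cases "x \<in> cball c 2") auto
   then show False using pos[OF _ elim(2)] elim(1) \<open>u x = 1\<close> by simp
  qed
 qed
qed

end

section \<open>The limit equation\<close>

text \<open>\<open>flat_exp [:0, 0, 1:]\<close> is the derivative of \<open>flat1\<close>. The
  factor \<open>1 + x\<close> is what remains of \<open>h(u)^2\<close> times the slope of the
  truncations in \<open>weak_form\<close>.\<close>

lemma flat1_tail:
 assumes "x > 0" shows "1 - 1 / x <= flat1 x" "flat_exp [:0, 0, 1:] x * (1 + x) <= 2" "flat_exp [:0, 0, 1:] x * (1 + x) <= (1 / x)^2 + 1 / x"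
  "flat_exp [:0, 0, 1:] x >= 0"
proof -
 define y where "y = 1 / x"
 have y: "y > 0" "y * x = 1" using assms by (auto simp: y_def)
 show "1 - 1 / x <= flat1 x" using exp_ge_add_one_self[of "- (1 / x)"] assms by (simp add: flat1_def flat_exp_def)
 have "flat_exp [:0, 0, 1:] x * (1 + x) = (y * y * (1 + x)) * exp (- y)" using assms by (simp add: flat_exp_def y_def)
 also have "y * y * (1 + x) = y^2 + y" using y by (simp add: algebra_simps power2_eq_square)
 finally have e: "flat_exp [:0, 0, 1:] x * (1 + x) = (y^2 + y) * exp (- y)" .
 have "y^2 + y <= 2 * exp y" using exp_lower_Taylor_quadratic[of y] y by simp
 then have "(y^2 + y) * exp (- y) <= (2 * exp y) * exp (- y)" by (rule mult_right_mono) simp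
 moreover have "(2 * exp y) * exp (- y) = 2" by (simp add: exp_minus)
 ultimately show "flat_exp [:0, 0, 1:] x * (1 + x) <= 2" unfolding e by linarith
 have "(y^2 + y) * exp (- y) <= (y^2 + y) * 1" using y by (intro mult_left_mono) auto
 then show "flat_exp [:0, 0, 1:] x * (1 + x) <= (1 / x)^2 + 1 / x" unfolding e by (simp add: y_def)
 show "flat_exp [:0, 0, 1:] x >= 0" using assms by (simp add: flat_exp_def)
qed

context cusp_sequence
begin

text \<open>The limit of the regularised equations tested with \<open>phi h(u) kappa(u)\<close>, where \<open>kappa\<close> vanishes near the contact value.\<close>

lemma truncated_form:
 assumes p: "phi \<in> Cc" and k: "!!t. (kappa has_real_derivative kappa' t) (at t)" "continuous_on UNIV kappa'" "!!t. \<bar>kappa t\<bar> <= 1"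
  and e: "0 < e" "e <= 1/2" "!!t. t >= 1 - e ==> kappa t = 0 & kappa' t = 0"
 shows "(LBINT x. phi x * (kappa' (u x) * (hh 1 (u x))^2 - u x * kappa (u x)) * (norm (v x))^2) + (LBINT x. (hh 1 (u x))^2 * kappa (u x) * (v x \<bullet> grad phi x))
  + (LBINT x. (V x - r (u x)) * u x * kappa (u x) * phi x) = 0"
proof -
 have "bounded (kappa' ` {-1..1})" by (rule compact_imp_bounded[OF compact_continuous_image[OF continuous_on_subset[OF k(2)]]]) auto
 then have "\<exists>B. \<forall>t\<in>{-1..1}. \<bar>kappa' t\<bar> <= B" by (auto simp: bounded_iff)
 then obtain B where B: "!!t. t \<in> {-1..1} ==> \<bar>kappa' t\<bar> <= B" by blast
 have ck: "continuous_on UNIV kappa" using DERIV_isCont[OF k(1)] by (simp add: continuous_at_imp_continuous_on)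
 note [measurable] = borel_measurable_continuous_onI[OF ck] borel_measurable_continuous_onI[OF k(2)] test_measurable[OF p] grad_measurable[OF Cc_infinityD(1)[OF p]]
 obtain R where R: "R > 0" "!!x. phi x \<noteq> 0 ==> norm x <= R" using Cc_infinityD(2)[OF p] by blast
 \<comment> \<open>Being 1 on the support of \<open>phi\<close>, it splits the quadratic gradient
   term into a weakly convergent factor and the factor of \<open>strong_local\<close>.\<close>
 obtain omega :: "real^'n => real" where om: "omega \<in> Cc" "!!x. norm x <= R ==> omega x = 1" using ball_cutoff[of R "R + 1"] R(1) by auto
 have po: "phi x * omega x = phi x" for x using R(2) om(2) by (cases "phi x = 0") auto
 obtain P where P: "P > 0" "!!x. \<bar>phi x\<bar> <= P" using test_bounded[OF p] by blast
 \<comment> \<open>\<open>A rho (UU rho s)\<close> is the derivative in \<open>s\<close> of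
   \<open>h * kappa\<close> composed with \<open>UU rho\<close>. It is bounded uniformly in
   \<open>rho\<close>, since \<open>kappa\<close> and its derivative vanish from
   \<open>1 - e\<close> on and \<open>h^2 >= e\<close> below.\<close>
 define A where "A rho' t = - (rho' * t) / (hh rho' t)^2 * kappa t + kappa' t" for rho' t
 have Ab: "\<bar>A rho' t\<bar> <= 1 / e + B" if rr: "0 <= rho'" "rho' <= 1" and t: "- (1/4) <= t" "t <= 1" for rho' t
 proof (cases "t >= 1 - e")
  case True
  then show ?thesis using e B[of 0] by (simp add: A_def)
 next
  case False
  have "\<bar>t\<bar> <= 1 - e" using False t e by auto
  then have "t^2 <= (1 - e)^2" using power_mono[of "\<bar>t\<bar>" "1 - e" 2] by simp
  moreover have "(1 - e)^2 <= 1 - e" using e by (simp add: power2_eq_square mult_left_le)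
  moreover have "rho' * t^2 <= 1 * t^2" using rr by (intro mult_right_mono) auto
  ultimately have h: "e <= (hh rho' t)^2" using hh_square[OF rr, of t] t by simp
  have "\<bar>rho' * t\<bar> <= 1 * 1" unfolding abs_mult using rr t by (intro mult_mono) auto
  then have "\<bar>rho' * t\<bar> / (hh rho' t)^2 <= 1 / e" using h e by (intro frac_le) auto
  then have "\<bar>- (rho' * t) / (hh rho' t)^2 * kappa t\<bar> <= 1 / e * 1" unfolding abs_mult using k(3) e by (intro mult_mono) (auto simp: abs_mult)
  moreover have "\<bar>kappa' t\<bar> <= B" using B[of t] t by simp
  ultimately show ?thesis unfolding A_def mult_1_right by (rule order_trans[OF abs_triangle_ineq add_mono])
 qed
 define C where "C = P * (1 / e + B)"
 have AC: "\<bar>phi x * A rho' t\<bar> <= C" if "0 <= rho'" "rho' <= 1" "- (1/4) <= t" "t <= 1" for rho' t x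
  unfolding C_def abs_mult using Ab[OF that] P by (intro mult_mono) auto
 have nh: "AE x in lborel. hh 1 (u x) \<noteq> 0"
  using contact_null
 proof eventually_elim
  case (elim x)
  then have "\<bar>u x\<bar> < 1" using ub[of x] by linarith
  then show ?case using hh_square[of 1 "u x"] abs_square_less_1[of "u x"] by auto
 qed
 have Mg: "(LBINT x. (norm (g n x))^2) <= M" and Mv: "(LBINT x. (norm (vn n x))^2) <= M" for n
  using order_trans[OF en_parts(1) M(1)] order_trans[OF en_parts(1) M(2)[of n]] by (simp_all add: vn_def[abs_def] hn_def un_def)
 let ?a = "%n x. phi x * A (rho n) (un n x)"
 have hm: "(%x. hh (rho n) (un n x)) \<in> BM" for n using meas(8)[of n] by (simp add: hn_def[abs_def])
 note [measurable] = hm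
 have am[measurable]: "?a n \<in> BM" "(%x. phi x * A 1 (u x)) \<in> BM" for n unfolding A_def by measurable
 have W1: "wconv (%n x. ?a n x *R g n x) (%x. (phi x * A 1 (u x)) *R g' x)"
 proof (rule wconv_mult_bounded[OF lim(4) inED(3)[OF F(1)] inED(3)[OF lim(1)] Mg, where C = C])
  show "AE x in lborel. (%n. ?a n x) ----> phi x * A 1 (u x)"
   using AE_lim nh
  proof eventually_elim
   case (elim x)
   then have un: "(%n. un n x) ----> u x" and hl: "(%n. hh (rho n) (un n x)) ----> hh 1 (u x)" by (auto simp: hn_def)
   show ?case unfolding A_def using elim(2)
    by (intro tendsto_intros un hl rho(3) continuous_on_tendsto_compose[OF ck un] continuous_on_tendsto_compose[OF k(2) un]) auto
  qed
 qed (use AC F(3,4) ub rho(1) rho1 in auto)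
 have bd: "(LBINT x. (norm (?a n x *R g n x))^2) <= C^2 * M" "sq_int (%x. ?a n x *R g n x)" for n
 proof -
  show s: "sq_int (%x. ?a n x *R g n x)" by (rule sq_int_mult_bounded[OF inED(3)[OF F(1)] am(1)]) (rule AC[OF rho(1) rho1 F(3,4)])
  have "(LBINT x. (norm (?a n x *R g n x))^2) <= (LBINT x. C^2 * (norm (g n x))^2)"
  proof (rule integral_mono[OF sq_int_integrable[OF s]])
   show "(norm (?a n x *R g n x))^2 <= C^2 * (norm (g n x))^2" for x
    using power_mono[OF AC[OF rho(1) rho1 F(3,4), of x n n x] abs_ge_zero, of 2] by (simp add: power_mult_distrib mult_right_mono)
  qed (use sq_int_integrable[OF inED(3)[OF F(1)[of n]]] in simp)
  also have "\<dots> <= C^2 * M" using Mg by (simp add: mult_left_mono)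
  finally show "(LBINT x. (norm (?a n x *R g n x))^2) <= C^2 * M" .
 qed
 have sA: "sq_int (%x. (phi x * A 1 (u x)) *R g' x)" by (rule sq_int_mult_bounded[OF inED(3)[OF lim(1)] am(2), where C = C]) (use AC ub in auto)
 have I1: "?a n x * (norm (g n x))^2 = (?a n x *R g n x) \<bullet> (omega x *R g n x)" for n x
 proof -
  have "(?a n x *R g n x) \<bullet> (omega x *R g n x) = (phi x * omega x) * (A (rho n) (un n x) * (norm (g n x))^2)" by (simp add: dot_square_norm)
  also have "\<dots> = ?a n x * (norm (g n x))^2" unfolding po by simp
  finally show ?thesis by (rule sym)
 qed
 have "(%n. LBINT x. (?a n x *R g n x) \<bullet> (omega x *R g n x)) ----> (LBINT x. ((phi x * A 1 (u x)) *R g' x) \<bullet> (omega x *R g' x))"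
  by (rule weak_strong_tendsto[OF W1 strong_local[OF om(1)] bd(2) sA bd(1) sq_int_mult_test[OF inED(3)[OF F(1)] om(1)] sq_int_mult_test[OF inED(3)[OF lim(1)] om(1)]])
 also have "(LBINT x. ((phi x * A 1 (u x)) *R g' x) \<bullet> (omega x *R g' x)) = (LBINT x. phi x * (kappa' (u x) * (hh 1 (u x))^2 - u x * kappa (u x)) * (norm (v x))^2)"
 proof (rule integral_cong_AE)
  show "AE x in lborel. ((phi x * A 1 (u x)) *R g' x) \<bullet> (omega x *R g' x) = phi x * (kappa' (u x) * (hh 1 (u x))^2 - u x * kappa (u x)) * (norm (v x))^2"
   using g'_eq nh
  proof eventually_elim
   case (elim x)
   have "((phi x * A 1 (u x)) *R g' x) \<bullet> (omega x *R g' x) = (phi x * omega x) * (A 1 (u x) * (hh 1 (u x))^2) * (norm (v x))^2"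
    unfolding elim(1) by (simp add: dot_square_norm power2_eq_square)
   also have "A 1 (u x) * (hh 1 (u x))^2 = kappa' (u x) * (hh 1 (u x))^2 - u x * kappa (u x)" using elim(2) by (simp add: A_def left_diff_distrib)
   finally show ?case unfolding po .
  qed
  note [measurable] = test_measurable[OF om(1)]
 qed (use test_measurable[OF om(1)] in measurable)
 finally have L1: "(%n. LBINT x. ?a n x * (norm (g n x))^2) ----> (LBINT x. phi x * (kappa' (u x) * (hh 1 (u x))^2 - u x * kappa (u x)) * (norm (v x))^2)"
  unfolding I1 .
 have hb: "\<bar>(hn n x)^2 * kappa (un n x)\<bar> <= 1" "\<bar>(hh 1 (u x))^2 * kappa (u x)\<bar> <= 1" for n x
  unfolding abs_mult using k(3) hn[of n x] hh_le_1[of 1 "u x"] hh_nonneg[of 1 "u x"] by (auto intro!: mult_le_one simp: abs_square_le_1)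
 have "wconv (%n x. ((hn n x)^2 * kappa (un n x)) *R vn n x) (%x. ((hh 1 (u x))^2 * kappa (u x)) *R v x)"
 proof (rule wconv_mult_bounded[OF _ inED(3)[OF F(2)] inED(3)[OF limu(1)] Mv _ hb])
  show "wconv vn v" using limu(3) by (simp add: vn_def[abs_def] hn_def un_def)
  show "AE x in lborel. (%n. (hn n x)^2 * kappa (un n x)) ----> (hh 1 (u x))^2 * kappa (u x)"
   using AE_lim by eventually_elim (intro tendsto_intros continuous_on_tendsto_compose[OF ck], auto)
 qed auto
 from wconvD[OF this sq_int_grad[OF p]]
 have L2: "(%n. LBINT x. (hn n x)^2 * kappa (un n x) * (vn n x \<bullet> grad phi x)) ----> (LBINT x. (hh 1 (u x))^2 * kappa (u x) * (v x \<bullet> grad phi x))" by simp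
 have Cf: "Cf >= 0" using r(2)[of 0] by simp
 have rm: "(%x. r (un n x)) \<in> BM" for n using borel_measurable_continuous_onI[OF r(1)] by measurable
 have L3: "(%n. LBINT x. (V x - r (un n x)) * un n x * kappa (un n x) * phi x) ----> (LBINT x. (V x - r (u x)) * u x * kappa (u x) * phi x)"
 proof (rule integral_dominated_convergence[where w = "%x. 1 * (\<bar>V x\<bar> + Cf) * \<bar>phi x\<bar>"])
  show "integrable lborel (%x. 1 * (\<bar>V x\<bar> + Cf) * \<bar>phi x\<bar>)" by (rule integrable_dominated_test(2)[OF p, of "%x. 0"]) (use Cf in auto)
  show "AE x in lborel. (%n. (V x - r (un n x)) * un n x * kappa (un n x) * phi x) ----> (V x - r (u x)) * u x * kappa (u x) * phi x"
   using AE_lim by eventually_elim (intro tendsto_intros continuous_on_tendsto_compose[OF ck] continuous_on_tendsto_compose[OF r(1)], auto)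
  show "AE x in lborel. norm ((V x - r (un n x)) * un n x * kappa (un n x) * phi x) <= 1 * (\<bar>V x\<bar> + Cf) * \<bar>phi x\<bar>" for n
  proof (rule AE_I2)
   fix x
   have "\<bar>V x - r (un n x)\<bar> * \<bar>un n x\<bar> * \<bar>kappa (un n x)\<bar> * \<bar>phi x\<bar> <= (\<bar>V x\<bar> + Cf) * 1 * 1 * \<bar>phi x\<bar>"
    using r(2)[of "un n x"] F(3,4)[of n x] k(3) Cf by (intro mult_right_mono mult_mono) auto
   then show "norm ((V x - r (un n x)) * un n x * kappa (un n x) * phi x) <= 1 * (\<bar>V x\<bar> + Cf) * \<bar>phi x\<bar>" by (simp add: abs_mult)
  qed
 qed (use rm in measurable)
 have eqn: "(LBINT x. ?a n x * (norm (g n x))^2) + (LBINT x. (hn n x)^2 * kappa (un n x) * (vn n x \<bullet> grad phi x)) + (LBINT x. (V x - r (un n x)) * un n x * kappa (un n x) * phi x) = 0" for n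
 proof -
  let ?I = "{- (1/8)..HH (rho n) 1}" and ?D = "%s. - (rho n * UU (rho n) s) / (hh (rho n) (UU (rho n) s))^2 * kappa (UU (rho n) s) + kappa' (UU (rho n) s) * (1 / hh (rho n) (UU (rho n) s)) * hh (rho n) (UU (rho n) s) - 0"
  have I0: "- (1/8) <= (0::real)" "0 <= HH (rho n) 1" using HH_1_bounds(1)[OF rho(1) rho1, of n] by auto
  have dk: "((%s. kappa (UU (rho n) s)) has_real_derivative kappa' (UU (rho n) s) * (1 / hh (rho n) (UU (rho n) s))) (at s within ?I)" for s
   by (rule has_field_derivative_at_within[OF DERIV_chain2[OF k(1) UU_deriv[OF rho(1,2)]]])
  note der = DERIV_diff[OF DERIV_mult[OF hh_UU_deriv(1)[OF rho(1,2)[of n]] dk] DERIV_const[of "kappa 0"]]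
  have cU: "continuous_on ?I (UU (rho n))" using UU_cont[OF rho(1,2)] by (simp add: continuous_at_imp_continuous_on)
  have ct: "continuous_on ?I (%s. ?D s)"
   using hh_pos[OF rho(1,2)]
   by (intro continuous_intros hh_UU_deriv(2)[OF rho(1,2)] continuous_on_compose2[OF ck cU] continuous_on_compose2[OF k(2) cU] continuous_on_compose2[OF hh_cont(1) cU])
    (auto simp: less_imp_neq[symmetric])
  \<comment> \<open>Subtracting \<open>kappa 0\<close> makes the function vanish at 0, as
    \<open>C1_extension\<close> demands. The boundary value is then \<open>- kappa 0\<close> because
    \<open>kappa 1 = 0\<close>, and the constant cancels in the difference.\<close>
  have z0: "hh (rho n) (UU (rho n) 0) * kappa (UU (rho n) 0) - kappa 0 = 0" using UU_0[OF rho(1,2)] by simp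
  have "\<exists>G G' B. (\<forall>t. (G has_real_derivative G' t) (at t)) & continuous_on UNIV G' & (\<forall>t. \<bar>G' t\<bar> <= B) & G 0 = 0 &
   (\<forall>s\<in>?I. G s = hh (rho n) (UU (rho n) s) * kappa (UU (rho n) s) - kappa 0 & G' s = ?D s)"
   by (rule C1_extension[OF I0 der ct z0]) (assumption, blast)
  then obtain G G' B where G: "!!t. (G has_real_derivative G' t) (at t)" "continuous_on UNIV G'" "!!t. \<bar>G' t\<bar> <= B" "G 0 = 0"
   and Ge: "!!s. s \<in> ?I ==> G s = hh (rho n) (UU (rho n) s) * kappa (UU (rho n) s) - kappa 0 & G' s = ?D s" by blast
  have Gw: "G (w n x) = hn n x * kappa (un n x) - kappa 0" "G' (w n x) = A (rho n) (un n x)" for x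
   using Ge[of "w n x"] appr[of n] hn[of n x] by (auto simp: approx_def hn_def un_def A_def)
  have Ga: "G (HH (rho n) 1) = - kappa 0" using Ge[of "HH (rho n) 1"] I0 UU_HH[OF rho(1,2), of n 1] e by auto
  define eta where "eta x = phi x *R (A (rho n) (un n x) *R g n x) + (hn n x * kappa (un n x)) *R grad phi x" for x
  have "X (%x. phi x * (G (w n x) - G (HH (rho n) 1))) (%x. phi x *R (G' (w n x) *R g n x) + (G (w n x) - G (HH (rho n) 1)) *R grad phi x)"
   by (rule test_compose(1)[OF _ z(1) _ G p]) (use appr[of n] z(2) in \<open>auto simp: approx_def\<close>)
  then have X': "X (%x. phi x * (hn n x * kappa (un n x))) eta" by (simp add: Gw Ga eta_def[abs_def])
  have e1: "g n x \<bullet> eta x = ?a n x * (norm (g n x))^2 + (hn n x)^2 * kappa (un n x) * (vn n x \<bullet> grad phi x)" for x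
   using hn[of n x] by (simp add: eta_def vn_def inner_add_right dot_square_norm power2_eq_square[of "hn n x"])
  have e2: "bn n x * (phi x * (hn n x * kappa (un n x))) = (V x - r (un n x)) * un n x * kappa (un n x) * phi x" for x
   using hn[of n x] by (simp add: bn_def)
  have "integrable lborel (%x. ?a n x * (norm (g n x))^2)"
   unfolding I1 by (rule integrable_inner[OF bd(2) sq_int_mult_test[OF inED(3)[OF F(1)] om(1)]])
  moreover have "integrable lborel (%x. (hn n x)^2 * kappa (un n x) * (vn n x \<bullet> grad phi x))"
  proof -
   have "integrable lborel (%x. (((hn n x)^2 * kappa (un n x)) *R vn n x) \<bullet> grad phi x)"
    by (rule integrable_inner[OF sq_int_mult_bounded[OF inED(3)[OF F(2)] _ hb(1)] sq_int_grad[OF p]]) measurable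
   then show ?thesis by simp
  qed
  ultimately show ?thesis using F(9)[OF X', of n] unfolding e1 e2 by simp
 qed
 show ?thesis using tendsto_add[OF tendsto_add[OF L1 L2] L3] unfolding eqn by (simp add: LIMSEQ_const_iff)
qed

text \<open>The truncations \<open>kappa m\<close> increase their support towards
  \<open>u = 1\<close>; as contact is null, they tend to 1 almost everywhere. The terms with their
  derivatives stay bounded and tend to zero because they carry the factor \<open>h(u)^2\<close>, so
  the square integrability of \<open>v\<close> gives the limit.\<close>

theorem weak_form:
 assumes p: "phi \<in> Cc"
 shows "integrable lborel (%x. (1 - (u x)^2) * (v x \<bullet> grad phi x))" "integrable lborel (%x. phi x * u x * (norm (v x))^2)"
  "integrable lborel (%x. (V x - r (u x)) * u x * phi x)"
  "(LBINT x. (1 - (u x)^2) * (v x \<bullet> grad phi x)) - (LBINT x. phi x * u x * (norm (v x))^2) + (LBINT x. (V x - r (u x)) * u x * phi x) = 0"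
proof -
 \<comment> \<open>\<open>m + 2\<close> and the shift by 1 make the truncation zero from
   \<open>1 - 1 / (m + 2)\<close> on, with distance at most \<open>1/2\<close> as
   \<open>truncated_form\<close> requires.\<close>
 define q where "q m t = (real m + 2) * (1 - t) - 1" for m t
 define kappa where "kappa m t = flat1 (q m t)" for m t
 define kappa' where "kappa' m t = flat_exp [:0, 0, 1:] (q m t) * (- (real m + 2))" for m t
 have dk: "(kappa m has_real_derivative kappa' m t) (at t)" for m t
 proof -
  have "((%t. q m t) has_real_derivative - (real m + 2)) (at t)" unfolding q_def by (auto intro!: derivative_eq_intros)
  from DERIV_chain2[OF flat_exp_derivative[of "[:1:]"] this] show ?thesis unfolding kappa_def[abs_def] kappa'_def flat1_def by simp
 qed
 have ck: "continuous_on UNIV (kappa' m)" for m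
 proof -
  have c: "continuous_on UNIV (flat_exp [:0, 0, 1:])" by (rule continuous_at_imp_continuous_on) (use DERIV_isCont[OF flat_exp_derivative] in blast)
  have "continuous_on UNIV (q m)" unfolding q_def[abs_def] by (intro continuous_intros)
  from continuous_on_compose2[OF c this] show ?thesis unfolding kappa'_def[abs_def] by (intro continuous_on_mult continuous_on_const) auto
 qed
 have k01: "0 <= kappa m t" "kappa m t <= 1" for m t using flat1_nonneg flat1_le by (auto simp: kappa_def)
 have kz: "kappa m t = 0 & kappa' m t = 0" if "t >= 1 - 1 / (real m + 2)" for m t
 proof -
  have "(real m + 2) * (1 - t) <= (real m + 2) * (1 / (real m + 2))" using that by (intro mult_left_mono) auto
  then have "q m t <= 0" by (simp add: q_def)
  then show ?thesis using flat1_0 by (simp add: kappa_def kappa'_def flat_exp_def)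
 qed
 have em: "0 < 1 / (real m + 2)" "1 / (real m + 2) <= 1/2" for m by (auto simp: field_simps)
 have h2: "(hh 1 (u x))^2 = 1 - (u x)^2" for x using hh_square[of 1 "u x"] ub[of x] by (auto simp: abs_le_iff)
 \<comment> \<open>From \<open>h^2 = (1 - u) (1 + u)\<close> and
   \<open>q + 1 = (m + 2) (1 - u)\<close>: the small factor \<open>h^2\<close> compensates the slope
   \<open>m + 2\<close>, up to the factor \<open>1 + u <= 2\<close>.\<close>
 have tail: "\<bar>kappa' m (u x) * (hh 1 (u x))^2\<bar> <= 4" "q m (u x) > 0 ==> \<bar>kappa' m (u x) * (hh 1 (u x))^2\<bar> <= 2 * ((1 / q m (u x))^2 + 1 / q m (u x))" for m x
 proof -
  have "\<bar>kappa' m (u x) * (hh 1 (u x))^2\<bar> <= 4 & \<bar>kappa' m (u x) * (hh 1 (u x))^2\<bar> <= 2 * ((1 / q m (u x))^2 + 1 / q m (u x))" if qp: "q m (u x) > 0"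
  proof -
   have e: "(hh 1 (u x))^2 * (real m + 2) = (1 + u x) * (1 + q m (u x))" unfolding h2 q_def by (simp add: algebra_simps power2_eq_square)
   have "\<bar>kappa' m (u x) * (hh 1 (u x))^2\<bar> = flat_exp [:0, 0, 1:] (q m (u x)) * ((hh 1 (u x))^2 * (real m + 2))"
    using flat1_tail(4)[OF qp] by (simp add: kappa'_def abs_mult)
   also have "\<dots> = (1 + u x) * (flat_exp [:0, 0, 1:] (q m (u x)) * (1 + q m (u x)))" unfolding e by simp
   also have "\<dots> <= 2 * (flat_exp [:0, 0, 1:] (q m (u x)) * (1 + q m (u x)))"
    using ub[of x] flat1_tail(4)[OF qp] qp by (intro mult_right_mono) auto
   finally have h: "\<bar>kappa' m (u x) * (hh 1 (u x))^2\<bar> <= 2 * (flat_exp [:0, 0, 1:] (q m (u x)) * (1 + q m (u x)))" .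
   show ?thesis
   proof
    show "\<bar>kappa' m (u x) * (hh 1 (u x))^2\<bar> <= 4" using h flat1_tail(2)[OF qp] by linarith
    show "\<bar>kappa' m (u x) * (hh 1 (u x))^2\<bar> <= 2 * ((1 / q m (u x))^2 + 1 / q m (u x))"
     by (rule order_trans[OF h mult_left_mono[OF flat1_tail(3)[OF qp]]]) simp
   qed
  qed
  then show "q m (u x) > 0 ==> \<bar>kappa' m (u x) * (hh 1 (u x))^2\<bar> <= 2 * ((1 / q m (u x))^2 + 1 / q m (u x))"
   "\<bar>kappa' m (u x) * (hh 1 (u x))^2\<bar> <= 4" by (auto, cases "q m (u x) > 0") (auto simp: kappa'_def flat_exp_def)
 qed
 have lims: "AE x in lborel. (%m. kappa m (u x)) ----> 1 & (%m. kappa' m (u x) * (hh 1 (u x))^2) ----> 0"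
  using contact_null
 proof eventually_elim
  case (elim x)
  then have u1: "1 - u x > 0" using ub[of x] by auto
  have qi: "filterlim (%m. q m (u x)) at_top sequentially"
  proof -
   have "filterlim (%m. ((1 - u x) * 2 - 1) + (1 - u x) * real m) at_top sequentially"
    by (intro filterlim_tendsto_add_at_top[OF tendsto_const] filterlim_tendsto_pos_mult_at_top[OF tendsto_const u1] filterlim_real_sequentially)
   moreover have "(%m. ((1 - u x) * 2 - 1) + (1 - u x) * real m) = (%m. q m (u x))" by (auto simp: q_def algebra_simps)
   ultimately show ?thesis by simp
  qed
  have i: "(%m. 1 / q m (u x)) ----> 0" by (rule tendsto_divide_0[OF tendsto_const filterlim_at_top_imp_at_infinity[OF qi]])
  have ev: "\<forall>\<^sub>F m in sequentially. q m (u x) > 0" using qi unfolding filterlim_at_top_dense by blast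
  have "(%m. 1 - 1 / q m (u x)) ----> 1 - 0" by (intro tendsto_intros i)
  then have b: "(%m. 1 - 1 / q m (u x)) ----> 1" by simp
  have a: "(%m. kappa m (u x)) ----> 1"
   by (rule tendsto_sandwich[OF _ _ b tendsto_const]) (use ev k01 in \<open>auto elim!: eventually_mono simp: kappa_def flat1_tail(1)\<close>)
  have "(%m. 2 * ((1 / q m (u x))^2 + 1 / q m (u x))) ----> 2 * (0^2 + 0)" by (intro tendsto_intros i)
  then have "(%m. 2 * ((1 / q m (u x))^2 + 1 / q m (u x))) ----> 0" by simp
  moreover have "\<forall>\<^sub>F m in sequentially. norm (kappa' m (u x) * (hh 1 (u x))^2) <= 2 * ((1 / q m (u x))^2 + 1 / q m (u x))"
   using ev by eventually_elim (simp only: real_norm_def tail(2))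
  ultimately have "(%m. kappa' m (u x) * (hh 1 (u x))^2) ----> 0" by (rule Lim_null_comparison[rotated])
  then show ?case using a by simp
 qed
 note [measurable] = borel_measurable_continuous_onI[OF ck] test_measurable[OF p] grad_measurable[OF Cc_infinityD(1)[OF p]]
 have km[measurable]: "kappa m \<in> BM" for m
  using DERIV_isCont[OF dk] by (intro borel_measurable_continuous_onI continuous_at_imp_continuous_on) auto
 obtain P where P: "P > 0" "!!x. \<bar>phi x\<bar> <= P" using test_bounded[OF p] by blast
 have iv: "integrable lborel (%x. 5 * (P * (norm (v x))^2))" using sq_int_integrable[OF inED(3)[OF limu(1)]] by simp
 have ig: "integrable lborel (%x. \<bar>v x \<bullet> grad phi x\<bar>)" using integrable_inner[OF inED(3)[OF limu(1)] sq_int_grad[OF p]] by simp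
 have Cf: "Cf >= 0" using r(2)[of 0] by simp
 have iV: "integrable lborel (%x. 1 * (\<bar>V x\<bar> + Cf) * \<bar>phi x\<bar>)" by (rule integrable_dominated_test(2)[OF p, of "%x. 0"]) (use Cf in auto)
 have u1: "\<bar>u x\<bar> <= 1" for x using ub[of x] by (simp add: abs_le_iff)
 have b1: "\<bar>phi x * (s - u x * t) * (norm (v x))^2\<bar> <= 5 * (P * (norm (v x))^2)" if "\<bar>s\<bar> <= 4" "0 <= t" "t <= 1" for s t x
 proof -
  have "\<bar>u x * t\<bar> <= 1 * 1" unfolding abs_mult using u1 that by (intro mult_mono) auto
  then have "\<bar>s - u x * t\<bar> <= 5" using that(1) by linarith
  then have "\<bar>phi x\<bar> * \<bar>s - u x * t\<bar> * (norm (v x))^2 <= P * 5 * (norm (v x))^2" using P by (intro mult_right_mono mult_mono) auto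
  then show ?thesis by (simp add: abs_mult mult_ac)
 qed
 have b2: "\<bar>(hh 1 (u x))^2 * t * (v x \<bullet> grad phi x)\<bar> <= \<bar>v x \<bullet> grad phi x\<bar>" if "0 <= t" "t <= 1" for t x
 proof -
  have "\<bar>(hh 1 (u x))^2 * t\<bar> * \<bar>v x \<bullet> grad phi x\<bar> <= 1 * \<bar>v x \<bullet> grad phi x\<bar>"
   using that hh_le_1[of 1 "u x"] hh_nonneg[of 1 "u x"] by (intro mult_right_mono) (auto simp: abs_mult abs_square_le_1 intro!: mult_le_one)
  then show ?thesis by (simp add: abs_mult)
 qed
 have b3: "\<bar>(V x - r (u x)) * u x * t * phi x\<bar> <= 1 * (\<bar>V x\<bar> + Cf) * \<bar>phi x\<bar>" if "0 <= t" "t <= 1" for t x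
 proof -
  have "\<bar>V x - r (u x)\<bar> * \<bar>u x\<bar> * \<bar>t\<bar> * \<bar>phi x\<bar> <= (\<bar>V x\<bar> + Cf) * 1 * 1 * \<bar>phi x\<bar>"
   using r(2)[of "u x"] u1 that Cf by (intro mult_right_mono mult_mono) auto
  then show ?thesis by (simp add: abs_mult)
 qed
 show i1: "integrable lborel (%x. (1 - (u x)^2) * (v x \<bullet> grad phi x))"
  by (rule Bochner_Integration.integrable_bound[OF ig]) (use b2[of 1] in \<open>auto simp: h2\<close>)
 show i2: "integrable lborel (%x. phi x * u x * (norm (v x))^2)"
  by (rule Bochner_Integration.integrable_bound[OF iv]) (use b1[of 0 1] in \<open>auto intro!: AE_I2 order_trans[OF _ abs_ge_self]\<close>)
 show i3: "integrable lborel (%x. (V x - r (u x)) * u x * phi x)"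
  by (rule integrable_dominated_test(1)[OF p, where K = 1]) (use b3[of 1] in auto)
 have L1: "(%m. LBINT x. phi x * (kappa' m (u x) * (hh 1 (u x))^2 - u x * kappa m (u x)) * (norm (v x))^2) ----> (LBINT x. phi x * (0 - u x * 1) * (norm (v x))^2)"
 proof (rule integral_dominated_convergence[OF _ _ iv])
  show "AE x in lborel. (%m. phi x * (kappa' m (u x) * (hh 1 (u x))^2 - u x * kappa m (u x)) * (norm (v x))^2) ----> phi x * (0 - u x * 1) * (norm (v x))^2"
   using lims by eventually_elim (intro tendsto_intros, auto)
  show "AE x in lborel. norm (phi x * (kappa' m (u x) * (hh 1 (u x))^2 - u x * kappa m (u x)) * (norm (v x))^2) <= 5 * (P * (norm (v x))^2)" for m
   using b1[OF tail(1) k01] by simp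
 qed measurable
 have L2: "(%m. LBINT x. (hh 1 (u x))^2 * kappa m (u x) * (v x \<bullet> grad phi x)) ----> (LBINT x. (hh 1 (u x))^2 * 1 * (v x \<bullet> grad phi x))"
 proof (rule integral_dominated_convergence[OF _ _ ig])
  show "AE x in lborel. (%m. (hh 1 (u x))^2 * kappa m (u x) * (v x \<bullet> grad phi x)) ----> (hh 1 (u x))^2 * 1 * (v x \<bullet> grad phi x)"
   using lims by eventually_elim (intro tendsto_intros, auto)
  show "AE x in lborel. norm ((hh 1 (u x))^2 * kappa m (u x) * (v x \<bullet> grad phi x)) <= \<bar>v x \<bullet> grad phi x\<bar>" for m using b2[OF k01] by simp
 qed measurable
 have L3: "(%m. LBINT x. (V x - r (u x)) * u x * kappa m (u x) * phi x) ----> (LBINT x. (V x - r (u x)) * u x * 1 * phi x)"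
 proof (rule integral_dominated_convergence[OF _ _ iV])
  show "AE x in lborel. (%m. (V x - r (u x)) * u x * kappa m (u x) * phi x) ----> (V x - r (u x)) * u x * 1 * phi x"
   using lims by eventually_elim (intro tendsto_intros, auto)
  show "AE x in lborel. norm ((V x - r (u x)) * u x * kappa m (u x) * phi x) <= 1 * (\<bar>V x\<bar> + Cf) * \<bar>phi x\<bar>" for m using b3[OF k01] by simp
 qed measurable
 have eqn: "(LBINT x. phi x * (kappa' m (u x) * (hh 1 (u x))^2 - u x * kappa m (u x)) * (norm (v x))^2) + (LBINT x. (hh 1 (u x))^2 * kappa m (u x) * (v x \<bullet> grad phi x))
  + (LBINT x. (V x - r (u x)) * u x * kappa m (u x) * phi x) = 0" for m
  by (rule truncated_form[OF p dk ck _ em kz]) (use k01 in auto)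
 have "(LBINT x. phi x * (0 - u x * 1) * (norm (v x))^2) + (LBINT x. (hh 1 (u x))^2 * 1 * (v x \<bullet> grad phi x)) + (LBINT x. (V x - r (u x)) * u x * 1 * phi x) = 0"
  using tendsto_add[OF tendsto_add[OF L1 L2] L3] unfolding eqn by (simp add: LIMSEQ_const_iff)
 then show "(LBINT x. (1 - (u x)^2) * (v x \<bullet> grad phi x)) - (LBINT x. phi x * u x * (norm (v x))^2) + (LBINT x. (V x - r (u x)) * u x * phi x) = 0"
  by (simp add: h2)
qed

end

section \<open>Assembly and scaling\<close>

text \<open>The weak equation for \<open>k = 1\<close> with right-hand side \<open>r(u) u\<close>.
  Integrability is recorded termwise so that the scaling step can split and recombine the
  integral.\<close>

definition (in coercive_potential) scaled_solution :: "(real => real) => (real^'n => real) => (real^'n => real^'n) => bool" where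
 "scaled_solution r u v \<longleftrightarrow> (\<forall>phi\<in>Cc.
  integrable lborel (%x. (1 - (u x)^2) * (v x \<bullet> grad phi x)) & integrable lborel (%x. phi x * u x * (norm (v x))^2) &
  integrable lborel (%x. (V x - r (u x)) * u x * phi x) &
  (LBINT x. (1 - (u x)^2) * (v x \<bullet> grad phi x)) - (LBINT x. phi x * u x * (norm (v x))^2) + (LBINT x. (V x - r (u x)) * u x * phi x) = 0)"

theorem (in coercive_potential) cusp_solution:
 assumes ne: "~ schroedinger_eigenvalue V 0" and r: "continuous_on UNIV r" "r 0 = 0" "!!t. \<bar>r t\<bar> <= Cf"
 shows "\<exists>u v. inE u v & (\<forall>x. \<bar>u x\<bar> <= 1) & ~ (AE x in lborel. u x = 0) & scaled_solution r u v"
proof -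
 obtain c zeta where z: "zeta \<in> Cc" "!!x. 0 <= zeta x & zeta x <= 1 & (dist c x <= 1 --> zeta x = 1) & (dist c x >= 2 --> zeta x = 0)"
  and Vc: "!!x. x \<in> cball c 5 ==> V x >= Cf + 1" and ex: "!!rho. 0 <= rho ==> rho < 1 ==> \<exists>w g. approx r c zeta rho w g"
  using regularized_solution[OF ne r] by blast
 \<comment> \<open>Starts at \<open>1/2\<close>, the lower end of the range of
   \<open>uniform_energy_bound\<close>.\<close>
 define rho where "rho n = 1 - 1 / (real n + 2)" for n
 have rho: "0 <= rho n" "rho n < 1" "1/2 <= rho n" for n by (auto simp: rho_def field_simps)
 have rl: "rho ----> 1"
 proof -
  have "(%n. 1 / (real n + 2)) ----> 0" using LIMSEQ_ignore_initial_segment[OF lim_1_over_n, of 2] by (simp add: add.commute)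
  from tendsto_diff[OF tendsto_const[of 1] this] show ?thesis by (simp add: rho_def[abs_def])
 qed
 have "\<forall>n. \<exists>w g. approx r c zeta (rho n) w g" using ex rho by blast
 then obtain w g where a: "!!n. approx r c zeta (rho n) (w n) (g n)" by metis
 define un where "un n x = UU (rho n) (w n x)" for n x
 define vn where "vn n x = (1 / hh (rho n) (un n x)) *R g n x" for n x
 obtain M where M: "!!n. en (w n) (g n) <= M" "!!n. en (un n) (vn n) <= M"
  using uniform_energy_bound[OF z r(1,3) Vc] rho(2,3) a unfolding un_def[abs_def] vn_def[abs_def] by blast
 note F = approx_facts[OF a rho(1,2) z(1) r(1,3), folded un_def, folded vn_def]
 obtain r1 w' g' where c1: "strict_mono r1" "inE w' g'" "l2conv (%n. w (r1 n)) w'" "wconv (%n. g (r1 n)) g'" "AE x in lborel. (%n. w (r1 n) x) ----> w' x"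
  using energy_compactness[of w g, OF F(1) M(1)] by blast
 obtain r2 u' v where c2: "strict_mono r2" "inE u' v" "wconv (%n. vn (r1 (r2 n))) v" "AE x in lborel. (%n. un (r1 (r2 n)) x) ----> u' x"
  using energy_compactness[of "%n. un (r1 n)" "%n. vn (r1 n)", OF F(2) M(2)] by blast
 define s where "s n = r1 (r2 n)" for n
 have sm: "strict_mono s" using c1(1) c2(1) unfolding s_def by (auto simp: strict_mono_def)
 \<comment> \<open>The limit inherits the bounds almost everywhere; redefinition on a null set makes
   them hold at every point.\<close>
 define u where "u x = (if - (1/4) <= u' x & u' x <= 1 then u' x else 0)" for x
 note [measurable] = inED(4)[OF c2(2)]
 have uu: "AE x in lborel. u x = u' x"
  using c2(4)
 proof eventually_elim
  case (elim x)
  have "- (1/4) <= u' x" "u' x <= 1"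
   using LIMSEQ_le_const[OF elim, of "- (1/4)"] LIMSEQ_le_const2[OF elim, of 1] F(3,4) by auto
  then show ?case by (simp add: u_def)
 qed
 have um: "u \<in> BM" unfolding u_def[abs_def] by measurable
 have Eu: "inE u v" using inX_cong_AE[of "{}", OF _ uu um] c2(2) by (simp add: inX_empty)
 interpret cusp_sequence V m0 r Cf M c zeta "%n. rho (s n)" "%n. w (s n)" "%n. g (s n)" w' g' u v
 proof
  show "(%n. rho (s n)) ----> 1" using LIMSEQ_subseq_LIMSEQ[OF rl sm] by (simp add: o_def)
  show "l2conv (%n. w (s n)) w'" using l2conv_subseq[OF c1(3) c2(1)] by (simp add: s_def)
  show "wconv (%n. g (s n)) g'" using wconv_subseq[OF c1(4) c2(1)] by (simp add: s_def)
  show "AE x in lborel. (%n. w (s n) x) ----> w' x"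
   using c1(5) by eventually_elim (use LIMSEQ_subseq_LIMSEQ[OF _ c2(1)] in \<open>fastforce simp: o_def s_def\<close>)
  show "AE x in lborel. (%n. UU (rho (s n)) (w (s n) x)) ----> u x" using c2(4) uu by eventually_elim (simp add: un_def s_def)
  show "wconv (%n x. (1 / hh (rho (s n)) (UU (rho (s n)) (w (s n) x))) *R g (s n) x) v" using c2(3) by (simp add: vn_def[abs_def] un_def s_def)
  show "en (%x. UU (rho (s n)) (w (s n) x)) (%x. (1 / hh (rho (s n)) (UU (rho (s n)) (w (s n) x))) *R g (s n) x) <= M" for n
   using M(2)[of "s n"] by (simp add: vn_def[abs_def] un_def[abs_def])
  show "- (1/4) <= u x & u x <= 1" for x by (simp add: u_def)
 qed (use r z Vc rho a M c1(2) Eu in \<open>auto\<close>)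
 have "\<bar>u x\<bar> <= 1" for x by (auto simp: u_def)
 then show ?thesis unfolding scaled_solution_def using Eu nontrivial weak_form by (intro exI[of _ u] exI[of _ v]) blast
qed

text \<open>The substitution \<open>u = sqrt k * U\<close> reduces to \<open>k = 1\<close>. As
  \<open>|u| <= 1\<close>, the modulus of \<open>U\<close> is at most \<open>1 / sqrt k\<close>, and
  on this range \<open>f(U)\<close> is \<open>U\<close> times a bounded continuous quotient.\<close>

theorem theorem1p1:
  fixes V :: "real^'n::finite \<Rightarrow> real" and f :: "real \<Rightarrow> real" and k :: real
  assumes "CARD('n) \<ge> 3"
    and "k > 0"
    and "cond_V V"
    and "cond_f1 f" and "cond_f2 CARD('n) f" and "cond_f3 f"
    and "\<not> schroedinger_eigenvalue V 0"
  shows "\<exists>u. weak_solution V k f u \<and> \<not> (AE x in lebesgue. u x = 0)"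
proof -
 obtain b where b: "!!x. b <= V x" using assms(3) unfolding cond_V_def bdd_below_def by auto
 \<comment> \<open>With \<open>b\<close> a lower bound of \<open>V\<close>, this shift is the
   smallest nonnegative one that ensures \<open>b + m0 >= 1\<close>.\<close>
 interpret coercive_potential V "max 0 (1 - b)"
 proof
  show "1 <= V x + max 0 (1 - b)" for x using b[of x] by linarith
 qed (use assms(3) in \<open>auto simp: cond_V_def\<close>)
 have cf: "continuous_on UNIV f" using assms(5) by (simp add: cond_f2_def)
 have f1: "((%s. f s / s) \<longlongrightarrow> 0) (at 0)" using assms(4) unfolding cond_f1_def by (rule smalloD_tendsto)
 have f0: "f 0 = 0"
 proof -
  have "(f \<longlongrightarrow> f 0) (at 0)" using cf by (simp add: continuous_on_eq_continuous_at isCont_def)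
  moreover have "((%s. f s / s * s) \<longlongrightarrow> 0 * 0) (at 0)" by (intro tendsto_mult f1 tendsto_ident_at)
  then have "(f \<longlongrightarrow> 0) (at 0)" by (subst LIM_equal[of 0 f "%s. f s / s * s"]) auto
  ultimately show ?thesis using LIM_unique by blast
 qed
 \<comment> \<open>At \<open>s = 0\<close> the quotient is 0 by the convention for division, and by
   \<open>cond_f1\<close> this is its limit, so it is continuous there.\<close>
 define phi where "phi s = f s / s" for s
 have cphi: "continuous_on UNIV phi"
 proof (rule continuous_at_imp_continuous_on, rule ballI)
  fix s
  show "isCont phi s"
  proof (cases "s = 0")
   case True
   then show ?thesis using f1 by (simp add: isCont_def phi_def[abs_def])
  next
   case False
   then show ?thesis unfolding phi_def[abs_def] using cf by (intro continuous_intros) (auto simp: continuous_on_eq_continuous_at)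
  qed
 qed
 define a where "a = sqrt k"
 have a: "a > 0" "a^2 = k" using assms(2) by (auto simp: a_def)
 \<comment> \<open>The clamp makes \<open>r\<close> bounded; on \<open>[- 1, 1]\<close>, where
   \<open>u\<close> takes its values, it changes nothing.\<close>
 define r where "r t = phi (max (-1) (min 1 t) / a)" for t
 have cr: "continuous_on UNIV r"
  unfolding r_def[abs_def] by (rule continuous_on_compose2[OF cphi]) (use a in \<open>auto intro!: continuous_intros\<close>)
 have r0: "r 0 = 0" by (simp add: r_def phi_def)
 have "bounded (r ` {-1..1})" by (rule compact_imp_bounded[OF compact_continuous_image[OF continuous_on_subset[OF cr]]]) auto
 then have "\<exists>C. \<forall>t\<in>{-1..1}. \<bar>r t\<bar> <= C" by (auto simp: bounded_iff)
 then obtain C where C: "!!t. t \<in> {-1..1} ==> \<bar>r t\<bar> <= C" by blast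
 have rb: "\<bar>r t\<bar> <= C" for t
 proof -
  have "r t = r (max (-1) (min 1 t))" by (simp add: r_def)
  then show ?thesis using C[of "max (-1) (min 1 t)"] by auto
 qed
 obtain u v where E: "inE u v" and u1: "!!x. \<bar>u x\<bar> <= 1" and nt: "~ (AE x in lborel. u x = 0)" and W: "scaled_solution r u v"
  using cusp_solution[OF assms(7) cr r0 rb] by blast
 note [measurable] = inED(4,5)[OF E] borel_measurable_continuous_onI[OF cr] borel_measurable_continuous_onI[OF cf]
 define U where "U x = (1 / a) * u x" for x
 define G where "G x = (1 / a) *R v x" for x
 have EU: "inE U G" unfolding U_def[abs_def] G_def[abs_def] by (rule inE_scale[OF E])
 note [measurable] = inED(4,5)[OF EU]
 have fU: "f (U x) = (1 / a) * (r (u x) * u x)" for x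
 proof (cases "u x = 0")
  case False
  have "max (-1) (min 1 (u x)) = u x" using u1[of x] by auto
  then have "r (u x) = f (U x) / U x" by (simp add: r_def phi_def U_def)
  then show ?thesis using False a by (simp add: U_def)
 qed (simp add: U_def f0)
 have kU: "k * (U x)^2 = (u x)^2" for x using a assms(2) by (simp add: U_def power_divide)
 have "weak_solution V k f U"
  unfolding weak_solution_def
 proof (intro conjI exI[of _ G] ballI)
  show "U \<in> space_E V" by (rule inE_space_E[OF EU])
  show "has_weak_gradient U G" by (rule wgrad_has_weak_gradient[OF inED(1)[OF EU]])
  have "integrable lborel (%x. (U x)^2 * (norm (G x))^2)"
  proof (rule Bochner_Integration.integrable_bound)
   show "integrable lborel (%x. (1 / k) * (norm (G x))^2)" using sq_int_integrable[OF inED(3)[OF EU]] by simp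
   have "(U x)^2 <= 1 / k" for x using kU[of x] u1[of x] assms(2) by (simp add: pos_le_divide_eq mult.commute abs_square_le_1)
   then have "(U x)^2 * (norm (G x))^2 <= (1 / k) * (norm (G x))^2" for x by (rule mult_right_mono) simp
   then show "AE x in lborel. norm ((U x)^2 * (norm (G x))^2) <= norm ((1 / k) * (norm (G x))^2)"
    using assms(2) by simp
  qed measurable
  then show "integrable lebesgue (%x. (U x)^2 * (norm (G x))^2)" by (subst completion_facts(2)) auto
  fix psi :: "real^'n => real" assume p: "psi \<in> Cc"
  note [measurable] = test_measurable[OF p] grad_measurable[OF Cc_infinityD(1)[OF p]]
  note i = W[unfolded scaled_solution_def, rule_format, OF p]
  have ir: "integrable lborel (%x. r (u x) * u x * psi x)"
   by (rule integrable_sq_mult[OF sq_int_mult_bounded'[OF inED(2)[OF E] _ rb] sq_int_test[OF p]]) measurable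
  let ?L = "%x. (1 - k * (U x)^2) * (G x \<bullet> grad psi x) - k * U x * (norm (G x))^2 * psi x + V x * U x * psi x"
  \<comment> \<open>All terms scale with \<open>1 / a\<close>, because \<open>k * U^2 = u^2\<close>
    and \<open>k * U * |G|^2 = (1 / a) * u * |v|^2\<close>; the term \<open>r(u) u psi\<close> is
    split off to become the right-hand side.\<close>
  have eL: "?L x = (1 / a) * ((1 - (u x)^2) * (v x \<bullet> grad psi x) - psi x * u x * (norm (v x))^2 + ((V x - r (u x)) * u x * psi x + r (u x) * u x * psi x))" for x
   unfolding kU using a by (simp add: U_def G_def a(2)[symmetric] power_mult_distrib field_simps power2_eq_square)
  have eR: "f (U x) * psi x = (1 / a) * (r (u x) * u x * psi x)" for x unfolding fU by simp
  have iL: "integrable lborel ?L" unfolding eL using i ir by simp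
  have iR: "integrable lborel (%x. f (U x) * psi x)" unfolding eR using ir by simp
  have "(LBINT x. ?L x) = (LBINT x. f (U x) * psi x)" unfolding eL eR using i ir by simp
  moreover have m: "?L \<in> BM" "(%x. f (U x) * psi x) \<in> BM" by measurable
  ultimately show "integrable lebesgue ?L" "integrable lebesgue (%x. f (U x) * psi x)"
   "(\<integral>x. ?L x \<partial>lebesgue) = (\<integral>x. f (U x) * psi x \<partial>lebesgue)"
   using iL iR by (simp_all only: completion_facts(2,3)[OF m(1)] completion_facts(2,3)[OF m(2)])
 qed
 moreover have "~ (AE x in lebesgue. U x = 0)"
  using nt a by (subst AE_completion_iff) (auto simp: U_def)
 ultimately show ?thesis by blast
qed

end
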